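(* Let $\{X_{t,T_1}\}_{t=1}^{T_1}$ and $\{Y_{t,T_2}\}_{t=1}^{T_2}$ be independent $H$-valued functional time series with $$X_{t,T_1}(s)=m_1\Big(\frac t{T_1},s\Big)+v_{t,T_1}(s),\qquad Y_{t,T_2}(s)=m_2\Big(\frac t{T_2},s\Big)+w_{t,T_2}(s),$$ where $m_j(u,\cdot)\in H$ and $\|m_j(v,\cdot)-m_j(u,\cdot)\|\le C_m|u-v|$ for all $u,v\in[0,1]$, $j=1,2$, for some constant $C_m>0$, and where each of the error processes $\{v_{t,T_1}\}$ and $\{w_{t,T_2}\}$ is a zero-mean locally stationary process in $L^2_H$ (in the sense of the definition with $p=2$ and some $\rho\ge2$) whose associated stationary processes $\{v_t^{(u)}\}$, $\{w_t^{(u)}\}$ are $L^2$-$m$-approximable with mean zero in $L^2$. Let $c_{1,u}$ and $c_{2,u}$ be the long-run covariance kernels of $\{v_t^{(u)}\}$ and $\{w_t^{(u)}\}$. Let $K_1:\mathbb R\to\mathbb R$ be symmetric around zero, bounded, Lipschitz continuous, with compact support and $\int K_1(z)\,dz=1$; put $K_{1,h}(x)=K_1(x/h)$, with $h>0$, $h\to0$, and $$\bar X_{T_1}^{(u)}=\frac1{T_1h}\sum_{t=1}^{T_1}K_{1,h}\Big(u-\frac t{T_1}\Big)X_{t,T_1},\qquad \bar Y_{T_2}^{(u)}=\frac1{T_2h}\sum_{t=1}^{T_2}K_{1,h}\Big(u-\frac t{T_2}\Big)Y_{t,T_2}.$$ Suppose $\min\{T_1h,\frac1{T_1h^3}\}\to\infty$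 and $\frac{T_1}{T_1+T_2}\to\theta\in(0,1)$ as $\min\{T_1,T_2\}\to\infty$. Fix $u\in(0,1)$ and let $$U_{T_1,T_2}^{(u)}=\frac{T_1T_2h}{T_1+T_2}\big\|\bar X_{T_1}^{(u)}-\bar Y_{T_2}^{(u)}\big\|^2 .$$ (1) If $m_1(u,\cdot)=m_2(u,\cdot)$ in $L^2$ (hypothesis $H_0$), then $U_{T_1,T_2}^{(u)}\stackrel d\to\|Z^{(u)}\|^2$, where $Z^{(u)}$ is a Gaussian process in $L^2$ with $E[Z^{(u)}]=0$ and $E[Z^{(u)}(s_1)Z^{(u)}(s_2)]=\phi^{(u)}(s_1,s_2)\int K_1^2(w)\,dw$, with $\phi^{(u)}(s_1,s_2)=(1-\theta)c_{1,u}(s_1,s_2)+\theta c_{2,u}(s_1,s_2)$. (2) If $\|m_1(u,\cdot)-m_2(u,\cdot)\|>0$ (hypothesis $H_1$), then $\|\bar X_{T_1}^{(u)}-\bar Y_{T_2}^{(u)}\|^2\stackrel p\to\|m_1(u,\cdot)-m_2(u,\cdot)\|^2$, and consequently $U_{T_1,T_2}^{(u)}\stackrel p\to\infty$ as $\min\{T_1,T_2\}\to\infty$.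
   Context: $H=L^2=L^2([0,1]^d)$ is the real Hilbert space with $\langle x,y\rangle=\int_{[0,1]^d}x(t)y(t)\,dt$ and norm $\|\cdot\|$. $L^p_H$ is the space of $H$-valued random functions $X$ on a probability space with $v_p(X)=(E\|X\|^p)^{1/p}<\infty$. Long-run covariance kernel. For a stationary zero-mean process $\{Z_t\}$ in $H$ it is $c(s_1,s_2)=E[Z_0(s_1)Z_0(s_2)]+\sum_{t\ge1}E[Z_0(s_1)Z_t(s_2)]+\sum_{t\ge1}E[Z_0(s_2)Z_t(s_1)]$ (sums in $L^2([0,1]^d\times[0,1]^d)$). Local stationarity. $\{X_{t,T}\}_{t=1}^T$ in $L^p_H$ is locally stationary if for each $u\in[0,1]$ there is an $H$-valued process $\{X_t^{(u)}\}_{t\in\mathbb Z}$ in $L^p_H$ such that (i) $\{X_t^{(u)}\}_t$ is strictly stationary; (ii) for all $1\le t\le T$, almost surely $$\|X_{t,T}-X_t^{(u)}\|\le\Big(\Big|\frac tT-u\Big|+\frac1T\Big)U_{t,T}^{(u)},$$ where $U_{t,T}^{(u)}$ are positive random variables with $E[(U_{t,T}^{(u)})^\rho]<C$ for some $\rho>0$ and $C<\infty$ independent of $u,t,T$. $L^p$-$m$-approximability. $\{X_t^{(u)}\}$ is $L^p$-$m$-approximable if $X_t^{(u)}\in L^p_H$ has the form $X_t^{(u)}=f_u(\varepsilon_t,\varepsilon_{t-1},\dots)$ with $\varepsilon_j$ i.i.d. elements of a measurable space $S$ and $f_u:S^\infty\to H$ measurable, and, with $\{\varepsilon_{t,k}^{(m)}\}_k$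 (for each $t$ and $m$) independent copies of $\{\varepsilon_k\}_k$ defined on the same probability space and $$X_{m,t}^{(u)}=f_u(\varepsilon_t,\dots,\varepsilon_{t-m+1},\varepsilon_{t,t-m}^{(m)},\varepsilon_{t,t-m-1}^{(m)},\dots),$$ one has $\sum_{m\ge1}v_p(X_t^{(u)}-X_{m,t}^{(u)})<\infty$. *)

theory Defs
  imports "HOL-Probability.Probability"
begin

text \<open>
  Lebesgue measure on the unit cube. It is written as a density on the whole space, not as a
  restriction, so that representatives of square-integrable functions are total functions and no
  extensionality side conditions arise. For a product type it is the Lebesgue measure on the
  product of the two cubes (lemma \<open>cube_prod\<close>).
\<close>

definition cube :: "'a::euclidean_space measure"
  where "cube = density lborel (indicator (cbox 0 One))"

definition square_integrable :: "('a::euclidean_space \<Rightarrow> real) \<Rightarrow> bool"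
  where "square_integrable f \<longleftrightarrow> f \<in> borel_measurable borel \<and> integrable cube (\<lambda>x. (f x)\<^sup>2)"

lemma sets_cube [measurable_cong, simp]: "sets cube = sets borel"
  by (simp add: cube_def)

lemma space_cube [simp]: "space cube = UNIV"
  by (simp add: cube_def)

lemma prob_space_cube: "prob_space (cube :: 'a::euclidean_space measure)"
proof
  have "emeasure lborel (cbox 0 (One :: 'a)) = 1"
    by (subst emeasure_lborel_cbox) (auto simp: inner_sum_left_Basis)
  then show "emeasure cube (space cube :: 'a set) = 1"
    by (simp add: cube_def emeasure_density)
qed

interpretation cube: prob_space cube
  by (rule prob_space_cube)

lemma square_integrable_measurable [measurable_dest]:
  "square_integrable f \<Longrightarrow> f \<in> borel_measurable borel"
  by (simp add: square_integrable_def)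

lemma square_integrable_mult:
  assumes "square_integrable f" "square_integrable g"
  shows "integrable cube (\<lambda>x. f x * g x)"
proof (rule Bochner_Integration.integrable_bound)
  show "integrable cube (\<lambda>x. (f x)\<^sup>2 + (g x)\<^sup>2)"
    using assms by (simp add: square_integrable_def)
  show "(\<lambda>x. f x * g x) \<in> borel_measurable cube"
    using assms by measurable
  have "\<bar>a * b\<bar> \<le> a\<^sup>2 + b\<^sup>2" for a b :: real
  proof -
    have "2 * (\<bar>a\<bar> * \<bar>b\<bar>) \<le> a\<^sup>2 + b\<^sup>2"
      using sum_squares_bound[of "\<bar>a\<bar>" "\<bar>b\<bar>"] by simp
    moreover have "0 \<le> \<bar>a\<bar> * \<bar>b\<bar>" by simp
    ultimately show ?thesis unfolding abs_mult by linarith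
  qed
  then show "AE x in cube. norm (f x * g x) \<le> norm ((f x)\<^sup>2 + (g x)\<^sup>2)"
    by (intro AE_I2) (simp add: abs_of_nonneg del: abs_mult)
qed

lemma square_integrable_add:
  assumes "square_integrable f" "square_integrable g"
  shows "square_integrable (\<lambda>x. f x + g x)"
proof -
  have "integrable cube (\<lambda>x. (f x)\<^sup>2 + (g x)\<^sup>2 + 2 * (f x * g x))"
    using assms square_integrable_mult[OF assms]
    by (intro Bochner_Integration.integrable_add integrable_mult_right)
       (simp_all add: square_integrable_def)
  moreover have "(\<lambda>x. f x + g x) \<in> borel_measurable borel"
    using assms by measurable
  ultimately show ?thesis
    by (simp add: square_integrable_def power2_sum mult.assoc)
qed

lemma square_integrable_scale:
  assumes "square_integrable f"
  shows "square_integrable (\<lambda>x. r * f x)"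
proof -
  have "(\<lambda>x. r * f x) \<in> borel_measurable borel"
    using assms by measurable
  moreover have "integrable cube (\<lambda>x. (r * f x)\<^sup>2)"
    using assms by (simp add: square_integrable_def power_mult_distrib)
  ultimately show ?thesis
    unfolding square_integrable_def by blast
qed

lemma square_integrable_minus:
  assumes "square_integrable f"
  shows "square_integrable (\<lambda>x. - f x)"
  using assms by (simp add: square_integrable_def)

lemma square_integrable_diff:
  assumes "square_integrable f" "square_integrable g"
  shows "square_integrable (\<lambda>x. f x - g x)"
  using square_integrable_add[OF assms(1) square_integrable_minus[OF assms(2)]] by simp

lemma square_integrable_zero: "square_integrable (\<lambda>x. 0)"
  by (simp add: square_integrable_def)

definition L2_rel :: "('a::euclidean_space \<Rightarrow> real) \<Rightarrow> ('a \<Rightarrow> real) \<Rightarrow> bool"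
  where "L2_rel f g \<longleftrightarrow> square_integrable f \<and> square_integrable g \<and> (AE x in cube. f x = g x)"

text \<open>
  The Hilbert space of square-integrable functions on the unit cube, modulo almost everywhere
  equality. The parameter is the ambient Euclidean space: the type \<open>(real ^ 'd) L2\<close> is
  $L^2([0,1]^d)$, and kernels, that is, elements of $L^2([0,1]^d \times [0,1]^d)$, have type
  \<open>((real ^ 'd) \<times> (real ^ 'd)) L2\<close>.
\<close>

quotient_type (overloaded) 'a L2 = "'a::euclidean_space \<Rightarrow> real" / partial: L2_rel
proof (rule part_equivpI)
  show "\<exists>f. L2_rel f f"
    using square_integrable_zero by (auto simp: L2_rel_def)
  show "symp (L2_rel :: ('a \<Rightarrow> real) \<Rightarrow> _)"
    by (auto simp: L2_rel_def symp_def elim: eventually_mono)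
  show "transp (L2_rel :: ('a \<Rightarrow> real) \<Rightarrow> _)"
    by (rule transpI) (auto simp: L2_rel_def elim: eventually_elim2)
qed

instantiation L2 :: (euclidean_space) real_vector
begin

lift_definition zero_L2 :: "'a L2" is "\<lambda>x. 0"
  by (simp add: L2_rel_def square_integrable_zero)

lift_definition plus_L2 :: "'a L2 \<Rightarrow> 'a L2 \<Rightarrow> 'a L2" is "\<lambda>f g x. f x + g x"
  by (auto simp: L2_rel_def intro: square_integrable_add elim: eventually_elim2)

lift_definition uminus_L2 :: "'a L2 \<Rightarrow> 'a L2" is "\<lambda>f x. - f x"
  by (auto simp: L2_rel_def intro: square_integrable_minus elim: eventually_mono)

lift_definition minus_L2 :: "'a L2 \<Rightarrow> 'a L2 \<Rightarrow> 'a L2" is "\<lambda>f g x. f x - g x"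
  by (auto simp: L2_rel_def intro: square_integrable_diff elim: eventually_elim2)

lift_definition scaleR_L2 :: "real \<Rightarrow> 'a L2 \<Rightarrow> 'a L2" is "\<lambda>r f x. r * f x"
  by (auto simp: L2_rel_def intro: square_integrable_scale elim: eventually_mono)

instance
proof
  fix f g h :: "'a L2" and r s :: real
  show "f + g + h = f + (g + h)"
    by transfer (simp add: L2_rel_def square_integrable_add add.assoc)
  show "f + g = g + f"
    by transfer (simp add: L2_rel_def square_integrable_add add.commute)
  show "0 + f = f"
    by transfer (simp add: L2_rel_def)
  show "- f + f = 0"
    by transfer (simp add: L2_rel_def square_integrable_zero)
  show "f - g = f + - g"
    by transfer (simp add: L2_rel_def square_integrable_diff)
  show "r *\<^sub>R (f + g) = r *\<^sub>R f + r *\<^sub>R g"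
    by transfer (simp add: L2_rel_def distrib_left square_integrable_add square_integrable_scale)
  show "(r + s) *\<^sub>R f = r *\<^sub>R f + s *\<^sub>R f"
    by transfer (simp add: L2_rel_def distrib_right square_integrable_add square_integrable_scale)
  show "r *\<^sub>R s *\<^sub>R f = (r * s) *\<^sub>R f"
    by transfer (simp add: L2_rel_def mult.assoc square_integrable_scale)
  show "1 *\<^sub>R f = f"
    by transfer (simp add: L2_rel_def)
qed

end

instantiation L2 :: (euclidean_space) real_inner
begin

lift_definition inner_L2 :: "'a L2 \<Rightarrow> 'a L2 \<Rightarrow> real" is "\<lambda>f g. \<integral>x. f x * g x \<partial>cube"
proof (rule integral_cong_AE)
  fix f f' g g' :: "'a \<Rightarrow> real"
  assume *: "L2_rel f f'" "L2_rel g g'"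
  then show "(\<lambda>x. f x * g x) \<in> borel_measurable cube" "(\<lambda>x. f' x * g' x) \<in> borel_measurable cube"
    by (auto simp: L2_rel_def intro: borel_measurable_integrable square_integrable_mult)
  show "AE x in cube. f x * g x = f' x * g' x"
    using * by (auto simp: L2_rel_def elim: eventually_elim2)
qed

definition norm_L2 :: "'a L2 \<Rightarrow> real" where "norm_L2 f = sqrt (inner f f)"

definition sgn_L2 :: "'a L2 \<Rightarrow> 'a L2" where "sgn_L2 f = f /\<^sub>R norm f"

definition dist_L2 :: "'a L2 \<Rightarrow> 'a L2 \<Rightarrow> real" where "dist_L2 f g = norm (f - g)"

definition uniformity_L2 :: "('a L2 \<times> 'a L2) filter"
  where "uniformity_L2 = (INF e\<in>{0 <..}. principal {(f, g). dist f g < e})"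

definition open_L2 :: "'a L2 set \<Rightarrow> bool"
  where "open_L2 U = (\<forall>f\<in>U. eventually (\<lambda>(f', g). f' = f \<longrightarrow> g \<in> U) uniformity)"

instance
proof
  fix f g h :: "'a L2" and r :: real
  show "dist f g = norm (f - g)" by (rule dist_L2_def)
  show "sgn f = f /\<^sub>R norm f" by (rule sgn_L2_def)
  show "uniformity = (INF e\<in>{0 <..}. principal {(x :: 'a L2, y). dist x y < e})"
    by (rule uniformity_L2_def)
  show "open U = (\<forall>x\<in>U. \<forall>\<^sub>F (x', y) in uniformity. x' = x \<longrightarrow> y \<in> U)" for U :: "'a L2 set"
    by (rule open_L2_def)
  show "inner f g = inner g f"
    by transfer (simp add: mult.commute)
  show "inner (f + g) h = inner f h + inner g h"
    by transfer (simp add: L2_rel_def distrib_right square_integrable_mult)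
  show "inner (r *\<^sub>R f) g = r * inner f g"
    by transfer (simp add: L2_rel_def mult.assoc)
  show "0 \<le> inner f f"
    by transfer simp
  show "inner f f = 0 \<longleftrightarrow> f = 0"
  proof transfer
    fix f :: "'a \<Rightarrow> real" assume "L2_rel f f"
    then have f: "square_integrable f" by (simp add: L2_rel_def)
    have "(\<integral>x. f x * f x \<partial>cube) = 0 \<longleftrightarrow> (AE x in cube. f x * f x = 0)"
      by (rule integral_nonneg_eq_0_iff_AE) (use f in \<open>auto intro: square_integrable_mult\<close>)
    then show "(\<integral>x. f x * f x \<partial>cube) = 0 \<longleftrightarrow> L2_rel f (\<lambda>x. 0)"
      by (simp add: L2_rel_def f square_integrable_zero)
  qed
  show "norm f = sqrt (inner f f)" by (rule norm_L2_def)
qed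

end

lemma One_Pair: "(One :: 'a::euclidean_space \<times> 'b::euclidean_space) = (One, One)"
proof -
  have "(One :: 'a \<times> 'b) = (\<Sum>u\<in>Basis. (u, 0)) + (\<Sum>v\<in>Basis. (0, v))"
    unfolding Basis_prod_def
    by (subst sum.union_disjoint) (auto simp: sum.reindex inj_on_def)
  also have "\<dots> = (One, One)"
    by (simp add: prod_eq_iff fst_sum snd_sum)
  finally show ?thesis .
qed

lemma cube_prod: "(cube :: ('a::euclidean_space \<times> 'b::euclidean_space) measure) = cube \<Otimes>\<^sub>M cube"
proof -
  have "(cube \<Otimes>\<^sub>M cube :: ('a \<times> 'b) measure) =
     density (lborel \<Otimes>\<^sub>M lborel) (\<lambda>(x, y). indicator (cbox 0 One) x * indicator (cbox 0 One) y)"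
    unfolding cube_def
    by (rule pair_measure_density)
       (auto simp: cube_def[symmetric] intro: sigma_finite_lborel prob_space_imp_sigma_finite prob_space_cube)
  also have "(\<lambda>(x, y). indicator (cbox 0 One) x * indicator (cbox 0 One) y :: ennreal) =
      indicator (cbox 0 (One :: 'a \<times> 'b))"
    by (auto simp: One_Pair zero_prod_def cbox_Pair_eq indicator_def)
  finally show ?thesis
    by (simp add: cube_def lborel_prod)
qed

interpretation cube_pair: pair_sigma_finite "cube :: 'a::euclidean_space measure" "cube :: 'b::euclidean_space measure" ..

lemma square_integrable_tensor:
  fixes f :: "'a::euclidean_space \<Rightarrow> real" and g :: "'b::euclidean_space \<Rightarrow> real"
  assumes "square_integrable f" "square_integrable g"
  shows "square_integrable (\<lambda>(s, t). f s * g t)"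
proof -
  have [measurable]: "f \<in> borel_measurable borel" "g \<in> borel_measurable borel"
    and i: "integrable cube (\<lambda>x. (f x)\<^sup>2)" "integrable cube (\<lambda>x. (g x)\<^sup>2)"
    using assms by (auto simp: square_integrable_def)
  have m: "(\<lambda>(s, t). f s * g t) \<in> borel_measurable borel"
    unfolding borel_prod[symmetric] by measurable
  have "integrable (cube \<Otimes>\<^sub>M cube) (\<lambda>(s, t). (f s)\<^sup>2 * (g t)\<^sup>2)"
    by (rule cube_pair.Fubini_integrable) (use i in \<open>simp_all add: abs_mult\<close>)
  then show ?thesis
    using m by (simp add: square_integrable_def cube_prod power_mult_distrib case_prod_unfold)
qed

text \<open>The kernel $(s_1,s_2) \mapsto f(s_1)\,g(s_2)$.\<close>

lift_definition tensor :: "'a::euclidean_space L2 \<Rightarrow> 'b::euclidean_space L2 \<Rightarrow> ('a \<times> 'b) L2"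
  is "\<lambda>f g (s, t). f s * g t"
proof -
  fix f f' :: "'a \<Rightarrow> real" and g g' :: "'b \<Rightarrow> real"
  assume *: "L2_rel f f'" "L2_rel g g'"
  then have [measurable]: "f \<in> borel_measurable borel" "g \<in> borel_measurable borel"
    "f' \<in> borel_measurable borel" "g' \<in> borel_measurable borel"
    and ae: "AE x in cube. f x = f' x" "AE x in cube. g x = g' x"
    by (auto simp: L2_rel_def square_integrable_def)
  have "AE z in cube \<Otimes>\<^sub>M cube. (case z of (s, t) \<Rightarrow> f s * g t) = (case z of (s, t) \<Rightarrow> f' s * g' t)"
  proof (rule cube_pair.AE_pair_measure)
    show "AE s in cube. AE t in cube.
      (case (s, t) of (s, t) \<Rightarrow> f s * g t) = (case (s, t) of (s, t) \<Rightarrow> f' s * g' t)"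
      using ae(1)
    proof eventually_elim
      case (elim s)
      then show ?case
        using ae(2) by (auto elim: eventually_mono)
    qed
  qed measurable
  then show "L2_rel (\<lambda>(s, t). f s * g t) (\<lambda>(s, t). f' s * g' t)"
    using * unfolding L2_rel_def cube_prod[where 'a = 'a and 'b = 'b]
    by (auto intro: square_integrable_tensor)
qed

lemma L2_cases:
  obtains f' where "square_integrable f'" "f = abs_L2 f'"
proof
  have "L2_rel (rep_L2 f) (rep_L2 f)"
    by (rule Quotient_rep_reflp[OF Quotient_L2])
  then show "square_integrable (rep_L2 f)"
    by (simp add: L2_rel_def)
  show "f = abs_L2 (rep_L2 f)"
    by (rule Quotient_abs_rep[OF Quotient_L2, symmetric])
qed

lemma L2_rel_refl: "square_integrable f \<Longrightarrow> L2_rel f f"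
  by (simp add: L2_rel_def)

lemma abs_L2_simps:
  assumes "square_integrable f" "square_integrable g"
  shows "abs_L2 f + abs_L2 g = abs_L2 (\<lambda>x. f x + g x)"
    and "abs_L2 f - abs_L2 g = abs_L2 (\<lambda>x. f x - g x)"
    and "inner (abs_L2 f) (abs_L2 g) = (\<integral>x. f x * g x \<partial>cube)"
  using assms
  by (simp_all add: plus_L2.abs_eq minus_L2.abs_eq inner_L2.abs_eq L2_rel_refl)

lemma abs_L2_scaleR: "square_integrable f \<Longrightarrow> r *\<^sub>R abs_L2 f = abs_L2 (\<lambda>x. r * f x)"
  by (simp add: scaleR_L2.abs_eq L2_rel_refl)

lemma norm_abs_L2: "square_integrable f \<Longrightarrow> (norm (abs_L2 f))\<^sup>2 = (\<integral>x. (f x)\<^sup>2 \<partial>cube)"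
  unfolding power2_norm_eq_inner by (simp add: abs_L2_simps power2_eq_square)

lemma dist_abs_L2:
  assumes "square_integrable f" "square_integrable g"
  shows "(dist (abs_L2 f) (abs_L2 g))\<^sup>2 = (\<integral>x. (f x - g x)\<^sup>2 \<partial>cube)"
  by (simp add: dist_norm abs_L2_simps assms norm_abs_L2 square_integrable_diff)

lemma square_integrableI:
  assumes "g \<in> borel_measurable borel" "square_integrable f" "\<And>x. \<bar>g x\<bar> \<le> \<bar>f x\<bar>"
  shows "square_integrable g"
  unfolding square_integrable_def
proof
  show "integrable cube (\<lambda>x. (g x)\<^sup>2)"
    by (rule Bochner_Integration.integrable_bound[of _ "\<lambda>x. (f x)\<^sup>2"])
       (use assms in \<open>auto simp: square_integrable_def abs_le_square_iff\<close>)
qed (rule assms)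

lemma square_integrable_const: "square_integrable (\<lambda>x. c)"
  by (simp add: square_integrable_def)

lemma square_integrable_indicator: "A \<in> sets borel \<Longrightarrow> square_integrable (indicator A)"
  by (rule square_integrableI[OF _ square_integrable_const[of 1]]) (auto simp: indicator_def)

lemma integral_abs_le_norm_L2:
  assumes "square_integrable f"
  shows "(\<integral>x. \<bar>f x\<bar> \<partial>cube) \<le> norm (abs_L2 f)"
proof -
  have f: "square_integrable (\<lambda>x. \<bar>f x\<bar>)"
  proof (rule square_integrableI[OF _ assms])
    show "(\<lambda>x. \<bar>f x\<bar>) \<in> borel_measurable borel"
      using assms by measurable
  qed simp
  have "(\<integral>x. \<bar>f x\<bar> \<partial>cube) = inner (abs_L2 (\<lambda>x. \<bar>f x\<bar>)) (abs_L2 (\<lambda>x. 1))"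
    by (simp add: abs_L2_simps f square_integrable_const)
  also have "\<dots> \<le> norm (abs_L2 (\<lambda>x. \<bar>f x\<bar>)) * norm (abs_L2 (\<lambda>x. 1) :: 'a L2)"
    by (rule norm_cauchy_schwarz)
  also have "norm (abs_L2 (\<lambda>x. 1) :: 'a L2) = 1"
    using norm_abs_L2[OF square_integrable_const[of 1, where 'a = 'a]]
    by (simp add: cube.prob_space[simplified] power2_eq_1_iff) (smt (verit) norm_ge_zero)
  also have "norm (abs_L2 (\<lambda>x. \<bar>f x\<bar>)) = norm (abs_L2 f)"
    by (simp add: norm_eq_sqrt_inner abs_L2_simps f assms)
  finally show ?thesis by simp
qed

instance L2 :: (euclidean_space) complete_space
proof
  fix X :: "nat \<Rightarrow> 'a L2"
  assume "Cauchy X"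
  then have "\<exists>N. \<forall>k. \<forall>m\<ge>N k. \<forall>n\<ge>N k. dist (X m) (X n) < (1/2) ^ k"
    by (intro choice) (auto simp: Cauchy_def)
  then obtain N where N: "\<And>k m n. N k \<le> m \<Longrightarrow> N k \<le> n \<Longrightarrow> dist (X m) (X n) < (1/2) ^ k"
    by metis
  define r where "r k = k + (\<Sum>i\<le>k. N i)" for k
  have "strict_mono r"
    by (auto simp: strict_mono_Suc_iff r_def)
  have rN: "N k \<le> r k" for k
    unfolding r_def by (rule trans_le_add2) (rule member_le_sum, auto)
  have dX: "dist (X (r n)) (X (r k)) < (1/2) ^ n" if "n \<le> k" for n k
    by (rule N) (use rN[of n] strict_mono_leD[OF \<open>strict_mono r\<close> that] in linarith)+
  have "\<exists>f. square_integrable f \<and> X (r k) = abs_L2 f" for k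
    by (metis L2_cases)
  then obtain F where F: "\<And>k. square_integrable (F k)" "\<And>k. X (r k) = abs_L2 (F k)"
    by metis
  have Fm [measurable]: "\<And>k. F k \<in> borel_measurable borel"
    using F by (simp add: square_integrable_def)
  have "AE x in cube. summable (\<lambda>k. F (Suc k) x - F k x)"
  proof -
    have "(\<integral>\<^sup>+x. (\<Sum>k. ennreal \<bar>F (Suc k) x - F k x\<bar>) \<partial>cube)
        = (\<Sum>k. \<integral>\<^sup>+x. ennreal \<bar>F (Suc k) x - F k x\<bar> \<partial>cube)"
      by (rule nn_integral_suminf) simp
    also have "\<dots> \<le> (\<Sum>k. ennreal ((1/2) ^ k))"
    proof (rule suminf_le)
      fix k
      have sq: "square_integrable (\<lambda>x. F (Suc k) x - F k x)"
        by (intro square_integrable_diff F)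
      have "integrable cube (\<lambda>x. F (Suc k) x - F k x)"
        using square_integrable_mult[OF sq square_integrable_const[of 1]] by simp
      then have "(\<integral>\<^sup>+x. ennreal \<bar>F (Suc k) x - F k x\<bar> \<partial>cube) = ennreal (\<integral>x. \<bar>F (Suc k) x - F k x\<bar> \<partial>cube)"
        by (intro nn_integral_eq_integral) auto
      also have "\<dots> \<le> ennreal (norm (X (r (Suc k)) - X (r k)))"
        using integral_abs_le_norm_L2[OF sq] by (intro ennreal_leI) (simp add: F abs_L2_simps)
      also have "\<dots> \<le> ennreal ((1/2) ^ k)"
        using dX[of k "Suc k"] by (intro ennreal_leI) (simp add: dist_norm norm_minus_commute)
      finally show "(\<integral>\<^sup>+x. ennreal \<bar>F (Suc k) x - F k x\<bar> \<partial>cube) \<le> ennreal ((1/2) ^ k)" .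
    qed auto
    also have "\<dots> = ennreal (\<Sum>k. (1/2) ^ k)"
      by (rule suminf_ennreal2) (auto intro: summable_geometric)
    also have "\<dots> < \<infinity>" by simp
    finally have "AE x in cube. (\<Sum>k. ennreal \<bar>F (Suc k) x - F k x\<bar>) \<noteq> \<infinity>"
      by (intro nn_integral_PInf_AE) auto
    then show ?thesis
    proof eventually_elim
      case (elim x)
      then have "summable (\<lambda>k. \<bar>F (Suc k) x - F k x\<bar>)"
        by (intro summable_suminf_not_top) auto
      then show ?case
        by (rule summable_rabs_cancel)
    qed
  qed
  then have conv: "AE x in cube. convergent (\<lambda>k. F k x)"
  proof eventually_elim
    case (elim x)
    then have "convergent (\<lambda>n. F n x - F 0 x)"
      unfolding summable_iff_convergent sum_lessThan_telescope[of "\<lambda>k. F k x"] .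
    then have "convergent (\<lambda>n. (F n x - F 0 x) + F 0 x)"
      by (intro convergent_add convergent_const)
    then show ?case by simp
  qed
  define g where "g x = lim (\<lambda>k. F k x)" for x
  have gm [measurable]: "g \<in> borel_measurable borel"
    unfolding g_def by (rule borel_measurable_lim_metric) measurable
  have le: "(\<integral>\<^sup>+x. ennreal ((F n x - g x)\<^sup>2) \<partial>cube) \<le> ennreal (((1/2) ^ n)\<^sup>2)" for n
  proof -
    have "AE x in cube. ennreal ((F n x - g x)\<^sup>2) = liminf (\<lambda>k. ennreal ((F n x - F k x)\<^sup>2))"
      using conv
    proof eventually_elim
      case (elim x)
      then have "(\<lambda>k. F k x) \<longlonglongrightarrow> g x"
        by (simp add: g_def convergent_LIMSEQ_iff)
      then have "(\<lambda>k. ennreal ((F n x - F k x)\<^sup>2)) \<longlonglongrightarrow> ennreal ((F n x - g x)\<^sup>2)"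
        by (intro tendsto_intros)
      then show ?case
        by (rule lim_imp_Liminf[OF sequentially_bot, symmetric])
    qed
    then have "(\<integral>\<^sup>+x. ennreal ((F n x - g x)\<^sup>2) \<partial>cube)
        = (\<integral>\<^sup>+x. liminf (\<lambda>k. ennreal ((F n x - F k x)\<^sup>2)) \<partial>cube)"
      by (rule nn_integral_cong_AE)
    also have "\<dots> \<le> liminf (\<lambda>k. \<integral>\<^sup>+x. ennreal ((F n x - F k x)\<^sup>2) \<partial>cube)"
      by (rule nn_integral_liminf) measurable
    also have "\<dots> \<le> ennreal (((1/2) ^ n)\<^sup>2)"
    proof (rule Liminf_le)
      show "\<forall>\<^sub>F k in sequentially. (\<integral>\<^sup>+x. ennreal ((F n x - F k x)\<^sup>2) \<partial>cube) \<le> ennreal (((1/2) ^ n)\<^sup>2)"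
      proof (rule eventually_sequentiallyI[of n])
        fix k assume "n \<le> k"
        have "(\<integral>\<^sup>+x. ennreal ((F n x - F k x)\<^sup>2) \<partial>cube) = ennreal (\<integral>x. (F n x - F k x)\<^sup>2 \<partial>cube)"
          by (rule nn_integral_eq_integral)
             (use square_integrable_diff[OF F(1) F(1)] in \<open>auto simp: square_integrable_def\<close>)
        also have "\<dots> = ennreal ((dist (X (r n)) (X (r k)))\<^sup>2)"
          by (simp add: dist_abs_L2 F)
        also have "\<dots> \<le> ennreal (((1/2) ^ n)\<^sup>2)"
          using dX[OF \<open>n \<le> k\<close>] by (intro ennreal_leI power_mono) auto
        finally show "(\<integral>\<^sup>+x. ennreal ((F n x - F k x)\<^sup>2) \<partial>cube) \<le> ennreal (((1/2) ^ n)\<^sup>2)" .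
      qed
    qed simp
    finally show ?thesis .
  qed
  have sd: "square_integrable (\<lambda>x. F n x - g x)" for n
  proof -
    have "integrable cube (\<lambda>x. (F n x - g x)\<^sup>2)"
    proof (rule integrableI_nonneg)
      show "(\<integral>\<^sup>+x. ennreal ((F n x - g x)\<^sup>2) \<partial>cube) < \<infinity>"
        by (rule order_le_less_trans[OF le]) simp
    qed auto
    then show ?thesis by (simp add: square_integrable_def)
  qed
  have sg: "square_integrable g"
    using square_integrable_diff[OF F(1)[of 0] sd[of 0]] by simp
  have dg: "dist (X (r n)) (abs_L2 g) \<le> (1/2) ^ n" for n
  proof (rule power2_le_imp_le)
    have "ennreal (\<integral>x. (F n x - g x)\<^sup>2 \<partial>cube) \<le> ennreal (((1/2) ^ n)\<^sup>2)"
      using le[of n] sd[of n] by (subst nn_integral_eq_integral[symmetric]) (auto simp: square_integrable_def)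
    then show "(dist (X (r n)) (abs_L2 g))\<^sup>2 \<le> ((1/2) ^ n)\<^sup>2"
      by (simp add: F dist_abs_L2 sg ennreal_le_iff)
  qed simp
  have "(\<lambda>n. X (r n)) \<longlonglongrightarrow> abs_L2 g"
  proof (subst tendsto_dist_iff, rule Lim_null_comparison)
    show "\<forall>\<^sub>F n in sequentially. norm (dist (X (r n)) (abs_L2 g)) \<le> (1/2) ^ n"
      using dg by (intro always_eventually) simp
    show "(\<lambda>n. (1/2 :: real) ^ n) \<longlonglongrightarrow> 0"
      by (rule LIMSEQ_realpow_zero) auto
  qed
  then have "(X \<circ> r) \<longlonglongrightarrow> abs_L2 g" by (simp add: o_def)
  with \<open>Cauchy X\<close> \<open>strict_mono r\<close> have "X \<longlonglongrightarrow> abs_L2 g"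
    by (rule Cauchy_converges_subseq)
  then show "convergent X" by (rule convergentI)
qed

instance L2 :: (euclidean_space) banach ..

lemma tendsto_abs_L2_dominated:
  assumes "\<And>n. f n \<in> borel_measurable borel" "square_integrable w" "square_integrable g"
    and le: "\<And>n x. \<bar>f n x\<bar> \<le> \<bar>w x\<bar>" and lim: "\<And>x. (\<lambda>n. f n x) \<longlonglongrightarrow> g x"
  shows "(\<lambda>n. abs_L2 (f n)) \<longlonglongrightarrow> abs_L2 g"
proof -
  note [measurable] = assms(1)
  have [measurable]: "g \<in> borel_measurable borel" "w \<in> borel_measurable borel"
    using assms by (auto simp: square_integrable_def)
  have f: "square_integrable (f n)" for n
    using assms by (intro square_integrableI[OF _ assms(2)]) auto
  have g: "\<bar>g x\<bar> \<le> \<bar>w x\<bar>" for x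
    using tendsto_rabs[OF lim] by (rule tendsto_upperbound) (use le in auto)
  have "(\<lambda>n. \<integral>x. (f n x - g x)\<^sup>2 \<partial>cube) \<longlonglongrightarrow> (\<integral>x. (0::real) \<partial>(cube :: 'a measure))"
  proof (rule integral_dominated_convergence)
    show "integrable cube (\<lambda>x. 4 * (w x)\<^sup>2)"
      using assms by (auto simp: square_integrable_def)
    show "AE x in cube. (\<lambda>n. (f n x - g x)\<^sup>2) \<longlonglongrightarrow> 0"
    proof (rule AE_I2)
      fix x
      have "(\<lambda>n. (f n x - g x)\<^sup>2) \<longlonglongrightarrow> (g x - g x)\<^sup>2"
        by (intro tendsto_intros lim)
      then show "(\<lambda>n. (f n x - g x)\<^sup>2) \<longlonglongrightarrow> 0" by simp
    qed
    show "AE x in cube. norm ((f n x - g x)\<^sup>2) \<le> 4 * (w x)\<^sup>2" for n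
    proof (rule AE_I2)
      fix x
      have "\<bar>f n x - g x\<bar> \<le> \<bar>2 * w x\<bar>"
        using le[of n x] g[of x] by linarith
      then have "(f n x - g x)\<^sup>2 \<le> (2 * w x)\<^sup>2"
        by (simp only: abs_le_square_iff)
      then show "norm ((f n x - g x)\<^sup>2) \<le> 4 * (w x)\<^sup>2"
        by (simp add: power_mult_distrib)
    qed
  qed auto
  then have "(\<lambda>n. (dist (abs_L2 (f n)) (abs_L2 g))\<^sup>2) \<longlonglongrightarrow> 0"
    by (simp add: dist_abs_L2 f assms)
  then have "(\<lambda>n. sqrt ((dist (abs_L2 (f n)) (abs_L2 g))\<^sup>2)) \<longlonglongrightarrow> sqrt 0"
    by (rule tendsto_real_sqrt)
  then show ?thesis
    by (subst tendsto_dist_iff) simp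
qed

lemma abs_L2_sum:
  assumes "finite I" "\<And>i. i \<in> I \<Longrightarrow> square_integrable (h i)"
  shows "square_integrable (\<lambda>x. \<Sum>i\<in>I. h i x) \<and> abs_L2 (\<lambda>x. \<Sum>i\<in>I. h i x) = (\<Sum>i\<in>I. abs_L2 (h i))"
  using assms
proof (induction I)
  case empty
  show ?case by (simp add: zero_L2_def[symmetric] square_integrable_zero)
next
  case (insert i I)
  then have "square_integrable (h i)" "square_integrable (\<lambda>x. \<Sum>i\<in>I. h i x)"
    "abs_L2 (\<lambda>x. \<Sum>i\<in>I. h i x) = (\<Sum>i\<in>I. abs_L2 (h i))" by auto
  then show ?case
    using insert.hyps by (simp add: square_integrable_add abs_L2_simps(1)[symmetric])
qed

lemma abs_L2_indicator_empty: "abs_L2 (indicator {}) = 0"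
proof -
  have "indicator {} = (\<lambda>x :: 'a. 0 :: real)" by auto
  then show ?thesis by (simp add: zero_L2_def)
qed

instance L2 :: (euclidean_space) second_countable_topology
proof
  obtain \<B> :: "'a set set" where \<B>: "countable \<B>" "topological_basis \<B>"
    using ex_countable_basis by blast
  define G where "G = (\<lambda>F. \<Inter>F) ` {F. finite F \<and> F \<subseteq> \<B>}"
  have "countable G"
    unfolding G_def using \<B>(1) by (intro countable_image countable_Collect_finite_subset)
  have open_G: "open A" if "A \<in> G" for A
    using that topological_basis_open[OF \<B>(2)] unfolding G_def by (auto intro!: open_Inter)
  have "Int_stable G"
  proof (rule Int_stableI)
    fix A B assume "A \<in> G" "B \<in> G"
    then obtain F F' where "finite F" "F \<subseteq> \<B>" "A = \<Inter>F" "finite F'" "F' \<subseteq> \<B>" "B = \<Inter>F'"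
      unfolding G_def by auto
    then show "A \<inter> B \<in> G"
      unfolding G_def by (intro image_eqI[of _ _ "F \<union> F'"]) auto
  qed
  have "UNIV \<in> G"
    unfolding G_def by (intro image_eqI[of _ _ "{}"]) auto
  have "\<B> \<subseteq> G"
  proof
    fix A assume "A \<in> \<B>"
    then show "A \<in> G" unfolding G_def by (intro image_eqI[of _ _ "{A}"]) auto
  qed
  have sigma_G: "A \<in> sigma_sets UNIV G" if "A \<in> sets borel" for A
  proof -
    have "A \<in> sigma_sets UNIV \<B>"
      using that by (subst (asm) borel_eq_countable_basis[OF \<B>]) simp
    then show ?thesis using sigma_sets_subseteq[OF \<open>\<B> \<subseteq> G\<close>] by blast
  qed

  have G_borel: "sigma_sets UNIV G \<subseteq> sets borel"
  proof -
    have "G \<subseteq> sets borel" using open_G by auto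
    then show ?thesis using sets.sigma_sets_subset[of G borel] by simp
  qed

  have G_Pow: "G \<subseteq> Pow UNIV" by simp

  define ind where "ind A = abs_L2 (indicator A)" for A :: "'a set"
  define comb where "comb xs = (\<Sum>(q, A)\<leftarrow>xs. of_rat q *\<^sub>R ind A)" for xs
  define D where "D = comb ` lists (UNIV \<times> G)"
  have "countable D"
    unfolding D_def using \<open>countable G\<close> by (intro countable_image countable_lists countable_SIGMA) auto
  have D_zero: "0 \<in> D"
    unfolding D_def by (intro image_eqI[of _ _ "[]"]) (auto simp: comb_def)
  have D_add: "f + g \<in> D" if "f \<in> D" "g \<in> D" for f g
  proof -
    from that obtain xs ys where "f = comb xs" "xs \<in> lists (UNIV \<times> G)" "g = comb ys" "ys \<in> lists (UNIV \<times> G)"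
      unfolding D_def by auto
    then show ?thesis
      unfolding D_def by (intro image_eqI[of _ _ "xs @ ys"]) (auto simp: comb_def)
  qed
  have D_scale: "of_rat q *\<^sub>R f \<in> D" if "f \<in> D" for f q
  proof -
    have eq: "of_rat q *\<^sub>R comb xs = comb (map (\<lambda>(p, A). (q * p, A)) xs)" for xs
      unfolding comb_def by (induction xs) (auto simp: of_rat_mult scaleR_add_right)
    from that obtain xs where "f = comb xs" "xs \<in> lists (UNIV \<times> G)"
      unfolding D_def by auto
    then show ?thesis
      unfolding D_def by (intro image_eqI[of _ _ "map (\<lambda>(p, A). (q * p, A)) xs"]) (auto simp: eq lists_eq_set)
  qed
  have D_ind: "ind A \<in> D" if "A \<in> G" for A
    unfolding D_def using that by (intro image_eqI[of _ _ "[(1, A)]"]) (auto simp: comb_def)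

  define V where "V = closure D"
  have "closed V" "D \<subseteq> V"
    unfolding V_def by (auto intro: closure_subset[THEN subsetD])
  have V_add: "f + g \<in> V" if fg: "f \<in> V" "g \<in> V" for f g
  proof -
    obtain F F' where "\<And>n. F n \<in> D" "F \<longlonglongrightarrow> f" "\<And>n. F' n \<in> D" "F' \<longlonglongrightarrow> g"
      using fg unfolding V_def closure_sequential by blast
    then show ?thesis
      unfolding V_def closure_sequential
      by (intro exI[of _ "\<lambda>n. F n + F' n"]) (auto intro: D_add tendsto_add)
  qed
  have V_scale: "c *\<^sub>R f \<in> V" if f: "f \<in> V" for f c
  proof -
    obtain F where F: "\<And>n. F n \<in> D" "F \<longlonglongrightarrow> f"
      using f unfolding V_def closure_sequential by auto
    have "\<exists>q. dist (of_rat q) c < inverse (real (Suc n))" for n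
    proof -
      obtain q where "c - inverse (real (Suc n)) < of_rat q" "of_rat q < c"
        using of_rat_dense[of "c - inverse (real (Suc n))" c] by auto
      then show ?thesis by (intro exI[of _ q]) (simp add: dist_real_def)
    qed
    then have "\<forall>n. \<exists>q. dist (of_rat q) c < inverse (real (Suc n))" by blast
    from choice[OF this] obtain q where q: "\<And>n. dist (of_rat (q n)) c < inverse (real (Suc n))"
      by blast
    have "(\<lambda>n. of_rat (q n)) \<longlonglongrightarrow> c"
    proof (subst tendsto_dist_iff, rule Lim_null_comparison[OF _ LIMSEQ_inverse_real_of_nat])
      show "\<forall>\<^sub>F n in sequentially. norm (dist (of_rat (q n)) c) \<le> inverse (real (Suc n))"
        using less_imp_le[OF q] by (intro always_eventually) simp
    qed
    with F(2) have "(\<lambda>n. of_rat (q n) *\<^sub>R F n) \<longlonglongrightarrow> c *\<^sub>R f"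
      by (intro tendsto_scaleR)
    then show ?thesis
      unfolding V_def closure_sequential using D_scale[OF F(1)]
      by (intro exI[of _ "\<lambda>n. of_rat (q n) *\<^sub>R F n"]) auto
  qed
  have V_sum: "(\<Sum>i\<in>I. h i) \<in> V" if "finite I" "\<And>i. i \<in> I \<Longrightarrow> h i \<in> V" for h and I :: "'i set"
    using that \<open>D \<subseteq> V\<close> D_zero by (induction I) (auto intro: V_add)

  have V_ind: "ind A \<in> V" if A: "A \<in> sets borel" for A
    using \<open>Int_stable G\<close> G_Pow sigma_G[OF A]
  proof (induction rule: sigma_sets_induct_disjoint)
    case (basic A)
    then show ?case using D_ind \<open>D \<subseteq> V\<close> by auto
  next
    case empty
    have "ind {} = 0"
      by (simp add: ind_def abs_L2_indicator_empty)
    then show ?case using D_zero \<open>D \<subseteq> V\<close> by auto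
  next
    case (compl A)
    have "A \<in> sets borel"
      using compl(1) G_borel by blast
    have "indicator (UNIV - A) = (\<lambda>x. indicator UNIV x - indicator A x :: real)"
      by (auto simp: indicator_def)
    then have "ind (UNIV - A) = ind UNIV - ind A"
      using \<open>A \<in> sets borel\<close> by (simp add: ind_def abs_L2_simps square_integrable_indicator square_integrable_const)
    then have "ind (UNIV - A) = ind UNIV + (-1) *\<^sub>R ind A" by simp
    moreover have "ind UNIV \<in> V" using D_ind[OF \<open>UNIV \<in> G\<close>] \<open>D \<subseteq> V\<close> by blast
    moreover have "(-1) *\<^sub>R ind A \<in> V" by (rule V_scale) (rule compl)
    ultimately show ?case using V_add by metis
  next
    case (union A)
    have A: "A i \<in> sets borel" for i
      using union(2) G_borel by blast
    have eq: "(\<Sum>i<n. ind (A i)) = abs_L2 (indicator (\<Union>i<n. A i))" for n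
    proof (induction n)
      case 0
      show ?case by (simp add: zero_L2_def[symmetric])
    next
      case (Suc n)
      have "x \<notin> A n \<or> x \<notin> A i" if "i < n" for x i
        using disjoint_family_onD[OF union(1), of i n] that by auto
      then have "indicator (\<Union>i<Suc n. A i) = (\<lambda>x. indicator (\<Union>i<n. A i) x + indicator (A n) x :: real)"
        by (intro ext) (auto simp: indicator_def less_Suc_eq)
      then have "abs_L2 (indicator (\<Union>i<Suc n. A i)) = abs_L2 (\<lambda>x. indicator (\<Union>i<n. A i) x + indicator (A n) x)"
        by simp
      also have "\<dots> = abs_L2 (indicator (\<Union>i<n. A i)) + ind (A n)"
        unfolding ind_def using A by (subst abs_L2_simps) (auto intro!: square_integrable_indicator)
      finally show ?case using Suc by simp
    qed
    have "(\<lambda>n. abs_L2 (indicator (\<Union>i<n. A i))) \<longlonglongrightarrow> abs_L2 (indicator (\<Union>i. A i))"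
    proof (rule tendsto_abs_L2_dominated)
      show "(\<lambda>n. indicator (\<Union>i<n. A i) x) \<longlonglongrightarrow> (indicator (\<Union>i. A i) x :: real)" for x
        by (rule LIMSEQ_indicator_UN)
      show "square_integrable (\<lambda>x. 1)" by (rule square_integrable_const)
    qed (use A in \<open>auto intro!: square_integrable_indicator simp: indicator_def\<close>)
    then show ?case
      unfolding ind_def[of "\<Union>i. A i"] eq[symmetric]
      by (rule closed_sequentially[OF \<open>closed V\<close>, rotated]) (rule V_sum, auto intro: union)
  qed

  have "f \<in> V" for f
  proof -
    obtain g where g: "square_integrable g" and f: "f = abs_L2 g"
      by (rule L2_cases)
    obtain s where s: "\<And>i. simple_function borel (s i)" "\<And>x. (\<lambda>i. s i x) \<longlonglongrightarrow> g x"
      "\<And>i x. dist (s i x) 0 \<le> 2 * dist (g x) 0"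
      using borel_measurable_implies_sequence_metric[of g borel 0] g
      by (auto simp: square_integrable_def)
    have "abs_L2 (s i) \<in> V" for i
    proof -
      have fin: "finite (range (s i))"
        using simple_functionD(1)[OF s(1)[of i]] by simp
      have meas: "s i -` {y} \<in> sets borel" for y
        using simple_functionD(2)[OF s(1)[of i], of "{y}"] by simp
      have sq: "square_integrable (\<lambda>x. y * indicator (s i -` {y}) x)" for y
        by (rule square_integrable_scale[OF square_integrable_indicator[OF meas]])
      have "abs_L2 (\<lambda>x. \<Sum>y\<in>range (s i). y * indicator (s i -` {y}) x)
          = (\<Sum>y\<in>range (s i). abs_L2 (\<lambda>x. y * indicator (s i -` {y}) x))"
        using abs_L2_sum[OF fin, of "\<lambda>y x. y * indicator (s i -` {y}) x"] sq by blast
      also have "\<dots> = (\<Sum>y\<in>range (s i). y *\<^sub>R ind (s i -` {y}))"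
        unfolding ind_def by (intro sum.cong refl abs_L2_scaleR[symmetric] square_integrable_indicator meas)
      finally have eq: "abs_L2 (\<lambda>x. \<Sum>y\<in>range (s i). y * indicator (s i -` {y}) x)
          = (\<Sum>y\<in>range (s i). y *\<^sub>R ind (s i -` {y}))" .
      have s_eq: "(\<Sum>y\<in>range (s i). y * indicator (s i -` {y}) x) = s i x" for x
      proof -
        have "(\<Sum>y\<in>range (s i). y * indicator (s i -` {y}) x) = (\<Sum>y\<in>{s i x}. y * indicator (s i -` {y}) x)"
          by (rule sum.mono_neutral_right) (use fin in \<open>auto simp: indicator_def\<close>)
        then show ?thesis by simp
      qed
      have "abs_L2 (s i) = (\<Sum>y\<in>range (s i). y *\<^sub>R ind (s i -` {y}))"
        using eq unfolding s_eq by simp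
      then show ?thesis using fin meas by (auto intro!: V_sum V_scale V_ind)
    qed
    moreover have "(\<lambda>i. abs_L2 (s i)) \<longlonglongrightarrow> abs_L2 g"
    proof (rule tendsto_abs_L2_dominated)
      show "square_integrable (\<lambda>x. 2 * g x)" by (rule square_integrable_scale[OF g])
      show "s n \<in> borel_measurable borel" for n by (rule borel_measurable_simple_function[OF s(1)])
      show "\<bar>s n x\<bar> \<le> \<bar>2 * g x\<bar>" for n x using s(3)[of n x] by (simp add: dist_real_def abs_mult)
    qed (use s g in auto)
    ultimately show ?thesis
      unfolding f by (rule closed_sequentially[OF \<open>closed V\<close>])
  qed
  then have dense: "closure D = UNIV"
    unfolding V_def by auto

  define \<C> where "\<C> = (\<lambda>(d, q). ball d (of_rat q)) ` (D \<times> UNIV)"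
  have "countable \<C>"
    unfolding \<C>_def using \<open>countable D\<close> by (intro countable_image countable_SIGMA) auto
  have "topological_basis \<C>"
  proof (rule topological_basisI)
    show "open B" if "B \<in> \<C>" for B
      using that by (auto simp: \<C>_def)
    fix U :: "'a L2 set" and f assume "open U" "f \<in> U"
    then obtain e where e: "e > 0" "ball f e \<subseteq> U"
      by (auto simp: open_contains_ball)
    obtain q where q: "(0 :: real) < of_rat q" "of_rat q < e / 2"
      using of_rat_dense[of 0 "e / 2"] e by (metis half_gt_zero)
    obtain d where d: "d \<in> D" "dist d f < of_rat q"
      using dense q(1) by (metis UNIV_I closure_approachable)
    have "ball d (of_rat q) \<subseteq> ball f e"
    proof
      fix x assume "x \<in> ball d (of_rat q)"
      then show "x \<in> ball f e"
        using d(2) q dist_triangle[of f x d] by (simp add: dist_commute)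
    qed
    with e d show "\<exists>B'\<in>\<C>. f \<in> B' \<and> B' \<subseteq> U"
      by (intro bexI[of _ "ball d (of_rat q)"]) (auto simp: \<C>_def)
  qed
  with \<open>countable \<C>\<close> show "\<exists>B :: 'a L2 set set. countable B \<and> open = generate_topology B"
    by (blast intro: topological_basis_imp_subbasis)
qed

definition in_Lp :: "'w measure \<Rightarrow> real \<Rightarrow> ('w \<Rightarrow> 'a::euclidean_space L2) \<Rightarrow> bool"
  where "in_Lp M p X \<longleftrightarrow> X \<in> borel_measurable M \<and> integrable M (\<lambda>\<omega>. norm (X \<omega>) powr p)"

definition Lp_norm :: "'w measure \<Rightarrow> real \<Rightarrow> ('w \<Rightarrow> 'a::euclidean_space L2) \<Rightarrow> real"
  where "Lp_norm M p X = (\<integral>\<omega>. norm (X \<omega>) powr p \<partial>M) powr (1 / p)"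

definition strictly_stationary :: "'w measure \<Rightarrow> (int \<Rightarrow> 'w \<Rightarrow> 'b::topological_space) \<Rightarrow> bool"
  where "strictly_stationary M Z \<longleftrightarrow> (\<forall>t. Z t \<in> borel_measurable M) \<and>
    (\<forall>J k. finite J \<longrightarrow>
      distr M (\<Pi>\<^sub>M j\<in>J. borel) (\<lambda>\<omega>. \<lambda>j\<in>J. Z (j + k) \<omega>) =
      distr M (\<Pi>\<^sub>M j\<in>J. borel) (\<lambda>\<omega>. \<lambda>j\<in>J. Z j \<omega>))"

text \<open>
  \<open>X T t\<close> is $X_{t,T}$, and \<open>Xs u t\<close> is $X^{(u)}_t$. The approximating stationary processes and the
  moment exponent are arguments, because further conditions are imposed on them.
\<close>

definition locally_stationary ::
  "'w measure \<Rightarrow> real \<Rightarrow> real \<Rightarrow> (nat \<Rightarrow> nat \<Rightarrow> 'w \<Rightarrow> 'a::euclidean_space L2) \<Rightarrow>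
    (real \<Rightarrow> int \<Rightarrow> 'w \<Rightarrow> 'a L2) \<Rightarrow> bool"
  where "locally_stationary M p \<rho> X Xs \<longleftrightarrow> \<rho> > 0 \<and>
    (\<forall>T. \<forall>t\<in>{1..T}. in_Lp M p (X T t)) \<and>
    (\<forall>u\<in>{0..1}. (\<forall>t. in_Lp M p (Xs u t)) \<and> strictly_stationary M (Xs u)) \<and>
    (\<exists>U C. \<forall>u\<in>{0..1}. \<forall>T. \<forall>t\<in>{1..T}.
      U u T t \<in> borel_measurable M \<and> (AE \<omega> in M. 0 < U u T t \<omega>) \<and>
      integrable M (\<lambda>\<omega>. U u T t \<omega> powr \<rho>) \<and> (\<integral>\<omega>. U u T t \<omega> powr \<rho> \<partial>M) < C \<and>
      (AE \<omega> in M. norm (X T t \<omega> - Xs u (int t) \<omega>)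
        \<le> (\<bar>real t / real T - u\<bar> + 1 / real T) * U u T t \<omega>))"

text \<open>
  $L^p$-$m$-approximability with innovations in the measurable space \<open>S\<close>. A sequence
  $(e_0, e_1, \dots)$ fed to \<open>f\<close> lists the present innovation first and then the past ones.
  The process \<open>\<epsilon>' m t\<close> is the copy $\{\varepsilon^{(m)}_{t,k}\}_k$. Each copy is only required to be
  independent of the original innovations: the condition involves one pair \<open>(m, t)\<close> at a time,
  so the joint law of different copies is irrelevant. The series over $m \ge 1$ is indexed by \<open>Suc m\<close>.
\<close>

definition Lp_m_approximable ::
  "'w measure \<Rightarrow> 's measure \<Rightarrow> real \<Rightarrow> (int \<Rightarrow> 'w \<Rightarrow> 'a::euclidean_space L2) \<Rightarrow> bool"
  where "Lp_m_approximable M S p Z \<longleftrightarrow> (\<forall>t. in_Lp M p (Z t)) \<and>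
    (\<exists>f \<epsilon> \<epsilon>'.
      f \<in> borel_measurable (\<Pi>\<^sub>M k\<in>(UNIV :: nat set). S) \<and>
      prob_space.indep_vars M (\<lambda>_. S) \<epsilon> (UNIV :: int set) \<and>
      (\<forall>j. distr M S (\<epsilon> j) = distr M S (\<epsilon> 0)) \<and>
      (\<forall>t. AE \<omega> in M. Z t \<omega> = f (\<lambda>k. \<epsilon> (t - int k) \<omega>)) \<and>
      (\<forall>m\<ge>1. \<forall>t.
        prob_space.indep_var M
          (\<Pi>\<^sub>M k\<in>UNIV. S) (\<lambda>\<omega> k. \<epsilon> k \<omega>) (\<Pi>\<^sub>M k\<in>UNIV. S) (\<lambda>\<omega> k. \<epsilon>' m t k \<omega>) \<and>
        distr M (\<Pi>\<^sub>M k\<in>UNIV. S) (\<lambda>\<omega> k. \<epsilon>' m t k \<omega>) = distr M (\<Pi>\<^sub>M k\<in>UNIV. S) (\<lambda>\<omega> k. \<epsilon> k \<omega>)) \<and>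
      (\<forall>t. summable (\<lambda>m. Lp_norm M p (\<lambda>\<omega>. Z t \<omega> -
        f (\<lambda>k. if k < Suc m then \<epsilon> (t - int k) \<omega> else \<epsilon>' (Suc m) t (t - int k) \<omega>)))))"

text \<open>
  The kernel $E[X(s_1) Y(s_2)]$ as a Bochner integral in $L^2$ of the product of the cubes.
  Exchanging \<open>X\<close> and \<open>Y\<close> transposes it to $E[X(s_2) Y(s_1)]$.
\<close>

definition cross_moment :: "'w measure \<Rightarrow> ('w \<Rightarrow> 'a::euclidean_space L2) \<Rightarrow> ('w \<Rightarrow> 'a L2) \<Rightarrow> ('a \<times> 'a) L2"
  where "cross_moment M X Y = (\<integral>\<omega>. tensor (X \<omega>) (Y \<omega>) \<partial>M)"

definition long_run_cov :: "'w measure \<Rightarrow> (int \<Rightarrow> 'w \<Rightarrow> 'a::euclidean_space L2) \<Rightarrow> ('a \<times> 'a) L2"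
  where "long_run_cov M Z = cross_moment M (Z 0) (Z 0)
    + (\<Sum>t. cross_moment M (Z 0) (Z (int (Suc t))))
    + (\<Sum>t. cross_moment M (Z (int (Suc t))) (Z 0))"

text \<open>
  Gaussian random elements of $L^2$: all one-dimensional projections are normal, where point
  masses count as normal distributions of variance $0$.
\<close>

definition gaussian :: "'w measure \<Rightarrow> ('w \<Rightarrow> 'a::euclidean_space L2) \<Rightarrow> bool"
  where "gaussian M Z \<longleftrightarrow> Z \<in> borel_measurable M \<and>
    (\<forall>x. \<exists>\<mu> \<sigma>. distr M borel (\<lambda>\<omega>. inner (Z \<omega>) x) = return borel \<mu> \<or>
      \<sigma> > 0 \<and> distr M borel (\<lambda>\<omega>. inner (Z \<omega>) x) = density lborel (normal_density \<mu> \<sigma>))"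

definition tendsto_in_prob :: "'w measure \<Rightarrow> (nat \<Rightarrow> 'w \<Rightarrow> real) \<Rightarrow> real \<Rightarrow> bool"
  where "tendsto_in_prob M Y c \<longleftrightarrow>
    (\<forall>e>0. (\<lambda>n. measure M {\<omega> \<in> space M. \<bar>Y n \<omega> - c\<bar> > e}) \<longlonglongrightarrow> 0)"

definition tendsto_infinity_in_prob :: "'w measure \<Rightarrow> (nat \<Rightarrow> 'w \<Rightarrow> real) \<Rightarrow> bool"
  where "tendsto_infinity_in_prob M Y \<longleftrightarrow>
    (\<forall>B. (\<lambda>n. measure M {\<omega> \<in> space M. Y n \<omega> > B}) \<longlonglongrightarrow> 1)"

definition local_mean ::
  "(real \<Rightarrow> real) \<Rightarrow> real \<Rightarrow> real \<Rightarrow> nat \<Rightarrow> (nat \<Rightarrow> nat \<Rightarrow> 'w \<Rightarrow> 'a::euclidean_space L2) \<Rightarrow> 'w \<Rightarrow> 'a L2"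
  where "local_mean K h u T X \<omega> =
    (1 / (real T * h)) *\<^sub>R (\<Sum>t=1..T. K ((u - real t / real T) / h) *\<^sub>R X T t \<omega>)"

definition two_sample_stat ::
  "(real \<Rightarrow> real) \<Rightarrow> real \<Rightarrow> real \<Rightarrow> nat \<Rightarrow> nat \<Rightarrow> (nat \<Rightarrow> nat \<Rightarrow> 'w \<Rightarrow> 'a::euclidean_space L2) \<Rightarrow>
    (nat \<Rightarrow> nat \<Rightarrow> 'w \<Rightarrow> 'a L2) \<Rightarrow> 'w \<Rightarrow> real"
  where "two_sample_stat K h u T\<^sub>1 T\<^sub>2 X Y \<omega> =
    real T\<^sub>1 * real T\<^sub>2 * h / (real T\<^sub>1 + real T\<^sub>2) *
      (norm (local_mean K h u T\<^sub>1 X \<omega> - local_mean K h u T\<^sub>2 Y \<omega>))\<^sup>2"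

end

theory Submission
  imports Defs
begin

text \<open>
  Standardise each local mean: after division by the square root of the mesh \<open>1 / (T h)\<close> its
  centred version differs from the kernel-weighted sum of the stationary process at \<open>u\<close> by a
  term whose second moment is of order \<open>T h\<^sup>3 + 1 / (T h)\<close>. For that sum, one-dimensional projections
  are replaced by bounded functions of finitely many innovations, and Stein's differential equation
  for the characteristic function applies because summands far apart are independent.
  Independence of the samples multiplies the characteristic functions, which gives the limit
  \<open>exp (- Q x x / 2)\<close> with the covariance form \<open>Q\<close> of the Gaussian element.

  To pass to squared norms, write \<open>exp (- l * (norm W)\<^sup>2)\<close>, along a Parseval frame truncated at finitely
  many coordinates, as a Gaussian mixture of the characters of \<open>W\<close>. The coordinates beyond the
  truncation are uniformly negligible, since the covariances of the weighted sums have uniformly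
  small traces there. Convergence of the Laplace transform at the integers \<open>l\<close> then gives weak
  convergence by polynomial approximation.
\<close>

section \<open>Weak convergence from Laplace transforms\<close>

text \<open>The hypotheses give second moments and a summable sequence of L2 coupling distances.
  Stein's bound has a cubic term, so it only reaches bounded summands with finite memory
  \<open>m\<close>. Replacing \<open>F\<close> by such a \<open>g\<close> changes the variance of a
  weighted sum by about \<open>m\<close> times the squared L2 distance of \<open>F\<close> and
  \<open>g\<close>, because within the memory nothing is decorrelated; hence m (d m)^2 has to be
  small, and summability of the coupling distances \<open>d\<close> is just enough for that. One
  inequality carries the rest: a variable depending on the innovations up to time s has covariance
  with \<open>F\<close> at time s + r at most its L2 norm times \<open>d r\<close>. It makes the
  long-run covariances summable and, combined with Cauchy-Schwarz over the coordinates of a frame,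
  gives the trace bounds that replace tightness. The condition T h^3 -> 0 enters because on the
  kernel window both the mean and the process differ by order h from those at u, and standardising
  multiplies this by the square root of T h.\<close>

lemma laplace_tendsto_imp_weak_conv:
  fixes W :: "nat \<Rightarrow> 'a \<Rightarrow> real" and V :: "'b \<Rightarrow> real"
  assumes M: "prob_space M" and N: "prob_space N"
    and [measurable]: "\<And>n. W n \<in> borel_measurable M" "V \<in> borel_measurable N"
    and nonneg: "\<And>n \<omega>. 0 \<le> W n \<omega>" "\<And>\<omega>. 0 \<le> V \<omega>"
    and lim: "\<And>j::nat. (\<lambda>n. \<integral>\<omega>. exp (- real j * W n \<omega>) \<partial>M) \<longlonglongrightarrow> (\<integral>\<omega>. exp (- real j * V \<omega>) \<partial>N)"
  shows "weak_conv_m (\<lambda>n. distr M borel (W n)) (distr N borel V)"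
proof (rule integral_cts_step_conv_imp_weak_conv)
  interpret M: prob_space M by (rule M)
  interpret N: prob_space N by (rule N)
  show "real_distribution (distr M borel (W n))" for n
    by (rule M.real_distribution_distr) simp
  show "real_distribution (distr N borel V)"
    by (rule N.real_distribution_distr) simp
  fix x y :: real assume xy: "x < y"
  \<comment> \<open>In the variable v = exp (- w) the half-line becomes a subset of [0,1], and
    polynomials in v are combinations of the functions exp (- i w). The maximum keeps
    \<open>ln\<close> away from 0; it alters only arguments beyond y + 1, where
    \<open>cts_step x y\<close> is 0 anyway.\<close>
  define \<psi> where "\<psi> v = cts_step x y (- ln (max v (exp (- y - 1))))" for v
  have cont_step: "continuous_on UNIV (cts_step x y)"
    by (rule uniformly_continuous_imp_continuous[OF cts_step_uniformly_continuous[OF xy]])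
  have [measurable]: "cts_step x y \<in> borel_measurable borel"
    by (rule borel_measurable_continuous_onI[OF cont_step])
  have "continuous_on {0..1} \<psi>"
    unfolding \<psi>_def
  proof (rule continuous_on_compose2[OF cont_step])
    have "max v (exp (- y - 1)) \<noteq> 0" for v
      using exp_gt_zero[of "- y - 1"] by linarith
    then show "continuous_on {0..1} (\<lambda>v. - ln (max v (exp (- y - 1))))"
      by (intro continuous_intros) auto
  qed auto
  have \<psi>_exp: "cts_step x y w = \<psi> (exp (- w))" for w
  proof (cases "w \<le> y + 1")
    case True
    then have "max (exp (- w)) (exp (- y - 1)) = exp (- w)" by (simp add: max_def)
    then show ?thesis by (simp add: \<psi>_def)
  next
    case False
    then have "max (exp (- w)) (exp (- y - 1)) = exp (- y - 1)" by (simp add: max_def)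
    then show ?thesis using False xy by (simp add: \<psi>_def cts_step_def)
  qed
  show "(\<lambda>n. integral\<^sup>L (distr M borel (W n)) (cts_step x y)) \<longlonglongrightarrow> integral\<^sup>L (distr N borel V) (cts_step x y)"
  proof (rule LIMSEQ_I)
    fix r :: real assume "0 < r"
    then obtain g where "real_polynomial_function g" and g: "\<And>v. v \<in> {0..1} \<Longrightarrow> \<bar>\<psi> v - g v\<bar> < r / 4"
      using Stone_Weierstrass_real_polynomial_function[OF compact_Icc \<open>continuous_on {0..1} \<psi>\<close>, of "r / 4"]
      by auto
    then obtain a k where ga: "g = (\<lambda>v. \<Sum>i\<le>k. a i * v ^ i)"
      by (auto simp: real_polynomial_function_iff_sum)
    have near: "\<bar>cts_step x y w - g (exp (- w))\<bar> \<le> r / 4" if "0 \<le> w" for w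
      unfolding \<psi>_exp using g[of "exp (- w)"] that by simp
    have g_exp: "g (exp (- w)) = (\<Sum>i\<le>k. a i * exp (- real i * w))" for w
      by (simp add: ga exp_of_nat_mult[symmetric])
    have step: "integrable Q (\<lambda>\<omega>. cts_step x y (U \<omega>)) \<and> integrable Q (\<lambda>\<omega>. g (exp (- U \<omega>))) \<and>
        (\<integral>\<omega>. g (exp (- U \<omega>)) \<partial>Q) = (\<Sum>i\<le>k. a i * (\<integral>\<omega>. exp (- real i * U \<omega>) \<partial>Q)) \<and>
        \<bar>(\<integral>\<omega>. cts_step x y (U \<omega>) \<partial>Q) - (\<integral>\<omega>. g (exp (- U \<omega>)) \<partial>Q)\<bar> \<le> r / 4"
      if "prob_space Q" and [measurable]: "U \<in> borel_measurable Q" and U: "\<And>\<omega>. 0 \<le> U \<omega>"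
      for Q :: "'c measure" and U
    proof -
      interpret Q: prob_space Q by fact
      have i: "integrable Q (\<lambda>\<omega>. exp (- real i * U \<omega>))" for i
        by (rule Q.integrable_const_bound[of _ 1]) (use U in auto)
      have i1: "integrable Q (\<lambda>\<omega>. cts_step x y (U \<omega>))"
        by (rule Q.integrable_const_bound[of _ 1]) (use xy in \<open>auto simp: cts_step_def\<close>)
      have i2: "integrable Q (\<lambda>\<omega>. g (exp (- U \<omega>)))"
        unfolding g_exp using i by auto
      have "\<bar>(\<integral>\<omega>. cts_step x y (U \<omega>) \<partial>Q) - (\<integral>\<omega>. g (exp (- U \<omega>)) \<partial>Q)\<bar>
          = \<bar>\<integral>\<omega>. cts_step x y (U \<omega>) - g (exp (- U \<omega>)) \<partial>Q\<bar>"
        using i1 i2 by simp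
      also have "\<dots> \<le> (\<integral>\<omega>. \<bar>cts_step x y (U \<omega>) - g (exp (- U \<omega>))\<bar> \<partial>Q)"
        by (rule integral_abs_bound)
      also have "\<dots> \<le> (\<integral>\<omega>. r / 4 \<partial>Q)"
        by (rule integral_mono) (use i1 i2 near[OF U] in auto)
      also have "\<dots> = r / 4" by (simp add: Q.prob_space)
      finally show ?thesis using i1 i2 i by (simp add: g_exp)
    qed
    have "(\<lambda>n. \<integral>\<omega>. g (exp (- W n \<omega>)) \<partial>M) \<longlonglongrightarrow> (\<integral>\<omega>. g (exp (- V \<omega>)) \<partial>N)"
    proof -
      have "(\<integral>\<omega>. g (exp (- W n \<omega>)) \<partial>M) = (\<Sum>i\<le>k. a i * (\<integral>\<omega>. exp (- real i * W n \<omega>) \<partial>M))" for n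
        using step[OF M assms(3) nonneg(1)] by blast
      moreover have "(\<integral>\<omega>. g (exp (- V \<omega>)) \<partial>N) = (\<Sum>i\<le>k. a i * (\<integral>\<omega>. exp (- real i * V \<omega>) \<partial>N))"
        using step[OF N assms(4) nonneg(2)] by blast
      ultimately show ?thesis
        by (simp only:) (intro tendsto_sum tendsto_mult tendsto_const lim)
    qed
    then obtain no where no: "\<And>n. n \<ge> no \<Longrightarrow>
        \<bar>(\<integral>\<omega>. g (exp (- W n \<omega>)) \<partial>M) - (\<integral>\<omega>. g (exp (- V \<omega>)) \<partial>N)\<bar> < r / 4"
      using LIMSEQ_D[of _ _ "r / 4"] \<open>0 < r\<close> by fastforce
    show "\<exists>no. \<forall>n\<ge>no. norm (integral\<^sup>L (distr M borel (W n)) (cts_step x y)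
        - integral\<^sup>L (distr N borel V) (cts_step x y)) < r"
    proof (intro exI[of _ no] allI impI)
      fix n assume n: "no \<le> n"
      show "norm (integral\<^sup>L (distr M borel (W n)) (cts_step x y)
        - integral\<^sup>L (distr N borel V) (cts_step x y)) < r"
      proof -
        have "\<bar>(\<integral>\<omega>. cts_step x y (W n \<omega>) \<partial>M) - (\<integral>\<omega>. g (exp (- W n \<omega>)) \<partial>M)\<bar> \<le> r / 4"
          using step[OF M assms(3) nonneg(1)] by blast
        moreover have "\<bar>(\<integral>\<omega>. cts_step x y (V \<omega>) \<partial>N) - (\<integral>\<omega>. g (exp (- V \<omega>)) \<partial>N)\<bar> \<le> r / 4"
          using step[OF N assms(4) nonneg(2)] by blast
        ultimately have "\<bar>(\<integral>\<omega>. cts_step x y (W n \<omega>) \<partial>M) - (\<integral>\<omega>. cts_step x y (V \<omega>) \<partial>N)\<bar> < r"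
          using no[OF n] \<open>0 < r\<close> by linarith
        then show ?thesis by (simp add: integral_distr)
      qed
    qed
  qed
qed

text \<open>Gaussian elimination: \<open>B x (schur B d n z)\<close> is the Schur complement of
  \<open>B\<close> after the directions \<open>d 0\<close>, ..., \<open>d (n - 1)\<close> are
  eliminated. Acting on the vector \<open>z\<close> and not on the form keeps everything an
  evaluation of \<open>B\<close>. A zero pivot makes the quotient 0 and the step void.\<close>

fun schur :: "('h::real_vector \<Rightarrow> 'h \<Rightarrow> real) \<Rightarrow> (nat \<Rightarrow> 'h) \<Rightarrow> nat \<Rightarrow> 'h \<Rightarrow> 'h" where
  "schur B d 0 z = z"
| "schur B d (Suc n) z =
    schur B d n z - (B z (schur B d n (d n)) / B (d n) (schur B d n (d n))) *\<^sub>R schur B d n (d n)"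

section \<open>Positive semidefinite forms and Parseval frames\<close>

locale psd_form =
  fixes B :: "'h::real_vector \<Rightarrow> 'h \<Rightarrow> real"
  assumes add_left: "B (x + y) z = B x z + B y z"
    and scale_left: "B (r *\<^sub>R x) z = r * B x z"
    and sym: "B x y = B y x"
    and nonneg: "0 \<le> B x x"
begin

lemma add_right: "B z (x + y) = B z x + B z y"
  by (metis add_left sym)

lemma scale_right: "B z (r *\<^sub>R x) = r * B z x"
  by (metis scale_left sym)

lemma diff_left: "B (x - y) z = B x z - B y z"
  using add_left[of "x - y" y z] by simp

lemma diff_right: "B z (x - y) = B z x - B z y"
  by (metis diff_left sym)

lemmas bilinear = add_left add_right diff_left diff_right scale_left scale_right

lemma zero_left [simp]: "B 0 x = 0"
  using scale_left[of 0 0 x] by simp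

lemma cauchy_schwarz: "(B x y)\<^sup>2 \<le> B x x * B y y"
proof -
  have q: "0 \<le> B x x + 2 * t * B x y + t\<^sup>2 * B y y" for t
    using nonneg[of "x + t *\<^sub>R y"] sym[of y x]
    by (simp add: bilinear power2_eq_square algebra_simps)
  show ?thesis
  proof (cases "B y y = 0")
    case True
    have "B x y = 0"
    proof (rule ccontr)
      assume "B x y \<noteq> 0"
      \<comment> \<open>With this \<open>t\<close> the inequality \<open>q\<close> reads 0 \<le> -1:
        if \<open>B y y = 0\<close>, the right-hand side is affine in \<open>t\<close> and cannot
        stay nonnegative with a nonzero slope.\<close>
      define t where "t = - (B x x + 1) / (2 * B x y)"
      have "2 * t * B x y = - (B x x + 1)"
        using \<open>B x y \<noteq> 0\<close> by (simp add: t_def)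
      then show False using q[of t] by (simp add: True)
    qed
    then show ?thesis by (simp add: True)
  next
    case False
    then have "B y y > 0" using nonneg[of y] by simp
    then show ?thesis using q[of "- B x y / B y y"]
      by (simp add: field_simps power2_eq_square)
  qed
qed

lemma schur_Suc: "B x (schur B d (Suc n) z) = B x (schur B d n z)
    - B z (schur B d n (d n)) * B x (schur B d n (d n)) / B (d n) (schur B d n (d n))"
  by (simp add: bilinear)

text \<open>Nonnegativity of the next complement is exactly Cauchy-Schwarz, in the present one,
  between \<open>x\<close> and the pivot \<open>d n\<close>.\<close>

lemma psd_form_schur: "psd_form (\<lambda>x z. B x (schur B d n z))"
proof (induction n)
  case 0
  show ?case by unfold_locales (auto simp: bilinear sym nonneg)
next
  case (Suc n)
  interpret C: psd_form "\<lambda>x z. B x (schur B d n z)" by (rule Suc)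
  let ?C = "\<lambda>x z. B x (schur B d n z)"
  show ?case
  proof
    fix x :: 'h
    have "?C x (d n) * ?C x (d n) / ?C (d n) (d n) \<le> ?C x x"
    proof (cases "?C (d n) (d n) = 0")
      case True
      then show ?thesis using C.nonneg by simp
    next
      case False
      then have "?C (d n) (d n) > 0" using C.nonneg[of "d n"] by simp
      then show ?thesis using C.cauchy_schwarz[of x "d n"]
        by (simp add: field_simps power2_eq_square)
    qed
    then show "0 \<le> B x (schur B d (Suc n) x)"
      unfolding schur_Suc by simp
  next
    fix x y
    show "B x (schur B d (Suc n) y) = B y (schur B d (Suc n) x)"
      unfolding schur_Suc using C.sym[of x y] by (simp add: mult.commute)
  qed (rule add_left scale_left)+
qed

text \<open>Cholesky factorisation. \<open>y k\<close> is the k-th pivot vector, normalised so that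
  \<open>(B x (y k))\<^sup>2\<close> is what the complement at \<open>x\<close> loses in step
  \<open>k\<close>. The sum telescopes to \<open>B x x\<close> minus the complement after
  \<open>n\<close> steps, which is nonnegative in general and 0 at directions already
  eliminated.\<close>

lemma orthogonalization:
  fixes d :: "nat \<Rightarrow> 'h"
  obtains y where "\<And>x n. (\<Sum>k<n. (B x (y k))\<^sup>2) \<le> B x x"
    and "\<And>i n. i < n \<Longrightarrow> (\<Sum>k<n. (B (d i) (y k))\<^sup>2) = B (d i) (d i)"
proof -
  define C where "C n x z = B x (schur B d n z)" for n x z
  define y where "y k = (1 / sqrt (C k (d k) (d k))) *\<^sub>R schur B d k (d k)" for k
  have C: "psd_form (C n)" for n
    using psd_form_schur[of d n] by (simp add: C_def[abs_def])
  have C_nonneg: "0 \<le> C n x x" for n x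
    by (rule psd_form.nonneg[OF C])
  have C_Suc: "C (Suc n) x z = C n x z - C n z (d n) * C n x (d n) / C n (d n) (d n)" for n x z
    unfolding C_def by (rule schur_Suc)
  have C_0: "C 0 x z = B x z" for x z
    by (simp add: C_def)
  have sq: "(B x (y k))\<^sup>2 = C k x x - C (Suc k) x x" for x k
  proof -
    have "(B x (y k))\<^sup>2 = (C k x (d k))\<^sup>2 / C k (d k) (d k)"
      using C_nonneg[of k "d k"] by (simp add: y_def scale_right power_divide C_def[symmetric])
    also have "\<dots> = C k x x - C (Suc k) x x"
      by (simp add: C_Suc power2_eq_square)
    finally show ?thesis .
  qed
  have sum: "(\<Sum>k<n. (B x (y k))\<^sup>2) = B x x - C n x x" for n x
    unfolding sq by (induction n) (simp_all add: C_0)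
  have dec: "C (Suc n) x x \<le> C n x x" for n x
    using sq[of x n] zero_le_power2[of "B x (y n)"] by linarith
  \<comment> \<open>A nonzero pivot cancels itself; a zero pivot stays zero because the complements
    decrease and are nonnegative.\<close>
  have zero: "C (Suc i) (d i) (d i) = 0" for i
    by (cases "C i (d i) (d i) = 0")
      (use dec[of i "d i"] C_nonneg[of "Suc i" "d i"] in \<open>simp_all add: C_Suc\<close>)
  show ?thesis
  proof
    show "(\<Sum>k<n. (B x (y k))\<^sup>2) \<le> B x x" for x n
      using C_nonneg[of n x] by (simp add: sum)
    fix i n :: nat assume "i < n"
    then have "C n (d i) (d i) \<le> C (Suc i) (d i) (d i)"
      using lift_Suc_antimono_le[of "\<lambda>n. C n (d i) (d i)", OF dec, of "Suc i" n] by simp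
    then have "C n (d i) (d i) = 0"
      using zero C_nonneg[of n "d i"] by simp
    then show "(\<Sum>k<n. (B (d i) (y k))\<^sup>2) = B (d i) (d i)"
      by (simp add: sum)
  qed
qed

end

text \<open>Eliminating a dense sequence gives equality on that sequence. The defect
  \<open>q n\<close> is again a nonnegative quadratic form, bounded by a multiple of the squared
  norm, so its parallelogram law passes from a nearby \<open>d i\<close>, where it vanishes for
  large \<open>n\<close>, to an arbitrary \<open>x\<close>.\<close>

lemma psd_form_expansion:
  fixes B :: "'h::{real_normed_vector, second_countable_topology} \<Rightarrow> 'h \<Rightarrow> real"
  assumes "psd_form B" and bound: "\<And>x. B x x \<le> C * (norm x)\<^sup>2"
  obtains y where "\<And>x. (\<lambda>k. (B x (y k))\<^sup>2) sums B x x"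
proof -
  interpret psd_form B by fact
  obtain D :: "'h set" where D: "countable D" "\<And>X. open X \<Longrightarrow> X \<noteq> {} \<Longrightarrow> \<exists>d\<in>D. d \<in> X"
    using countable_dense_exists by blast
  then have "D \<noteq> {}" by blast
  define d where "d = from_nat_into D"
  have range_d: "range d = D"
    unfolding d_def by (rule range_from_nat_into[OF \<open>D \<noteq> {}\<close> D(1)])
  obtain y where y: "\<And>x n. (\<Sum>k<n. (B x (y k))\<^sup>2) \<le> B x x"
    "\<And>i n. i < n \<Longrightarrow> (\<Sum>k<n. (B (d i) (y k))\<^sup>2) = B (d i) (d i)"
    using orthogonalization[of d] by blast
  define q where "q n x = B x x - (\<Sum>k<n. (B x (y k))\<^sup>2)" for n x
  have q_nonneg: "0 \<le> q n x" for n x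
    using y(1)[of x n] by (simp add: q_def)
  have para: "q n (a + b) + q n (a - b) = 2 * q n a + 2 * q n b" for n a b
  proof -
    have "(\<Sum>k<n. (B (a + b) (y k))\<^sup>2) + (\<Sum>k<n. (B (a - b) (y k))\<^sup>2)
        = (\<Sum>k<n. 2 * (B a (y k))\<^sup>2 + 2 * (B b (y k))\<^sup>2)"
      unfolding sum.distrib[symmetric]
      by (rule sum.cong) (auto simp: bilinear power2_eq_square algebra_simps)
    then show ?thesis
      by (simp add: q_def bilinear sum.distrib sum_distrib_left[symmetric] algebra_simps)
  qed
  have "(\<lambda>n. q n x) \<longlonglongrightarrow> 0" for x
  proof (rule LIMSEQ_I)
    fix r :: real assume r: "0 < r"
    \<comment> \<open>With this radius 2 |C| e^2 < r; the added 1 covers C = 0.\<close>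
    define e where "e = sqrt (r / (2 * \<bar>C\<bar> + 1))"
    have "e > 0" using r by (simp add: e_def)
    obtain i where i: "dist (d i) x < e"
    proof -
      have "\<exists>z\<in>D. z \<in> ball x e" using D(2)[of "ball x e"] \<open>e > 0\<close> by force
      then show ?thesis using that range_d by (metis dist_commute imageE mem_ball)
    qed
    have "q n x < r" if "n > i" for n
    proof -
      have "q n x \<le> 2 * q n (x - d i) + 2 * q n (d i)"
        using para[of n "x - d i" "d i"] q_nonneg[of n "x - d i - d i"] by simp
      also have "q n (d i) = 0" using y(2)[OF that] by (simp add: q_def)
      also have "q n (x - d i) \<le> B (x - d i) (x - d i)"
        unfolding q_def by (simp add: sum_nonneg)
      also have "\<dots> \<le> \<bar>C\<bar> * (norm (x - d i))\<^sup>2"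
        using bound[of "x - d i"] by (smt (verit) mult_right_mono zero_le_power2)
      also have "\<dots> \<le> \<bar>C\<bar> * e\<^sup>2"
        using i by (intro mult_left_mono power_mono) (auto simp: dist_norm norm_minus_commute)
      also have "2 * (\<bar>C\<bar> * e\<^sup>2) + 2 * 0 < r"
        using r by (simp add: e_def field_simps)
      finally show ?thesis by simp
    qed
    then show "\<exists>no. \<forall>n\<ge>no. norm (q n x - 0) < r"
      using q_nonneg by (intro exI[of _ "Suc i"]) auto
  qed
  then have "(\<lambda>k. (B x (y k))\<^sup>2) sums B x x" for x
  proof -
    have "(\<lambda>n. B x x - q n x) \<longlonglongrightarrow> B x x - 0"
      by (intro tendsto_diff tendsto_const \<open>(\<lambda>n. q n x) \<longlonglongrightarrow> 0\<close>)
    then show ?thesis by (simp add: q_def sums_def)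
  qed
  then show ?thesis by (rule that)
qed

text \<open>A Parseval frame, not necessarily an orthonormal basis, is all that is needed.\<close>

lemma parseval_frame_exists:
  obtains e :: "nat \<Rightarrow> 'h::{real_inner, second_countable_topology}"
  where "\<And>x. (\<lambda>k. (inner x (e k))\<^sup>2) sums (norm x)\<^sup>2"
proof -
  have "psd_form (inner :: 'h \<Rightarrow> 'h \<Rightarrow> real)"
  proof
    show "inner x y = inner y x" for x y :: 'h by (rule inner_commute)
  qed (simp_all add: inner_add_left)
  then obtain y where y: "\<And>x :: 'h. (\<lambda>k. (inner x (y k))\<^sup>2) sums inner x x"
    using psd_form_expansion[of inner 1] by (metis dual_order.refl mult_1 power2_norm_eq_inner)
  show ?thesis
    by (rule that[of y]) (simp add: power2_norm_eq_inner y)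
qed

section \<open>Squared norms from characteristic functions\<close>

lemma square_expectation_le:
  fixes X :: "'a \<Rightarrow> real"
  assumes "prob_space M" "X \<in> borel_measurable M" "integrable M (\<lambda>x. (X x)\<^sup>2)"
  shows "(\<integral>x. X x \<partial>M)\<^sup>2 \<le> (\<integral>x. (X x)\<^sup>2 \<partial>M)"
proof -
  interpret prob_space M by fact
  have "integrable M X" by (rule square_integrable_imp_integrable[OF assms(2,3)])
  then have "variance X = (\<integral>x. (X x)\<^sup>2 \<partial>M) - (\<integral>x. X x \<partial>M)\<^sup>2"
    using assms(3) by (rule variance_eq)
  moreover have "0 \<le> variance X" by (rule variance_positive)
  ultimately show ?thesis by simp
qed

lemma expectation_le_sqrt:
  fixes X :: "'a \<Rightarrow> real"
  assumes "prob_space M" "X \<in> borel_measurable M" "integrable M (\<lambda>x. (X x)\<^sup>2)"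
  shows "(\<integral>x. \<bar>X x\<bar> \<partial>M) \<le> sqrt (\<integral>x. (X x)\<^sup>2 \<partial>M)"
  using square_expectation_le[of M "\<lambda>x. \<bar>X x\<bar>"] assms by (intro real_le_rsqrt) simp

lemma char_std_normal_scale:
  "(CLINT g|std_normal_distribution. iexp (g * c)) = complex_of_real (exp (- c\<^sup>2 / 2))"
  using fun_cong[OF char_std_normal_distribution, of c] unfolding char_def by (simp add: mult.commute)

lemma prob_space_std_normal: "prob_space std_normal_distribution"
  using real_dist_normal_dist by (simp add: real_distribution_def)

context
  fixes e :: "nat \<Rightarrow> 'h::{real_inner, second_countable_topology}" and l :: real
begin

text \<open>Fourier transform in \<open>x\<close> and Laplace transform in the squares of the first
  \<open>K\<close> coordinates at once: removing one damping factor shifts \<open>x\<close>, so the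
  induction on \<open>K\<close> has to carry the character along.\<close>

definition damped_char :: "'a measure \<Rightarrow> ('a \<Rightarrow> 'h) \<Rightarrow> nat \<Rightarrow> 'h \<Rightarrow> complex"
  where "damped_char Q U K x =
    (CLINT \<omega>|Q. iexp (inner (U \<omega>) x) * of_real (exp (- l * (\<Sum>k<K. (inner (U \<omega>) (e k))\<^sup>2))))"

text \<open>Each Gaussian damping factor is itself an average of characters, so it can be absorbed into the
  character.\<close>

lemma damped_char_Suc:
  assumes "prob_space Q" and [measurable]: "U \<in> borel_measurable Q" and "0 \<le> l"
  shows "damped_char Q U (Suc K) x =
    (CLINT g|std_normal_distribution. damped_char Q U K (x + (sqrt (2 * l) * g) *\<^sub>R e K))"
proof -
  interpret Q: prob_space Q by fact
  interpret \<gamma>: prob_space std_normal_distribution by (rule prob_space_std_normal)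
  interpret pair_prob_space std_normal_distribution Q ..
  define D where "D \<omega> = exp (- l * (\<Sum>k<K. (inner (U \<omega>) (e k))\<^sup>2))" for \<omega>
  have D: "0 \<le> D \<omega>" "D \<omega> \<le> 1" for \<omega>
    using \<open>0 \<le> l\<close> by (auto simp: D_def sum_nonneg)
  have [measurable]: "D \<in> borel_measurable Q"
    unfolding D_def[abs_def] by measurable
  have eq: "iexp (inner (U \<omega>) x) * of_real (exp (- l * (\<Sum>k<Suc K. (inner (U \<omega>) (e k))\<^sup>2)))
      = (CLINT g|std_normal_distribution. iexp (inner (U \<omega>) (x + (sqrt (2 * l) * g) *\<^sub>R e K)) * of_real (D \<omega>))"
    for \<omega>
  proof -
    let ?c = "inner (U \<omega>) (e K)"
    have "(CLINT g|std_normal_distribution. iexp (inner (U \<omega>) (x + (sqrt (2 * l) * g) *\<^sub>R e K)) * of_real (D \<omega>))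
      = (CLINT g|std_normal_distribution. (iexp (inner (U \<omega>) x) * of_real (D \<omega>)) * iexp (g * (sqrt (2 * l) * ?c)))"
      by (intro Bochner_Integration.integral_cong refl)
         (simp add: inner_add_right exp_add[symmetric] algebra_simps)
    \<comment> \<open>The factor sqrt (2 l) in the shift turns the standard normal character exp (-
      c^2 / 2) into the damping factor exp (- l c^2).\<close>
    also have "\<dots> = (iexp (inner (U \<omega>) x) * of_real (D \<omega>)) * of_real (exp (- (sqrt (2 * l) * ?c)\<^sup>2 / 2))"
      by (subst integral_mult_right_zero) (simp only: char_std_normal_scale)
    also have "(sqrt (2 * l) * ?c)\<^sup>2 = 2 * l * ?c\<^sup>2"
      using \<open>0 \<le> l\<close> by (simp add: power_mult_distrib)
    finally show ?thesis
      by (simp add: D_def exp_add[symmetric] of_real_mult[symmetric] algebra_simps del: of_real_mult)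
  qed
  have int: "integrable (std_normal_distribution \<Otimes>\<^sub>M Q)
    (\<lambda>(g, \<omega>). iexp (inner (U \<omega>) (x + (sqrt (2 * l) * g) *\<^sub>R e K)) * of_real (D \<omega>))"
  proof (rule integrable_const_bound[of _ 1])
    show "AE z in std_normal_distribution \<Otimes>\<^sub>M Q.
      norm (case z of (g, \<omega>) \<Rightarrow> iexp (inner (U \<omega>) (x + (sqrt (2 * l) * g) *\<^sub>R e K)) * of_real (D \<omega>)) \<le> 1"
      using D by (auto simp: norm_mult abs_of_nonneg)
  qed measurable
  show ?thesis
    unfolding damped_char_def eq D_def[symmetric]
    by (rule Fubini_integral[OF int])
qed

lemma norm_damped_char_le:
  assumes "prob_space Q" and [measurable]: "U \<in> borel_measurable Q" and "0 \<le> l"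
  shows "norm (damped_char Q U K x) \<le> 1"
proof -
  interpret Q: prob_space Q by fact
  have le: "norm (iexp (inner (U \<omega>) x) * of_real (exp (- l * (\<Sum>k<K. (inner (U \<omega>) (e k))\<^sup>2)))) \<le> 1" for \<omega>
    using \<open>0 \<le> l\<close> by (simp add: norm_mult sum_nonneg)
  have "norm (damped_char Q U K x)
      \<le> (\<integral>\<omega>. norm (iexp (inner (U \<omega>) x) * of_real (exp (- l * (\<Sum>k<K. (inner (U \<omega>) (e k))\<^sup>2)))) \<partial>Q)"
    unfolding damped_char_def by (rule integral_norm_bound)
  also have "\<dots> \<le> (\<integral>\<omega>. 1 \<partial>Q)"
    by (rule integral_mono'[OF _ le]) simp_all
  finally show ?thesis by (simp add: Q.prob_space)
qed

text \<open>Dominated convergence under the Gaussian mixture of \<open>damped_char_Suc\<close> lifts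
  convergence at all shifts from \<open>K\<close> to \<open>Suc K\<close>.\<close>

lemma damped_char_tendsto:
  fixes W :: "nat \<Rightarrow> 'a \<Rightarrow> 'h" and Z :: "'b \<Rightarrow> 'h"
  assumes M: "prob_space M" and N: "prob_space N"
    and [measurable]: "\<And>n. W n \<in> borel_measurable M" "Z \<in> borel_measurable N" and l: "0 \<le> l"
    and char: "\<And>x. (\<lambda>n. CLINT \<omega>|M. iexp (inner (W n \<omega>) x)) \<longlonglongrightarrow> (CLINT \<omega>|N. iexp (inner (Z \<omega>) x))"
  shows "(\<lambda>n. damped_char M (W n) K x) \<longlonglongrightarrow> damped_char N Z K x"
proof (induction K arbitrary: x)
  case 0
  then show ?case using char by (simp add: damped_char_def)
next
  case (Suc K)
  interpret M: prob_space M by fact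
  interpret N: prob_space N by fact
  interpret \<gamma>: prob_space std_normal_distribution by (rule prob_space_std_normal)
  have "(\<lambda>n. CLINT g|std_normal_distribution. damped_char M (W n) K (x + (sqrt (2 * l) * g) *\<^sub>R e K))
    \<longlonglongrightarrow> (CLINT g|std_normal_distribution. damped_char N Z K (x + (sqrt (2 * l) * g) *\<^sub>R e K))"
  proof (rule integral_dominated_convergence)
    show "(\<lambda>g. damped_char N Z K (x + (sqrt (2 * l) * g) *\<^sub>R e K)) \<in> borel_measurable std_normal_distribution"
      unfolding damped_char_def by measurable
    show "(\<lambda>g. damped_char M (W n) K (x + (sqrt (2 * l) * g) *\<^sub>R e K)) \<in> borel_measurable std_normal_distribution" for n
      unfolding damped_char_def by measurable
    show "integrable std_normal_distribution (\<lambda>_. 1 :: real)" by simp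
    show "AE g in std_normal_distribution. norm (damped_char M (W n) K (x + (sqrt (2 * l) * g) *\<^sub>R e K)) \<le> 1" for n
      using norm_damped_char_le[OF M _ l] by simp
  qed (use Suc in auto)
  then show ?case
    by (simp add: damped_char_Suc[OF M _ l] damped_char_Suc[OF N _ l])
qed

end

lemma abs_exp_diff_le:
  fixes a b :: real
  assumes "0 \<le> a" "a \<le> b"
  shows "\<bar>exp (- b) - exp (- a)\<bar> \<le> b - a"
proof -
  have "exp (- a) - exp (- b) = exp (- a) * (1 - exp (- (b - a)))"
    by (simp add: algebra_simps exp_add[symmetric])
  also have "\<dots> \<le> 1 * (b - a)"
  proof (rule mult_mono)
    show "1 - exp (- (b - a)) \<le> b - a"
      using exp_ge_add_one_self[of "- (b - a)"] by linarith
  qed (use assms in auto)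
  finally show ?thesis using assms by simp
qed

text \<open>In infinite dimension convergence of all characters does not prevent mass from escaping
  through the high coordinates; \<open>tail\<close> excludes this. Since exp (- l t) is Lipschitz in
  t on the half-line, cutting to \<open>K\<close> coordinates costs at most \<open>l\<close> times
  the expected remainder, which \<open>tail\<close> keeps small for all large \<open>n\<close>. For
  \<open>Z\<close> the cut is removed by dominated convergence.\<close>

lemma char_tendsto_imp_weak_conv_norm:
  fixes W :: "nat \<Rightarrow> 'a \<Rightarrow> 'h::{real_inner, second_countable_topology}" and Z :: "'b \<Rightarrow> 'h"
  assumes M: "prob_space M" and N: "prob_space N"
    and [measurable]: "\<And>n. W n \<in> borel_measurable M" "Z \<in> borel_measurable N"
    and char: "\<And>x. (\<lambda>n. CLINT \<omega>|M. iexp (inner (W n \<omega>) x)) \<longlonglongrightarrow> (CLINT \<omega>|N. iexp (inner (Z \<omega>) x))"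
    and e: "\<And>x. (\<lambda>k. (inner x (e k))\<^sup>2) sums (norm x)\<^sup>2"
    and int: "\<And>n. integrable M (\<lambda>\<omega>. (norm (W n \<omega>))\<^sup>2)"
    and tail: "\<And>r. r > 0 \<Longrightarrow> \<exists>K0. \<forall>K\<ge>K0. \<forall>\<^sub>F n in sequentially.
      (\<integral>\<omega>. (norm (W n \<omega>))\<^sup>2 - (\<Sum>k<K. (inner (W n \<omega>) (e k))\<^sup>2) \<partial>M) \<le> r"
  shows "weak_conv_m (\<lambda>n. distr M borel (\<lambda>\<omega>. (norm (W n \<omega>))\<^sup>2)) (distr N borel (\<lambda>\<omega>. (norm (Z \<omega>))\<^sup>2))"
proof (rule laplace_tendsto_imp_weak_conv[OF M N])
  interpret M: prob_space M by fact
  interpret N: prob_space N by fact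
  fix j :: nat
  define l where "l = real j"
  have l: "0 \<le> l" by (simp add: l_def)
  define p where "p K x = (\<Sum>k<K. (inner x (e k))\<^sup>2)" for K and x :: 'h
  have [measurable]: "p K \<in> borel_measurable borel" for K
    unfolding p_def by measurable
  have p_nonneg: "0 \<le> p K x" for K x
    by (simp add: p_def sum_nonneg)
  have p_le: "p K x \<le> (norm x)\<^sup>2" for K x
    unfolding p_def sums_unique[OF e] by (rule sum_le_suminf) (use e in \<open>auto simp: sums_iff\<close>)
  have p_lim: "(\<lambda>K. p K x) \<longlonglongrightarrow> (norm x)\<^sup>2" for x
    using e by (simp add: p_def sums_def)
  define A where "A n = (\<integral>\<omega>. exp (- (l * (norm (W n \<omega>))\<^sup>2)) \<partial>M)" for n
  define AK where "AK K n = (\<integral>\<omega>. exp (- (l * p K (W n \<omega>))) \<partial>M)" for K n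
  define B where "B = (\<integral>\<omega>. exp (- (l * (norm (Z \<omega>))\<^sup>2)) \<partial>N)"
  define BK where "BK K = (\<integral>\<omega>. exp (- (l * p K (Z \<omega>))) \<partial>N)" for K
  have AK: "AK K \<longlonglongrightarrow> BK K" for K
  proof -
    have eq: "damped_char e l Q U K 0 = of_real (\<integral>\<omega>. exp (- (l * p K (U \<omega>))) \<partial>Q)" for Q :: "'c measure" and U
      by (simp add: damped_char_def p_def)
    have "(\<lambda>n. damped_char e l M (W n) K 0) \<longlonglongrightarrow> damped_char e l N Z K 0"
      by (rule damped_char_tendsto[OF M N _ _ l char]) simp_all
    then show ?thesis
      unfolding eq tendsto_of_real_iff by (simp add: AK_def[abs_def] BK_def)
  qed
  have BK: "BK \<longlonglongrightarrow> B"
    unfolding BK_def[abs_def] B_def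
  proof (rule integral_dominated_convergence)
    show "AE \<omega> in N. (\<lambda>K. exp (- (l * p K (Z \<omega>)))) \<longlonglongrightarrow> exp (- (l * (norm (Z \<omega>))\<^sup>2))"
      by (intro AE_I2 tendsto_intros p_lim)
    show "AE \<omega> in N. norm (exp (- (l * p K (Z \<omega>)))) \<le> 1" for K
      using l p_nonneg by simp
    show "integrable N (\<lambda>_. 1 :: real)" by simp
  qed simp_all
  have close: "\<bar>A n - AK K n\<bar> \<le> l * (\<integral>\<omega>. (norm (W n \<omega>))\<^sup>2 - p K (W n \<omega>) \<partial>M)" for n K
  proof -
    have i: "integrable M (\<lambda>\<omega>. exp (- (l * (norm (W n \<omega>))\<^sup>2)))" "integrable M (\<lambda>\<omega>. exp (- (l * p K (W n \<omega>))))"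
      by (rule M.integrable_const_bound[of _ 1]; use l p_nonneg in auto)+
    have i2: "integrable M (\<lambda>\<omega>. p K (W n \<omega>))"
      by (rule Bochner_Integration.integrable_bound[OF int[of n]])
         (use p_nonneg p_le in \<open>auto simp: abs_of_nonneg\<close>)
    have "\<bar>A n - AK K n\<bar> = \<bar>\<integral>\<omega>. exp (- (l * (norm (W n \<omega>))\<^sup>2)) - exp (- (l * p K (W n \<omega>))) \<partial>M\<bar>"
      unfolding A_def AK_def using i by simp
    also have "\<dots> \<le> (\<integral>\<omega>. \<bar>exp (- (l * (norm (W n \<omega>))\<^sup>2)) - exp (- (l * p K (W n \<omega>)))\<bar> \<partial>M)"
      by (rule integral_abs_bound)
    also have "\<dots> \<le> (\<integral>\<omega>. l * ((norm (W n \<omega>))\<^sup>2 - p K (W n \<omega>)) \<partial>M)"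
    proof (rule integral_mono)
      show "\<bar>exp (- (l * (norm (W n \<omega>))\<^sup>2)) - exp (- (l * p K (W n \<omega>)))\<bar> \<le> l * ((norm (W n \<omega>))\<^sup>2 - p K (W n \<omega>))" for \<omega>
        using abs_exp_diff_le[of "l * p K (W n \<omega>)" "l * (norm (W n \<omega>))\<^sup>2"] l p_nonneg p_le
        by (simp add: mult_left_mono right_diff_distrib)
    qed (use i i2 int in auto)
    finally show ?thesis by simp
  qed
  show "(\<lambda>n. \<integral>\<omega>. exp (- real j * (norm (W n \<omega>))\<^sup>2) \<partial>M) \<longlonglongrightarrow> (\<integral>\<omega>. exp (- real j * (norm (Z \<omega>))\<^sup>2) \<partial>N)"
  proof -
    have "A \<longlonglongrightarrow> B"
    proof (rule tendstoI)
      fix r :: real assume r: "0 < r"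
      \<comment> \<open>Chosen with l r' < r / 3; the other two thirds go to the limits in
        \<open>n\<close> and in \<open>K\<close>.\<close>
      define r' where "r' = r / (4 * (l + 1))"
      have r': "r' > 0" "l * r' < r / 3" using r l by (auto simp: r'_def field_simps intro: add_nonneg_pos)
      obtain K0 where K0: "\<And>K. K \<ge> K0 \<Longrightarrow> \<forall>\<^sub>F n in sequentially. (\<integral>\<omega>. (norm (W n \<omega>))\<^sup>2 - p K (W n \<omega>) \<partial>M) \<le> r'"
        using tail[OF r'(1)] unfolding p_def by blast
      have "\<forall>\<^sub>F K in sequentially. K \<ge> K0 \<and> dist (BK K) B < r / 3"
        using tendstoD[OF BK, of "r / 3"] r eventually_ge_at_top[of K0] by (auto intro: eventually_conj)
      then obtain K where K: "K \<ge> K0" "dist (BK K) B < r / 3"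
        using eventually_happens'[OF sequentially_bot] by blast
      show "\<forall>\<^sub>F n in sequentially. dist (A n) B < r"
        using K0[OF K(1)] tendstoD[OF AK[of K], of "r / 3", simplified, OF r]
      proof eventually_elim
        case (elim n)
        have "\<bar>A n - AK K n\<bar> \<le> l * r'"
          using close[of n K] mult_left_mono[OF elim(1) l] by linarith
        moreover have "\<bar>AK K n - BK K\<bar> < r / 3" using elim(2) by (simp add: dist_real_def)
        ultimately show ?case
          using r'(2) K(2) unfolding dist_real_def abs_less_iff abs_le_iff by linarith
      qed
    qed
    then show ?thesis by (simp add: A_def[abs_def] B_def l_def)
  qed
qed simp_all

section \<open>Gaussian series\<close>

text \<open>The expected total length of the increments is finite, so almost every path has
  absolutely summable increments.\<close>

lemma AE_convergent_of_summable_L1: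
  fixes V :: "nat \<Rightarrow> 'a \<Rightarrow> 'h::{banach, second_countable_topology}"
  assumes int: "\<And>j. integrable M (V j)" and le: "\<And>j. (\<integral>\<omega>. norm (V (Suc j) \<omega> - V j \<omega>) \<partial>M) \<le> (1/2) ^ j"
  shows "AE \<omega> in M. convergent (\<lambda>j. V j \<omega>)"
proof -
  have [measurable]: "V j \<in> borel_measurable M" for j using int by auto
  have "(\<integral>\<^sup>+\<omega>. (\<Sum>j. ennreal (norm (V (Suc j) \<omega> - V j \<omega>))) \<partial>M)
      = (\<Sum>j. \<integral>\<^sup>+\<omega>. ennreal (norm (V (Suc j) \<omega> - V j \<omega>)) \<partial>M)"
    by (rule nn_integral_suminf) simp
  also have "\<dots> \<le> (\<Sum>j. ennreal ((1/2) ^ j))"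
  proof (rule suminf_le)
    fix j
    have "(\<integral>\<^sup>+\<omega>. ennreal (norm (V (Suc j) \<omega> - V j \<omega>)) \<partial>M) = ennreal (\<integral>\<omega>. norm (V (Suc j) \<omega> - V j \<omega>) \<partial>M)"
      using int by (intro nn_integral_eq_integral) auto
    also have "\<dots> \<le> ennreal ((1/2) ^ j)" by (rule ennreal_leI[OF le])
    finally show "(\<integral>\<^sup>+\<omega>. ennreal (norm (V (Suc j) \<omega> - V j \<omega>)) \<partial>M) \<le> ennreal ((1/2) ^ j)" .
  qed auto
  also have "\<dots> = ennreal (\<Sum>j. (1/2) ^ j)"
    by (rule suminf_ennreal2) (auto intro: summable_geometric)
  also have "\<dots> < \<infinity>" by simp
  finally have "AE \<omega> in M. (\<Sum>j. ennreal (norm (V (Suc j) \<omega> - V j \<omega>))) \<noteq> \<infinity>"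
    by (intro nn_integral_PInf_AE) auto
  then show ?thesis
  proof eventually_elim
    case (elim \<omega>)
    then have "summable (\<lambda>j. norm (V (Suc j) \<omega> - V j \<omega>))"
      by (intro summable_suminf_not_top) auto
    then have "summable (\<lambda>j. V (Suc j) \<omega> - V j \<omega>)"
      by (rule summable_norm_cancel)
    then have "convergent (\<lambda>n. V n \<omega> - V 0 \<omega>)"
      unfolding summable_iff_convergent sum_lessThan_telescope[of "\<lambda>k. V k \<omega>"] .
    then have "convergent (\<lambda>n. (V n \<omega> - V 0 \<omega>) + V 0 \<omega>)"
      by (intro convergent_add convergent_const)
    then show ?case by simp
  qed
qed

abbreviation normal_seq :: "(nat \<Rightarrow> real) measure"
  where "normal_seq \<equiv> \<Pi>\<^sub>M k\<in>UNIV. std_normal_distribution"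

lemma prob_space_normal_seq: "prob_space normal_seq"
  by (rule prob_space_PiM) (rule prob_space_std_normal)

lemma measurable_normal_seq_component [measurable]: "(\<lambda>\<omega>. \<omega> k) \<in> borel_measurable normal_seq"
  using measurable_component_singleton[of k UNIV "\<lambda>_. std_normal_distribution"]
  by (simp cong: measurable_cong_sets)

lemma distr_normal_seq_component: "distr normal_seq borel (\<lambda>\<omega>. \<omega> k) = std_normal_distribution"
  using distr_PiM_component[of UNIV "\<lambda>_. std_normal_distribution" k] prob_space_std_normal
  by (simp cong: distr_cong)

lemma indep_vars_normal_seq:
  "prob_space.indep_vars normal_seq (\<lambda>_. borel) (\<lambda>k \<omega>. c k * \<omega> k) UNIV"
proof -
  interpret prob_space normal_seq by (rule prob_space_normal_seq)
  have *: "distr normal_seq std_normal_distribution (\<lambda>\<omega>. \<omega> k) = std_normal_distribution" for k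
    using distr_PiM_component[of UNIV "\<lambda>_. std_normal_distribution" k] prob_space_std_normal by simp
  have "distr normal_seq normal_seq (\<lambda>x. \<lambda>i\<in>UNIV. x i) = normal_seq"
    by (simp add: restrict_UNIV distr_id)
  then have "indep_vars (\<lambda>_. std_normal_distribution) (\<lambda>k \<omega>. \<omega> k) UNIV"
    by (subst indep_vars_iff_distr_eq_PiM') (simp_all add: *)
  then show ?thesis
    by (rule indep_vars_compose2) simp
qed

lemma char_normal_seq_sum:
  "(CLINT \<omega>|normal_seq. iexp (\<Sum>k<n. c k * \<omega> k)) = of_real (exp (- (\<Sum>k<n. (c k)\<^sup>2) / 2))"
proof -
  interpret prob_space normal_seq by (rule prob_space_normal_seq)
  have comp: "char (distr normal_seq borel (\<lambda>\<omega>. c k * \<omega> k)) 1 = of_real (exp (- (c k)\<^sup>2 / 2))" for k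
  proof -
    have "char (distr normal_seq borel (\<lambda>\<omega>. c k * \<omega> k)) 1 = (CLINT \<omega>|normal_seq. iexp (\<omega> k * c k))"
      by (simp add: char_def integral_distr mult.commute)
    also have "\<dots> = (CLINT x|distr normal_seq borel (\<lambda>\<omega>. \<omega> k). iexp (x * c k))"
      by (subst integral_distr) simp_all
    finally show ?thesis
      unfolding distr_normal_seq_component char_std_normal_scale .
  qed
  have "indep_vars (\<lambda>_. borel) (\<lambda>k \<omega>. c k * \<omega> k) {..<n}"
    by (rule indep_vars_subset[OF indep_vars_normal_seq]) simp
  then have "char (distr normal_seq borel (\<lambda>\<omega>. \<Sum>k<n. c k * \<omega> k)) 1 = (\<Prod>k<n. of_real (exp (- (c k)\<^sup>2 / 2)))"
    by (simp only: char_distr_sum comp)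
  also have "\<dots> = of_real (exp (- (\<Sum>k<n. (c k)\<^sup>2) / 2))"
    by (simp add: exp_sum[symmetric] sum_negf sum_divide_distrib of_real_prod[symmetric] del: of_real_prod)
  finally show ?thesis
    by (simp add: char_def integral_distr)
qed

lemma normal_seq_moments:
  "integrable normal_seq (\<lambda>\<omega>. \<omega> i * \<omega> j)" "(\<integral>\<omega>. \<omega> i * \<omega> j \<partial>normal_seq) = (if i = j then 1 else 0)"
proof -
  interpret prob_space normal_seq by (rule prob_space_normal_seq)
  have sq: "integrable std_normal_distribution (\<lambda>x. x\<^sup>2)" "(\<integral>x. x\<^sup>2 \<partial>std_normal_distribution) = 1"
    using std_normal_distribution_even_moments[of 1] by (simp_all add: fact_numeral)
  have sq': "integrable normal_seq (\<lambda>\<omega>. (\<omega> k)\<^sup>2)" "(\<integral>\<omega>. (\<omega> k)\<^sup>2 \<partial>normal_seq) = 1" for k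
    using sq integrable_distr_eq[of "\<lambda>\<omega>. \<omega> k" normal_seq borel "\<lambda>x. x\<^sup>2"]
      integral_distr[of "\<lambda>\<omega>. \<omega> k" normal_seq borel "\<lambda>x. x\<^sup>2"]
    by (simp_all add: distr_normal_seq_component)
  have lin: "integrable normal_seq (\<lambda>\<omega>. \<omega> k)" for k
    by (rule square_integrable_imp_integrable) (use sq' in auto)
  have mean: "(\<integral>\<omega>. \<omega> k \<partial>normal_seq) = 0" for k
  proof -
    have "(\<integral>\<omega>. \<omega> k \<partial>normal_seq) = (\<integral>x. x ^ 1 \<partial>distr normal_seq borel (\<lambda>\<omega>. \<omega> k))"
      by (subst integral_distr) simp_all
    also have "\<dots> = 0"
      unfolding distr_normal_seq_component by (rule integral_std_normal_distribution_moment_odd) simp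
    finally show ?thesis .
  qed
  have "integrable normal_seq (\<lambda>\<omega>. \<omega> i * \<omega> j) \<and> (\<integral>\<omega>. \<omega> i * \<omega> j \<partial>normal_seq) = (if i = j then 1 else 0)"
  proof (cases "i = j")
    case True
    then show ?thesis using sq'[of j] by (simp add: power2_eq_square)
  next
    case False
    have ind: "indep_vars (\<lambda>_. borel) (\<lambda>k \<omega>. \<omega> k) {i, j}"
      using indep_vars_subset[OF indep_vars_normal_seq[of "\<lambda>_. 1"], of "{i, j}"] by simp
    show ?thesis
      using indep_vars_lebesgue_integral[OF _ ind] indep_vars_integrable[OF _ ind] lin mean False by simp
  qed
  then show "integrable normal_seq (\<lambda>\<omega>. \<omega> i * \<omega> j)" "(\<integral>\<omega>. \<omega> i * \<omega> j \<partial>normal_seq) = (if i = j then 1 else 0)"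
    by auto
qed

lemma normal_seq_norm_sum:
  fixes l :: "nat \<Rightarrow> 'h::{real_inner, banach, second_countable_topology}"
  assumes "finite I"
  shows "integrable normal_seq (\<lambda>\<omega>. (norm (\<Sum>k\<in>I. \<omega> k *\<^sub>R l k))\<^sup>2)"
    and "(\<integral>\<omega>. (norm (\<Sum>k\<in>I. \<omega> k *\<^sub>R l k))\<^sup>2 \<partial>normal_seq) = (\<Sum>k\<in>I. (norm (l k))\<^sup>2)"
proof -
  have eq: "(norm (\<Sum>k\<in>I. \<omega> k *\<^sub>R l k))\<^sup>2 = (\<Sum>i\<in>I. \<Sum>j\<in>I. inner (l i) (l j) * (\<omega> i * \<omega> j))" for \<omega> :: "nat \<Rightarrow> real"
    unfolding power2_norm_eq_inner inner_sum_left inner_sum_right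
    by (intro sum.cong refl) (simp add: mult_ac inner_commute)
  show "integrable normal_seq (\<lambda>\<omega>. (norm (\<Sum>k\<in>I. \<omega> k *\<^sub>R l k))\<^sup>2)"
    unfolding eq by (intro Bochner_Integration.integrable_sum integrable_mult_right normal_seq_moments)
  have "(\<integral>\<omega>. (norm (\<Sum>k\<in>I. \<omega> k *\<^sub>R l k))\<^sup>2 \<partial>normal_seq)
      = (\<Sum>i\<in>I. \<Sum>j\<in>I. inner (l i) (l j) * (if i = j then 1 else 0))"
    unfolding eq
    by (simp add: Bochner_Integration.integral_sum Bochner_Integration.integrable_sum
        integrable_mult_right normal_seq_moments del: mult_eq_0_iff)
  also have "\<dots> = (\<Sum>k\<in>I. (norm (l k))\<^sup>2)"
    using assms by (intro sum.cong refl) (simp add: power2_norm_eq_inner if_distrib cong: if_cong)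
  finally show "(\<integral>\<omega>. (norm (\<Sum>k\<in>I. \<omega> k *\<^sub>R l k))\<^sup>2 \<partial>normal_seq) = (\<Sum>k\<in>I. (norm (l k))\<^sup>2)" .
qed

text \<open>\<open>Z\<close> is the sum of the terms \<open>\<omega> k *\<^sub>R l k\<close>. Almost
  sure convergence is established along a sparse sequence of partial sums, which suffices to define
  \<open>Z\<close> and to pass to the limit in the characters.\<close>

lemma gaussian_vector_exists:
  fixes l :: "nat \<Rightarrow> 'h::{real_inner, banach, second_countable_topology}"
  assumes sm: "summable (\<lambda>k. (norm (l k))\<^sup>2)"
  obtains Z where "Z \<in> borel_measurable normal_seq"
    and "\<And>x. (CLINT \<omega>|normal_seq. iexp (inner (Z \<omega>) x)) = of_real (exp (- (\<Sum>k. (inner (l k) x)\<^sup>2) / 2))"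
proof -
  interpret prob_space normal_seq by (rule prob_space_normal_seq)
  have "\<exists>n>m. \<forall>b\<ge>n. (\<Sum>k=n..<b. (norm (l k))\<^sup>2) \<le> (1/4) ^ j" for m j :: nat
  proof -
    obtain n where n: "\<And>a b. n \<le> a \<Longrightarrow> norm (\<Sum>k=a..<b. (norm (l k))\<^sup>2) < (1/4) ^ j"
      using sm[unfolded summable_Cauchy] by (metis zero_less_divide_1_iff zero_less_numeral zero_less_power)
    show ?thesis
      using n[of "max n (Suc m)"] by (intro exI[of _ "max n (Suc m)"]) (auto simp: abs_less_iff intro: less_imp_le)
  qed
  then obtain nx where nx: "\<And>m j. nx m j > m" "\<And>m j b. b \<ge> nx m j \<Longrightarrow> (\<Sum>k=nx m j..<b. (norm (l k))\<^sup>2) \<le> (1/4) ^ j"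
    by metis
  \<comment> \<open>Block ends so sparse that the squared norms beyond \<open>r j\<close> sum to at
    most 4^(-j); by orthogonality the j-th block then has expected norm at most 2^(-j).\<close>
  define r where "r = rec_nat (nx 0 0) (\<lambda>j m. nx m (Suc j))"
  have r_Suc: "r (Suc j) = nx (r j) (Suc j)" for j by (simp add: r_def)
  have r: "strict_mono r" unfolding strict_mono_Suc_iff r_Suc using nx(1) by simp
  have r_tail: "(\<Sum>k=r j..<b. (norm (l k))\<^sup>2) \<le> (1/4) ^ j" if "r j \<le> b" for j b
  proof (cases j)
    case 0
    then show ?thesis using that nx(2)[of 0 0 b] by (simp add: r_def)
  next
    case (Suc i)
    then show ?thesis using that nx(2)[of "r i" "Suc i" b] by (simp add: r_Suc)
  qed
  define V where "V j \<omega> = (\<Sum>k<r j. \<omega> k *\<^sub>R l k)" for j and \<omega> :: "nat \<Rightarrow> real"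
  have [measurable]: "V j \<in> borel_measurable normal_seq" for j
    unfolding V_def by measurable
  have comp_int: "integrable normal_seq (\<lambda>\<omega>. \<omega> k)" for k
    by (rule square_integrable_imp_integrable)
       (use normal_seq_moments(1)[of k k] in \<open>auto simp: power2_eq_square\<close>)
  have "AE \<omega> in normal_seq. convergent (\<lambda>j. V j \<omega>)"
  proof (rule AE_convergent_of_summable_L1)
    show "integrable normal_seq (V j)" for j
      unfolding V_def by (intro Bochner_Integration.integrable_sum integrable_scaleR_left comp_int)
    fix j
    have lt: "r j < r (Suc j)" using r by (simp add: strict_mono_Suc_iff)
    have eq: "V (Suc j) \<omega> - V j \<omega> = (\<Sum>k=r j..<r (Suc j). \<omega> k *\<^sub>R l k)" for \<omega>
    proof -
      have "{..<r (Suc j)} = {..<r j} \<union> {r j..<r (Suc j)}" using lt by auto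
      then show ?thesis
        unfolding V_def by (simp only:) (subst sum.union_disjoint; force)
    qed
    have "(\<integral>\<omega>. \<bar>norm (V (Suc j) \<omega> - V j \<omega>)\<bar> \<partial>normal_seq) \<le> sqrt (\<integral>\<omega>. (norm (V (Suc j) \<omega> - V j \<omega>))\<^sup>2 \<partial>normal_seq)"
      unfolding eq
      by (rule expectation_le_sqrt[OF prob_space_normal_seq]) (simp_all add: normal_seq_norm_sum(1))
    also have "\<dots> = sqrt (\<Sum>k=r j..<r (Suc j). (norm (l k))\<^sup>2)"
      unfolding eq by (simp only: normal_seq_norm_sum(2) finite_atLeastLessThan)
    also have "\<dots> \<le> sqrt (((1/2) ^ j)\<^sup>2)"
    proof (rule real_sqrt_le_mono)
      have "((1/2) ^ j)\<^sup>2 = ((1/2)\<^sup>2 :: real) ^ j" by (metis mult.commute power_mult)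
      then show "(\<Sum>k=r j..<r (Suc j). (norm (l k))\<^sup>2) \<le> ((1/2) ^ j)\<^sup>2"
        using r_tail[of j "r (Suc j)"] lt by (simp add: power_one_over)
    qed
    finally show "(\<integral>\<omega>. norm (V (Suc j) \<omega> - V j \<omega>) \<partial>normal_seq) \<le> (1/2) ^ j"
      by simp
  qed
  then have conv: "AE \<omega> in normal_seq. (\<lambda>j. V j \<omega>) \<longlonglongrightarrow> lim (\<lambda>j. V j \<omega>)"
    by (simp add: convergent_LIMSEQ_iff)
  define Z where "Z \<omega> = lim (\<lambda>j. V j \<omega>)" for \<omega>
  have Z: "Z \<in> borel_measurable normal_seq"
    unfolding Z_def by (rule borel_measurable_lim_metric) simp
  note [measurable] = Z
  have "(CLINT \<omega>|normal_seq. iexp (inner (Z \<omega>) x)) = of_real (exp (- (\<Sum>k. (inner (l k) x)\<^sup>2) / 2))" for x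
  proof (rule LIMSEQ_unique)
    show "(\<lambda>j. CLINT \<omega>|normal_seq. iexp (inner (V j \<omega>) x)) \<longlonglongrightarrow> (CLINT \<omega>|normal_seq. iexp (inner (Z \<omega>) x))"
    proof (rule integral_dominated_convergence)
      show "AE \<omega> in normal_seq. (\<lambda>j. iexp (inner (V j \<omega>) x)) \<longlonglongrightarrow> iexp (inner (Z \<omega>) x)"
        using conv unfolding Z_def[symmetric] by eventually_elim (intro tendsto_intros)
      show "integrable normal_seq (\<lambda>_. 1 :: real)" by simp
    qed simp_all
    have "(\<lambda>k. (inner (l k) x)\<^sup>2) sums (\<Sum>k. (inner (l k) x)\<^sup>2)"
    proof (rule summable_sums, rule summable_comparison_test)
      show "summable (\<lambda>k. (norm (l k))\<^sup>2 * (norm x)\<^sup>2)"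
        by (rule summable_mult2[OF sm])
      show "\<exists>N. \<forall>k\<ge>N. norm ((inner (l k) x)\<^sup>2) \<le> (norm (l k))\<^sup>2 * (norm x)\<^sup>2"
        using Cauchy_Schwarz_ineq[of "l _" x] by (auto simp: power2_norm_eq_inner)
    qed
    then have "(\<lambda>j. \<Sum>k<r j. (inner (l k) x)\<^sup>2) \<longlonglongrightarrow> (\<Sum>k. (inner (l k) x)\<^sup>2)"
      unfolding sums_def by (rule LIMSEQ_subseq_LIMSEQ[OF _ r, unfolded o_def])
    then have "(\<lambda>j. complex_of_real (exp (- (\<Sum>k<r j. (inner (l k) x)\<^sup>2) / 2)))
        \<longlonglongrightarrow> of_real (exp (- (\<Sum>k. (inner (l k) x)\<^sup>2) / 2))"
      by (intro tendsto_intros) auto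
    moreover have "(CLINT \<omega>|normal_seq. iexp (inner (V j \<omega>) x)) = of_real (exp (- (\<Sum>k<r j. (inner (l k) x)\<^sup>2) / 2))" for j
      using char_normal_seq_sum[of "\<lambda>k. inner (l k) x" "r j"]
      by (simp add: V_def inner_sum_left mult.commute)
    ultimately show "(\<lambda>j. CLINT \<omega>|normal_seq. iexp (inner (V j \<omega>) x))
        \<longlonglongrightarrow> of_real (exp (- (\<Sum>k. (inner (l k) x)\<^sup>2) / 2))"
      by simp
  qed
  then show ?thesis using Z by (rule that[rotated])
qed

text \<open>The degenerate case \<open>s = 0\<close> is the point mass at \<open>0\<close>.\<close>

lemma normal_law_of_char:
  fixes X :: "'a \<Rightarrow> real"
  assumes "prob_space M" and [measurable]: "X \<in> borel_measurable M" and "0 \<le> s"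
    and char: "\<And>t. (CLINT \<omega>|M. iexp (t * X \<omega>)) = of_real (exp (- t\<^sup>2 * s / 2))"
  shows "distr M borel X = distr std_normal_distribution borel (\<lambda>g. sqrt s * g)"
proof (rule Levy_uniqueness)
  interpret prob_space M by fact
  interpret \<gamma>: prob_space std_normal_distribution by (rule prob_space_std_normal)
  show "real_distribution (distr M borel X)" by (rule real_distribution_distr) simp
  show "real_distribution (distr std_normal_distribution borel (\<lambda>g. sqrt s * g))"
    by (rule \<gamma>.real_distribution_distr) simp
  show "char (distr M borel X) = char (distr std_normal_distribution borel (\<lambda>g. sqrt s * g))"
  proof
    fix t
    have "char (distr std_normal_distribution borel (\<lambda>g. sqrt s * g)) t
        = (CLINT g|std_normal_distribution. iexp (g * (t * sqrt s)))"
      by (simp add: char_def integral_distr mult_ac)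
    also have "\<dots> = of_real (exp (- t\<^sup>2 * s / 2))"
      unfolding char_std_normal_scale using \<open>0 \<le> s\<close> by (simp add: power_mult_distrib)
    also have "\<dots> = (CLINT \<omega>|M. iexp (t * X \<omega>))"
      by (rule char[symmetric])
    also have "\<dots> = char (distr M borel X) t"
      by (simp add: char_def integral_distr)
    finally show "char (distr M borel X) t = char (distr std_normal_distribution borel (\<lambda>g. sqrt s * g)) t"
      by (rule sym)
  qed
qed

lemma normal_law_cases:
  assumes "0 \<le> s"
  shows "distr std_normal_distribution borel (\<lambda>g. sqrt s * g) = return borel 0 \<or>
    (\<exists>\<sigma>>0. distr std_normal_distribution borel (\<lambda>g. sqrt s * g) = density lborel (normal_density 0 \<sigma>))"
proof (cases "s = 0")
  case True
  interpret \<gamma>: prob_space std_normal_distribution by (rule prob_space_std_normal)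
  show ?thesis
    using True \<gamma>.distr_const[of 0 borel] by simp
next
  case False
  interpret \<gamma>: prob_space std_normal_distribution by (rule prob_space_std_normal)
  have "distributed std_normal_distribution lborel (\<lambda>g. g) (normal_density 0 1)"
    unfolding distributed_def by (auto simp: distr_id2)
  then have "distributed std_normal_distribution lborel (\<lambda>g. 0 + sqrt s * g) (normal_density (0 + sqrt s * 0) (\<bar>sqrt s\<bar> * 1))"
    by (rule \<gamma>.normal_density_affine) (use False assms in auto)
  then have "distr std_normal_distribution lborel (\<lambda>g. sqrt s * g) = density lborel (normal_density 0 (sqrt s))"
    unfolding distributed_def using assms by simp
  moreover have "distr std_normal_distribution borel (\<lambda>g. sqrt s * g) = distr std_normal_distribution lborel (\<lambda>g. sqrt s * g)"
    by (rule distr_cong) simp_all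
  ultimately show ?thesis
    using False assms by (intro disjI2 exI[of _ "sqrt s"]) simp
qed

section \<open>Stein bound for characteristic functions\<close>

lemma cmod_iexp_diff_le: "cmod (iexp x - iexp y) \<le> \<bar>x - y\<bar>"
proof -
  have "iexp x - iexp y = iexp y * (iexp (x - y) - 1)"
    by (simp add: algebra_simps exp_add[symmetric])
  then have "cmod (iexp x - iexp y) = cmod (iexp (x - y) - 1)"
    by (simp only: norm_mult norm_exp_i_times)
  also have "\<dots> \<le> \<bar>x - y\<bar>"
    using iexp_approx1[of "x - y" 0] by simp
  finally show ?thesis .
qed

lemma cmod_iexp_approx2: "cmod (iexp x - 1 - \<i> * x) \<le> x\<^sup>2 / 2"
  using iexp_approx1[of x 1] by (simp add: algebra_simps numeral_2_eq_2 power2_eq_square)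

lemma norm_integral_le_bound:
  fixes f :: "'a \<Rightarrow> 'b::{banach, second_countable_topology}"
  assumes "prob_space M" "\<And>x. norm (f x) \<le> c"
  shows "norm (integral\<^sup>L M f) \<le> c"
proof -
  interpret prob_space M by fact
  have "norm (integral\<^sup>L M f) \<le> (\<integral>x. norm (f x) \<partial>M)" by (rule integral_norm_bound)
  also have "\<dots> \<le> (\<integral>x. c \<partial>M)"
    by (rule integral_mono'[OF _ assms(2)]) (use order_trans[OF norm_ge_zero assms(2)] in auto)
  finally show ?thesis by (simp add: prob_space)
qed

text \<open>For bounded \<open>S\<close> the second-order Taylor remainder of the exponential is at
  most |t - s|^2 c^2 / 2 uniformly in \<open>\<omega>\<close>, so integrating it bounds the
  difference quotient directly.\<close>

lemma char_has_vector_derivative: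
  fixes S :: "'a \<Rightarrow> real"
  assumes "prob_space M" and [measurable]: "S \<in> borel_measurable M" and S: "\<And>\<omega>. \<bar>S \<omega>\<bar> \<le> c"
  shows "((\<lambda>s. CLINT \<omega>|M. iexp (s * S \<omega>)) has_vector_derivative
    \<i> * (CLINT \<omega>|M. S \<omega> * iexp (s * S \<omega>))) (at s within A)"
proof -
  interpret prob_space M by fact
  define \<phi> where "\<phi> s = (CLINT \<omega>|M. iexp (s * S \<omega>))" for s
  define D where "D = \<i> * (CLINT \<omega>|M. S \<omega> * iexp (s * S \<omega>))"
  have i1: "integrable M (\<lambda>\<omega>. iexp (t * S \<omega>))" for t
    by (rule integrable_const_bound[of _ 1]) simp_all
  have i2: "integrable M (\<lambda>\<omega>. S \<omega> * iexp (s * S \<omega>))"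
    by (rule integrable_const_bound[of _ c]) (use S in \<open>simp_all add: norm_mult\<close>)
  have le: "norm (\<phi> t - \<phi> s - (t - s) *\<^sub>R D) \<le> \<bar>t - s\<bar>\<^sup>2 * c\<^sup>2 / 2" for t
  proof -
    have "\<phi> t - \<phi> s - (t - s) *\<^sub>R D
        = (CLINT \<omega>|M. iexp (t * S \<omega>) - iexp (s * S \<omega>) - (\<i> * of_real (t - s)) * (S \<omega> * iexp (s * S \<omega>)))"
    proof -
      have "(t - s) *\<^sub>R D = (CLINT \<omega>|M. (\<i> * of_real (t - s)) * (S \<omega> * iexp (s * S \<omega>)))"
        unfolding D_def integral_mult_right_zero by (simp add: scaleR_conv_of_real)
      then show ?thesis
        unfolding \<phi>_def using i1 i2
        by (simp only: Bochner_Integration.integral_diff Bochner_Integration.integrable_diff integrable_mult_right)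
    qed
    also have "norm \<dots> \<le> \<bar>t - s\<bar>\<^sup>2 * c\<^sup>2 / 2"
    proof (rule norm_integral_le_bound[OF assms(1)])
      fix \<omega>
      have "iexp (t * S \<omega>) - iexp (s * S \<omega>) - (\<i> * of_real (t - s)) * (S \<omega> * iexp (s * S \<omega>))
          = iexp (s * S \<omega>) * (iexp ((t - s) * S \<omega>) - 1 - \<i> * of_real ((t - s) * S \<omega>))"
        by (simp add: algebra_simps exp_add[symmetric])
      then have "cmod (iexp (t * S \<omega>) - iexp (s * S \<omega>) - (\<i> * of_real (t - s)) * (S \<omega> * iexp (s * S \<omega>)))
          \<le> ((t - s) * S \<omega>)\<^sup>2 / 2"
        using cmod_iexp_approx2[of "(t - s) * S \<omega>"] by (simp only: norm_mult norm_exp_i_times mult_1)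
      also have "\<dots> \<le> \<bar>t - s\<bar>\<^sup>2 * c\<^sup>2 / 2"
        using power_mono[OF S[of \<omega>], of 2] by (simp add: power_mult_distrib mult_left_mono)
      finally show "cmod (iexp (t * S \<omega>) - iexp (s * S \<omega>) - (\<i> * of_real (t - s)) * (S \<omega> * iexp (s * S \<omega>)))
          \<le> \<bar>t - s\<bar>\<^sup>2 * c\<^sup>2 / 2" .
    qed
    finally show ?thesis .
  qed
  have "((\<lambda>t. norm (\<phi> t - \<phi> s - (t - s) *\<^sub>R D) / norm (t - s)) \<longlongrightarrow> 0) (at s within A)"
  proof (rule Lim_null_comparison)
    show "\<forall>\<^sub>F t in at s within A. norm (norm (\<phi> t - \<phi> s - (t - s) *\<^sub>R D) / norm (t - s)) \<le> \<bar>t - s\<bar> * c\<^sup>2 / 2"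
      unfolding eventually_at_filter
      by (rule always_eventually)
         (use le in \<open>auto simp: divide_simps power2_eq_square mult_ac\<close>)
    have "((\<lambda>t. \<bar>t - s\<bar> * c\<^sup>2 / 2) \<longlongrightarrow> \<bar>s - s\<bar> * c\<^sup>2 / 2) (at s within A)"
      by (intro tendsto_intros) auto
    then show "((\<lambda>t. \<bar>t - s\<bar> * c\<^sup>2 / 2) \<longlongrightarrow> 0) (at s within A)" by simp
  qed
  then show ?thesis
    unfolding has_vector_derivative_def has_derivative_iff_norm \<phi>_def[symmetric] D_def[symmetric]
    by (simp add: bounded_linear_scaleR_left)
qed

text \<open>Stein's method with dependency neighbourhoods: the characteristic function nearly solves
  the differential equation of the normal one.\<close>

lemma (in prob_space) stein_char_bound:
  fixes X :: "'i \<Rightarrow> 'a \<Rightarrow> real" and A B :: "'i \<Rightarrow> 'i set" and b q :: real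
  assumes fin: "finite I" and X [measurable]: "\<And>i. X i \<in> borel_measurable M"
    and bound: "\<And>i \<omega>. \<bar>X i \<omega>\<bar> \<le> b" and mean: "\<And>i. i \<in> I \<Longrightarrow> expectation (X i) = 0"
    and sub: "\<And>i. i \<in> I \<Longrightarrow> A i \<subseteq> B i" "\<And>i. i \<in> I \<Longrightarrow> B i \<subseteq> I" and card: "\<And>i. i \<in> I \<Longrightarrow> real (card (B i)) \<le> q"
    and ind1: "\<And>i. i \<in> I \<Longrightarrow> indep_var borel (X i) borel (\<lambda>\<omega>. \<Sum>j\<in>I - A i. X j \<omega>)"
    and ind2: "\<And>i j. i \<in> I \<Longrightarrow> j \<in> A i \<Longrightarrow>
      indep_var borel (\<lambda>\<omega>. X i \<omega> * X j \<omega>) borel (\<lambda>\<omega>. \<Sum>k\<in>I - B i. X k \<omega>)"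
  shows "cmod ((CLINT \<omega>|M. iexp (\<Sum>i\<in>I. X i \<omega>)) - of_real (exp (- (\<integral>\<omega>. (\<Sum>i\<in>I. X i \<omega>)\<^sup>2 \<partial>M) / 2)))
    \<le> 3 * real (card I) * q\<^sup>2 * b ^ 3"
proof -
  have b: "0 \<le> b" using order_trans[OF abs_ge_zero bound] .
  define S where "S \<omega> = (\<Sum>i\<in>I. X i \<omega>)" for \<omega>
  define N where "N i \<omega> = (\<Sum>j\<in>A i. X j \<omega>)" for i \<omega>
  define R where "R i \<omega> = (\<Sum>j\<in>I - A i. X j \<omega>)" for i \<omega>
  define R' where "R' i \<omega> = (\<Sum>j\<in>I - B i. X j \<omega>)" for i \<omega>
  define V where "V = (\<integral>\<omega>. (S \<omega>)\<^sup>2 \<partial>M)"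
  define \<phi> where "\<phi> s = (CLINT \<omega>|M. iexp (s * S \<omega>))" for s
  define \<kappa> where "\<kappa> = 3 * real (card I) * q\<^sup>2 * b ^ 3"
  have [measurable]: "S \<in> borel_measurable M" "N i \<in> borel_measurable M" "R i \<in> borel_measurable M"
    "R' i \<in> borel_measurable M" for i
    unfolding S_def[abs_def] N_def[abs_def] R_def[abs_def] R'_def[abs_def] by measurable
  have sum_le: "\<bar>\<Sum>j\<in>J. X j \<omega>\<bar> \<le> card J * b" for J \<omega>
  proof -
    have "\<bar>\<Sum>j\<in>J. X j \<omega>\<bar> \<le> (\<Sum>j\<in>J. \<bar>X j \<omega>\<bar>)" by (rule sum_abs)
    also have "\<dots> \<le> card J * b" using bound by (rule sum_bounded_above)
    finally show ?thesis .
  qed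
  have sum_le_q: "\<bar>\<Sum>j\<in>J. X j \<omega>\<bar> \<le> q * b" if "J \<subseteq> B i" "i \<in> I" for J i \<omega>
  proof -
    have "finite (B i)" using sub(2)[OF that(2)] fin by (rule finite_subset)
    then have "card J \<le> q" using card_mono[of "B i" J] that card[OF that(2)] by simp
    then have "card J * b \<le> q * b" using b by (simp add: mult_right_mono)
    then show ?thesis by (rule order_trans[OF sum_le])
  qed
  have int: "integrable M f" if "f \<in> borel_measurable M" "\<And>\<omega>. norm (f \<omega>) \<le> c"
    for f :: "'a \<Rightarrow> 'c::{banach, second_countable_topology}" and c
    by (rule integrable_const_bound[of _ c]) (use that in auto)
  have ie: "integrable M (\<lambda>\<omega>. X i \<omega> * iexp (s * Y \<omega>))" if [measurable]: "Y \<in> borel_measurable M" for i s Y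
    by (rule int[of _ b]) (use bound in \<open>auto simp: norm_mult\<close>)
  have iXX: "integrable M (\<lambda>\<omega>. X i \<omega> * X j \<omega>)" for i j
    by (rule int[of _ "b * b"]) (use bound b in \<open>auto simp: abs_mult intro!: mult_mono\<close>)
  have iX: "integrable M (X i)" for i
    by (rule int[of _ b]) (use bound in auto)
  have split1: "S \<omega> = N i \<omega> + R i \<omega>" if "i \<in> I" for i \<omega>
  proof -
    have "A i \<subseteq> I" using sub that by blast
    then show ?thesis unfolding S_def N_def R_def using sum.subset_diff[OF _ fin, of "A i" "\<lambda>j. X j \<omega>"] by simp
  qed
  have split2: "R i \<omega> - R' i \<omega> = (\<Sum>j\<in>B i - A i. X j \<omega>)" if "i \<in> I" for i \<omega>
  proof -
    have "I - A i = (I - B i) \<union> (B i - A i)" "(I - B i) \<inter> (B i - A i) = {}" using sub that by blast+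
    then have "R i \<omega> = R' i \<omega> + (\<Sum>j\<in>B i - A i. X j \<omega>)"
      unfolding R_def R'_def using fin finite_subset[OF sub(2)[OF that] fin]
      by (metis finite_Diff sum.union_disjoint)
    then show ?thesis by simp
  qed
  \<comment> \<open>The zeroth-order term of the expansion in \<open>N i\<close> disappears:
    \<open>X i\<close> is centred and independent of \<open>R i\<close>.\<close>
  have EXR: "(CLINT \<omega>|M. X i \<omega> * iexp (s * R i \<omega>)) = 0" if "i \<in> I" for i s
  proof -
    have "indep_var borel (complex_of_real \<circ> X i) borel ((\<lambda>x. iexp (s * x)) \<circ> R i)"
      by (rule indep_var_compose[OF ind1[OF that, folded R_def]]) measurable
    then have "(CLINT \<omega>|M. (complex_of_real \<circ> X i) \<omega> * ((\<lambda>x. iexp (s * x)) \<circ> R i) \<omega>)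
        = (CLINT \<omega>|M. (complex_of_real \<circ> X i) \<omega>) * (CLINT \<omega>|M. ((\<lambda>x. iexp (s * x)) \<circ> R i) \<omega>)"
      by (rule indep_var_lebesgue_integral) (use iX in \<open>auto intro!: int[of _ 1] simp: comp_def\<close>)
    then show ?thesis using mean[OF that] by simp
  qed
  have EXXR: "(CLINT \<omega>|M. of_real (X i \<omega> * X j \<omega>) * iexp (s * R' i \<omega>))
      = of_real (\<integral>\<omega>. X i \<omega> * X j \<omega> \<partial>M) * (CLINT \<omega>|M. iexp (s * R' i \<omega>))" if "i \<in> I" "j \<in> A i" for i j s
  proof -
    have "indep_var borel (complex_of_real \<circ> (\<lambda>\<omega>. X i \<omega> * X j \<omega>)) borel ((\<lambda>x. iexp (s * x)) \<circ> R' i)"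
      by (rule indep_var_compose[OF ind2[OF that, folded R'_def]]) measurable
    then have "(CLINT \<omega>|M. (complex_of_real \<circ> (\<lambda>\<omega>. X i \<omega> * X j \<omega>)) \<omega> * ((\<lambda>x. iexp (s * x)) \<circ> R' i) \<omega>)
        = (CLINT \<omega>|M. (complex_of_real \<circ> (\<lambda>\<omega>. X i \<omega> * X j \<omega>)) \<omega>) * (CLINT \<omega>|M. ((\<lambda>x. iexp (s * x)) \<circ> R' i) \<omega>)"
      by (rule indep_var_lebesgue_integral)
         (use iXX[of i j] in \<open>auto intro!: int[of _ 1] integrable_of_real simp: comp_def simp del: of_real_mult\<close>)
    then show ?thesis by (simp add: comp_def del: of_real_mult)
  qed
  have iXN: "integrable M (\<lambda>\<omega>. X i \<omega> * N i \<omega>)" for i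
    unfolding N_def sum_distrib_left by (intro Bochner_Integration.integrable_sum iXX)
  \<comment> \<open>Expand the exponential of \<open>S\<close> to first order in the neighbourhood
    sum \<open>N i\<close>. The zeroth order vanishes by \<open>EXR\<close>. In the first order
    \<open>R i\<close> is replaced by \<open>R' i\<close>, which is independent of every product
    \<open>X i * X j\<close> with \<open>j\<close> in \<open>A i\<close>; after factorising, the
    character of \<open>R' i\<close> is replaced by that of \<open>S\<close>. Each replacement moves
    the exponent by a sum over part of \<open>B i\<close>, hence by at most
    \<open>\<bar>s\<bar> * (q * b)\<close>.\<close>
  have term_le: "cmod ((CLINT \<omega>|M. X i \<omega> * iexp (s * S \<omega>)) - \<i> * s * (\<integral>\<omega>. X i \<omega> * N i \<omega> \<partial>M) * \<phi> s)
      \<le> 3 * s\<^sup>2 * q\<^sup>2 * b ^ 3" if i: "i \<in> I" for i s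
  proof -
    have q: "0 \<le> q" using card[OF i] by (smt (verit) of_nat_0_le_iff)
    have Nq: "\<bar>N i \<omega>\<bar> \<le> q * b" for \<omega>
      unfolding N_def by (rule sum_le_q[OF sub(1)[OF i] i])
    have Rq: "\<bar>R i \<omega> - R' i \<omega>\<bar> \<le> q * b" for \<omega>
      unfolding split2[OF i] by (rule sum_le_q[OF _ i]) auto
    have SR: "\<bar>R' i \<omega> - S \<omega>\<bar> \<le> q * b" for \<omega>
    proof -
      have "S \<omega> = (\<Sum>j\<in>B i. X j \<omega>) + R' i \<omega>"
        unfolding S_def R'_def using sum.subset_diff[OF sub(2)[OF i] fin, of "\<lambda>j. X j \<omega>"] by simp
      then show ?thesis using sum_le_q[OF subset_refl i, of \<omega>] by simp
    qed
    have XN: "\<bar>X i \<omega> * N i \<omega>\<bar> \<le> b * (q * b)" for \<omega>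
      unfolding abs_mult by (rule mult_mono) (use bound Nq b in auto)
    have iXNR: "integrable M (\<lambda>\<omega>. of_real (X i \<omega> * N i \<omega>) * iexp (s * R' i \<omega>))"
      by (rule int[of _ "b * (q * b)"]) (use XN in \<open>auto simp: norm_mult abs_mult simp del: of_real_mult\<close>)
    have EXNR: "(CLINT \<omega>|M. of_real (X i \<omega> * N i \<omega>) * iexp (s * R' i \<omega>))
        = of_real (\<integral>\<omega>. X i \<omega> * N i \<omega> \<partial>M) * (CLINT \<omega>|M. iexp (s * R' i \<omega>))"
    proof -
      have i3: "integrable M (\<lambda>\<omega>. of_real (X i \<omega> * X j \<omega>) * iexp (s * R' i \<omega>))" for j
        by (rule int[of _ "b * b"]) (use bound b in \<open>auto simp: norm_mult intro!: mult_mono\<close>)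
      have "(CLINT \<omega>|M. of_real (X i \<omega> * N i \<omega>) * iexp (s * R' i \<omega>))
          = (CLINT \<omega>|M. (\<Sum>j\<in>A i. of_real (X i \<omega> * X j \<omega>) * iexp (s * R' i \<omega>)))"
        unfolding N_def sum_distrib_left of_real_sum sum_distrib_right by simp
      also have "\<dots> = (\<Sum>j\<in>A i. (CLINT \<omega>|M. of_real (X i \<omega> * X j \<omega>) * iexp (s * R' i \<omega>)))"
        by (rule Bochner_Integration.integral_sum[OF i3])
      also have "\<dots> = (\<Sum>j\<in>A i. of_real (\<integral>\<omega>. X i \<omega> * X j \<omega> \<partial>M) * (CLINT \<omega>|M. iexp (s * R' i \<omega>)))"
        by (rule sum.cong[OF refl EXXR[OF i]])
      also have "\<dots> = of_real (\<Sum>j\<in>A i. \<integral>\<omega>. X i \<omega> * X j \<omega> \<partial>M) * (CLINT \<omega>|M. iexp (s * R' i \<omega>))"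
        by (simp add: sum_distrib_right)
      also have "(\<Sum>j\<in>A i. \<integral>\<omega>. X i \<omega> * X j \<omega> \<partial>M) = (\<integral>\<omega>. X i \<omega> * N i \<omega> \<partial>M)"
        unfolding N_def sum_distrib_left by (rule Bochner_Integration.integral_sum[OF iXX, symmetric])
      finally show ?thesis .
    qed
    define P where "P \<omega> = X i \<omega> * iexp (s * S \<omega>) - X i \<omega> * iexp (s * R i \<omega>)
      - \<i> * s * (of_real (X i \<omega> * N i \<omega>) * iexp (s * R' i \<omega>))" for \<omega>
    have "cmod (P \<omega>) \<le> 2 * s\<^sup>2 * q\<^sup>2 * b ^ 3" for \<omega>
    proof -
      have "P \<omega> = X i \<omega> * iexp (s * R i \<omega>) * (iexp (s * N i \<omega>) - 1 - \<i> * of_real (s * N i \<omega>))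
          + \<i> * s * of_real (X i \<omega> * N i \<omega>) * (iexp (s * R i \<omega>) - iexp (s * R' i \<omega>))"
        unfolding P_def split1[OF i] by (simp add: algebra_simps exp_add)
      then have "cmod (P \<omega>) \<le> cmod (X i \<omega> * iexp (s * R i \<omega>) * (iexp (s * N i \<omega>) - 1 - \<i> * of_real (s * N i \<omega>)))
          + cmod (\<i> * s * of_real (X i \<omega> * N i \<omega>) * (iexp (s * R i \<omega>) - iexp (s * R' i \<omega>)))"
        by (simp only: norm_triangle_ineq)
      also have "\<dots> = \<bar>X i \<omega>\<bar> * cmod (iexp (s * N i \<omega>) - 1 - \<i> * of_real (s * N i \<omega>))
          + \<bar>s\<bar> * \<bar>X i \<omega> * N i \<omega>\<bar> * cmod (iexp (s * R i \<omega>) - iexp (s * R' i \<omega>))"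
        by (simp only: norm_mult norm_exp_i_times norm_of_real norm_ii mult_1 mult_1_right)
      also have "\<dots> \<le> b * ((s * N i \<omega>)\<^sup>2 / 2) + \<bar>s\<bar> * (b * (q * b)) * \<bar>s * R i \<omega> - s * R' i \<omega>\<bar>"
        by (intro add_mono mult_mono cmod_iexp_approx2 cmod_iexp_diff_le bound XN) (use b q in auto)
      also have "\<dots> \<le> b * ((\<bar>s\<bar> * (q * b))\<^sup>2 / 2) + \<bar>s\<bar> * (b * (q * b)) * (\<bar>s\<bar> * (q * b))"
      proof (intro add_mono mult_left_mono divide_right_mono)
        show "(s * N i \<omega>)\<^sup>2 \<le> (\<bar>s\<bar> * (q * b))\<^sup>2"
          using Nq[of \<omega>] by (intro abs_le_square_iff[THEN iffD1]) (simp add: abs_mult b q mult_left_mono)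
        show "\<bar>s * R i \<omega> - s * R' i \<omega>\<bar> \<le> \<bar>s\<bar> * (q * b)"
          unfolding right_diff_distrib[symmetric] abs_mult using Rq by (rule mult_left_mono) simp
      qed (use b q in auto)
      also have "\<dots> = (3/2) * s\<^sup>2 * q\<^sup>2 * b ^ 3"
        by (simp add: power2_eq_square power3_eq_cube algebra_simps)
      \<comment> \<open>Rounded up, so that with the cost of replacing the character of
        \<open>R' i\<close> the total constant is 3.\<close>
      also have "\<dots> \<le> 2 * s\<^sup>2 * q\<^sup>2 * b ^ 3"
        using b by (intro mult_right_mono) auto
      finally show ?thesis .
    qed
    then have 1: "cmod (integral\<^sup>L M P) \<le> 2 * s\<^sup>2 * q\<^sup>2 * b ^ 3"
      by (rule norm_integral_le_bound[OF prob_space_axioms])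
    have "integral\<^sup>L M P = (CLINT \<omega>|M. X i \<omega> * iexp (s * S \<omega>))
        - \<i> * s * (of_real (\<integral>\<omega>. X i \<omega> * N i \<omega> \<partial>M) * (CLINT \<omega>|M. iexp (s * R' i \<omega>)))"
      unfolding P_def EXNR[symmetric] using EXR[OF i, of s] ie[of S i s] ie[of "R i" i s] iXNR
      by (subst Bochner_Integration.integral_diff, simp_all del: of_real_mult)
    moreover have "cmod (\<i> * s * (of_real (\<integral>\<omega>. X i \<omega> * N i \<omega> \<partial>M) * (CLINT \<omega>|M. iexp (s * R' i \<omega>)))
        - \<i> * s * (\<integral>\<omega>. X i \<omega> * N i \<omega> \<partial>M) * \<phi> s) \<le> s\<^sup>2 * q\<^sup>2 * b ^ 3"
    proof -
      have "cmod ((CLINT \<omega>|M. iexp (s * R' i \<omega>)) - \<phi> s) = cmod (CLINT \<omega>|M. iexp (s * R' i \<omega>) - iexp (s * S \<omega>))"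
        unfolding \<phi>_def by (subst Bochner_Integration.integral_diff) (auto intro!: int[of _ 1])
      also have "\<dots> \<le> \<bar>s\<bar> * (q * b)"
      proof (rule norm_integral_le_bound[OF prob_space_axioms])
        fix \<omega>
        have "cmod (iexp (s * R' i \<omega>) - iexp (s * S \<omega>)) \<le> \<bar>s * R' i \<omega> - s * S \<omega>\<bar>" by (rule cmod_iexp_diff_le)
        also have "\<dots> \<le> \<bar>s\<bar> * (q * b)"
          unfolding right_diff_distrib[symmetric] abs_mult using SR by (rule mult_left_mono) simp
        finally show "cmod (iexp (s * R' i \<omega>) - iexp (s * S \<omega>)) \<le> \<bar>s\<bar> * (q * b)" .
      qed
      finally have a: "cmod ((CLINT \<omega>|M. iexp (s * R' i \<omega>)) - \<phi> s) \<le> \<bar>s\<bar> * (q * b)" .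
      have c: "\<bar>\<integral>\<omega>. X i \<omega> * N i \<omega> \<partial>M\<bar> \<le> b * (q * b)"
        using norm_integral_le_bound[OF prob_space_axioms, of "\<lambda>\<omega>. X i \<omega> * N i \<omega>"] XN by simp
      have "cmod (\<i> * s * (of_real (\<integral>\<omega>. X i \<omega> * N i \<omega> \<partial>M) * (CLINT \<omega>|M. iexp (s * R' i \<omega>)))
        - \<i> * s * (\<integral>\<omega>. X i \<omega> * N i \<omega> \<partial>M) * \<phi> s)
        = cmod (\<i> * s * of_real (\<integral>\<omega>. X i \<omega> * N i \<omega> \<partial>M) * ((CLINT \<omega>|M. iexp (s * R' i \<omega>)) - \<phi> s))"
        by (simp only: right_diff_distrib mult.assoc)
      also have "\<dots> = \<bar>s\<bar> * \<bar>\<integral>\<omega>. X i \<omega> * N i \<omega> \<partial>M\<bar> * cmod ((CLINT \<omega>|M. iexp (s * R' i \<omega>)) - \<phi> s)"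
        by (simp only: norm_mult norm_ii norm_of_real mult_1)
      also have "\<dots> \<le> \<bar>s\<bar> * (b * (q * b)) * (\<bar>s\<bar> * (q * b))"
        by (intro mult_mono a c) (use b q in auto)
      also have "\<dots> = s\<^sup>2 * q\<^sup>2 * b ^ 3"
        by (simp add: power2_eq_square power3_eq_cube algebra_simps)
      finally show ?thesis .
    qed
    ultimately show ?thesis
      using 1 norm_triangle_ineq[of "integral\<^sup>L M P"
          "\<i> * s * (of_real (\<integral>\<omega>. X i \<omega> * N i \<omega> \<partial>M) * (CLINT \<omega>|M. iexp (s * R' i \<omega>)))
        - \<i> * s * (\<integral>\<omega>. X i \<omega> * N i \<omega> \<partial>M) * \<phi> s"]
      by (simp add: algebra_simps)
  qed
  \<comment> \<open>The same independence confines the variance to pairs within neighbourhoods, so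
    that the first-order terms of \<open>term_le\<close> add up to a multiple of V.\<close>
  have V_eq: "V = (\<Sum>i\<in>I. \<integral>\<omega>. X i \<omega> * N i \<omega> \<partial>M)"
  proof -
    have "(\<integral>\<omega>. X i \<omega> * R i \<omega> \<partial>M) = 0" if i: "i \<in> I" for i
    proof -
      have "integrable M (R i)" unfolding R_def by (intro Bochner_Integration.integrable_sum iX)
      then show ?thesis
        using indep_var_lebesgue_integral[OF ind1[OF i, folded R_def] iX[of i]] mean[OF i] by simp
    qed
    moreover have "integrable M (\<lambda>\<omega>. X i \<omega> * R i \<omega>)" for i
      unfolding R_def sum_distrib_left by (intro Bochner_Integration.integrable_sum iXX)
    ultimately have XS: "integrable M (\<lambda>\<omega>. X i \<omega> * S \<omega>) \<and> (\<integral>\<omega>. X i \<omega> * S \<omega> \<partial>M) = (\<integral>\<omega>. X i \<omega> * N i \<omega> \<partial>M)"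
      if "i \<in> I" for i
      using iXN[of i] that by (simp add: split1[OF that] distrib_left)
    have "V = (\<integral>\<omega>. (\<Sum>i\<in>I. X i \<omega> * S \<omega>) \<partial>M)"
      unfolding V_def power2_eq_square by (simp add: S_def sum_distrib_right)
    also have "\<dots> = (\<Sum>i\<in>I. \<integral>\<omega>. X i \<omega> * S \<omega> \<partial>M)"
      by (rule Bochner_Integration.integral_sum) (use XS in auto)
    finally show ?thesis using XS by simp
  qed
  have V: "0 \<le> V" unfolding V_def by simp
  have \<kappa>: "0 \<le> \<kappa>" unfolding \<kappa>_def using b by simp
  have S_le: "\<bar>S \<omega>\<bar> \<le> card I * b" for \<omega> unfolding S_def by (rule sum_le)
  define D where "D s = \<i> * (CLINT \<omega>|M. S \<omega> * iexp (s * S \<omega>))" for s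
  have D: "cmod (D s + s * V * \<phi> s) \<le> \<kappa> * s\<^sup>2" for s
  proof -
    have "(CLINT \<omega>|M. S \<omega> * iexp (s * S \<omega>)) = (CLINT \<omega>|M. (\<Sum>i\<in>I. X i \<omega> * iexp (s * S \<omega>)))"
      by (intro Bochner_Integration.integral_cong refl) (simp add: S_def sum_distrib_right)
    also have "\<dots> = (\<Sum>i\<in>I. CLINT \<omega>|M. X i \<omega> * iexp (s * S \<omega>))"
      by (rule Bochner_Integration.integral_sum) (rule ie, simp)
    finally have "D s + s * V * \<phi> s = \<i> * (\<Sum>i\<in>I. (CLINT \<omega>|M. X i \<omega> * iexp (s * S \<omega>))
        - \<i> * s * (\<integral>\<omega>. X i \<omega> * N i \<omega> \<partial>M) * \<phi> s)"
      unfolding D_def V_eq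
      by (simp add: sum_subtractf sum_distrib_left sum_distrib_right sum_negf algebra_simps)
    then have "cmod (D s + s * V * \<phi> s) = cmod (\<Sum>i\<in>I. (CLINT \<omega>|M. X i \<omega> * iexp (s * S \<omega>))
        - \<i> * s * (\<integral>\<omega>. X i \<omega> * N i \<omega> \<partial>M) * \<phi> s)"
      by (simp only: norm_mult norm_ii mult_1)
    also have "\<dots> \<le> (\<Sum>i\<in>I. 3 * s\<^sup>2 * q\<^sup>2 * b ^ 3)"
      by (rule sum_norm_le) (rule term_le)
    finally show ?thesis by (simp add: \<kappa>_def mult_ac)
  qed
  \<comment> \<open>Integrating factor: if \<phi> solved the equation \<phi>' = - s V \<phi>
    exactly, \<psi> would be constant. Its derivative on [0,1] is at most
    \<open>\<kappa> * exp (V / 2)\<close>, and the factor exp (V / 2) cancels on the way back from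
    \<psi> to \<phi>, so the variance does not enter the final bound.\<close>
  define \<psi> where "\<psi> s = of_real (exp (V * s\<^sup>2 / 2)) * \<phi> s" for s
  have deriv: "(\<psi> has_vector_derivative of_real (exp (V * s\<^sup>2 / 2)) * (D s + s * V * \<phi> s)) (at s within {0..1})" for s
  proof -
    have 1: "(\<phi> has_vector_derivative D s) (at s within {0..1})"
      unfolding \<phi>_def[abs_def] D_def by (rule char_has_vector_derivative[OF prob_space_axioms _ S_le]) simp
    have 2: "((\<lambda>s. of_real (exp (V * s\<^sup>2 / 2))) has_vector_derivative complex_of_real (exp (V * s\<^sup>2 / 2) * (V * s))) (at s within {0..1})"
      by (rule has_vector_derivative_of_real) (auto intro!: derivative_eq_intros)
    show ?thesis
      unfolding \<psi>_def[abs_def]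
      by (rule has_vector_derivative_eq_rhs[OF has_vector_derivative_mult[OF 2 1]]) (simp add: algebra_simps)
  qed
  have "norm (\<psi> 1 - \<psi> 0) \<le> (\<kappa> * exp (V / 2)) * norm (1 - 0 :: real)"
  proof (rule differentiable_bound[of "{0..1}"])
    fix s :: real assume s: "s \<in> {0..1}"
    show "(\<psi> has_derivative (\<lambda>h. h *\<^sub>R (of_real (exp (V * s\<^sup>2 / 2)) * (D s + s * V * \<phi> s)))) (at s within {0..1})"
      using deriv[of s] unfolding has_vector_derivative_def .
    have s2: "s\<^sup>2 \<le> 1" using s by (simp add: power_le_one)
    have v: "norm (of_real (exp (V * s\<^sup>2 / 2)) * (D s + s * V * \<phi> s)) \<le> exp (V / 2) * (\<kappa> * 1)"
      unfolding norm_mult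
    proof (rule mult_mono)
      show "cmod (D s + s * V * \<phi> s) \<le> \<kappa> * 1"
        using D[of s] mult_left_mono[OF s2 \<kappa>] by linarith
      show "cmod (of_real (exp (V * s\<^sup>2 / 2))) \<le> exp (V / 2)"
        using mult_left_mono[OF s2 V] by simp
    qed auto
    show "onorm (\<lambda>h. h *\<^sub>R (of_real (exp (V * s\<^sup>2 / 2)) * (D s + s * V * \<phi> s))) \<le> \<kappa> * exp (V / 2)"
    proof (rule onorm_bound)
      fix h :: real
      show "norm (h *\<^sub>R (of_real (exp (V * s\<^sup>2 / 2)) * (D s + s * V * \<phi> s))) \<le> \<kappa> * exp (V / 2) * norm h"
        using mult_left_mono[OF v, of "\<bar>h\<bar>"]
        by (simp only: norm_scaleR real_norm_def mult_ac mult_1_left mult_1_right)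
    qed (use \<kappa> in simp)
  qed auto
  moreover have "\<psi> 0 = 1" by (simp add: \<psi>_def \<phi>_def prob_space)
  moreover have "\<psi> 1 - 1 = of_real (exp (V / 2)) * (\<phi> 1 - of_real (exp (- V / 2)))"
    by (simp add: \<psi>_def right_diff_distrib of_real_mult[symmetric] exp_add[symmetric] del: of_real_mult)
  ultimately have "exp (V / 2) * cmod (\<phi> 1 - of_real (exp (- V / 2))) \<le> exp (V / 2) * \<kappa>"
    by (simp add: norm_mult mult.commute)
  then have "cmod (\<phi> 1 - of_real (exp (- V / 2))) \<le> \<kappa>" by simp
  then show ?thesis by (simp add: \<phi>_def V_def \<kappa>_def S_def)
qed

section \<open>Functions of independent innovations\<close>

text \<open>With \<open>x\<close> the true past and \<open>y\<close> an independent one, this is the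
  argument fed to the m-approximation: recent innovations kept, remote ones resampled.\<close>

definition merge_at :: "nat \<Rightarrow> (nat \<Rightarrow> 's) \<Rightarrow> (nat \<Rightarrow> 's) \<Rightarrow> nat \<Rightarrow> 's"
  where "merge_at m x y = (\<lambda>k. if k < m then x k else y k)"

lemma merge_at_merge_at [simp]: "merge_at m (merge_at m x z) y = merge_at m x y"
  by (auto simp: merge_at_def)

lemma measurable_merge_at [measurable (raw)]:
  assumes g: "g \<in> measurable N (\<Pi>\<^sub>M k\<in>(UNIV::nat set). S)" and h: "h \<in> measurable N (\<Pi>\<^sub>M k\<in>UNIV. S)"
  shows "(\<lambda>z. merge_at m (g z) (h z)) \<in> measurable N (\<Pi>\<^sub>M k\<in>UNIV. S)"
  unfolding merge_at_def
proof (rule measurable_PiM_single')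
  fix k :: nat
  have "(\<lambda>z. g z k) \<in> measurable N S" "(\<lambda>z. h z k) \<in> measurable N S"
    using measurable_compose[OF g measurable_component_singleton[of k UNIV]]
      measurable_compose[OF h measurable_component_singleton[of k UNIV]] by auto
  then show "(\<lambda>z. if k < m then g z k else h z k) \<in> measurable N S" by simp
qed (use measurable_space[OF g] measurable_space[OF h] in \<open>auto simp: space_PiM PiE_iff\<close>)

lemma square_add_le: "((a::real) + b)\<^sup>2 \<le> 2 * a\<^sup>2 + 2 * b\<^sup>2"
  using zero_le_power2[of "a - b"] by (simp add: power2_eq_square algebra_simps)

lemma integrable_mult_of_squares:
  fixes f g :: "'a \<Rightarrow> real"
  assumes [measurable]: "f \<in> borel_measurable M" "g \<in> borel_measurable M"
    and i: "integrable M (\<lambda>x. (f x)\<^sup>2)" "integrable M (\<lambda>x. (g x)\<^sup>2)"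
  shows "integrable M (\<lambda>x. f x * g x)"
proof (rule Bochner_Integration.integrable_bound)
  show "integrable M (\<lambda>x. (f x)\<^sup>2 + (g x)\<^sup>2)" using i by simp
  have "\<bar>a * b\<bar> \<le> a\<^sup>2 + b\<^sup>2" for a b :: real
  proof -
    have "2 * (\<bar>a\<bar> * \<bar>b\<bar>) \<le> a\<^sup>2 + b\<^sup>2"
      using sum_squares_bound[of "\<bar>a\<bar>" "\<bar>b\<bar>"] by simp
    moreover have "0 \<le> \<bar>a\<bar> * \<bar>b\<bar>" by simp
    ultimately show ?thesis unfolding abs_mult by linarith
  qed
  then show "AE x in M. norm (f x * g x) \<le> norm ((f x)\<^sup>2 + (g x)\<^sup>2)"
    by (simp add: abs_of_nonneg del: abs_mult)
qed simp

lemma integrable_square_add: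
  fixes f g :: "'a \<Rightarrow> real"
  assumes [measurable]: "f \<in> borel_measurable M" "g \<in> borel_measurable M"
    and i: "integrable M (\<lambda>x. (f x)\<^sup>2)" "integrable M (\<lambda>x. (g x)\<^sup>2)"
  shows "integrable M (\<lambda>x. (f x + g x)\<^sup>2)"
  using i integrable_mult_of_squares[OF assms] by (simp add: power2_sum mult.assoc)

lemma integrable_square_diff:
  fixes f g :: "'a \<Rightarrow> real"
  assumes "f \<in> borel_measurable M" "g \<in> borel_measurable M"
    and "integrable M (\<lambda>x. (f x)\<^sup>2)" "integrable M (\<lambda>x. (g x)\<^sup>2)"
  shows "integrable M (\<lambda>x. (f x - g x)\<^sup>2)"
  using integrable_square_add[of f M "\<lambda>x. - g x"] assms by simp

lemma integral_Cauchy_Schwarz: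
  fixes f g :: "'a \<Rightarrow> real"
  assumes f: "f \<in> borel_measurable M" "integrable M (\<lambda>x. (f x)\<^sup>2)"
    and g: "g \<in> borel_measurable M" "integrable M (\<lambda>x. (g x)\<^sup>2)"
  shows "\<bar>\<integral>x. f x * g x \<partial>M\<bar> \<le> sqrt (\<integral>x. (f x)\<^sup>2 \<partial>M) * sqrt (\<integral>x. (g x)\<^sup>2 \<partial>M)"
proof -
  have fg: "integrable M (\<lambda>x. f x * g x)" by (rule integrable_mult_of_squares[OF f(1) g(1) f(2) g(2)])
  define A B C where "A = (\<integral>x. (f x)\<^sup>2 \<partial>M)" "B = (\<integral>x. f x * g x \<partial>M)" "C = (\<integral>x. (g x)\<^sup>2 \<partial>M)"
  have q: "0 \<le> A + 2 * t * B + t\<^sup>2 * C" for t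
  proof -
    have eq: "(f x + t * g x)\<^sup>2 = (f x)\<^sup>2 + 2 * t * (f x * g x) + t\<^sup>2 * (g x)\<^sup>2" for x
      by (simp add: power2_eq_square algebra_simps)
    have "0 \<le> (\<integral>x. (f x + t * g x)\<^sup>2 \<partial>M)" by simp
    then show ?thesis using f(2) g(2) fg by (simp add: eq A_B_C_def)
  qed
  have "B\<^sup>2 \<le> A * C"
  proof (cases "C = 0")
    case True
    have "B = 0"
    proof (rule ccontr)
      assume "B \<noteq> 0"
      define t where "t = - (A + 1) / (2 * B)"
      have "2 * t * B = - (A + 1)" using \<open>B \<noteq> 0\<close> by (simp add: t_def)
      then show False using q[of t] by (simp add: True)
    qed
    then show ?thesis by (simp add: True)
  next
    case False
    then have "C > 0" by (simp add: A_B_C_def less_le)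
    then show ?thesis using q[of "- B / C"] by (simp add: field_simps power2_eq_square)
  qed
  then have "sqrt (B\<^sup>2) \<le> sqrt (A * C)" by (rule real_sqrt_le_mono)
  then show ?thesis by (simp add: A_B_C_def real_sqrt_mult)
qed

text \<open>Jensen's inequality in the inner variable, for almost every \<open>x\<close>, since
  Fubini provides square integrability of almost every section.\<close>

lemma pair_square_expectation_le:
  fixes h :: "'a \<times> 'b \<Rightarrow> real"
  assumes "prob_space M" "prob_space N" and [measurable]: "h \<in> borel_measurable (M \<Otimes>\<^sub>M N)"
    and int: "integrable (M \<Otimes>\<^sub>M N) (\<lambda>z. (h z)\<^sup>2)"
  shows "integrable M (\<lambda>x. (\<integral>y. h (x, y) \<partial>N)\<^sup>2)"
    and "(\<integral>x. (\<integral>y. h (x, y) \<partial>N)\<^sup>2 \<partial>M) \<le> (\<integral>z. (h z)\<^sup>2 \<partial>(M \<Otimes>\<^sub>M N))"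
proof -
  interpret M: prob_space M by fact
  interpret N: prob_space N by fact
  interpret pair_prob_space M N ..
  have i1: "integrable M (\<lambda>x. \<integral>y. (h (x, y))\<^sup>2 \<partial>N)"
    using integrable_fst'[OF int] by simp
  have "AE x in M. integrable N (\<lambda>y. (h (x, y))\<^sup>2)"
    using AE_integrable_fst'[OF int] by simp
  then have le: "AE x in M. (\<integral>y. h (x, y) \<partial>N)\<^sup>2 \<le> (\<integral>y. (h (x, y))\<^sup>2 \<partial>N)"
    using AE_space
  proof eventually_elim
    case (elim x)
    note [measurable] = elim(2)
    show ?case by (rule square_expectation_le[OF N.prob_space_axioms _ elim(1)]) measurable
  qed
  show i2: "integrable M (\<lambda>x. (\<integral>y. h (x, y) \<partial>N)\<^sup>2)"
    by (rule Bochner_Integration.integrable_bound[OF i1]) (use le in \<open>auto elim: eventually_mono\<close>)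
  have "(\<integral>x. (\<integral>y. h (x, y) \<partial>N)\<^sup>2 \<partial>M) \<le> (\<integral>x. \<integral>y. (h (x, y))\<^sup>2 \<partial>N \<partial>M)"
    by (rule integral_mono_AE[OF i2 i1 le])
  also have "\<dots> = (\<integral>z. (h z)\<^sup>2 \<partial>(M \<Otimes>\<^sub>M N))"
    by (rule integral_fst'[OF int])
  finally show "(\<integral>x. (\<integral>y. h (x, y) \<partial>N)\<^sup>2 \<partial>M) \<le> (\<integral>z. (h z)\<^sup>2 \<partial>(M \<Otimes>\<^sub>M N))" .
qed

locale bernoulli_shift = prob_space M for M :: "'w measure" +
  fixes S :: "'s measure" and \<epsilon> :: "int \<Rightarrow> 'w \<Rightarrow> 's"
  assumes indep: "indep_vars (\<lambda>_. S) \<epsilon> UNIV" and ident: "\<And>j. distr M S (\<epsilon> j) = distr M S (\<epsilon> 0)"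
begin

abbreviation SQ :: "(nat \<Rightarrow> 's) measure" where "SQ \<equiv> \<Pi>\<^sub>M k\<in>UNIV. S"

definition past :: "int \<Rightarrow> 'w \<Rightarrow> nat \<Rightarrow> 's" where "past t \<omega> = (\<lambda>k. \<epsilon> (t - int k) \<omega>)"

text \<open>The law of the past at every time (\<open>law_past\<close>). Moments of functions of
  \<open>past t\<close> become integrals over \<open>P\<close>, in which time no longer
  occurs.\<close>

definition P :: "(nat \<Rightarrow> 's) measure" where "P = distr M SQ (past 0)"

lemma measurable_noise [measurable]: "\<epsilon> j \<in> measurable M S"
  using indep by (auto simp: indep_vars_def)

lemma measurable_past [measurable]: "past t \<in> measurable M SQ"
  unfolding past_def by (rule measurable_PiM_single') (auto simp: space_PiM measurable_space[OF measurable_noise])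

lemma sets_P [measurable_cong, simp]: "sets P = sets SQ" by (simp add: P_def)

lemma space_P [simp]: "space P = space SQ" by (simp add: P_def)

lemma prob_space_P: "prob_space P"
  unfolding P_def by (rule prob_space_distr) simp

lemma law_noise: "distr M (\<Pi>\<^sub>M j\<in>UNIV. S) (\<lambda>\<omega> j. \<epsilon> j \<omega>) = (\<Pi>\<^sub>M j\<in>(UNIV::int set). distr M S (\<epsilon> 0))"
proof -
  have "distr M (\<Pi>\<^sub>M j\<in>UNIV. S) (\<lambda>\<omega>. \<lambda>j\<in>UNIV. \<epsilon> j \<omega>) = (\<Pi>\<^sub>M j\<in>(UNIV::int set). distr M S (\<epsilon> j))"
    using indep by (subst (asm) indep_vars_iff_distr_eq_PiM) auto
  moreover have "(\<lambda>j. distr M S (\<epsilon> j)) = (\<lambda>j. distr M S (\<epsilon> 0))"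
    using ident by (rule ext)
  ultimately show ?thesis by (simp only: restrict_UNIV)
qed

text \<open>An injective reindexing of an i.i.d. family keeps the product law.\<close>

lemma law_past': "distr M SQ (past t) = (\<Pi>\<^sub>M k\<in>(UNIV::nat set). distr M S (\<epsilon> 0))"
proof -
  define \<mu> where "\<mu> = distr M S (\<epsilon> 0)"
  have \<mu>: "prob_space \<mu>" unfolding \<mu>_def by (rule prob_space_distr) simp
  have s: "sets (\<Pi>\<^sub>M j\<in>(UNIV::int set). \<mu>) = sets (\<Pi>\<^sub>M j\<in>UNIV. S)" "sets (\<Pi>\<^sub>M j\<in>(UNIV::nat set). \<mu>) = sets SQ"
    by (auto intro!: sets_PiM_cong simp: \<mu>_def)
  have "distr (\<Pi>\<^sub>M j\<in>(UNIV::int set). \<mu>) (\<Pi>\<^sub>M k\<in>(UNIV::nat set). \<mu>) (\<lambda>x. \<lambda>k\<in>UNIV. x (t - int k)) = (\<Pi>\<^sub>M k\<in>(UNIV::nat set). \<mu>)"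
    by (rule distr_PiM_reindex) (auto simp: \<mu> inj_on_def)
  then have "(\<Pi>\<^sub>M k\<in>(UNIV::nat set). \<mu>)
      = distr (distr M (\<Pi>\<^sub>M j\<in>UNIV. S) (\<lambda>\<omega> j. \<epsilon> j \<omega>)) SQ (\<lambda>x k. x (t - int k))"
    unfolding law_noise \<mu>_def[symmetric] using s by (simp add: restrict_UNIV cong: distr_cong)
  also have "\<dots> = distr M SQ ((\<lambda>x k. x (t - int k)) \<circ> (\<lambda>\<omega> j. \<epsilon> j \<omega>))"
  proof (rule distr_distr)
    show "(\<lambda>x k. x (t - int k)) \<in> measurable (\<Pi>\<^sub>M j\<in>UNIV. S) SQ"
      by (rule measurable_PiM_single') (auto simp: space_PiM)
    show "(\<lambda>\<omega> j. \<epsilon> j \<omega>) \<in> measurable M (\<Pi>\<^sub>M j\<in>UNIV. S)"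
      by (rule measurable_PiM_single') (auto simp: space_PiM measurable_space[OF measurable_noise])
  qed
  finally show ?thesis by (simp add: \<mu>_def comp_def past_def[abs_def])
qed

lemma law_past: "distr M SQ (past t) = P"
  unfolding P_def law_past' ..

lemma integral_past:
  fixes F :: "(nat \<Rightarrow> 's) \<Rightarrow> 'b::{banach, second_countable_topology}"
  assumes "F \<in> borel_measurable SQ"
  shows "(\<integral>\<omega>. F (past t \<omega>) \<partial>M) = (\<integral>x. F x \<partial>P)"
  unfolding law_past[of t, symmetric] by (rule integral_distr[symmetric]) (use assms in simp_all)

lemma integrable_past:
  fixes F :: "(nat \<Rightarrow> 's) \<Rightarrow> 'b::{banach, second_countable_topology}"
  assumes "F \<in> borel_measurable SQ"
  shows "integrable M (\<lambda>\<omega>. F (past t \<omega>)) \<longleftrightarrow> integrable P F"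
  unfolding law_past[of t, symmetric] by (rule integrable_distr_eq[symmetric]) (use assms in simp_all)

lemma past_shift: "past (t - int m) \<omega> = (\<lambda>k. past t \<omega> (k + m))"
  by (simp add: past_def algebra_simps)

lemma measurable_shift [measurable]: "(\<lambda>x k. x (k + m)) \<in> measurable SQ SQ"
  by (rule measurable_PiM_single') (auto simp: space_PiM)

lemma law_shift: "distr P SQ (\<lambda>x k. x (k + m)) = P"
proof -
  have "distr P SQ (\<lambda>x k. x (k + m)) = distr M SQ ((\<lambda>x k. x (k + m)) \<circ> past 0)"
    unfolding P_def by (rule distr_distr) simp_all
  also have "(\<lambda>x k. x (k + m)) \<circ> past 0 = past (0 - int m)"
    by (rule ext) (simp only: comp_def past_shift)
  finally show ?thesis unfolding law_past .
qed

text \<open>Replacing coordinates by those of an independent sample does not change a product law.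
  \<open>comb_seq m x y\<close> continues with \<open>y 0\<close> at position \<open>m\<close>, so
  it agrees with \<open>merge_at\<close> after \<open>y\<close> is shifted by \<open>m\<close>, and
  the shift preserves \<open>P\<close>.\<close>

lemma law_merge_at: "distr (P \<Otimes>\<^sub>M P) SQ (\<lambda>(x, y). merge_at m x y) = P"
proof -
  interpret \<mu>: prob_space "distr M S (\<epsilon> 0)" by (rule prob_space_distr) simp
  interpret seq: sequence_space "distr M S (\<epsilon> 0)" ..
  interpret P: prob_space P by (rule prob_space_P)
  have P_PiM: "(\<Pi>\<^sub>M k\<in>(UNIV::nat set). distr M S (\<epsilon> 0)) = P"
    unfolding P_def law_past' ..
  have 1: "distr (P \<Otimes>\<^sub>M P) (P \<Otimes>\<^sub>M P) (\<lambda>(x, y). (x, \<lambda>k. y (k + m))) = P \<Otimes>\<^sub>M P"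
  proof -
    have "distr P P (\<lambda>x. x) \<Otimes>\<^sub>M distr P P (\<lambda>x k. x (k + m)) = distr (P \<Otimes>\<^sub>M P) (P \<Otimes>\<^sub>M P) (\<lambda>(x, y). (x, \<lambda>k. y (k + m)))"
      by (rule pair_measure_distr) (auto intro!: prob_space_imp_sigma_finite P.prob_space_distr)
    moreover have "distr P P (\<lambda>x k. x (k + m)) = P"
      using law_shift[of m] by (simp cong: distr_cong)
    ultimately show ?thesis by (simp add: distr_id2)
  qed
  have "distr (P \<Otimes>\<^sub>M P) P (\<lambda>(x, y). comb_seq m x y) = P"
    using seq.PiM_comb_seq[of m] unfolding P_PiM .
  then have "P = distr (distr (P \<Otimes>\<^sub>M P) (P \<Otimes>\<^sub>M P) (\<lambda>(x, y). (x, \<lambda>k. y (k + m)))) SQ (\<lambda>(x, y). comb_seq m x y)"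
    unfolding 1 by (simp cong: distr_cong)
  also have "\<dots> = distr (P \<Otimes>\<^sub>M P) SQ ((\<lambda>(x, y). comb_seq m x y) \<circ> (\<lambda>(x, y). (x, \<lambda>k. y (k + m))))"
    by (rule distr_distr) measurable
  also have "(\<lambda>(x, y). comb_seq m x y) \<circ> (\<lambda>(x, y). (x, \<lambda>k. y (k + m))) = (\<lambda>(x, y). merge_at m x y)"
    by (auto simp: comb_seq_def merge_at_def fun_eq_iff)
  finally show ?thesis by simp
qed

lemma integral_merge_at:
  fixes F :: "(nat \<Rightarrow> 's) \<Rightarrow> 'b::{banach, second_countable_topology}"
  assumes "F \<in> borel_measurable SQ"
  shows "(\<integral>z. F (merge_at m (fst z) (snd z)) \<partial>(P \<Otimes>\<^sub>M P)) = (\<integral>x. F x \<partial>P)"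
proof -
  have "(\<integral>x. F x \<partial>distr (P \<Otimes>\<^sub>M P) SQ (\<lambda>(x, y). merge_at m x y)) = (\<integral>z. F (merge_at m (fst z) (snd z)) \<partial>(P \<Otimes>\<^sub>M P))"
    by (subst integral_distr) (use assms in \<open>auto simp: case_prod_unfold\<close>)
  then show ?thesis unfolding law_merge_at by simp
qed

lemma integrable_merge_at:
  fixes F :: "(nat \<Rightarrow> 's) \<Rightarrow> 'b::{banach, second_countable_topology}"
  assumes "F \<in> borel_measurable SQ"
  shows "integrable (P \<Otimes>\<^sub>M P) (\<lambda>z. F (merge_at m (fst z) (snd z))) \<longleftrightarrow> integrable P F"
proof -
  have "integrable (distr (P \<Otimes>\<^sub>M P) SQ (\<lambda>(x, y). merge_at m x y)) F = integrable (P \<Otimes>\<^sub>M P) (\<lambda>z. F (merge_at m (fst z) (snd z)))"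
    by (subst integrable_distr_eq) (use assms in \<open>auto simp: case_prod_unfold\<close>)
  then show ?thesis unfolding law_merge_at by simp
qed

text \<open>The conditional expectation given the first \<open>m\<close> coordinates.\<close>

definition trunc :: "nat \<Rightarrow> ((nat \<Rightarrow> 's) \<Rightarrow> real) \<Rightarrow> (nat \<Rightarrow> 's) \<Rightarrow> real"
  where "trunc m F x = (\<integral>y. F (merge_at m x y) \<partial>P)"

lemma trunc_merge_at [simp]: "trunc m F (merge_at m x z) = trunc m F x"
  by (simp add: trunc_def)

lemma measurable_trunc [measurable]:
  assumes [measurable]: "F \<in> borel_measurable SQ"
  shows "trunc m F \<in> borel_measurable SQ"
proof -
  interpret P: prob_space P by (rule prob_space_P)
  show ?thesis unfolding trunc_def by measurable
qed

text \<open>\<open>F - trunc m F\<close> is the average over \<open>y\<close> of the coupling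
  difference \<open>F x - F (merge_at m x y)\<close>. By Jensen its L2 norm is at most the coupling
  distance, which links the approximability condition to conditional expectations.\<close>

lemma
  assumes [measurable]: "F \<in> borel_measurable SQ" and int: "integrable P (\<lambda>x. (F x)\<^sup>2)"
  shows integrable_trunc_square: "integrable P (\<lambda>x. (trunc m F x)\<^sup>2)"
    and integrable_trunc_diff: "integrable P (\<lambda>x. (F x - trunc m F x)\<^sup>2)"
    and integral_trunc: "(\<integral>x. trunc m F x \<partial>P) = (\<integral>x. F x \<partial>P)"
    and integral_trunc_diff_le: "(\<integral>x. (F x - trunc m F x)\<^sup>2 \<partial>P)
      \<le> (\<integral>z. (F (fst z) - F (merge_at m (fst z) (snd z)))\<^sup>2 \<partial>(P \<Otimes>\<^sub>M P))"
    and integrable_merge_diff: "integrable (P \<Otimes>\<^sub>M P) (\<lambda>z. (F (fst z) - F (merge_at m (fst z) (snd z)))\<^sup>2)"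
proof -
  interpret P: prob_space P by (rule prob_space_P)
  interpret PP: pair_prob_space P P ..
  have sq: "integrable (P \<Otimes>\<^sub>M P) (\<lambda>z. (F (merge_at m (fst z) (snd z)))\<^sup>2)"
    using int by (subst integrable_merge_at[of "\<lambda>x. (F x)\<^sup>2"]) simp_all
  have F: "integrable P F" by (rule P.square_integrable_imp_integrable[OF _ int]) simp
  have Fm: "integrable (P \<Otimes>\<^sub>M P) (\<lambda>z. F (merge_at m (fst z) (snd z)))"
    using F by (subst integrable_merge_at) simp_all
  show 1: "integrable P (\<lambda>x. (trunc m F x)\<^sup>2)"
    using pair_square_expectation_le(1)[OF prob_space_P prob_space_P _ sq] by (simp add: trunc_def)
  show "integrable P (\<lambda>x. (F x - trunc m F x)\<^sup>2)"
    by (rule integrable_square_diff) (use int 1 in simp_all)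
  show "(\<integral>x. trunc m F x \<partial>P) = (\<integral>x. F x \<partial>P)"
    using PP.integral_fst'[OF Fm] integral_merge_at[of F m] by (simp add: trunc_def)
  have sqF: "integrable (P \<Otimes>\<^sub>M P) (\<lambda>z. (F (fst z))\<^sup>2)"
    by (rule PP.Fubini_integrable) (use int in \<open>simp_all add: P.prob_space[simplified]\<close>)
  show 2: "integrable (P \<Otimes>\<^sub>M P) (\<lambda>z. (F (fst z) - F (merge_at m (fst z) (snd z)))\<^sup>2)"
    by (rule integrable_square_diff) (use sq sqF in simp_all)
  have "AE x in P. integrable P (\<lambda>y. F (merge_at m x y))"
    using PP.AE_integrable_fst'[OF Fm] by simp
  then have "AE x in P. (F x - trunc m F x)\<^sup>2 = (\<integral>y. F x - F (merge_at m x y) \<partial>P)\<^sup>2"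
    by eventually_elim (simp add: trunc_def P.prob_space[simplified])
  then have "(\<integral>x. (F x - trunc m F x)\<^sup>2 \<partial>P) = (\<integral>x. (\<integral>y. F x - F (merge_at m x y) \<partial>P)\<^sup>2 \<partial>P)"
    by (intro integral_cong_AE) simp_all
  also have "\<dots> \<le> (\<integral>z. (F (fst z) - F (merge_at m (fst z) (snd z)))\<^sup>2 \<partial>(P \<Otimes>\<^sub>M P))"
    using pair_square_expectation_le(2)[OF prob_space_P prob_space_P _ 2] by simp
  finally show "(\<integral>x. (F x - trunc m F x)\<^sup>2 \<partial>P)
      \<le> (\<integral>z. (F (fst z) - F (merge_at m (fst z) (snd z)))\<^sup>2 \<partial>(P \<Otimes>\<^sub>M P))" .
qed

text \<open>Measurability with respect to the innovations with index in \<open>A\<close>, stated by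
  factorisation instead of a generated sigma-algebra: functions of disjoint blocks of an independent
  family are then independent by composition.\<close>

definition dep :: "int set \<Rightarrow> ('w \<Rightarrow> real) \<Rightarrow> bool"
  where "dep A \<phi> \<longleftrightarrow> (\<exists>\<Phi>\<in>borel_measurable (\<Pi>\<^sub>M i\<in>A. S). \<phi> = (\<lambda>\<omega>. \<Phi> (\<lambda>i\<in>A. \<epsilon> i \<omega>)))"

lemma depI:
  assumes "\<Phi> \<in> borel_measurable (\<Pi>\<^sub>M i\<in>A. S)" "\<And>\<omega>. \<phi> \<omega> = \<Phi> (\<lambda>i\<in>A. \<epsilon> i \<omega>)"
  shows "dep A \<phi>"
proof -
  have "\<phi> = (\<lambda>\<omega>. \<Phi> (\<lambda>i\<in>A. \<epsilon> i \<omega>))" using assms(2) by (rule ext)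
  then show ?thesis unfolding dep_def by (rule bexI[where x = \<Phi>]) (rule assms(1))
qed

lemma depE:
  assumes "dep A \<phi>"
  obtains \<Phi> where "\<Phi> \<in> borel_measurable (\<Pi>\<^sub>M i\<in>A. S)" "\<phi> = (\<lambda>\<omega>. \<Phi> (\<lambda>i\<in>A. \<epsilon> i \<omega>))"
  using assms unfolding dep_def by (rule bexE)

lemma dep_measurable: "dep A \<phi> \<Longrightarrow> \<phi> \<in> borel_measurable M"
  unfolding dep_def
proof clarify
  fix \<Phi> :: "(int \<Rightarrow> 's) \<Rightarrow> real" assume [measurable]: "\<Phi> \<in> borel_measurable (\<Pi>\<^sub>M i\<in>A. S)"
  show "(\<lambda>\<omega>. \<Phi> (\<lambda>i\<in>A. \<epsilon> i \<omega>)) \<in> borel_measurable M" by measurable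
qed

lemma dep_mono:
  assumes "dep A \<phi>" "A \<subseteq> B"
  shows "dep B \<phi>"
proof -
  obtain \<Phi> where \<Phi>: "\<Phi> \<in> borel_measurable (\<Pi>\<^sub>M i\<in>A. S)" "\<phi> = (\<lambda>\<omega>. \<Phi> (\<lambda>i\<in>A. \<epsilon> i \<omega>))"
    using assms(1) by (rule depE)
  show ?thesis
  proof (rule depI)
    show "(\<lambda>x. \<Phi> (restrict x A)) \<in> borel_measurable (\<Pi>\<^sub>M i\<in>B. S)"
      using measurable_compose[OF measurable_restrict_subset[OF assms(2)] \<Phi>(1)] .
    show "\<phi> \<omega> = \<Phi> (restrict (\<lambda>i\<in>B. \<epsilon> i \<omega>) A)" for \<omega>
      using assms(2) by (simp add: \<Phi>(2) restrict_restrict Int_absorb1)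
  qed
qed

lemma dep_comp2:
  assumes "dep A \<phi>" "dep A \<psi>" "case_prod g \<in> borel_measurable (borel \<Otimes>\<^sub>M borel)"
  shows "dep A (\<lambda>\<omega>. g (\<phi> \<omega>) (\<psi> \<omega>))"
proof -
  obtain \<Phi> where \<Phi>: "\<Phi> \<in> borel_measurable (\<Pi>\<^sub>M i\<in>A. S)" "\<phi> = (\<lambda>\<omega>. \<Phi> (\<lambda>i\<in>A. \<epsilon> i \<omega>))"
    using assms(1) by (rule depE)
  obtain \<Psi> where \<Psi>: "\<Psi> \<in> borel_measurable (\<Pi>\<^sub>M i\<in>A. S)" "\<psi> = (\<lambda>\<omega>. \<Psi> (\<lambda>i\<in>A. \<epsilon> i \<omega>))"
    using assms(2) by (rule depE)
  note [measurable] = assms(3) \<Phi>(1) \<Psi>(1)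
  have "(\<lambda>x. g (\<Phi> x) (\<Psi> x)) \<in> borel_measurable (\<Pi>\<^sub>M i\<in>A. S)" by measurable
  then show ?thesis by (rule depI) (simp add: \<Phi>(2) \<Psi>(2))
qed

lemma dep_mult: "dep A \<phi> \<Longrightarrow> dep A \<psi> \<Longrightarrow> dep A (\<lambda>\<omega>. \<phi> \<omega> * \<psi> \<omega>)"
  by (rule dep_comp2) simp_all

lemma dep_scale: "dep A \<phi> \<Longrightarrow> dep A (\<lambda>\<omega>. c * \<phi> \<omega>)"
  using dep_comp2[of A \<phi> \<phi> "\<lambda>x y. c * x"] by simp

lemma dep_sum:
  assumes "\<And>j. j \<in> J \<Longrightarrow> dep A (\<phi> j)"
  shows "dep A (\<lambda>\<omega>. \<Sum>j\<in>J. \<phi> j \<omega>)"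
  using assms
proof (induction J rule: infinite_finite_induct)
  case (insert j J)
  then show ?case using dep_comp2[of A "\<phi> j" "\<lambda>\<omega>. \<Sum>j\<in>J. \<phi> j \<omega>" "\<lambda>x y. x + y"] by simp
qed (auto intro!: depI[of "\<lambda>_. 0"])

lemma dep_indep:
  assumes "dep A \<phi>" "dep B \<psi>" "A \<inter> B = {}"
  shows "indep_var borel \<phi> borel \<psi>"
proof -
  obtain \<Phi> where \<Phi>: "\<Phi> \<in> borel_measurable (\<Pi>\<^sub>M i\<in>A. S)" "\<phi> = (\<lambda>\<omega>. \<Phi> (\<lambda>i\<in>A. \<epsilon> i \<omega>))"
    using assms(1) by (rule depE)
  obtain \<Psi> where \<Psi>: "\<Psi> \<in> borel_measurable (\<Pi>\<^sub>M i\<in>B. S)" "\<psi> = (\<lambda>\<omega>. \<Psi> (\<lambda>i\<in>B. \<epsilon> i \<omega>))"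
    using assms(2) by (rule depE)
  have "indep_var (\<Pi>\<^sub>M i\<in>A. S) (\<lambda>\<omega>. \<lambda>i\<in>A. \<epsilon> i \<omega>) (\<Pi>\<^sub>M i\<in>B. S) (\<lambda>\<omega>. \<lambda>i\<in>B. \<epsilon> i \<omega>)"
    by (rule indep_var_restrict[OF indep assms(3)]) auto
  from indep_var_compose[OF this \<Phi>(1) \<Psi>(1)] show ?thesis
    unfolding comp_def \<Phi>(2)[symmetric] \<Psi>(2)[symmetric] .
qed

lemma dep_past:
  assumes [measurable]: "F \<in> borel_measurable SQ"
  shows "dep {..t} (\<lambda>\<omega>. F (past t \<omega>))"
proof -
  have "(\<lambda>z k. z (t - int k)) \<in> measurable (\<Pi>\<^sub>M i\<in>{..t}. S) SQ"
    by (rule measurable_PiM_single') (auto simp: space_PiM PiE_iff)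
  note [measurable] = this
  have "(\<lambda>z. F (\<lambda>k. z (t - int k))) \<in> borel_measurable (\<Pi>\<^sub>M i\<in>{..t}. S)" by measurable
  then show ?thesis
    by (rule depI) (simp add: past_def)
qed

text \<open>A function that ignores all coordinates from \<open>m\<close> on factors through the
  window of the last \<open>m\<close> innovations. The factor is obtained by filling the other
  coordinates with those of a fixed point \<open>z0\<close> of the space.\<close>

lemma dep_recent:
  assumes [measurable]: "F \<in> borel_measurable SQ" and F: "\<And>x z. F (merge_at m x z) = F x"
  shows "dep {t - int m<..t} (\<lambda>\<omega>. F (past t \<omega>))"
proof -
  interpret P: prob_space P by (rule prob_space_P)
  obtain z0 where z0: "z0 \<in> space SQ" using P.not_empty unfolding space_P by blast
  have z0k: "z0 k \<in> space S" for k
    using z0 by (simp add: space_PiM PiE_iff)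
  define g where "g z k = (if k < m then z (t - int k) else z0 k)" for z :: "int \<Rightarrow> 's" and k
  have "g \<in> measurable (\<Pi>\<^sub>M i\<in>{t - int m<..t}. S) SQ"
    unfolding g_def[abs_def]
  proof (rule measurable_PiM_single')
    show comp: "(\<lambda>z. if k < m then z (t - int k) else z0 k) \<in> measurable (\<Pi>\<^sub>M i\<in>{t - int m<..t}. S) S" for k
    proof (cases "k < m")
      case True
      then have "t - int k \<in> {t - int m<..t}" by simp
      then show ?thesis using True by (simp add: measurable_component_singleton)
    qed (use z0k in simp)
    show "(\<lambda>z k. if k < m then z (t - int k) else z0 k) \<in> space (\<Pi>\<^sub>M i\<in>{t - int m<..t}. S) \<rightarrow> (UNIV \<rightarrow>\<^sub>E space S)"
      using measurable_space[OF comp] by auto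
  qed
  from measurable_compose[OF this assms(1)]
  have "(\<lambda>z. F (g z)) \<in> borel_measurable (\<Pi>\<^sub>M i\<in>{t - int m<..t}. S)" .
  moreover have "F (past t \<omega>) = F (g (\<lambda>i\<in>{t - int m<..t}. \<epsilon> i \<omega>))" for \<omega>
  proof -
    have "g (\<lambda>i\<in>{t - int m<..t}. \<epsilon> i \<omega>) = merge_at m (past t \<omega>) z0"
      by (auto simp: merge_at_def past_def fun_eq_iff g_def)
    then show ?thesis by (simp add: F)
  qed
  ultimately show ?thesis by (rule depI)
qed

text \<open>\<open>trunc r F (past t)\<close> involves only innovations after time \<open>s\<close>;
  hence it is independent of \<phi>, and it is centred like \<open>F\<close>. Only
  \<open>F - trunc r F\<close> can correlate with \<phi>. The decay of the covariances with the lag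
  comes from here.\<close>

lemma dep_orthogonal:
  assumes \<phi>: "dep {..s} \<phi>" "integrable M (\<lambda>\<omega>. (\<phi> \<omega>)\<^sup>2)"
    and F [measurable]: "F \<in> borel_measurable SQ" and int: "integrable P (\<lambda>x. (F x)\<^sup>2)"
    and mean: "(\<integral>x. F x \<partial>P) = 0" and t: "t = s + int r"
  shows "(\<integral>\<omega>. \<phi> \<omega> * trunc r F (past t \<omega>) \<partial>M) = 0"
    and "\<bar>\<integral>\<omega>. \<phi> \<omega> * F (past t \<omega>) \<partial>M\<bar> \<le> sqrt (\<integral>\<omega>. (\<phi> \<omega>)\<^sup>2 \<partial>M) * sqrt (\<integral>x. (F x - trunc r F x)\<^sup>2 \<partial>P)"
proof -
  interpret P: prob_space P by (rule prob_space_P)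
  note \<phi>m [measurable] = dep_measurable[OF \<phi>(1)]
  have i\<phi>: "integrable M \<phi>" by (rule square_integrable_imp_integrable[OF \<phi>m \<phi>(2)])
  have iF: "integrable M (\<lambda>\<omega>. (F (past t \<omega>))\<^sup>2)" "integrable M (\<lambda>\<omega>. (trunc r F (past t \<omega>))\<^sup>2)"
    "integrable M (\<lambda>\<omega>. (F (past t \<omega>) - trunc r F (past t \<omega>))\<^sup>2)"
    using integrable_past[of "\<lambda>x. (F x)\<^sup>2" t] integrable_past[of "\<lambda>x. (trunc r F x)\<^sup>2" t]
      integrable_past[of "\<lambda>x. (F x - trunc r F x)\<^sup>2" t]
      int integrable_trunc_square[OF F int, of r] integrable_trunc_diff[OF F int, of r] by simp_all
  have iT: "integrable M (\<lambda>\<omega>. trunc r F (past t \<omega>))"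
    by (rule square_integrable_imp_integrable[OF _ iF(2)]) simp
  have "dep {s<..t} (\<lambda>\<omega>. trunc r F (past t \<omega>))"
    using dep_recent[of "trunc r F" r t] by (simp add: t)
  then have "indep_var borel \<phi> borel (\<lambda>\<omega>. trunc r F (past t \<omega>))"
    by (rule dep_indep[OF \<phi>(1)]) auto
  then show 0: "(\<integral>\<omega>. \<phi> \<omega> * trunc r F (past t \<omega>) \<partial>M) = 0"
    using indep_var_lebesgue_integral[OF _ i\<phi> iT] integral_past[of "trunc r F" t]
      integral_trunc[OF F int, of r] mean by simp
  have "(\<integral>\<omega>. \<phi> \<omega> * F (past t \<omega>) \<partial>M) = (\<integral>\<omega>. \<phi> \<omega> * (F (past t \<omega>) - trunc r F (past t \<omega>)) \<partial>M)"
    using integrable_mult_of_squares[OF _ _ \<phi>(2) iF(1)] integrable_mult_of_squares[OF _ _ \<phi>(2) iF(2)] 0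
    by (simp add: right_diff_distrib)
  also have "\<bar>\<dots>\<bar> \<le> sqrt (\<integral>\<omega>. (\<phi> \<omega>)\<^sup>2 \<partial>M) * sqrt (\<integral>\<omega>. (F (past t \<omega>) - trunc r F (past t \<omega>))\<^sup>2 \<partial>M)"
    by (rule integral_Cauchy_Schwarz) (use \<phi>(2) iF(3) in simp_all)
  also have "(\<integral>\<omega>. (F (past t \<omega>) - trunc r F (past t \<omega>))\<^sup>2 \<partial>M) = (\<integral>x. (F x - trunc r F x)\<^sup>2 \<partial>P)"
    by (rule integral_past[of "\<lambda>x. (F x - trunc r F x)\<^sup>2"]) simp
  finally show "\<bar>\<integral>\<omega>. \<phi> \<omega> * F (past t \<omega>) \<partial>M\<bar> \<le> sqrt (\<integral>\<omega>. (\<phi> \<omega>)\<^sup>2 \<partial>M) * sqrt (\<integral>x. (F x - trunc r F x)\<^sup>2 \<partial>P)" .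
qed

end

section \<open>Central limit theorem for weighted sums\<close>

text \<open>Schur's test: |a s a t| is at most the mean of the two squares, and each row of the
  kernel \<kappa>(|t - s|) meets every lag at most twice.\<close>

lemma quadratic_form_bound:
  fixes c :: "nat \<Rightarrow> nat \<Rightarrow> real" and a \<kappa> :: "nat \<Rightarrow> real"
  assumes fin: "finite I" and c: "\<And>s t. s \<in> I \<Longrightarrow> t \<in> I \<Longrightarrow> s \<le> t \<Longrightarrow> \<bar>c s t\<bar> \<le> \<kappa> (t - s)"
    and sym: "\<And>s t. c s t = c t s" and nonneg: "\<And>r. 0 \<le> \<kappa> r" and sm: "summable \<kappa>"
  shows "\<bar>\<Sum>s\<in>I. \<Sum>t\<in>I. a s * a t * c s t\<bar> \<le> (\<Sum>s\<in>I. (a s)\<^sup>2) * (2 * suminf \<kappa>)"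
proof -
  define k where "k s t = \<kappa> (if s \<le> t then t - s else s - t)" for s t :: nat
  have k_sym: "k s t = k t s" for s t by (simp add: k_def)
  have k_nonneg: "0 \<le> k s t" for s t by (simp add: k_def nonneg)
  have ck: "\<bar>c s t\<bar> \<le> k s t" if "s \<in> I" "t \<in> I" for s t
    using c[OF that] c[OF that(2) that(1)] sym[of s t] by (auto simp: k_def)
  have row: "(\<Sum>t\<in>I. k s t) \<le> 2 * suminf \<kappa>" for s
  proof -
    have le: "(\<Sum>t\<in>J. \<kappa> (f t)) \<le> suminf \<kappa>" if "finite J" "inj_on f J" for J :: "nat set" and f
    proof -
      have "(\<Sum>t\<in>J. \<kappa> (f t)) = sum \<kappa> (f ` J)" using that by (simp add: sum.reindex)
      also have "\<dots> \<le> suminf \<kappa>" using that sm nonneg by (intro sum_le_suminf) auto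
      finally show ?thesis .
    qed
    have "(\<Sum>t\<in>I. k s t) = (\<Sum>t\<in>{t\<in>I. s \<le> t}. k s t) + (\<Sum>t\<in>{t\<in>I. \<not> s \<le> t}. k s t)"
      using fin by (subst sum.union_disjoint[symmetric]) (auto intro: sum.cong)
    also have "\<dots> = (\<Sum>t\<in>{t\<in>I. s \<le> t}. \<kappa> (t - s)) + (\<Sum>t\<in>{t\<in>I. \<not> s \<le> t}. \<kappa> (s - t))"
      by (intro arg_cong2[where f = "(+)"] sum.cong) (auto simp: k_def)
    also have "\<dots> \<le> suminf \<kappa> + suminf \<kappa>"
      using fin by (intro add_mono le) (auto intro!: inj_onI)
    finally show ?thesis by simp
  qed
  have "\<bar>\<Sum>s\<in>I. \<Sum>t\<in>I. a s * a t * c s t\<bar> \<le> (\<Sum>s\<in>I. \<Sum>t\<in>I. \<bar>a s * a t * c s t\<bar>)"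
    by (intro order_trans[OF sum_abs] sum_mono sum_abs)
  also have "\<dots> \<le> (\<Sum>s\<in>I. \<Sum>t\<in>I. (a s)\<^sup>2 / 2 * k s t + (a t)\<^sup>2 / 2 * k s t)"
  proof (intro sum_mono)
    fix s t assume st: "s \<in> I" "t \<in> I"
    have "\<bar>a s * a t\<bar> \<le> (a s)\<^sup>2 / 2 + (a t)\<^sup>2 / 2"
      using sum_squares_bound[of "\<bar>a s\<bar>" "\<bar>a t\<bar>"] by (simp add: abs_mult)
    then have "\<bar>a s * a t\<bar> * \<bar>c s t\<bar> \<le> ((a s)\<^sup>2 / 2 + (a t)\<^sup>2 / 2) * k s t"
      using ck[OF st] by (intro mult_mono) auto
    then show "\<bar>a s * a t * c s t\<bar> \<le> (a s)\<^sup>2 / 2 * k s t + (a t)\<^sup>2 / 2 * k s t"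
      by (simp add: abs_mult distrib_right)
  qed
  also have "\<dots> = (\<Sum>s\<in>I. \<Sum>t\<in>I. (a s)\<^sup>2 / 2 * k s t) + (\<Sum>s\<in>I. \<Sum>t\<in>I. (a t)\<^sup>2 / 2 * k s t)"
    by (simp add: sum.distrib)
  also have "(\<Sum>s\<in>I. \<Sum>t\<in>I. (a t)\<^sup>2 / 2 * k s t) = (\<Sum>s\<in>I. \<Sum>t\<in>I. (a s)\<^sup>2 / 2 * k s t)"
    by (subst sum.swap) (simp add: k_sym)
  also have "(\<Sum>s\<in>I. \<Sum>t\<in>I. (a s)\<^sup>2 / 2 * k s t) + (\<Sum>s\<in>I. \<Sum>t\<in>I. (a s)\<^sup>2 / 2 * k s t)
      = (\<Sum>s\<in>I. (a s)\<^sup>2 * (\<Sum>t\<in>I. k s t))"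
    unfolding sum.distrib[symmetric] sum_distrib_left by (intro sum.cong refl) (simp add: field_simps)
  also have "\<dots> \<le> (\<Sum>s\<in>I. (a s)\<^sup>2 * (2 * suminf \<kappa>))"
    by (intro sum_mono mult_left_mono row) simp
  finally show ?thesis by (simp add: sum_distrib_right)
qed

lemma integral_square_sum:
  fixes f :: "'i \<Rightarrow> 'a \<Rightarrow> real"
  assumes "\<And>i j. i \<in> I \<Longrightarrow> j \<in> I \<Longrightarrow> integrable M (\<lambda>x. f i x * f j x)"
  shows "integrable M (\<lambda>x. (\<Sum>i\<in>I. a i * f i x)\<^sup>2)"
    and "(\<integral>x. (\<Sum>i\<in>I. a i * f i x)\<^sup>2 \<partial>M) = (\<Sum>i\<in>I. \<Sum>j\<in>I. a i * a j * (\<integral>x. f i x * f j x \<partial>M))"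
proof -
  have eq: "(\<Sum>i\<in>I. a i * f i x)\<^sup>2 = (\<Sum>i\<in>I. \<Sum>j\<in>I. a i * a j * (f i x * f j x))" for x
    unfolding power2_eq_square sum_product by (intro sum.cong refl) (simp add: mult_ac)
  show "integrable M (\<lambda>x. (\<Sum>i\<in>I. a i * f i x)\<^sup>2)"
    unfolding eq by (intro Bochner_Integration.integrable_sum integrable_mult_right assms)
  have "(\<integral>x. (\<Sum>i\<in>I. a i * f i x)\<^sup>2 \<partial>M) = (\<Sum>i\<in>I. \<integral>x. (\<Sum>j\<in>I. a i * a j * (f i x * f j x)) \<partial>M)"
    unfolding eq by (intro Bochner_Integration.integral_sum Bochner_Integration.integrable_sum integrable_mult_right assms)
  also have "\<dots> = (\<Sum>i\<in>I. \<Sum>j\<in>I. \<integral>x. a i * a j * (f i x * f j x) \<partial>M)"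
    by (intro sum.cong refl Bochner_Integration.integral_sum integrable_mult_right assms)
  finally show "(\<integral>x. (\<Sum>i\<in>I. a i * f i x)\<^sup>2 \<partial>M) = (\<Sum>i\<in>I. \<Sum>j\<in>I. a i * a j * (\<integral>x. f i x * f j x \<partial>M))"
    by simp
qed

lemma clip_approximation:
  fixes G :: "'a \<Rightarrow> real"
  assumes [measurable]: "G \<in> borel_measurable M" and int: "integrable M (\<lambda>x. (G x)\<^sup>2)" and "0 < e"
  shows "\<exists>n::nat. (\<integral>x. (G x - max (- real n) (min (real n) (G x)))\<^sup>2 \<partial>M) < e"
proof -
  have "(\<lambda>n. \<integral>x. (G x - max (- real n) (min (real n) (G x)))\<^sup>2 \<partial>M) \<longlonglongrightarrow> (\<integral>x. 0 \<partial>M)"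
  proof (rule integral_dominated_convergence[OF _ _ int])
    show "AE x in M. (\<lambda>n. (G x - max (- real n) (min (real n) (G x)))\<^sup>2) \<longlonglongrightarrow> 0"
    proof (rule AE_I2)
      fix x
      obtain N where N: "\<bar>G x\<bar> \<le> real N" using real_arch_simple by blast
      have "(G x - max (- real n) (min (real n) (G x)))\<^sup>2 = 0" if "n \<ge> N" for n
        using N that by (auto simp: max_def min_def)
      then show "(\<lambda>n. (G x - max (- real n) (min (real n) (G x)))\<^sup>2) \<longlonglongrightarrow> 0"
        by (intro tendsto_eventually eventually_sequentiallyI[of N])
    qed
    show "AE x in M. norm ((G x - max (- real n) (min (real n) (G x)))\<^sup>2) \<le> (G x)\<^sup>2" for n
      by (rule AE_I2) (auto simp: abs_le_square_iff[symmetric] max_def min_def)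
  qed simp_all
  then have "\<forall>\<^sub>F n in sequentially. (\<integral>x. (G x - max (- real n) (min (real n) (G x)))\<^sup>2 \<partial>M) < e"
    using \<open>0 < e\<close> by (auto intro: order_tendstoD)
  then show ?thesis by (rule eventually_happens'[OF sequentially_bot])
qed

lemma abs_exp_minus_diff_le:
  fixes a b :: real
  assumes "0 \<le> a" "0 \<le> b"
  shows "\<bar>exp (- a) - exp (- b)\<bar> \<le> \<bar>a - b\<bar>"
  using abs_exp_diff_le[of a b] abs_exp_diff_le[of b a] assms by (cases "a \<le> b") (auto simp: abs_minus_commute)

text \<open>Otherwise \<open>d\<close> would eventually dominate a multiple of the harmonic series.\<close>

lemma summable_imp_small_square:
  fixes d :: "nat \<Rightarrow> real"
  assumes "summable d" "\<And>r. 0 \<le> d r" "0 < e"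
  shows "\<exists>m\<ge>1. real m * (d m)\<^sup>2 \<le> e"
proof (rule ccontr)
  assume "\<not> ?thesis"
  then have gt: "e < real m * (d m)\<^sup>2" if "m \<ge> 1" for m using that by force
  have le: "sqrt e / real m \<le> d m" if "m \<ge> 1" for m
  proof -
    have "1 * (real m * (d m)\<^sup>2) \<le> real m * (real m * (d m)\<^sup>2)"
      using that by (intro mult_right_mono) auto
    then have "e \<le> real m * (real m * (d m)\<^sup>2)"
      using gt[OF that] by linarith
    then have "sqrt e \<le> sqrt ((real m * d m)\<^sup>2)"
      by (intro real_sqrt_le_mono) (simp add: power2_eq_square mult_ac)
    also have "sqrt ((real m * d m)\<^sup>2) = real m * d m"
      by (subst real_sqrt_abs) (use assms(2)[of m] in simp)
    finally show ?thesis using that by (simp add: field_simps)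
  qed
  have "summable (\<lambda>m. sqrt e / real m)"
    by (rule summable_comparison_test'[OF assms(1), of 1]) (use le \<open>0 < e\<close> in auto)
  then have "summable (\<lambda>m. inverse (sqrt e) * (sqrt e / real m))"
    by (rule summable_mult)
  then have "summable (\<lambda>m. inverse (real m))"
    using \<open>0 < e\<close> by (simp add: field_simps)
  then show False using not_summable_harmonic[where 'a = real] by simp
qed

context bernoulli_shift
begin

context
  fixes F :: "(nat \<Rightarrow> 's) \<Rightarrow> real"
  assumes F [measurable]: "F \<in> borel_measurable SQ" and int: "integrable P (\<lambda>x. (F x)\<^sup>2)"
    and mean: "(\<integral>x. F x \<partial>P) = 0"
    and sm: "summable (\<lambda>r. sqrt (\<integral>x. (F x - trunc r F x)\<^sup>2 \<partial>P))"
begin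

text \<open>Clipping acts pointwise on \<open>trunc m F\<close>, so it keeps the finite range while
  making the function bounded. The factor \<open>m\<close> in the last bound answers to the first
  \<open>m\<close> lags in \<open>variance_remainder_le\<close>, where there is no decay.\<close>

lemma bounded_finite_range_approximation:
  assumes "0 < e"
  obtains m g c where "m \<ge> 1" "g \<in> borel_measurable SQ" "\<And>x. \<bar>g x\<bar> \<le> c" "(\<integral>x. g x \<partial>P) = 0"
    "\<And>x z. g (merge_at m x z) = g x" "integrable P (\<lambda>x. (F x - g x)\<^sup>2)"
    "real m * (\<integral>x. (F x - g x)\<^sup>2 \<partial>P) \<le> e"
proof -
  interpret P: prob_space P by (rule prob_space_P)
  \<comment> \<open>\<open>m\<close> is fixed before the clipping level because the clipping error
    gets multiplied by \<open>m\<close>. The quarters leave room for the factor 2 of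
    \<open>square_add_le\<close>.\<close>
  obtain m where m: "m \<ge> 1" "real m * (\<integral>x. (F x - trunc m F x)\<^sup>2 \<partial>P) \<le> e / 4"
    using summable_imp_small_square[OF sm, of "e / 4"] \<open>0 < e\<close> by auto
  define G where "G = trunc m F"
  have [measurable]: "G \<in> borel_measurable SQ" by (simp add: G_def)
  have G: "integrable P (\<lambda>x. (G x)\<^sup>2)" "integrable P (\<lambda>x. (F x - G x)\<^sup>2)" "(\<integral>x. G x \<partial>P) = 0"
    using integrable_trunc_square[OF F int] integrable_trunc_diff[OF F int] integral_trunc[OF F int] mean
    by (simp_all add: G_def)
  obtain n :: nat where n: "(\<integral>x. (G x - max (- real n) (min (real n) (G x)))\<^sup>2 \<partial>P) < e / (4 * real m)"
    using clip_approximation[OF _ G(1), of "e / (4 * real m)"] \<open>0 < e\<close> m(1) by auto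
  define q where "q x = max (- real n) (min (real n) (G x))" for x
  have [measurable]: "q \<in> borel_measurable SQ" unfolding q_def by measurable
  have q: "\<bar>q x\<bar> \<le> real n" for x by (auto simp: q_def max_def min_def)
  have iq: "integrable P q" by (rule P.integrable_const_bound[of _ "real n"]) (use q in auto)
  have iq2: "integrable P (\<lambda>x. (q x)\<^sup>2)"
    by (rule P.integrable_const_bound[of _ "(real n)\<^sup>2"]) (use q in \<open>auto simp: abs_le_square_iff[symmetric]\<close>)
  have iG: "integrable P G" by (rule P.square_integrable_imp_integrable[OF _ G(1)]) simp
  define \<mu> where "\<mu> = (\<integral>x. q x \<partial>P)"
  define g where "g x = q x - \<mu>" for x
  have [measurable]: "g \<in> borel_measurable SQ" unfolding g_def by measurable
  have iGq: "integrable P (\<lambda>x. (G x - q x)\<^sup>2)"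
    by (rule integrable_square_diff) (use G(1) iq2 in simp_all)
  have "integrable P (\<lambda>x. (q x - \<mu>)\<^sup>2)"
    using iq iq2 by (simp add: power2_diff P.prob_space[simplified])
  then have ig2: "integrable P (\<lambda>x. (g x)\<^sup>2)" by (simp add: g_def)
  have iGg: "integrable P (\<lambda>x. (G x - g x)\<^sup>2)"
    by (rule integrable_square_diff) (use G(1) ig2 in simp_all)
  \<comment> \<open>\<open>G\<close> is centred, so \<open>G - g\<close> is \<open>G - q\<close>
    minus its mean; centring can only lower the second moment.\<close>
  have Gg: "(\<integral>x. (G x - g x)\<^sup>2 \<partial>P) \<le> (\<integral>x. (G x - q x)\<^sup>2 \<partial>P)"
  proof -
    have i: "integrable P (\<lambda>x. G x - q x)" using iG iq by simp
    have E: "(\<integral>x. G x - q x \<partial>P) = - \<mu>" using iG iq G(3) by (simp add: \<mu>_def)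
    have "(\<integral>x. ((G x - q x) - (\<integral>x. G x - q x \<partial>P))\<^sup>2 \<partial>P) = (\<integral>x. (G x - q x)\<^sup>2 \<partial>P) - (\<integral>x. G x - q x \<partial>P)\<^sup>2"
      by (rule P.variance_eq[OF i iGq])
    then have "(\<integral>x. ((G x - q x) + \<mu>)\<^sup>2 \<partial>P) \<le> (\<integral>x. (G x - q x)\<^sup>2 \<partial>P)"
      unfolding E by simp
    moreover have "(G x - q x) + \<mu> = G x - g x" for x by (simp add: g_def)
    ultimately show ?thesis by simp
  qed
  show ?thesis
  proof
    show "m \<ge> 1" by (rule m(1))
    show "g \<in> borel_measurable SQ" by simp
    show "\<bar>g x\<bar> \<le> real n + \<bar>\<mu>\<bar>" for x
      using q[of x] by (simp add: g_def)
    show "(\<integral>x. g x \<partial>P) = 0"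
      using iq by (simp add: g_def \<mu>_def P.prob_space[simplified])
    show "g (merge_at m x z) = g x" for x z by (simp add: g_def q_def G_def)
    have eq: "F x - g x = (F x - G x) + (G x - g x)" for x by simp
    show iFg: "integrable P (\<lambda>x. (F x - g x)\<^sup>2)"
      unfolding eq by (rule integrable_square_add) (use G(2) iGg in simp_all)
    have "(\<integral>x. (F x - g x)\<^sup>2 \<partial>P) \<le> (\<integral>x. 2 * (F x - G x)\<^sup>2 + 2 * (G x - g x)\<^sup>2 \<partial>P)"
    proof (rule integral_mono[OF iFg])
      show "(F x - g x)\<^sup>2 \<le> 2 * (F x - G x)\<^sup>2 + 2 * (G x - g x)\<^sup>2" for x
        unfolding eq by (rule square_add_le)
    qed (use G(2) iGg in simp)
    also have "\<dots> = 2 * (\<integral>x. (F x - G x)\<^sup>2 \<partial>P) + 2 * (\<integral>x. (G x - g x)\<^sup>2 \<partial>P)"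
      using G(2) iGg by simp
    also have "\<dots> \<le> 2 * (\<integral>x. (F x - G x)\<^sup>2 \<partial>P) + 2 * (e / (4 * real m))"
      using Gg n unfolding q_def by simp
    finally have "real m * (\<integral>x. (F x - g x)\<^sup>2 \<partial>P)
        \<le> real m * (2 * (\<integral>x. (F x - G x)\<^sup>2 \<partial>P) + 2 * (e / (4 * real m)))"
      by (rule mult_left_mono) simp
    also have "\<dots> = 2 * (real m * (\<integral>x. (F x - G x)\<^sup>2 \<partial>P)) + e / 2"
      using m(1) by (simp add: field_simps)
    also have "\<dots> \<le> e" using m(2) by (simp add: G_def)
    finally show "real m * (\<integral>x. (F x - g x)\<^sup>2 \<partial>P) \<le> e" .
  qed
qed

text \<open>By \<open>dep_orthogonal\<close> the covariance at lag \<open>r\<close> is at most the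
  L2 norm of \<open>F\<close> times its r-th coefficient; Schur's test sums these bounds.\<close>

lemma variance_sum_le:
  assumes "finite I"
  shows "integrable M (\<lambda>\<omega>. (\<Sum>i\<in>I. a i * F (past (int i) \<omega>))\<^sup>2)"
    and "(\<integral>\<omega>. (\<Sum>i\<in>I. a i * F (past (int i) \<omega>))\<^sup>2 \<partial>M)
      \<le> (\<Sum>i\<in>I. (a i)\<^sup>2) * (2 * (sqrt (\<integral>x. (F x)\<^sup>2 \<partial>P) * (\<Sum>r. sqrt (\<integral>x. (F x - trunc r F x)\<^sup>2 \<partial>P))))"
proof -
  have sq: "integrable M (\<lambda>\<omega>. (F (past t \<omega>))\<^sup>2)" "(\<integral>\<omega>. (F (past t \<omega>))\<^sup>2 \<partial>M) = (\<integral>x. (F x)\<^sup>2 \<partial>P)" for t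
    using integrable_past[of "\<lambda>x. (F x)\<^sup>2" t] integral_past[of "\<lambda>x. (F x)\<^sup>2" t] int by simp_all
  have i: "integrable M (\<lambda>\<omega>. F (past (int i) \<omega>) * F (past (int j) \<omega>))" for i j
    by (rule integrable_mult_of_squares) (use sq in simp_all)
  show "integrable M (\<lambda>\<omega>. (\<Sum>i\<in>I. a i * F (past (int i) \<omega>))\<^sup>2)"
    by (rule integral_square_sum(1)) (rule i)
  have "\<bar>\<Sum>s\<in>I. \<Sum>t\<in>I. a s * a t * (\<integral>\<omega>. F (past (int s) \<omega>) * F (past (int t) \<omega>) \<partial>M)\<bar>
    \<le> (\<Sum>i\<in>I. (a i)\<^sup>2) * (2 * (\<Sum>r. sqrt (\<integral>x. (F x)\<^sup>2 \<partial>P) * sqrt (\<integral>x. (F x - trunc r F x)\<^sup>2 \<partial>P)))"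
  proof (rule quadratic_form_bound[OF assms])
    fix s t :: nat assume "s \<le> t"
    then have t: "int t = int s + int (t - s)" by simp
    show "\<bar>\<integral>\<omega>. F (past (int s) \<omega>) * F (past (int t) \<omega>) \<partial>M\<bar>
        \<le> sqrt (\<integral>x. (F x)\<^sup>2 \<partial>P) * sqrt (\<integral>x. (F x - trunc (t - s) F x)\<^sup>2 \<partial>P)"
      using dep_orthogonal(2)[OF dep_past[OF F, of "int s"] sq(1) F int mean t] by (simp add: sq(2))
  qed (simp_all add: mult.commute sm)
  also have "(\<Sum>r. sqrt (\<integral>x. (F x)\<^sup>2 \<partial>P) * sqrt (\<integral>x. (F x - trunc r F x)\<^sup>2 \<partial>P))
      = sqrt (\<integral>x. (F x)\<^sup>2 \<partial>P) * (\<Sum>r. sqrt (\<integral>x. (F x - trunc r F x)\<^sup>2 \<partial>P))"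
    by (rule suminf_mult[OF sm])
  finally show "(\<integral>\<omega>. (\<Sum>i\<in>I. a i * F (past (int i) \<omega>))\<^sup>2 \<partial>M)
      \<le> (\<Sum>i\<in>I. (a i)\<^sup>2) * (2 * (sqrt (\<integral>x. (F x)\<^sup>2 \<partial>P) * (\<Sum>r. sqrt (\<integral>x. (F x - trunc r F x)\<^sup>2 \<partial>P))))"
    unfolding integral_square_sum(2)[OF i] by linarith
qed

text \<open>Let H = F - g. For lags below \<open>m\<close> Cauchy-Schwarz is used. From lag
  \<open>m\<close> on, \<open>g\<close> at the later time is independent of \<open>H\<close> at the
  earlier one, so only \<open>F\<close> remains at the later time and \<open>dep_orthogonal\<close>
  applies. Thus the coefficients of \<open>F\<close> alone enter, and those of the clipped function
  never have to be estimated.\<close>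

lemma variance_remainder_le:
  assumes g [measurable]: "g \<in> borel_measurable SQ" and g2: "integrable P (\<lambda>x. (F x - g x)\<^sup>2)"
    and g_mean: "(\<integral>x. g x \<partial>P) = 0" and g_range: "\<And>x z. g (merge_at m x z) = g x" and fin: "finite I"
  shows "integrable M (\<lambda>\<omega>. (\<Sum>i\<in>I. a i * (F (past (int i) \<omega>) - g (past (int i) \<omega>)))\<^sup>2)"
    and "(\<integral>\<omega>. (\<Sum>i\<in>I. a i * (F (past (int i) \<omega>) - g (past (int i) \<omega>)))\<^sup>2 \<partial>M)
      \<le> (\<Sum>i\<in>I. (a i)\<^sup>2) * (2 * (real m * (\<integral>x. (F x - g x)\<^sup>2 \<partial>P)
        + sqrt (\<integral>x. (F x - g x)\<^sup>2 \<partial>P) * (\<Sum>r. sqrt (\<integral>x. (F x - trunc r F x)\<^sup>2 \<partial>P))))"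
proof -
  interpret P: prob_space P by (rule prob_space_P)
  define H where "H x = F x - g x" for x
  define d where "d r = sqrt (\<integral>x. (F x - trunc r F x)\<^sup>2 \<partial>P)" for r
  define h where "h = sqrt (\<integral>x. (H x)\<^sup>2 \<partial>P)"
  have hh: "h * h = (\<integral>x. (H x)\<^sup>2 \<partial>P)" by (simp add: h_def)
  have hs: "sqrt (h * h) = h" by (simp add: h_def)
  have h0: "0 \<le> h" "\<And>r. 0 \<le> d r" by (simp_all add: h_def d_def)
  have [measurable]: "H \<in> borel_measurable SQ" unfolding H_def by measurable
  have sq: "integrable M (\<lambda>\<omega>. (H (past t \<omega>))\<^sup>2)" "(\<integral>\<omega>. (H (past t \<omega>))\<^sup>2 \<partial>M) = (\<integral>x. (H x)\<^sup>2 \<partial>P)" for t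
    using integrable_past[of "\<lambda>x. (H x)\<^sup>2" t] integral_past[of "\<lambda>x. (H x)\<^sup>2" t] g2 by (simp_all add: H_def)
  have sqF: "integrable M (\<lambda>\<omega>. (F (past t \<omega>))\<^sup>2)" for t
    using integrable_past[of "\<lambda>x. (F x)\<^sup>2" t] int by simp
  have gFH: "g x = F x - H x" for x by (simp add: H_def)
  have ig2: "integrable P (\<lambda>x. (g x)\<^sup>2)"
    unfolding gFH by (rule integrable_square_diff) (use int g2 in \<open>simp_all add: H_def\<close>)
  have ig: "integrable P g" by (rule P.square_integrable_imp_integrable[OF _ ig2]) simp
  have sqg: "integrable M (\<lambda>\<omega>. (g (past t \<omega>))\<^sup>2)" for t
    using integrable_past[of "\<lambda>x. (g x)\<^sup>2" t] ig2 by simp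
  have i: "integrable M (\<lambda>\<omega>. H (past (int i) \<omega>) * H (past (int j) \<omega>))" for i j
    by (rule integrable_mult_of_squares) (use sq in simp_all)
  show "integrable M (\<lambda>\<omega>. (\<Sum>i\<in>I. a i * (F (past (int i) \<omega>) - g (past (int i) \<omega>)))\<^sup>2)"
    unfolding H_def[symmetric] by (rule integral_square_sum(1)) (rule i)
  define \<kappa> where "\<kappa> r = (if r < m then h * h else h * d r)" for r
  \<comment> \<open>A majorant of \<kappa> whose sum is explicit.\<close>
  define \<kappa>' where "\<kappa>' r = (if r < m then h * h else 0) + h * d r" for r
  have fin_sum: "(\<lambda>r. if r < m then h * h else 0) sums (real m * (h * h))"
    using sums_If_finite_set[of "{..<m}" "\<lambda>_. h * h"] by simp
  have \<kappa>': "\<kappa>' sums (real m * (h * h) + h * suminf d)"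
    unfolding \<kappa>'_def using fin_sum sm by (intro sums_add sums_mult summable_sums) (simp_all add: d_def)
  have \<kappa>\<kappa>': "\<kappa> r \<le> \<kappa>' r" "0 \<le> \<kappa> r" for r using h0 by (simp_all add: \<kappa>_def \<kappa>'_def)
  have sm\<kappa>: "summable \<kappa>"
    by (rule summable_comparison_test'[OF sums_summable[OF \<kappa>'], of 0]) (use \<kappa>\<kappa>' in auto)
  have "suminf \<kappa> \<le> suminf \<kappa>'"
    by (rule suminf_le[OF \<kappa>\<kappa>'(1) sm\<kappa> sums_summable[OF \<kappa>']])
  then have \<kappa>_le: "suminf \<kappa> \<le> real m * (h * h) + h * suminf d"
    using sums_unique[OF \<kappa>'] by simp
  have "\<bar>\<Sum>s\<in>I. \<Sum>t\<in>I. a s * a t * (\<integral>\<omega>. H (past (int s) \<omega>) * H (past (int t) \<omega>) \<partial>M)\<bar>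
    \<le> (\<Sum>i\<in>I. (a i)\<^sup>2) * (2 * suminf \<kappa>)"
  proof (rule quadratic_form_bound[OF fin _ _ \<kappa>\<kappa>'(2) sm\<kappa>])
    fix s t :: nat assume st: "s \<le> t"
    show "\<bar>\<integral>\<omega>. H (past (int s) \<omega>) * H (past (int t) \<omega>) \<partial>M\<bar> \<le> \<kappa> (t - s)"
    proof (cases "t - s < m")
      case True
      then show ?thesis
        using integral_Cauchy_Schwarz[OF _ sq(1)[of "int s"] _ sq(1)[of "int t"]]
        by (simp add: \<kappa>_def h_def sq(2))
    next
      case False
      have t: "int t = int s + int (t - s)" using st by simp
      have dH: "dep {..int s} (\<lambda>\<omega>. H (past (int s) \<omega>))" by (rule dep_past) simp
      have "indep_var borel (\<lambda>\<omega>. H (past (int s) \<omega>)) borel (\<lambda>\<omega>. g (past (int t) \<omega>))"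
        by (rule dep_indep[OF dH dep_recent[OF g g_range]]) (use False in auto)
      moreover have "integrable M (\<lambda>\<omega>. H (past (int s) \<omega>))"
        by (rule square_integrable_imp_integrable[OF _ sq(1)]) simp
      moreover have "integrable M (\<lambda>\<omega>. g (past (int t) \<omega>))"
        by (rule square_integrable_imp_integrable[OF _ sqg]) simp
      ultimately have "(\<integral>\<omega>. H (past (int s) \<omega>) * g (past (int t) \<omega>) \<partial>M) = 0"
        using integral_past[OF g, of "int t"] g_mean by (simp add: indep_var_lebesgue_integral)
      moreover have "integrable M (\<lambda>\<omega>. H (past (int s) \<omega>) * g (past (int t) \<omega>))"
        "integrable M (\<lambda>\<omega>. H (past (int s) \<omega>) * F (past (int t) \<omega>))"
        by (rule integrable_mult_of_squares; use sq sqg sqF in simp)+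
      ultimately have "(\<integral>\<omega>. H (past (int s) \<omega>) * H (past (int t) \<omega>) \<partial>M) = (\<integral>\<omega>. H (past (int s) \<omega>) * F (past (int t) \<omega>) \<partial>M)"
        by (simp add: H_def[of "past (int t) _"] right_diff_distrib)
      also have "\<bar>\<dots>\<bar> \<le> h * d (t - s)"
        using dep_orthogonal(2)[OF dH sq(1) F int mean t] by (simp add: sq(2) h_def d_def)
      finally show ?thesis using False by (simp add: \<kappa>_def)
    qed
  qed (simp add: mult.commute)
  also have "\<dots> \<le> (\<Sum>i\<in>I. (a i)\<^sup>2) * (2 * (real m * (h * h) + h * suminf d))"
    by (intro mult_left_mono \<kappa>_le sum_nonneg) simp_all
  finally show "(\<integral>\<omega>. (\<Sum>i\<in>I. a i * (F (past (int i) \<omega>) - g (past (int i) \<omega>)))\<^sup>2 \<partial>M)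
      \<le> (\<Sum>i\<in>I. (a i)\<^sup>2) * (2 * (real m * (\<integral>x. (F x - g x)\<^sup>2 \<partial>P)
        + sqrt (\<integral>x. (F x - g x)\<^sup>2 \<partial>P) * (\<Sum>r. sqrt (\<integral>x. (F x - trunc r F x)\<^sup>2 \<partial>P))))"
    unfolding H_def[symmetric] integral_square_sum(2)[OF i] hh[symmetric] hs d_def[symmetric]
    by linarith
qed

end

text \<open>The summands are functions of windows of length \<open>m\<close>. Distance below
  \<open>m\<close> defines the neighbourhood \<open>A i\<close>. A product \<open>X i * X j\<close>
  with \<open>j\<close> in \<open>A i\<close> lives on innovations between i - 2m and i + m, which
  the radius 2m of \<open>B i\<close> separates from the remaining windows. So q = 4m, and 48 is 3
  times 16.\<close>

lemma stein_finite_range: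
  assumes g [measurable]: "g \<in> borel_measurable SQ" and bound: "\<And>x. \<bar>g x\<bar> \<le> c" and "(\<integral>x. g x \<partial>P) = 0"
    and range: "\<And>x z. g (merge_at m x z) = g x" and fin: "finite I" and \<alpha>: "\<And>i. i \<in> I \<Longrightarrow> \<bar>a i\<bar> \<le> \<alpha>"
  shows "cmod ((CLINT \<omega>|M. iexp (\<Sum>i\<in>I. a i * g (past (int i) \<omega>)))
      - of_real (exp (- (\<integral>\<omega>. (\<Sum>i\<in>I. a i * g (past (int i) \<omega>))\<^sup>2 \<partial>M) / 2)))
    \<le> (48 * (real m)\<^sup>2 * c ^ 3) * real (card I) * \<alpha> ^ 3"
proof (cases "I = {}")
  case True
  then show ?thesis by (simp add: prob_space)
next
  case False
  then have "0 \<le> \<alpha>" using \<alpha> by (metis abs_ge_zero all_not_in_conv order_trans)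
  have "0 \<le> c" by (rule order_trans[OF abs_ge_zero bound])
  \<comment> \<open>Set to 0 off \<open>I\<close>, since \<open>stein_char_bound\<close> asks for a
    bound at every index while \<alpha> bounds \<open>a\<close> only on \<open>I\<close>.\<close>
  define X where "X i \<omega> = (if i \<in> I then a i else 0) * g (past (int i) \<omega>)" for i \<omega>
  define A where "A i = {j\<in>I. \<bar>int i - int j\<bar> < int m}" for i
  define B where "B i = {j\<in>I. \<bar>int i - int j\<bar> < 2 * int m}" for i
  have [measurable]: "X i \<in> borel_measurable M" for i unfolding X_def[abs_def] by measurable
  have depX: "dep {int i - int m<..int i} (X i)" for i
    unfolding X_def by (rule dep_scale[OF dep_recent[OF g range]])
  have "cmod ((CLINT \<omega>|M. iexp (\<Sum>i\<in>I. X i \<omega>)) - of_real (exp (- (\<integral>\<omega>. (\<Sum>i\<in>I. X i \<omega>)\<^sup>2 \<partial>M) / 2)))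
    \<le> 3 * real (card I) * (4 * real m)\<^sup>2 * (\<alpha> * c) ^ 3"
  proof (rule stein_char_bound[where A = A and B = B])
    show "\<bar>X i \<omega>\<bar> \<le> \<alpha> * c" for i \<omega>
      unfolding X_def abs_mult by (rule mult_mono) (use \<alpha> bound \<open>0 \<le> \<alpha>\<close> in auto)
    show "expectation (X i) = 0" for i
      unfolding X_def using integral_past[OF g, of "int i"] assms(3) by simp
    show "real (card (B i)) \<le> 4 * real m" for i
    proof -
      have "card (B i) \<le> card {i - 2 * m..<i + 2 * m}"
        by (rule card_mono) (auto simp: B_def)
      also have "\<dots> \<le> 4 * m" by simp
      finally show ?thesis by linarith
    qed
    show "indep_var borel (X i) borel (\<lambda>\<omega>. \<Sum>j\<in>I - A i. X j \<omega>)" for i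
    proof (rule dep_indep[OF depX])
      show "dep {x. x \<le> int i - int m \<or> int i < x} (\<lambda>\<omega>. \<Sum>j\<in>I - A i. X j \<omega>)"
        by (rule dep_sum, rule dep_mono[OF depX]) (auto simp: A_def)
    qed auto
    show "indep_var borel (\<lambda>\<omega>. X i \<omega> * X j \<omega>) borel (\<lambda>\<omega>. \<Sum>k\<in>I - B i. X k \<omega>)" if "j \<in> A i" for i j
    proof (rule dep_indep)
      show "dep {int i - 2 * int m<..<int i + int m} (\<lambda>\<omega>. X i \<omega> * X j \<omega>)"
        by (intro dep_mult; rule dep_mono[OF depX]) (use that in \<open>auto simp: A_def\<close>)
      show "dep {x. x \<le> int i - 2 * int m \<or> int i + int m \<le> x} (\<lambda>\<omega>. \<Sum>k\<in>I - B i. X k \<omega>)"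
        by (rule dep_sum, rule dep_mono[OF depX]) (auto simp: B_def)
    qed auto
  qed (use fin in \<open>auto simp: A_def B_def\<close>)
  also have "3 * real (card I) * (4 * real m)\<^sup>2 * (\<alpha> * c) ^ 3 = (48 * (real m)\<^sup>2 * c ^ 3) * real (card I) * \<alpha> ^ 3"
    by (simp add: power_mult_distrib)
  finally show ?thesis by (simp add: X_def cong: sum.cong)
qed

text \<open>\<open>C\<close> is chosen after \<eta> but before the index set and the weights: it
  comes from the memory and the bound of the approximating \<open>g\<close>. This order lets the
  weights change with \<open>n\<close> while \<eta> stays fixed.\<close>

lemma clt_bound:
  assumes F [measurable]: "F \<in> borel_measurable SQ" and int: "integrable P (\<lambda>x. (F x)\<^sup>2)"
    and mean: "(\<integral>x. F x \<partial>P) = 0"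
    and sm: "summable (\<lambda>r. sqrt (\<integral>x. (F x - trunc r F x)\<^sup>2 \<partial>P))" and "0 < \<eta>"
  shows "\<exists>C. \<forall>I (a :: nat \<Rightarrow> real) \<alpha>. finite I \<longrightarrow> (\<forall>i\<in>I. \<bar>a i\<bar> \<le> \<alpha>) \<longrightarrow>
    cmod ((CLINT \<omega>|M. iexp (\<Sum>i\<in>I. a i * F (past (int i) \<omega>)))
      - of_real (exp (- (\<integral>\<omega>. (\<Sum>i\<in>I. a i * F (past (int i) \<omega>))\<^sup>2 \<partial>M) / 2)))
    \<le> \<eta> * (1 + (\<Sum>i\<in>I. (a i)\<^sup>2)) + C * real (card I) * \<alpha> ^ 3"
proof -
  interpret P: prob_space P by (rule prob_space_P)
  define D where "D = (\<Sum>r. sqrt (\<integral>x. (F x - trunc r F x)\<^sup>2 \<partial>P))"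
  define K where "K = 2 * (sqrt (\<integral>x. (F x)\<^sup>2 \<partial>P) * D)"
  have D: "0 \<le> D" unfolding D_def by (rule suminf_nonneg[OF sm]) simp
  have K: "0 \<le> K" unfolding K_def using D by simp
  \<comment> \<open>\<open>e1 e\<close> times the sum of squared weights bounds the variance of the
    remainder \<open>SH\<close> once \<open>m\<close> times the squared distance of \<open>F\<close>
    and \<open>g\<close> is at most \<open>e\<close>; it tends to 0 with \<open>e\<close>.\<close>
  define e1 where "e1 e = 2 * (e + sqrt e * D)" for e
  have "((\<lambda>e. sqrt (e1 e) + sqrt (e1 e) * sqrt K + e1 e / 2) \<longlongrightarrow> sqrt (e1 0) + sqrt (e1 0) * sqrt K + e1 0 / 2) (at_right 0)"
    unfolding e1_def by (intro tendsto_intros) simp_all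
  then have "\<forall>\<^sub>F e in at_right 0. sqrt (e1 e) + sqrt (e1 e) * sqrt K + e1 e / 2 < \<eta>"
    by (rule order_tendstoD) (use \<open>0 < \<eta>\<close> in \<open>simp add: e1_def\<close>)
  moreover have "\<forall>\<^sub>F e in at_right (0::real). 0 < e" by (rule eventually_at_right_less)
  ultimately have "\<forall>\<^sub>F e in at_right 0. 0 < e \<and> sqrt (e1 e) + sqrt (e1 e) * sqrt K + e1 e / 2 < \<eta>"
    by eventually_elim simp
  then obtain e where e: "0 < e" "sqrt (e1 e) + sqrt (e1 e) * sqrt K + e1 e / 2 < \<eta>"
    using eventually_happens'[OF trivial_limit_at_right_real] by blast
  obtain m g c where m: "m \<ge> 1" and g [measurable]: "g \<in> borel_measurable SQ" and bound: "\<And>x. \<bar>g x\<bar> \<le> c"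
    and g_mean: "(\<integral>x. g x \<partial>P) = 0" and g_range: "\<And>x z. g (merge_at m x z) = g x"
    and g2: "integrable P (\<lambda>x. (F x - g x)\<^sup>2)" and small: "real m * (\<integral>x. (F x - g x)\<^sup>2 \<partial>P) \<le> e"
    using bounded_finite_range_approximation[OF F int mean sm e(1)] by blast
  have "(\<integral>x. (F x - g x)\<^sup>2 \<partial>P) \<le> real m * (\<integral>x. (F x - g x)\<^sup>2 \<partial>P)"
    using mult_right_mono[of 1 "real m" "\<integral>x. (F x - g x)\<^sup>2 \<partial>P"] m by simp
  then have small': "sqrt (\<integral>x. (F x - g x)\<^sup>2 \<partial>P) \<le> sqrt e"
    using small by (intro real_sqrt_le_mono) linarith
  show ?thesis
  proof (intro exI[of _ "48 * (real m)\<^sup>2 * c ^ 3"] allI impI)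
    fix I :: "nat set" and a :: "nat \<Rightarrow> real" and \<alpha> assume fin: "finite I" and \<alpha>: "\<forall>i\<in>I. \<bar>a i\<bar> \<le> \<alpha>"
    define A where "A = (\<Sum>i\<in>I. (a i)\<^sup>2)"
    define SF where "SF \<omega> = (\<Sum>i\<in>I. a i * F (past (int i) \<omega>))" for \<omega>
    define Sg where "Sg \<omega> = (\<Sum>i\<in>I. a i * g (past (int i) \<omega>))" for \<omega>
    define SH where "SH \<omega> = (\<Sum>i\<in>I. a i * (F (past (int i) \<omega>) - g (past (int i) \<omega>)))" for \<omega>
    have A: "0 \<le> A" unfolding A_def by (simp add: sum_nonneg)
    have [measurable]: "SF \<in> borel_measurable M" "Sg \<in> borel_measurable M" "SH \<in> borel_measurable M"
      unfolding SF_def[abs_def] Sg_def[abs_def] SH_def[abs_def] by measurable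
    have SH: "SH \<omega> = SF \<omega> - Sg \<omega>" for \<omega>
      by (simp add: SH_def SF_def Sg_def right_diff_distrib sum_subtractf)
    have iF: "integrable M (\<lambda>\<omega>. (SF \<omega>)\<^sup>2)" and VF: "(\<integral>\<omega>. (SF \<omega>)\<^sup>2 \<partial>M) \<le> A * K"
      unfolding SF_def A_def K_def D_def by (rule variance_sum_le[OF F int mean sm fin])+
    have iH: "integrable M (\<lambda>\<omega>. (SH \<omega>)\<^sup>2)" and VH0: "(\<integral>\<omega>. (SH \<omega>)\<^sup>2 \<partial>M)
      \<le> A * (2 * (real m * (\<integral>x. (F x - g x)\<^sup>2 \<partial>P) + sqrt (\<integral>x. (F x - g x)\<^sup>2 \<partial>P) * D))"
      unfolding SH_def A_def D_def by (rule variance_remainder_le[OF F int mean sm g g2 g_mean g_range fin])+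
    have VH: "(\<integral>\<omega>. (SH \<omega>)\<^sup>2 \<partial>M) \<le> A * e1 e"
    proof (rule order_trans[OF VH0])
      show "A * (2 * (real m * (\<integral>x. (F x - g x)\<^sup>2 \<partial>P) + sqrt (\<integral>x. (F x - g x)\<^sup>2 \<partial>P) * D)) \<le> A * e1 e"
        unfolding e1_def using A D small small' by (intro mult_left_mono add_mono mult_right_mono) auto
    qed
    have e1: "0 \<le> e1 e" using e(1) D by (simp add: e1_def)
    have ig: "integrable M (\<lambda>\<omega>. (Sg \<omega>)\<^sup>2)"
    proof -
      have "Sg \<omega> = SF \<omega> - SH \<omega>" for \<omega> by (simp add: SH)
      then show ?thesis using integrable_square_diff[OF _ _ iF iH] by simp
    qed
    have iFH: "integrable M (\<lambda>\<omega>. SF \<omega> * SH \<omega>)" by (rule integrable_mult_of_squares) (use iF iH in simp_all)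
    have sqrtH: "sqrt (\<integral>\<omega>. (SH \<omega>)\<^sup>2 \<partial>M) \<le> sqrt A * sqrt (e1 e)"
      using VH by (simp add: real_sqrt_mult[symmetric])
    have sqrtF: "sqrt (\<integral>\<omega>. (SF \<omega>)\<^sup>2 \<partial>M) \<le> sqrt A * sqrt K"
      using VF by (simp add: real_sqrt_mult[symmetric])
    have sqrtA: "sqrt A \<le> 1 + A"
      using A by (intro real_le_lsqrt) (auto simp: power2_eq_square algebra_simps)
    have t1: "cmod ((CLINT \<omega>|M. iexp (SF \<omega>)) - (CLINT \<omega>|M. iexp (Sg \<omega>))) \<le> sqrt (e1 e) * (1 + A)"
    proof -
      have ii: "integrable M (\<lambda>\<omega>. iexp (SF \<omega>))" "integrable M (\<lambda>\<omega>. iexp (Sg \<omega>))"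
        by (rule integrable_const_bound[of _ 1]; simp)+
      have "cmod ((CLINT \<omega>|M. iexp (SF \<omega>)) - (CLINT \<omega>|M. iexp (Sg \<omega>))) = cmod (CLINT \<omega>|M. iexp (SF \<omega>) - iexp (Sg \<omega>))"
        using ii by simp
      also have "\<dots> \<le> (\<integral>\<omega>. cmod (iexp (SF \<omega>) - iexp (Sg \<omega>)) \<partial>M)" by (rule integral_norm_bound)
      also have "\<dots> \<le> (\<integral>\<omega>. \<bar>SH \<omega>\<bar> \<partial>M)"
      proof (rule integral_mono)
        show "integrable M (\<lambda>\<omega>. \<bar>SH \<omega>\<bar>)"
          using square_integrable_imp_integrable[OF _ iH] by simp
        show "cmod (iexp (SF \<omega>) - iexp (Sg \<omega>)) \<le> \<bar>SH \<omega>\<bar>" for \<omega>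
          unfolding SH by (rule cmod_iexp_diff_le)
      qed (use ii in simp)
      also have "\<dots> \<le> sqrt (\<integral>\<omega>. (SH \<omega>)\<^sup>2 \<partial>M)"
        by (rule expectation_le_sqrt[OF prob_space_axioms _ iH]) simp
      also have "\<dots> \<le> sqrt A * sqrt (e1 e)" by (rule sqrtH)
      also have "\<dots> \<le> (1 + A) * sqrt (e1 e)" using sqrtA e1 by (intro mult_right_mono) auto
      finally show ?thesis by (simp add: mult.commute)
    qed
    have t2: "cmod (of_real (exp (- (\<integral>\<omega>. (SF \<omega>)\<^sup>2 \<partial>M) / 2)) - of_real (exp (- (\<integral>\<omega>. (Sg \<omega>)\<^sup>2 \<partial>M) / 2)))
        \<le> (sqrt (e1 e) * sqrt K + e1 e / 2) * (1 + A)"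
    proof -
      let ?VF = "\<integral>\<omega>. (SF \<omega>)\<^sup>2 \<partial>M" and ?Vg = "\<integral>\<omega>. (Sg \<omega>)\<^sup>2 \<partial>M" and ?VH = "\<integral>\<omega>. (SH \<omega>)\<^sup>2 \<partial>M"
      have "(Sg \<omega>)\<^sup>2 = (SF \<omega>)\<^sup>2 - 2 * (SF \<omega> * SH \<omega>) + (SH \<omega>)\<^sup>2" for \<omega>
        by (simp add: SH power2_eq_square algebra_simps)
      then have "?Vg = ?VF - 2 * (\<integral>\<omega>. SF \<omega> * SH \<omega> \<partial>M) + ?VH"
        using iF iH iFH by simp
      then have "\<bar>?VF - ?Vg\<bar> \<le> 2 * \<bar>\<integral>\<omega>. SF \<omega> * SH \<omega> \<partial>M\<bar> + ?VH"
        using zero_le_power2 by (smt (verit) Bochner_Integration.integral_nonneg)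
      also have "\<bar>\<integral>\<omega>. SF \<omega> * SH \<omega> \<partial>M\<bar> \<le> sqrt ?VF * sqrt ?VH"
        by (rule integral_Cauchy_Schwarz[OF _ iF _ iH]) simp_all
      also have "\<dots> \<le> (sqrt A * sqrt K) * (sqrt A * sqrt (e1 e))"
        by (intro mult_mono sqrtF sqrtH) (use A K in auto)
      also have "\<dots> = A * (sqrt (e1 e) * sqrt K)" using A by simp
      finally have "\<bar>?VF - ?Vg\<bar> \<le> 2 * (A * (sqrt (e1 e) * sqrt K)) + A * e1 e"
        using VH by simp
      moreover have "\<bar>exp (- (?VF / 2)) - exp (- (?Vg / 2))\<bar> \<le> \<bar>?VF / 2 - ?Vg / 2\<bar>"
        by (rule abs_exp_minus_diff_le) simp_all
      ultimately have "\<bar>exp (- (?VF / 2)) - exp (- (?Vg / 2))\<bar> \<le> A * (sqrt (e1 e) * sqrt K + e1 e / 2)"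
        by (simp add: field_simps)
      also have "\<dots> \<le> (1 + A) * (sqrt (e1 e) * sqrt K + e1 e / 2)"
        using e1 K by (intro mult_right_mono) auto
      finally show ?thesis
        by (simp only: of_real_diff[symmetric] norm_of_real mult.commute minus_divide_left)
    qed
    have t3: "cmod ((CLINT \<omega>|M. iexp (Sg \<omega>)) - of_real (exp (- (\<integral>\<omega>. (Sg \<omega>)\<^sup>2 \<partial>M) / 2)))
        \<le> (48 * (real m)\<^sup>2 * c ^ 3) * real (card I) * \<alpha> ^ 3"
      unfolding Sg_def by (rule stein_finite_range[OF g bound g_mean g_range fin]) (use \<alpha> in auto)
    let ?x = "CLINT \<omega>|M. iexp (SF \<omega>)" and ?y = "CLINT \<omega>|M. iexp (Sg \<omega>)"
      and ?u = "complex_of_real (exp (- (\<integral>\<omega>. (SF \<omega>)\<^sup>2 \<partial>M) / 2))" and ?v = "complex_of_real (exp (- (\<integral>\<omega>. (Sg \<omega>)\<^sup>2 \<partial>M) / 2))"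
    have "cmod (?x - ?u) \<le> cmod (?x - ?y) + cmod (?y - ?v) + cmod (?u - ?v)"
      using norm_triangle_ineq[of "?x - ?y" "?y - ?v"] norm_triangle_ineq4[of "?x - ?v" "?u - ?v"] by simp
    also have "\<dots> \<le> sqrt (e1 e) * (1 + A) + (48 * (real m)\<^sup>2 * c ^ 3) * real (card I) * \<alpha> ^ 3
        + (sqrt (e1 e) * sqrt K + e1 e / 2) * (1 + A)"
      by (intro add_mono t1 t2 t3)
    also have "\<dots> = (sqrt (e1 e) + sqrt (e1 e) * sqrt K + e1 e / 2) * (1 + A) + (48 * (real m)\<^sup>2 * c ^ 3) * real (card I) * \<alpha> ^ 3"
      by (simp add: algebra_simps)
    also have "\<dots> \<le> \<eta> * (1 + A) + (48 * (real m)\<^sup>2 * c ^ 3) * real (card I) * \<alpha> ^ 3"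
      using e(2) A by (intro add_right_mono mult_right_mono) auto
    finally show "cmod ((CLINT \<omega>|M. iexp (\<Sum>i\<in>I. a i * F (past (int i) \<omega>)))
      - of_real (exp (- (\<integral>\<omega>. (\<Sum>i\<in>I. a i * F (past (int i) \<omega>))\<^sup>2 \<partial>M) / 2)))
      \<le> \<eta> * (1 + (\<Sum>i\<in>I. (a i)\<^sup>2)) + 48 * (real m)\<^sup>2 * c ^ 3 * real (card I) * \<alpha> ^ 3"
      by (simp add: SF_def A_def)
  qed
qed

end

section \<open>Kernel weights\<close>

lemma card_grid_le:
  fixes z w R :: real
  assumes "0 < w" "0 \<le> R"
  shows "real (card {t\<in>{1..T::nat}. \<bar>z - real t * w\<bar> \<le> R}) \<le> 2 * R / w + 1"
proof -
  let ?A = "{t\<in>{1..T}. \<bar>z - real t * w\<bar> \<le> R}"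
  have sub: "int ` ?A \<subseteq> {\<lceil>(z - R) / w\<rceil>..\<lfloor>(z + R) / w\<rfloor>}"
  proof clarify
    fix t assume "\<bar>z - real t * w\<bar> \<le> R"
    then have "(z - R) / w \<le> real t" "real t \<le> (z + R) / w"
      using \<open>0 < w\<close> by (auto simp: field_simps abs_le_iff)
    then show "int t \<in> {\<lceil>(z - R) / w\<rceil>..\<lfloor>(z + R) / w\<rfloor>}"
      by (auto simp: ceiling_le_iff le_floor_iff)
  qed
  have "card ?A = card (int ` ?A)" by (rule card_image[symmetric]) simp
  also have "\<dots> \<le> card {\<lceil>(z - R) / w\<rceil>..\<lfloor>(z + R) / w\<rfloor>}" by (rule card_mono[OF _ sub]) simp
  finally have "real (card ?A) \<le> real (nat (\<lfloor>(z + R) / w\<rfloor> + 1 - \<lceil>(z - R) / w\<rceil>))" by simp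
  also have "\<dots> \<le> max 0 ((z + R) / w + 1 - (z - R) / w)"
    by (smt (verit) of_nat_0_le_iff of_nat_nat of_int_add of_int_diff of_int_1 le_of_int_ceiling of_int_floor_le nat_0_iff of_nat_0)
  also have "\<dots> = 2 * R / w + 1"
    using assms by (simp add: field_simps max_def)
  finally show ?thesis .
qed

lemma lipschitz_continuous:
  fixes \<phi> :: "real \<Rightarrow> real"
  assumes "\<And>x y. \<bar>\<phi> x - \<phi> y\<bar> \<le> L * \<bar>x - y\<bar>"
  shows "continuous_on A \<phi>"
proof (rule lipschitz_on_continuous_on)
  have "\<bar>L\<bar>-lipschitz_on UNIV \<phi>"
  proof (rule lipschitz_onI)
    show "dist (\<phi> x) (\<phi> y) \<le> \<bar>L\<bar> * dist x y" for x y
      using order_trans[OF assms[of x y] mult_right_mono[OF abs_ge_self[of L]]] by (simp add: dist_real_def)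
  qed simp
  then show "\<bar>L\<bar>-lipschitz_on A \<phi>" by (rule lipschitz_on_subset) simp
qed

lemma lipschitz_compact_support_integrable:
  fixes \<phi> :: "real \<Rightarrow> real"
  assumes "\<And>x y. \<bar>\<phi> x - \<phi> y\<bar> \<le> L * \<bar>x - y\<bar>" "\<And>z. R < \<bar>z\<bar> \<Longrightarrow> \<phi> z = 0"
  shows "integrable lborel \<phi>"
proof -
  have "integrable lborel (\<lambda>x. indicator {- R..R} x *\<^sub>R \<phi> x)"
    by (rule borel_integrable_compact) (use lipschitz_continuous[OF assms(1)] in auto)
  moreover have "indicator {- R..R} x *\<^sub>R \<phi> x = \<phi> x" for x
    using assms(2)[of x] by (cases "R < \<bar>x\<bar>") (auto simp: indicator_def abs_le_iff not_less)
  then have "(\<lambda>x. indicator {- R..R} x *\<^sub>R \<phi> x) = \<phi>" by (rule ext)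
  ultimately show ?thesis by (simp only:)
qed

text \<open>The sum is compared with the integral cell by cell; the conditions on \<open>z\<close>
  make the cells cover the support. A cell contributes only if its node is within R + w of 0, there
  are at most 2 (R + w) / w + 1 such nodes, and each error is at most L w^2.\<close>

lemma riemann_sum_bound:
  fixes \<phi> :: "real \<Rightarrow> real"
  assumes lip: "\<And>x y. \<bar>\<phi> x - \<phi> y\<bar> \<le> L * \<bar>x - y\<bar>" and supp: "\<And>z. R < \<bar>z\<bar> \<Longrightarrow> \<phi> z = 0"
    and nonneg: "0 \<le> L" "0 \<le> R" and w: "0 < w" and z: "R \<le> z" "z - real T * w \<le> - R"
  shows "\<bar>w * (\<Sum>t=1..T. \<phi> (z - real t * w)) - (\<integral>x. \<phi> x \<partial>lborel)\<bar> \<le> L * w * (2 * R + 3 * w)"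
proof -
  have cont: "continuous_on A \<phi>" for A by (rule lipschitz_continuous[OF lip])
  have intg: "\<phi> integrable_on {a..b}" for a b
    by (rule integrable_continuous_interval[OF cont])
  define J where "J t = integral {z - real t * w..z - real t * w + w} \<phi>" for t :: nat
  have "integral {z - real n * w..z} \<phi> = (\<Sum>t=1..n. J t)" for n :: nat
  proof (induction n)
    case (Suc n)
    have "integral {z - real (Suc n) * w..z} \<phi>
        = integral {z - real (Suc n) * w..z - real n * w} \<phi> + integral {z - real n * w..z} \<phi>"
      by (rule Henstock_Kurzweil_Integration.integral_combine[symmetric]) (use w intg in \<open>auto simp: field_simps\<close>)
    also have "integral {z - real (Suc n) * w..z - real n * w} \<phi> = J (Suc n)"
    proof -
      have "z - real (Suc n) * w + w = z - real n * w" by (simp add: algebra_simps)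
      then show ?thesis unfolding J_def by (simp only:)
    qed
    finally show ?case using Suc by simp
  qed simp
  moreover have "(\<integral>x. \<phi> x \<partial>lborel) = integral {z - real T * w..z} \<phi>"
  proof -
    have "(\<integral>x. \<phi> x \<partial>lborel) = integral UNIV \<phi>"
      by (rule integral_lborel[symmetric]) (rule lipschitz_compact_support_integrable[OF lip supp])
    also have "\<dots> = integral UNIV (\<lambda>x. if x \<in> {z - real T * w..z} then \<phi> x else 0)"
      by (rule arg_cong[where f = "integral UNIV"]) (use supp z in \<open>auto simp: fun_eq_iff\<close>)
    also have "\<dots> = integral {z - real T * w..z} \<phi>"
      by (rule integral_restrict_UNIV)
    finally show ?thesis .
  qed
  ultimately have eq: "w * (\<Sum>t=1..T. \<phi> (z - real t * w)) - (\<integral>x. \<phi> x \<partial>lborel) = (\<Sum>t=1..T. w * \<phi> (z - real t * w) - J t)"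
    by (simp add: sum_subtractf sum_distrib_left)
  have piece: "\<bar>w * \<phi> (z - real t * w) - J t\<bar> \<le> (if \<bar>z - real t * w\<bar> \<le> R + w then L * w * w else 0)" for t
  proof -
    let ?x = "z - real t * w"
    have "w * \<phi> ?x = integral {?x..?x + w} (\<lambda>_. \<phi> ?x)" using w by simp
    then have eq: "w * \<phi> ?x - J t = integral {?x..?x + w} (\<lambda>y. \<phi> ?x - \<phi> y)"
      unfolding J_def by (subst Henstock_Kurzweil_Integration.integral_diff) (use intg in auto)
    show ?thesis
    proof (cases "\<bar>?x\<bar> \<le> R + w")
      case True
      have "norm (integral {?x..?x + w} (\<lambda>y. \<phi> ?x - \<phi> y)) \<le> (L * w) * (?x + w - ?x)"
      proof (rule integral_bound)
        show "continuous_on {?x..?x + w} (\<lambda>y. \<phi> ?x - \<phi> y)"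
          by (intro continuous_intros cont)
        fix y assume "y \<in> {?x..?x + w}"
        then have "L * \<bar>?x - y\<bar> \<le> L * w" using nonneg by (intro mult_left_mono) auto
        then show "norm (\<phi> ?x - \<phi> y) \<le> L * w" using lip[of ?x y] by simp
      qed (use w in simp)
      then show ?thesis using True by (simp add: eq)
    next
      case False
      have "integral {?x..?x + w} (\<lambda>y. \<phi> ?x - \<phi> y) = integral {?x..?x + w} (\<lambda>y. 0)"
        by (rule Henstock_Kurzweil_Integration.integral_cong) (use False supp w nonneg in auto)
      then show ?thesis using False by (simp add: eq)
    qed
  qed
  have "\<bar>\<Sum>t=1..T. w * \<phi> (z - real t * w) - J t\<bar> \<le> (\<Sum>t=1..T. if \<bar>z - real t * w\<bar> \<le> R + w then L * w * w else 0)"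
    by (rule order_trans[OF sum_abs sum_mono[OF piece]])
  also have "\<dots> = real (card {t\<in>{1..T}. \<bar>z - real t * w\<bar> \<le> R + w}) * (L * w * w)"
    by (subst sum.inter_filter[symmetric]) simp_all
  also have "\<dots> \<le> (2 * (R + w) / w + 1) * (L * w * w)"
    using card_grid_le[OF w, of "R + w" T z] nonneg w by (intro mult_right_mono) auto
  also have "\<dots> = L * w * (2 * R + 3 * w)"
    using w by (simp add: field_simps)
  finally show ?thesis unfolding eq .
qed

text \<open>\<open>w n\<close> is the mesh \<open>1 / (T h)\<close> of the grid of kernel arguments.\<close>

locale kernel_weights =
  fixes K :: "real \<Rightarrow> real" and L B R u :: real and T :: "nat \<Rightarrow> nat" and h :: "nat \<Rightarrow> real"
  assumes lip: "\<And>x y. \<bar>K x - K y\<bar> \<le> L * \<bar>x - y\<bar>" and bnd: "\<And>x. \<bar>K x\<bar> \<le> B"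
    and supp: "\<And>z. R < \<bar>z\<bar> \<Longrightarrow> K z = 0" and L: "0 \<le> L" and R: "0 \<le> R"
    and K_int: "(\<integral>z. K z \<partial>lborel) = 1"
    and u: "0 < u" "u < 1" and h: "\<And>n. 0 < h n" "h \<longlonglongrightarrow> 0"
    and Th: "filterlim (\<lambda>n. real (T n) * h n) at_top sequentially"
begin

definition w :: "nat \<Rightarrow> real" where "w n = 1 / (real (T n) * h n)"

text \<open>Standardised weights: the local mean divided by sqrt (w n) is the sum of the
  observations with these weights, and their squares sum to approximately the integral of
  K^2.\<close>

definition a :: "nat \<Rightarrow> nat \<Rightarrow> real" where "a n t = sqrt (w n) * K ((u - real t / real (T n)) / h n)"

lemma B: "0 \<le> B" by (rule order_trans[OF abs_ge_zero bnd])

lemma w_nonneg: "0 \<le> w n" using h(1)[of n] by (simp add: w_def)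

lemma w_tendsto: "w \<longlonglongrightarrow> 0"
  unfolding w_def by (rule real_tendsto_divide_at_top[OF tendsto_const Th])

lemma ev_T: "\<forall>\<^sub>F n in sequentially. 0 < T n \<and> 0 < w n \<and> w n \<le> 1"
proof -
  have "\<forall>\<^sub>F n in sequentially. 1 < real (T n) * h n"
    using Th by (auto simp: filterlim_at_top_dense)
  then show ?thesis
  proof eventually_elim
    case (elim n)
    then have "0 < T n" by (cases "T n = 0") auto
    with elim h(1)[of n] show ?case by (simp add: w_def field_simps)
  qed
qed

lemma grid: "0 < T n \<Longrightarrow> (u - real t / real (T n)) / h n = u / h n - real t * w n"
  using h(1)[of n] by (simp add: w_def diff_divide_distrib)

text \<open>The kernel arguments descend from near u / h to (u - 1) / h in steps of
  \<open>w n\<close>. As \<open>u\<close> is interior and h tends to 0, they eventually cover the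
  support [-R, R] on both sides.\<close>

lemma ev_range: "\<forall>\<^sub>F n in sequentially. 0 < T n \<and> 0 < w n \<and> w n \<le> 1 \<and> R \<le> u / h n \<and> u / h n - real (T n) * w n \<le> - R"
proof -
  have lim: "(\<lambda>n. R * h n) \<longlonglongrightarrow> R * 0" by (intro tendsto_intros h)
  have "\<forall>\<^sub>F n in sequentially. R * h n < u" "\<forall>\<^sub>F n in sequentially. R * h n < 1 - u"
    using order_tendstoD(2)[OF lim, of u] order_tendstoD(2)[OF lim, of "1 - u"] u by simp_all
  with ev_T show ?thesis
  proof eventually_elim
    case (elim n)
    have "real (T n) * w n = 1 / h n" using elim by (simp add: w_def)
    then show ?case using elim h(1)[of n] by (auto simp: field_simps)
  qed
qed

lemma riemann_bound:
  fixes \<phi> :: "real \<Rightarrow> real"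
  assumes "\<And>x y. \<bar>\<phi> x - \<phi> y\<bar> \<le> L' * \<bar>x - y\<bar>" "\<And>z. R < \<bar>z\<bar> \<Longrightarrow> \<phi> z = 0" "0 \<le> L'"
  shows "\<forall>\<^sub>F n in sequentially. \<bar>w n * (\<Sum>t=1..T n. \<phi> ((u - real t / real (T n)) / h n)) - (\<integral>x. \<phi> x \<partial>lborel)\<bar>
    \<le> L' * (2 * R + 3) * w n"
  using ev_range
proof eventually_elim
  case (elim n)
  have "\<bar>w n * (\<Sum>t=1..T n. \<phi> ((u - real t / real (T n)) / h n)) - (\<integral>x. \<phi> x \<partial>lborel)\<bar> \<le> L' * w n * (2 * R + 3 * w n)"
    using riemann_sum_bound[OF assms R, of "w n" "u / h n" "T n"] elim by (simp add: grid)
  also have "\<dots> \<le> L' * w n * (2 * R + 3 * 1)"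
    using elim assms(3) by (intro mult_left_mono add_left_mono) auto
  finally show ?case by (simp add: mult_ac)
qed

lemma riemann_tendsto:
  fixes \<phi> :: "real \<Rightarrow> real"
  assumes "\<And>x y. \<bar>\<phi> x - \<phi> y\<bar> \<le> L' * \<bar>x - y\<bar>" "\<And>z. R < \<bar>z\<bar> \<Longrightarrow> \<phi> z = 0" "0 \<le> L'"
  shows "(\<lambda>n. w n * (\<Sum>t=1..T n. \<phi> ((u - real t / real (T n)) / h n))) \<longlonglongrightarrow> (\<integral>x. \<phi> x \<partial>lborel)"
proof (rule LIM_zero_cancel, rule Lim_null_comparison)
  show "\<forall>\<^sub>F n in sequentially. norm (w n * (\<Sum>t=1..T n. \<phi> ((u - real t / real (T n)) / h n)) - (\<integral>x. \<phi> x \<partial>lborel))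
      \<le> L' * (2 * R + 3) * w n"
    using riemann_bound[OF assms] by simp
  show "(\<lambda>n. L' * (2 * R + 3) * w n) \<longlonglongrightarrow> 0"
    using tendsto_mult_left[OF w_tendsto, of "L' * (2 * R + 3)"] by simp
qed

definition support :: "nat \<Rightarrow> nat set" where "support n = {t\<in>{1..T n}. K ((u - real t / real (T n)) / h n) \<noteq> 0}"

lemma finite_support [simp]: "finite (support n)" by (simp add: support_def)

lemma sum_support:
  fixes f :: "nat \<Rightarrow> 'z::comm_monoid_add"
  assumes "\<And>t. K ((u - real t / real (T n)) / h n) = 0 \<Longrightarrow> f t = 0"
  shows "(\<Sum>t=1..T n. f t) = (\<Sum>t\<in>support n. f t)"
  by (rule sum.mono_neutral_right) (use assms in \<open>auto simp: support_def\<close>)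

lemma support_bound: "0 < T n \<Longrightarrow> t \<in> support n \<Longrightarrow> \<bar>u - real t / real (T n)\<bar> \<le> R * h n"
  using supp[of "(u - real t / real (T n)) / h n"] h(1)[of n]
  by (force simp: support_def not_less[symmetric] pos_less_divide_eq)

text \<open>There are at most order 1 / w nonzero weights, each of order sqrt w; this makes the
  cubic term of \<open>clt_bound\<close> of order sqrt w.\<close>

lemma card_support: "\<forall>\<^sub>F n in sequentially. real (card (support n)) * w n \<le> 2 * R + 1"
  using ev_T
proof eventually_elim
  case (elim n)
  have "card (support n) \<le> card {t\<in>{1..T n}. \<bar>u / h n - real t * w n\<bar> \<le> R}"
  proof (rule card_mono)
    show "support n \<subseteq> {t\<in>{1..T n}. \<bar>u / h n - real t * w n\<bar> \<le> R}"
      unfolding support_def using supp elim by (auto simp: grid not_less[symmetric])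
  qed simp
  then have "real (card (support n)) \<le> 2 * R / w n + 1"
    using card_grid_le[of "w n" R "T n" "u / h n"] R elim by linarith
  then have "real (card (support n)) * w n \<le> (2 * R / w n + 1) * w n"
    using elim by (intro mult_right_mono) auto
  also have "\<dots> = 2 * R + w n" using elim by (simp add: field_simps)
  finally show ?case using elim by linarith
qed

lemma abs_a_le: "\<bar>a n t\<bar> \<le> sqrt (w n) * B"
  unfolding a_def abs_mult using w_nonneg[of n] bnd by (intro mult_mono) auto

lemma square_lipschitz: "\<bar>(K x)\<^sup>2 - (K y)\<^sup>2\<bar> \<le> 2 * B * L * \<bar>x - y\<bar>"
proof -
  have "\<bar>(K x)\<^sup>2 - (K y)\<^sup>2\<bar> = \<bar>K x + K y\<bar> * \<bar>K x - K y\<bar>"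
    by (simp add: abs_mult[symmetric] power2_eq_square algebra_simps)
  also have "\<dots> \<le> (2 * B) * (L * \<bar>x - y\<bar>)"
    using bnd[of x] bnd[of y] lip[of x y] B by (intro mult_mono) auto
  finally show ?thesis by (simp add: mult_ac)
qed

lemma sum_a_square: "(\<lambda>n. \<Sum>t=1..T n. (a n t)\<^sup>2) \<longlonglongrightarrow> (\<integral>z. (K z)\<^sup>2 \<partial>lborel)"
proof -
  have "(\<Sum>t=1..T n. (a n t)\<^sup>2) = w n * (\<Sum>t=1..T n. (K ((u - real t / real (T n)) / h n))\<^sup>2)" for n
    using w_nonneg[of n] by (simp add: a_def power_mult_distrib sum_distrib_left)
  then show ?thesis
    using riemann_tendsto[of "\<lambda>z. (K z)\<^sup>2" "2 * B * L"] square_lipschitz supp B L by simp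
qed

text \<open>The autocorrelation of the weights.\<close>

definition lag :: "nat \<Rightarrow> nat \<Rightarrow> real"
  where "lag n r = (\<Sum>t\<in>{t\<in>{1..T n}. t + r \<le> T n}. a n t * a n (t + r))"

text \<open>A shift by \<open>r\<close> places moves the kernel argument by \<open>r * w n\<close>.
  By the Lipschitz condition each of the order 1 / w products changes by order w^2, and at most
  \<open>r\<close> products of order w fall off the end; so every fixed lag has the limit of lag
  0.\<close>

lemma lag_tendsto: "(\<lambda>n. lag n r) \<longlonglongrightarrow> (\<integral>z. (K z)\<^sup>2 \<partial>lborel)"
proof -
  have "(\<lambda>n. lag n r - (\<Sum>t=1..T n. (a n t)\<^sup>2)) \<longlonglongrightarrow> 0"
  proof (rule Lim_null_comparison)
    show "(\<lambda>n. ((2 * R + 1) * (B * L * real r) + real r * B\<^sup>2) * w n) \<longlonglongrightarrow> 0"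
      using tendsto_mult_left[OF w_tendsto] by fastforce
    show "\<forall>\<^sub>F n in sequentially. norm (lag n r - (\<Sum>t=1..T n. (a n t)\<^sup>2))
        \<le> ((2 * R + 1) * (B * L * real r) + real r * B\<^sup>2) * w n"
      using ev_T card_support
    proof eventually_elim
      case (elim n)
      let ?I = "{t\<in>{1..T n}. t + r \<le> T n}" and ?J = "{t\<in>{1..T n}. \<not> t + r \<le> T n}"
      define k where "k t = K ((u - real t / real (T n)) / h n)" for t
      have ak: "a n t = sqrt (w n) * k t" for t by (simp add: a_def k_def)
      have aa: "a n s * a n t = w n * (k s * k t)" for s t
        using w_nonneg[of n] by (simp add: ak mult_ac)
      have "(\<Sum>t=1..T n. (a n t)\<^sup>2) = (\<Sum>t\<in>?I. (a n t)\<^sup>2) + (\<Sum>t\<in>?J. (a n t)\<^sup>2)"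
        by (subst sum.union_disjoint[symmetric]) (auto intro: sum.cong)
      then have eq: "lag n r - (\<Sum>t=1..T n. (a n t)\<^sup>2) = (\<Sum>t\<in>?I. a n t * (a n (t + r) - a n t)) - (\<Sum>t\<in>?J. (a n t)\<^sup>2)"
        by (simp add: lag_def right_diff_distrib sum_subtractf power2_eq_square)
      have "\<bar>\<Sum>t\<in>?I. a n t * (a n (t + r) - a n t)\<bar> \<le> (\<Sum>t\<in>?I. if t \<in> support n then w n * (B * (L * (real r * w n))) else 0)"
      proof (rule order_trans[OF sum_abs sum_mono])
        fix t assume t: "t \<in> ?I"
        show "\<bar>a n t * (a n (t + r) - a n t)\<bar> \<le> (if t \<in> support n then w n * (B * (L * (real r * w n))) else 0)"
        proof (cases "t \<in> support n")
          case True
          have "\<bar>k (t + r) - k t\<bar> \<le> L * (real r * w n)"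
          proof -
            have "\<bar>(u / h n - real (t + r) * w n) - (u / h n - real t * w n)\<bar> = real r * w n"
              using w_nonneg[of n] by (simp add: algebra_simps abs_mult)
            then show ?thesis
              using lip[of "u / h n - real (t + r) * w n" "u / h n - real t * w n"] elim
              by (simp only: k_def grid)
          qed
          then have "\<bar>k t\<bar> * \<bar>k (t + r) - k t\<bar> \<le> B * (L * (real r * w n))"
            using bnd B by (intro mult_mono) (auto simp: k_def)
          moreover have "a n t * (a n (t + r) - a n t) = w n * (k t * (k (t + r) - k t))"
            using aa[of t "t + r"] aa[of t t] by (simp add: right_diff_distrib)
          ultimately show ?thesis using True w_nonneg[of n] by (simp add: abs_mult mult_left_mono)
        next
          case False
          then have "k t = 0" using t by (auto simp: support_def k_def)
          then show ?thesis using False by (simp add: ak)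
        qed
      qed
      also have "\<dots> \<le> (\<Sum>t\<in>support n. w n * (B * (L * (real r * w n))))"
      proof (subst sum.inter_restrict[symmetric])
        show "(\<Sum>t\<in>?I \<inter> support n. w n * (B * (L * (real r * w n)))) \<le> (\<Sum>t\<in>support n. w n * (B * (L * (real r * w n))))"
          by (rule sum_mono2) (use B L w_nonneg[of n] in auto)
      qed simp
      also have "\<dots> = (real (card (support n)) * w n) * ((B * L * real r) * w n)"
        by (simp add: mult_ac)
      also have "\<dots> \<le> (2 * R + 1) * ((B * L * real r) * w n)"
        using elim(2) B L w_nonneg[of n] by (intro mult_right_mono) auto
      finally have 1: "\<bar>\<Sum>t\<in>?I. a n t * (a n (t + r) - a n t)\<bar> \<le> (2 * R + 1) * ((B * L * real r) * w n)" .
      have "\<bar>\<Sum>t\<in>?J. (a n t)\<^sup>2\<bar> \<le> real (card ?J) * (w n * B\<^sup>2)"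
      proof -
        have "\<bar>\<Sum>t\<in>?J. (a n t)\<^sup>2\<bar> \<le> (\<Sum>t\<in>?J. \<bar>(a n t)\<^sup>2\<bar>)" by (rule sum_abs)
        also have "\<dots> \<le> real (card ?J) * (w n * B\<^sup>2)"
        proof (rule sum_bounded_above)
          fix t
          have "(a n t)\<^sup>2 \<le> (sqrt (w n) * B)\<^sup>2"
            using abs_a_le[of n t] B w_nonneg[of n] by (intro abs_le_square_iff[THEN iffD1]) simp
          then show "\<bar>(a n t)\<^sup>2\<bar> \<le> w n * B\<^sup>2" using w_nonneg[of n] by (simp add: power_mult_distrib)
        qed
        finally show ?thesis .
      qed
      also have "\<dots> \<le> real r * (w n * B\<^sup>2)"
      proof (intro mult_right_mono)
        have "?J \<subseteq> {T n - r<..T n}" by auto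
        then have "card ?J \<le> card {T n - r<..T n}" by (rule card_mono[rotated]) simp
        then show "real (card ?J) \<le> real r" by simp
      qed (use w_nonneg[of n] in simp)
      finally have 2: "\<bar>\<Sum>t\<in>?J. (a n t)\<^sup>2\<bar> \<le> real r * (w n * B\<^sup>2)" .
      show ?case
        using 1 2 unfolding eq real_norm_def by (simp add: algebra_simps)
    qed
  qed
  from tendsto_add[OF this sum_a_square] show ?thesis by simp
qed

lemma abs_lag_le: "\<bar>lag n r\<bar> \<le> (\<Sum>t=1..T n. (a n t)\<^sup>2)"
proof -
  let ?I = "{t\<in>{1..T n}. t + r \<le> T n}"
  have "\<bar>lag n r\<bar> \<le> (\<Sum>t\<in>?I. (a n t)\<^sup>2 / 2 + (a n (t + r))\<^sup>2 / 2)"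
    unfolding lag_def
  proof (rule order_trans[OF sum_abs sum_mono])
    show "\<bar>a n t * a n (t + r)\<bar> \<le> (a n t)\<^sup>2 / 2 + (a n (t + r))\<^sup>2 / 2" for t
      using sum_squares_bound[of "\<bar>a n t\<bar>" "\<bar>a n (t + r)\<bar>"] by (simp add: abs_mult)
  qed
  also have "\<dots> = (\<Sum>t\<in>?I. (a n t)\<^sup>2) / 2 + (\<Sum>t\<in>(\<lambda>t. t + r) ` ?I. (a n t)\<^sup>2) / 2"
    by (simp add: sum.distrib sum_divide_distrib sum.reindex)
  also have "\<dots> \<le> (\<Sum>t=1..T n. (a n t)\<^sup>2) / 2 + (\<Sum>t=1..T n. (a n t)\<^sup>2) / 2"
    by (intro add_mono divide_right_mono sum_mono2) auto
  finally show ?thesis by simp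
qed

text \<open>Pairs are grouped by distance; a positive distance occurs in both orders. The result is
  an infinite series, zero beyond \<open>T n\<close>, so that Tannery's theorem can let
  \<open>n\<close> grow under the sum.\<close>

lemma pair_sum_lags:
  fixes \<gamma> :: "nat \<Rightarrow> real"
  shows "(\<lambda>r. (if r = 0 then 1 else 2) * \<gamma> r * lag n r) sums
    (\<Sum>s=1..T n. \<Sum>t=1..T n. a n s * a n t * \<gamma> (if s \<le> t then t - s else s - t))"
proof -
  let ?I = "{1..T n}" and ?f = "\<lambda>(s, t). a n s * a n t * \<gamma> (if s \<le> t then t - s else s - t)"
  define d where "d = (\<lambda>(s::nat, t). if s \<le> t then t - s else s - t)"
  have group: "sum ?f {z\<in>?I \<times> ?I. d z = r} = (if r = 0 then 1 else 2) * \<gamma> r * lag n r" for r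
  proof -
    let ?U = "{t\<in>?I. t + r \<le> T n}"
    have "sum ?f {z\<in>?I \<times> ?I. d z = r} = sum (\<lambda>(s, t). a n s * a n t * \<gamma> r) {z\<in>?I \<times> ?I. d z = r}"
      by (rule sum.cong) (auto simp: d_def)
    also have "\<dots> = (if r = 0 then 1 else 2) * \<gamma> r * lag n r"
    proof (cases "r = 0")
      case True
      have "{z\<in>?I \<times> ?I. d z = r} = (\<lambda>t. (t, t)) ` ?I" using True by (auto simp: d_def split: if_splits)
      moreover have "?U = ?I" using True by auto
      ultimately show ?thesis using True
        by (simp add: sum.reindex inj_on_def lag_def sum_distrib_left mult_ac)
    next
      case False
      have "{z\<in>?I \<times> ?I. d z = r} = (\<lambda>t. (t, t + r)) ` ?U \<union> (\<lambda>t. (t + r, t)) ` ?U"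
        using False by (auto simp: d_def image_iff split: if_splits)
      moreover have "(\<lambda>t. (t, t + r)) ` ?U \<inter> (\<lambda>t. (t + r, t)) ` ?U = {}"
        using False by auto
      ultimately show ?thesis using False
        by (simp add: sum.union_disjoint sum.reindex inj_on_def lag_def sum_distrib_left sum.distrib[symmetric] algebra_simps)
    qed
    finally show ?thesis .
  qed
  have "(\<Sum>s=1..T n. \<Sum>t=1..T n. a n s * a n t * \<gamma> (if s \<le> t then t - s else s - t)) = sum ?f (?I \<times> ?I)"
    by (simp add: sum.cartesian_product)
  also have "\<dots> = (\<Sum>r\<in>{..T n}. sum ?f {z\<in>?I \<times> ?I. d z = r})"
    by (rule sum.group[symmetric]) (auto simp: d_def)
  also have "\<dots> = (\<Sum>r\<in>{..T n}. (if r = 0 then 1 else 2) * \<gamma> r * lag n r)"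
    by (simp only: group)
  finally have eq: "(\<Sum>s=1..T n. \<Sum>t=1..T n. a n s * a n t * \<gamma> (if s \<le> t then t - s else s - t))
      = (\<Sum>r\<in>{..T n}. (if r = 0 then 1 else 2) * \<gamma> r * lag n r)" .
  have "lag n r = 0" if "r \<notin> {..T n}" for r
  proof -
    have empty: "{t\<in>{1..T n}. t + r \<le> T n} = {}" using that by auto
    show ?thesis unfolding lag_def empty by simp
  qed
  then show ?thesis unfolding eq by (intro sums_finite) auto
qed

text \<open>\<open>abs_lag_le\<close> and the convergence of the sum of squares bound all lags by
  one constant, so the absolutely summable \<gamma> dominates the series.\<close>

lemma variance_tendsto:
  fixes \<gamma> :: "nat \<Rightarrow> real"
  assumes sm: "summable (\<lambda>r. \<bar>\<gamma> r\<bar>)"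
  shows "(\<lambda>n. \<Sum>s=1..T n. \<Sum>t=1..T n. a n s * a n t * \<gamma> (if s \<le> t then t - s else s - t))
    \<longlonglongrightarrow> (\<integral>z. (K z)\<^sup>2 \<partial>lborel) * (\<gamma> 0 + 2 * (\<Sum>r. \<gamma> (Suc r)))"
proof -
  define c where "c r = (if r = 0 then 1 else 2) * \<gamma> r" for r
  obtain D where D: "\<And>n. (\<Sum>t=1..T n. (a n t)\<^sup>2) \<le> D"
    using convergent_imp_Bseq[OF convergentI[OF sum_a_square]] unfolding Bseq_def
    by (metis real_norm_def abs_ge_self order_trans)
  have sm\<gamma>: "summable \<gamma>" by (rule summable_rabs_cancel[OF sm])
  have c_le: "\<bar>c r\<bar> \<le> 2 * \<bar>\<gamma> r\<bar>" for r by (simp add: c_def abs_mult)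
  have "eventually (\<lambda>n. summable (\<lambda>r. norm (c r * lag n r))) sequentially \<and>
      summable (\<lambda>r. norm (c r * (\<integral>z. (K z)\<^sup>2 \<partial>lborel))) \<and>
      (\<lambda>n. \<Sum>r. c r * lag n r) \<longlonglongrightarrow> (\<Sum>r. c r * (\<integral>z. (K z)\<^sup>2 \<partial>lborel))"
  proof (rule tannerys_theorem)
    show "(\<lambda>n. c r * lag n r) \<longlonglongrightarrow> c r * (\<integral>z. (K z)\<^sup>2 \<partial>lborel)" for r
      by (intro tendsto_mult tendsto_const lag_tendsto)
    show "\<forall>\<^sub>F (r, n) in at_top \<times>\<^sub>F sequentially. norm (c r * lag n r) \<le> 2 * \<bar>\<gamma> r\<bar> * D"
    proof (rule always_eventually, clarify)
      fix r n
      show "norm (c r * lag n r) \<le> 2 * \<bar>\<gamma> r\<bar> * D"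
        unfolding real_norm_def abs_mult
        by (rule mult_mono) (use c_le order_trans[OF abs_lag_le D] in auto)
    qed
    show "summable (\<lambda>r. 2 * \<bar>\<gamma> r\<bar> * D)" by (intro summable_mult summable_mult2 sm)
  qed simp
  then have lim: "(\<lambda>n. \<Sum>r. c r * lag n r) \<longlonglongrightarrow> (\<Sum>r. c r * (\<integral>z. (K z)\<^sup>2 \<partial>lborel))" by blast
  have "(\<Sum>r. c r * (\<integral>z. (K z)\<^sup>2 \<partial>lborel)) = (\<integral>z. (K z)\<^sup>2 \<partial>lborel) * (\<gamma> 0 + 2 * (\<Sum>r. \<gamma> (Suc r)))"
  proof -
    have sm_c: "summable c" by (rule summable_comparison_test'[OF summable_mult[OF sm, of 2], of 0]) (use c_le in simp)
    have "suminf c = (\<Sum>r. c (Suc r)) + c 0" by (rule suminf_split_head[OF sm_c, THEN eq_diff_eq[THEN iffD1], symmetric])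
    also have "(\<Sum>r. c (Suc r)) = 2 * (\<Sum>r. \<gamma> (Suc r))"
      using sm\<gamma> by (simp add: c_def suminf_mult summable_Suc_iff)
    also have "c 0 = \<gamma> 0" by (simp add: c_def)
    finally have "suminf c = \<gamma> 0 + 2 * (\<Sum>r. \<gamma> (Suc r))" by (simp only: add.commute)
    then show ?thesis by (simp only: suminf_mult2[OF sm_c, symmetric] mult.commute)
  qed
  with lim show ?thesis
    unfolding c_def sums_unique[OF pair_sum_lags, symmetric] by simp
qed

end

section \<open>Hilbert space valued sums\<close>

lemma integrable_norm_square_add:
  fixes f g :: "'a \<Rightarrow> 'h::{real_normed_vector, second_countable_topology}"
  assumes [measurable]: "f \<in> borel_measurable M" "g \<in> borel_measurable M"
    and i: "integrable M (\<lambda>x. (norm (f x))\<^sup>2)" "integrable M (\<lambda>x. (norm (g x))\<^sup>2)"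
  shows "integrable M (\<lambda>x. (norm (f x + g x))\<^sup>2)"
proof (rule Bochner_Integration.integrable_bound)
  show "integrable M (\<lambda>x. 2 * (norm (f x))\<^sup>2 + 2 * (norm (g x))\<^sup>2)" using i by simp
  have "(norm (f x + g x))\<^sup>2 \<le> 2 * (norm (f x))\<^sup>2 + 2 * (norm (g x))\<^sup>2" for x
    by (rule order_trans[OF power_mono[OF norm_triangle_ineq norm_ge_zero] square_add_le])
  then show "AE x in M. norm ((norm (f x + g x))\<^sup>2) \<le> norm (2 * (norm (f x))\<^sup>2 + 2 * (norm (g x))\<^sup>2)"
    by simp
qed simp

lemma integrable_norm_square_diff:
  fixes f g :: "'a \<Rightarrow> 'h::{real_normed_vector, second_countable_topology}"
  assumes "f \<in> borel_measurable M" "g \<in> borel_measurable M"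
    and "integrable M (\<lambda>x. (norm (f x))\<^sup>2)" "integrable M (\<lambda>x. (norm (g x))\<^sup>2)"
  shows "integrable M (\<lambda>x. (norm (f x - g x))\<^sup>2)"
  using integrable_norm_square_add[of f M "\<lambda>x. - g x"] assms by simp

lemma integrable_norm_square_sum:
  fixes f :: "'i \<Rightarrow> 'a \<Rightarrow> 'h::{real_normed_vector, second_countable_topology}"
  assumes "\<And>i. i \<in> I \<Longrightarrow> f i \<in> borel_measurable M" "\<And>i. i \<in> I \<Longrightarrow> integrable M (\<lambda>x. (norm (f i x))\<^sup>2)"
  shows "integrable M (\<lambda>x. (norm (\<Sum>i\<in>I. f i x))\<^sup>2)"
  using assms
proof (induction I rule: infinite_finite_induct)
  case (insert i I)
  then show ?case by (simp add: integrable_norm_square_add)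
qed simp_all

lemma integrable_inner_square:
  fixes f :: "'a \<Rightarrow> 'h::{real_inner, second_countable_topology}"
  assumes [measurable]: "f \<in> borel_measurable M" and i: "integrable M (\<lambda>x. (norm (f x))\<^sup>2)"
  shows "integrable M (\<lambda>x. (inner (f x) b)\<^sup>2)"
    and "(\<integral>x. (inner (f x) b)\<^sup>2 \<partial>M) \<le> (norm b)\<^sup>2 * (\<integral>x. (norm (f x))\<^sup>2 \<partial>M)"
proof -
  have le: "(inner (f x) b)\<^sup>2 \<le> (norm b)\<^sup>2 * (norm (f x))\<^sup>2" for x
    using Cauchy_Schwarz_ineq[of "f x" b] by (simp add: power2_norm_eq_inner mult.commute)
  have i2: "integrable M (\<lambda>x. (norm b)\<^sup>2 * (norm (f x))\<^sup>2)" using i by simp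
  show i1: "integrable M (\<lambda>x. (inner (f x) b)\<^sup>2)"
    by (rule Bochner_Integration.integrable_bound[OF i2]) (use le in auto)
  have "(\<integral>x. (inner (f x) b)\<^sup>2 \<partial>M) \<le> (\<integral>x. (norm b)\<^sup>2 * (norm (f x))\<^sup>2 \<partial>M)"
    by (rule integral_mono[OF i1 i2 le])
  then show "(\<integral>x. (inner (f x) b)\<^sup>2 \<partial>M) \<le> (norm b)\<^sup>2 * (\<integral>x. (norm (f x))\<^sup>2 \<partial>M)" by simp
qed

lemma integrable_of_square_norm:
  fixes f :: "'a \<Rightarrow> 'h::{banach, second_countable_topology}"
  assumes "finite_measure M" and [measurable]: "f \<in> borel_measurable M" and i: "integrable M (\<lambda>x. (norm (f x))\<^sup>2)"
  shows "integrable M f"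
proof -
  interpret finite_measure M by fact
  have "integrable M (\<lambda>x. norm (f x))" by (rule square_integrable_imp_integrable[OF _ i]) simp
  then show ?thesis by (subst (asm) integrable_norm_iff) simp_all
qed

definition parseval :: "(nat \<Rightarrow> 'h::real_inner) \<Rightarrow> bool"
  where "parseval e \<longleftrightarrow> (\<forall>x. (\<lambda>k. (inner x (e k))\<^sup>2) sums (norm x)\<^sup>2)"

lemma bessel:
  assumes "parseval e" "finite J"
  shows "(\<Sum>k\<in>J. (inner x (e k))\<^sup>2) \<le> (norm x)\<^sup>2"
proof -
  have s: "(\<lambda>k. (inner x (e k))\<^sup>2) sums (norm x)\<^sup>2" using assms(1) by (simp add: parseval_def)
  show ?thesis
    unfolding sums_unique[OF s] by (rule sum_le_suminf) (use sums_summable[OF s] assms(2) in auto)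
qed

lemma parseval_tendsto: "parseval e \<Longrightarrow> (\<lambda>n. \<Sum>k<n. (inner x (e k))\<^sup>2) \<longlonglongrightarrow> (norm x)\<^sup>2"
  by (simp add: parseval_def sums_def)

lemma parseval_integral_tendsto:
  fixes f :: "'a \<Rightarrow> 'h::{real_inner, second_countable_topology}"
  assumes e: "parseval e" and [measurable]: "f \<in> borel_measurable M" and i: "integrable M (\<lambda>x. (norm (f x))\<^sup>2)"
  shows "(\<lambda>n. \<integral>x. (\<Sum>k<n. (inner (f x) (e k))\<^sup>2) \<partial>M) \<longlonglongrightarrow> (\<integral>x. (norm (f x))\<^sup>2 \<partial>M)"
proof (rule integral_dominated_convergence[OF _ _ i])
  show "AE x in M. (\<lambda>n. \<Sum>k<n. (inner (f x) (e k))\<^sup>2) \<longlonglongrightarrow> (norm (f x))\<^sup>2"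
    by (rule AE_I2) (rule parseval_tendsto[OF e])
  show "AE x in M. norm (\<Sum>k<n. (inner (f x) (e k))\<^sup>2) \<le> (norm (f x))\<^sup>2" for n
    using bessel[OF e, of "{..<n}"] by (simp add: sum_nonneg)
qed simp_all

text \<open>Assumption \<open>sm\<close> is L2-m-approximability with the copies integrated out: the
  true and the resampled past are two independent draws from \<open>P\<close>.\<close>

locale h_shift = bernoulli_shift M S \<epsilon> for M :: "'w measure" and S :: "'s measure" and \<epsilon> +
  fixes f :: "(nat \<Rightarrow> 's) \<Rightarrow> 'h::{real_inner, banach, second_countable_topology}"
  assumes f [measurable]: "f \<in> borel_measurable SQ" and f2: "integrable P (\<lambda>x. (norm (f x))\<^sup>2)"
    and f_mean: "(\<integral>x. f x \<partial>P) = 0"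
    and sm: "summable (\<lambda>r. sqrt (\<integral>z. (norm (f (fst z) - f (merge_at r (fst z) (snd z))))\<^sup>2 \<partial>(P \<Otimes>\<^sub>M P)))"
begin

definition \<delta> :: "nat \<Rightarrow> real"
  where "\<delta> r = sqrt (\<integral>z. (norm (f (fst z) - f (merge_at r (fst z) (snd z))))\<^sup>2 \<partial>(P \<Otimes>\<^sub>M P))"

definition \<Delta> :: real where "\<Delta> = suminf \<delta>"

definition v :: real where "v = sqrt (\<integral>x. (norm (f x))\<^sup>2 \<partial>P)"

definition Z :: "int \<Rightarrow> 'w \<Rightarrow> 'h" where "Z t \<omega> = f (past t \<omega>)"

text \<open>The coefficient of \<open>dep_orthogonal\<close> for the projection on \<open>b\<close>.
  Along a Parseval frame its squares sum to at most (\<delta> r)^2 (\<open>sum_d_square\<close>),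
  information that the cruder bound \<open>d_le\<close> loses.\<close>

definition d :: "nat \<Rightarrow> 'h \<Rightarrow> real"
  where "d r b = sqrt (\<integral>x. (inner (f x) b - trunc r (\<lambda>x. inner (f x) b) x)\<^sup>2 \<partial>P)"

lemma summable_\<delta>: "summable \<delta>" using sm by (simp add: \<delta>_def[abs_def])

lemma \<delta>_nonneg: "0 \<le> \<delta> r" by (simp add: \<delta>_def)

lemma v_nonneg: "0 \<le> v" by (simp add: v_def)

lemma \<Delta>_nonneg: "0 \<le> \<Delta>" unfolding \<Delta>_def by (rule suminf_nonneg[OF summable_\<delta> \<delta>_nonneg])

lemma measurable_Z [measurable]: "Z t \<in> borel_measurable M"
  unfolding Z_def[abs_def] by measurable

lemma inner_f:
  shows "(\<lambda>x. inner (f x) b) \<in> borel_measurable SQ" and "integrable P (\<lambda>x. (inner (f x) b)\<^sup>2)"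
    and "(\<integral>x. inner (f x) b \<partial>P) = 0"
proof -
  show "(\<lambda>x. inner (f x) b) \<in> borel_measurable SQ" by measurable
  show "integrable P (\<lambda>x. (inner (f x) b)\<^sup>2)" by (rule integrable_inner_square) (use f2 in simp_all)
  have "integrable P f"
    by (rule integrable_of_square_norm) (use f2 prob_space_P in \<open>simp_all add: prob_space_def\<close>)
  then show "(\<integral>x. inner (f x) b \<partial>P) = 0" using f_mean by simp
qed

lemma integrable_f_diff: "integrable (P \<Otimes>\<^sub>M P) (\<lambda>z. (norm (f (fst z) - f (merge_at r (fst z) (snd z))))\<^sup>2)"
proof (rule integrable_norm_square_diff)
  interpret P: prob_space P by (rule prob_space_P)
  interpret PP: pair_prob_space P P ..
  show "integrable (P \<Otimes>\<^sub>M P) (\<lambda>z. (norm (f (fst z)))\<^sup>2)"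
    by (rule PP.Fubini_integrable) (use f2 in \<open>simp_all add: P.prob_space[simplified]\<close>)
  show "integrable (P \<Otimes>\<^sub>M P) (\<lambda>z. (norm (f (merge_at r (fst z) (snd z))))\<^sup>2)"
    using f2 by (subst integrable_merge_at[of "\<lambda>x. (norm (f x))\<^sup>2"]) simp_all
qed measurable

lemma integral_f_diff: "(\<integral>z. (norm (f (fst z) - f (merge_at r (fst z) (snd z))))\<^sup>2 \<partial>(P \<Otimes>\<^sub>M P)) = (\<delta> r)\<^sup>2"
  by (simp add: \<delta>_def)

lemma d_square: "(d r b)\<^sup>2 \<le> (\<integral>z. (inner (f (fst z) - f (merge_at r (fst z) (snd z))) b)\<^sup>2 \<partial>(P \<Otimes>\<^sub>M P))"
  unfolding d_def using integral_trunc_diff_le[OF inner_f(1,2), of b r] by (simp add: inner_diff_left)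

lemma d_nonneg: "0 \<le> d r b" by (simp add: d_def)

lemma d_le: "d r b \<le> norm b * \<delta> r"
proof (rule power2_le_imp_le)
  have "(d r b)\<^sup>2 \<le> (\<integral>z. (inner (f (fst z) - f (merge_at r (fst z) (snd z))) b)\<^sup>2 \<partial>(P \<Otimes>\<^sub>M P))" by (rule d_square)
  also have "\<dots> \<le> (norm b)\<^sup>2 * (\<integral>z. (norm (f (fst z) - f (merge_at r (fst z) (snd z))))\<^sup>2 \<partial>(P \<Otimes>\<^sub>M P))"
    by (rule integrable_inner_square(2)) (use integrable_f_diff in simp_all)
  finally show "(d r b)\<^sup>2 \<le> (norm b * \<delta> r)\<^sup>2" by (simp add: integral_f_diff power_mult_distrib)
qed (simp add: \<delta>_nonneg)

lemma summable_d: "summable (\<lambda>r. d r b)"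
  by (rule summable_comparison_test'[OF summable_mult[OF summable_\<delta>, of "norm b"], of 0])
     (use d_le d_nonneg in simp)

lemma sum_d_square:
  assumes e: "parseval e" and J: "finite J"
  shows "(\<Sum>k\<in>J. (d r (e k))\<^sup>2) \<le> (\<delta> r)\<^sup>2"
proof -
  let ?D = "\<lambda>z. f (fst z) - f (merge_at r (fst z) (snd z))"
  have i: "integrable (P \<Otimes>\<^sub>M P) (\<lambda>z. (inner (?D z) b)\<^sup>2)" for b
    by (rule integrable_inner_square(1)) (use integrable_f_diff in simp_all)
  have "(\<Sum>k\<in>J. (d r (e k))\<^sup>2) \<le> (\<Sum>k\<in>J. \<integral>z. (inner (?D z) (e k))\<^sup>2 \<partial>(P \<Otimes>\<^sub>M P))"
    by (rule sum_mono) (rule d_square)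
  also have "\<dots> = (\<integral>z. (\<Sum>k\<in>J. (inner (?D z) (e k))\<^sup>2) \<partial>(P \<Otimes>\<^sub>M P))"
    by (rule Bochner_Integration.integral_sum[symmetric]) (rule i)
  also have "\<dots> \<le> (\<integral>z. (norm (?D z))\<^sup>2 \<partial>(P \<Otimes>\<^sub>M P))"
    by (rule integral_mono[OF _ integrable_f_diff bessel[OF e J]])
       (intro Bochner_Integration.integrable_sum i)
  finally show ?thesis by (simp add: integral_f_diff)
qed

lemma Z_square: "integrable M (\<lambda>\<omega>. (norm (Z t \<omega>))\<^sup>2)" "(\<integral>\<omega>. (norm (Z t \<omega>))\<^sup>2 \<partial>M) = v\<^sup>2"
  using integrable_past[of "\<lambda>x. (norm (f x))\<^sup>2" t] integral_past[of "\<lambda>x. (norm (f x))\<^sup>2" t] f2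
  by (simp_all add: Z_def v_def)

lemma Z_inner_square: "integrable M (\<lambda>\<omega>. (inner (Z t \<omega>) b)\<^sup>2)"
  "(\<integral>\<omega>. (inner (Z t \<omega>) b)\<^sup>2 \<partial>M) = (\<integral>x. (inner (f x) b)\<^sup>2 \<partial>P)"
  using integrable_past[of "\<lambda>x. (inner (f x) b)\<^sup>2" t] integral_past[of "\<lambda>x. (inner (f x) b)\<^sup>2" t] inner_f(2)
  by (simp_all add: Z_def)

lemma Z_product_integrable: "integrable M (\<lambda>\<omega>. inner (Z s \<omega>) a * inner (Z t \<omega>) b)"
  by (rule integrable_mult_of_squares) (use Z_inner_square in simp_all)

definition \<gamma> :: "nat \<Rightarrow> 'h \<Rightarrow> 'h \<Rightarrow> real"
  where "\<gamma> r a b = (\<integral>\<omega>. inner (Z 0 \<omega>) a * inner (Z (int r) \<omega>) b \<partial>M)"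

text \<open>Stationarity: \<open>past s\<close> is a shift of \<open>past (s + int r)\<close>, so
  the product is one fixed function \<open>G\<close> of the later past.\<close>

lemma covariance: "(\<integral>\<omega>. inner (Z s \<omega>) a * inner (Z (s + int r) \<omega>) b \<partial>M) = \<gamma> r a b"
proof -
  define G where "G x = inner (f (\<lambda>k. x (k + r))) a * inner (f x) b" for x
  have [measurable]: "G \<in> borel_measurable SQ" unfolding G_def by measurable
  have "(\<integral>\<omega>. inner (Z s \<omega>) a * inner (Z (s + int r) \<omega>) b \<partial>M) = (\<integral>x. G x \<partial>P)" for s
    using integral_past[of G "s + int r"] past_shift[of "s + int r" r] by (simp add: G_def Z_def)
  from this[of s] this[of 0] show ?thesis by (simp add: \<gamma>_def)
qed

lemma covariance_abs:
  "(\<integral>\<omega>. inner (Z (int s) \<omega>) a * inner (Z (int t) \<omega>) a \<partial>M) = \<gamma> (if s \<le> t then t - s else s - t) a a"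
proof (cases "s \<le> t")
  case True
  then have "int t = int s + int (t - s)" by simp
  then show ?thesis using covariance[of "int s" a "t - s" a] True by simp
next
  case False
  then have "int s = int t + int (s - t)" by simp
  then show ?thesis using covariance[of "int t" a "s - t" a] False by (simp add: mult.commute)
qed

lemma covariance_le: "\<bar>\<gamma> r a b\<bar> \<le> sqrt (\<integral>x. (inner (f x) a)\<^sup>2 \<partial>P) * d r b"
  using dep_orthogonal(2)[OF dep_past[OF inner_f(1), of 0 a] _ inner_f[of b], of "int r" r] Z_inner_square[of 0 a]
  by (simp add: \<gamma>_def Z_def d_def)

lemma sqrt_inner_f_le: "sqrt (\<integral>x. (inner (f x) a)\<^sup>2 \<partial>P) \<le> norm a * v"
proof (rule real_le_lsqrt)
  show "(\<integral>x. (inner (f x) a)\<^sup>2 \<partial>P) \<le> (norm a * v)\<^sup>2"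
    using integrable_inner_square(2)[of f P a] f2 by (simp add: power_mult_distrib v_def)
qed (simp add: v_nonneg)

lemma \<gamma>_le: "\<bar>\<gamma> r a b\<bar> \<le> norm a * v * (norm b * \<delta> r)"
  by (rule order_trans[OF covariance_le mult_mono[OF sqrt_inner_f_le d_le]]) (simp_all add: v_nonneg d_nonneg)

lemma summable_\<gamma>: "summable (\<lambda>r. \<bar>\<gamma> r a b\<bar>)"
  by (rule summable_comparison_test'[OF summable_mult[OF summable_mult[OF summable_\<delta>, of "norm b"], of "norm a * v"], of 0])
     (use \<gamma>_le in simp)

text \<open>The long-run covariance as a bilinear form; \<open>inner_long_run_cov\<close> identifies
  its kernel. The two series are transposes of each other, which makes it symmetric.\<close>

definition B :: "'h \<Rightarrow> 'h \<Rightarrow> real"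
  where "B a b = \<gamma> 0 a b + (\<Sum>r. \<gamma> (Suc r) a b) + (\<Sum>r. \<gamma> (Suc r) b a)"

lemma summable_\<gamma>_Suc: "summable (\<lambda>r. \<gamma> (Suc r) a b)"
  using summable_rabs_cancel[OF summable_\<gamma>] by (subst summable_Suc_iff)

lemma \<gamma>_add_left: "\<gamma> r (a + a') b = \<gamma> r a b + \<gamma> r a' b"
  unfolding \<gamma>_def using Z_product_integrable by (simp add: inner_add_right distrib_right)

lemma \<gamma>_add_right: "\<gamma> r b (a + a') = \<gamma> r b a + \<gamma> r b a'"
  unfolding \<gamma>_def using Z_product_integrable by (simp add: inner_add_right distrib_left)

lemma \<gamma>_scale_left: "\<gamma> r (c *\<^sub>R a) b = c * \<gamma> r a b"
  unfolding \<gamma>_def by (simp add: mult.assoc)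

lemma \<gamma>_scale_right: "\<gamma> r b (c *\<^sub>R a) = c * \<gamma> r b a"
  unfolding \<gamma>_def by (simp add: mult.left_commute)

lemma \<gamma>_0_sym: "\<gamma> 0 a b = \<gamma> 0 b a"
  by (simp add: \<gamma>_def mult.commute)

lemma B_add_left: "B (a + a') b = B a b + B a' b"
  unfolding B_def using summable_\<gamma>_Suc by (simp add: \<gamma>_add_left \<gamma>_add_right suminf_add[symmetric])

lemma B_scale_left: "B (c *\<^sub>R a) b = c * B a b"
  unfolding B_def using summable_\<gamma>_Suc by (simp add: \<gamma>_scale_left \<gamma>_scale_right suminf_mult distrib_left)

lemma B_sym: "B a b = B b a"
  unfolding B_def using \<gamma>_0_sym[of a b] by simp

lemma suminf_le_\<delta>:
  assumes "\<And>r. \<bar>g r\<bar> \<le> c * \<delta> r" "0 \<le> c"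
  shows "g 0 + (\<Sum>r. g (Suc r)) + (\<Sum>r. g (Suc r)) \<le> 2 * (c * \<Delta>)"
proof -
  have sg: "summable g"
    by (rule summable_comparison_test'[OF summable_mult[OF summable_\<delta>, of c], of 0]) (use assms in simp)
  have "(\<Sum>r. g (Suc r)) \<le> (\<Sum>r. c * \<delta> (Suc r))"
    using assms(1) sg summable_\<delta>
    by (intro suminf_le) (auto simp: summable_Suc_iff abs_le_iff intro!: summable_mult)
  also have "\<dots> = c * (\<Delta> - \<delta> 0)"
    using suminf_split_head[OF summable_\<delta>] summable_\<delta> by (simp add: suminf_mult summable_Suc_iff \<Delta>_def)
  finally have "g 0 + (\<Sum>r. g (Suc r)) + (\<Sum>r. g (Suc r)) \<le> c * \<delta> 0 + 2 * (c * (\<Delta> - \<delta> 0))"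
    using assms(1)[of 0] by simp
  also have "\<dots> \<le> 2 * (c * \<Delta>)"
    using assms(2) \<delta>_nonneg[of 0] by (simp add: algebra_simps)
  finally show ?thesis .
qed

lemma B_le: "B a a \<le> (2 * (v * \<Delta>)) * (norm a)\<^sup>2"
proof -
  have "B a a \<le> 2 * ((norm a * v * norm a) * \<Delta>)"
    unfolding B_def by (rule suminf_le_\<delta>) (use \<gamma>_le[of _ a a] v_nonneg in \<open>simp_all add: mult.assoc\<close>)
  then show ?thesis by (simp add: power2_eq_square mult_ac)
qed

text \<open>Cauchy-Schwarz over the coordinates: \<open>J\<close> enters only through the second
  moment of \<open>f\<close> that these coordinates carry. The bound therefore stays finite as
  \<open>J\<close> grows and is small for remote coordinates.\<close>

lemma sum_covariance_le:
  assumes e: "parseval e" and J: "finite J"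
  shows "(\<Sum>k\<in>J. \<bar>\<gamma> r (e k) (e k)\<bar>) \<le> sqrt (\<Sum>k\<in>J. \<integral>x. (inner (f x) (e k))\<^sup>2 \<partial>P) * \<delta> r"
proof -
  have "(\<Sum>k\<in>J. \<bar>\<gamma> r (e k) (e k)\<bar>) \<le> (\<Sum>k\<in>J. \<bar>sqrt (\<integral>x. (inner (f x) (e k))\<^sup>2 \<partial>P)\<bar> * \<bar>d r (e k)\<bar>)"
    by (rule sum_mono) (use covariance_le d_nonneg in simp)
  also have "\<dots> \<le> L2_set (\<lambda>k. sqrt (\<integral>x. (inner (f x) (e k))\<^sup>2 \<partial>P)) J * L2_set (\<lambda>k. d r (e k)) J"
    by (rule L2_set_mult_ineq)
  also have "\<dots> \<le> sqrt (\<Sum>k\<in>J. \<integral>x. (inner (f x) (e k))\<^sup>2 \<partial>P) * \<delta> r"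
  proof (rule mult_mono)
    show "L2_set (\<lambda>k. sqrt (\<integral>x. (inner (f x) (e k))\<^sup>2 \<partial>P)) J \<le> sqrt (\<Sum>k\<in>J. \<integral>x. (inner (f x) (e k))\<^sup>2 \<partial>P)"
      by (simp add: L2_set_def)
    show "L2_set (\<lambda>k. d r (e k)) J \<le> \<delta> r"
      unfolding L2_set_def by (rule real_le_lsqrt[OF \<delta>_nonneg sum_d_square[OF e J]])
  qed (simp_all add: L2_set_nonneg sum_nonneg)
  finally show ?thesis .
qed

lemma trace_f_le:
  assumes "parseval e" "finite J"
  shows "(\<Sum>k\<in>J. \<integral>x. (inner (f x) (e k))\<^sup>2 \<partial>P) \<le> v\<^sup>2"
proof -
  have "(\<Sum>k\<in>J. \<integral>x. (inner (f x) (e k))\<^sup>2 \<partial>P) = (\<integral>x. (\<Sum>k\<in>J. (inner (f x) (e k))\<^sup>2) \<partial>P)"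
    by (rule Bochner_Integration.integral_sum[symmetric]) (rule inner_f)
  also have "\<dots> \<le> (\<integral>x. (norm (f x))\<^sup>2 \<partial>P)"
    by (rule integral_mono[OF _ f2 bessel[OF assms]]) (intro Bochner_Integration.integrable_sum inner_f)
  finally show ?thesis by (simp add: v_def)
qed

lemma trace_B_le:
  assumes e: "parseval e" and J: "finite J"
  shows "(\<Sum>k\<in>J. B (e k) (e k)) \<le> 2 * (v * \<Delta>)"
proof -
  have "(\<Sum>k\<in>J. B (e k) (e k)) = (\<Sum>k\<in>J. \<gamma> 0 (e k) (e k)) + (\<Sum>r. \<Sum>k\<in>J. \<gamma> (Suc r) (e k) (e k)) + (\<Sum>r. \<Sum>k\<in>J. \<gamma> (Suc r) (e k) (e k))"
    unfolding B_def using summable_\<gamma>_Suc by (simp add: sum.distrib suminf_sum sum_distrib_left)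
  also have "\<dots> \<le> 2 * (v * \<Delta>)"
  proof (rule suminf_le_\<delta>)
    fix r
    have "\<bar>\<Sum>k\<in>J. \<gamma> r (e k) (e k)\<bar> \<le> (\<Sum>k\<in>J. \<bar>\<gamma> r (e k) (e k)\<bar>)" by (rule sum_abs)
    also have "\<dots> \<le> sqrt (\<Sum>k\<in>J. \<integral>x. (inner (f x) (e k))\<^sup>2 \<partial>P) * \<delta> r" by (rule sum_covariance_le[OF e J])
    also have "\<dots> \<le> v * \<delta> r"
      by (rule mult_right_mono[OF real_le_lsqrt[OF v_nonneg trace_f_le[OF e J]] \<delta>_nonneg])
    finally show "\<bar>\<Sum>k\<in>J. \<gamma> r (e k) (e k)\<bar> \<le> v * \<delta> r" .
  qed (rule v_nonneg)
  finally show ?thesis .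
qed

section \<open>Weighted sums of the stationary process\<close>

definition ZS :: "nat set \<Rightarrow> (nat \<Rightarrow> real) \<Rightarrow> 'w \<Rightarrow> 'h"
  where "ZS I a \<omega> = (\<Sum>t\<in>I. a t *\<^sub>R Z (int t) \<omega>)"

lemma measurable_ZS [measurable]: "ZS I a \<in> borel_measurable M"
  unfolding ZS_def[abs_def] by measurable

lemma ZS_square_integrable: "integrable M (\<lambda>\<omega>. (norm (ZS I a \<omega>))\<^sup>2)"
  unfolding ZS_def by (rule integrable_norm_square_sum) (use Z_square in \<open>simp_all add: power_mult_distrib\<close>)

lemma inner_ZS: "inner (ZS I a \<omega>) x = (\<Sum>t\<in>I. a t * inner (Z (int t) \<omega>) x)"
  by (simp add: ZS_def inner_sum_left)

lemma ZS_inner_square: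
  "(\<integral>\<omega>. (inner (ZS I a \<omega>) x)\<^sup>2 \<partial>M) = (\<Sum>s\<in>I. \<Sum>t\<in>I. a s * a t * \<gamma> (if s \<le> t then t - s else s - t) x x)"
  unfolding inner_ZS integral_square_sum(2)[OF Z_product_integrable] covariance_abs ..

text \<open>\<open>quadratic_form_bound\<close> is applied to the traces over \<open>J\<close> of
  the lag covariances. Initial segments \<open>J\<close> lead to \<open>ZS_bound\<close>, the blocks
  \<open>{K..<n}\<close> to \<open>ZS_tail_bound\<close>.\<close>

lemma ZS_partial_bound:
  assumes e: "parseval e" and I: "finite I" and J: "finite J"
  shows "(\<integral>\<omega>. (\<Sum>k\<in>J. (inner (ZS I a \<omega>) (e k))\<^sup>2) \<partial>M)
    \<le> (\<Sum>t\<in>I. (a t)\<^sup>2) * (2 * (sqrt (\<Sum>k\<in>J. \<integral>x. (inner (f x) (e k))\<^sup>2 \<partial>P) * \<Delta>))"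
proof -
  let ?c = "\<lambda>s t. \<Sum>k\<in>J. \<gamma> (if s \<le> t then t - s else s - t) (e k) (e k)"
  have "(\<integral>\<omega>. (\<Sum>k\<in>J. (inner (ZS I a \<omega>) (e k))\<^sup>2) \<partial>M) = (\<Sum>k\<in>J. \<integral>\<omega>. (inner (ZS I a \<omega>) (e k))\<^sup>2 \<partial>M)"
    by (rule Bochner_Integration.integral_sum) (rule integrable_inner_square(1)[OF measurable_ZS ZS_square_integrable])
  also have "\<dots> = (\<Sum>s\<in>I. \<Sum>t\<in>I. a s * a t * ?c s t)"
    unfolding ZS_inner_square sum_distrib_left
    by (subst sum.swap[of _ I J], rule sum.cong[OF refl], rule sum.swap)
  also have "\<dots> \<le> \<bar>\<Sum>s\<in>I. \<Sum>t\<in>I. a s * a t * ?c s t\<bar>" by simp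
  also have "\<dots> \<le> (\<Sum>t\<in>I. (a t)\<^sup>2) * (2 * (\<Sum>r. sqrt (\<Sum>k\<in>J. \<integral>x. (inner (f x) (e k))\<^sup>2 \<partial>P) * \<delta> r))"
  proof (rule quadratic_form_bound[OF I])
    fix s t :: nat assume "s \<le> t"
    then show "\<bar>?c s t\<bar> \<le> sqrt (\<Sum>k\<in>J. \<integral>x. (inner (f x) (e k))\<^sup>2 \<partial>P) * \<delta> (t - s)"
      using order_trans[OF sum_abs sum_covariance_le[OF e J, of "t - s"]] by simp
  next
    show "summable (\<lambda>r. sqrt (\<Sum>k\<in>J. \<integral>x. (inner (f x) (e k))\<^sup>2 \<partial>P) * \<delta> r)"
      by (rule summable_mult[OF summable_\<delta>])
  qed (auto simp: \<delta>_nonneg sum_nonneg)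
  finally show ?thesis by (simp add: suminf_mult[OF summable_\<delta>] \<Delta>_def)
qed

lemma ZS_bound:
  fixes e :: "nat \<Rightarrow> 'h"
  assumes e: "parseval e" and I: "finite I"
  shows "(\<integral>\<omega>. (norm (ZS I a \<omega>))\<^sup>2 \<partial>M) \<le> (\<Sum>t\<in>I. (a t)\<^sup>2) * (2 * (v * \<Delta>))"
proof (rule LIMSEQ_le_const2)
  show "(\<lambda>n. \<integral>\<omega>. (\<Sum>k<n. (inner (ZS I a \<omega>) (e k))\<^sup>2) \<partial>M) \<longlonglongrightarrow> (\<integral>\<omega>. (norm (ZS I a \<omega>))\<^sup>2 \<partial>M)"
    by (rule parseval_integral_tendsto[OF e]) (simp_all add: ZS_square_integrable)
  show "\<exists>N. \<forall>n\<ge>N. (\<integral>\<omega>. (\<Sum>k<n. (inner (ZS I a \<omega>) (e k))\<^sup>2) \<partial>M) \<le> (\<Sum>t\<in>I. (a t)\<^sup>2) * (2 * (v * \<Delta>))"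
  proof (intro exI allI impI)
    fix n :: nat
    have "(\<integral>\<omega>. (\<Sum>k<n. (inner (ZS I a \<omega>) (e k))\<^sup>2) \<partial>M)
      \<le> (\<Sum>t\<in>I. (a t)\<^sup>2) * (2 * (sqrt (\<Sum>k<n. \<integral>x. (inner (f x) (e k))\<^sup>2 \<partial>P) * \<Delta>))"
      by (rule ZS_partial_bound[OF e I]) simp
    also have "\<dots> \<le> (\<Sum>t\<in>I. (a t)\<^sup>2) * (2 * (v * \<Delta>))"
      by (intro mult_left_mono mult_right_mono real_le_lsqrt trace_f_le[OF e] v_nonneg \<Delta>_nonneg sum_nonneg) simp_all
    finally show "(\<integral>\<omega>. (\<Sum>k<n. (inner (ZS I a \<omega>) (e k))\<^sup>2) \<partial>M) \<le> (\<Sum>t\<in>I. (a t)\<^sup>2) * (2 * (v * \<Delta>))" .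
  qed
qed

definition tail :: "(nat \<Rightarrow> 'h) \<Rightarrow> nat \<Rightarrow> real"
  where "tail e K = (\<integral>x. (norm (f x))\<^sup>2 - (\<Sum>k<K. (inner (f x) (e k))\<^sup>2) \<partial>P)"

lemma tail_tendsto:
  assumes e: "parseval e"
  shows "tail e \<longlonglongrightarrow> 0"
proof -
  have eq: "tail e = (\<lambda>K. (\<integral>x. (norm (f x))\<^sup>2 \<partial>P) - (\<integral>x. (\<Sum>k<K. (inner (f x) (e k))\<^sup>2) \<partial>P))"
    unfolding tail_def[abs_def] using f2 inner_f(2) by simp
  have "(\<lambda>K. (\<integral>x. (norm (f x))\<^sup>2 \<partial>P) - (\<integral>x. (\<Sum>k<K. (inner (f x) (e k))\<^sup>2) \<partial>P))
      \<longlonglongrightarrow> (\<integral>x. (norm (f x))\<^sup>2 \<partial>P) - (\<integral>x. (norm (f x))\<^sup>2 \<partial>P)"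
    by (intro tendsto_diff tendsto_const parseval_integral_tendsto[OF e]) (use f2 in simp_all)
  then show ?thesis unfolding eq by simp
qed

text \<open>Uniform over weights with bounded sum of squares: this is the compactness behind the
  assumption \<open>tail\<close> of \<open>char_tendsto_imp_weak_conv_norm\<close>.\<close>

lemma ZS_tail_bound:
  assumes e: "parseval e" and I: "finite I"
  shows "(\<integral>\<omega>. (norm (ZS I a \<omega>))\<^sup>2 - (\<Sum>k<K. (inner (ZS I a \<omega>) (e k))\<^sup>2) \<partial>M)
    \<le> (\<Sum>t\<in>I. (a t)\<^sup>2) * (2 * (sqrt (tail e K) * \<Delta>))"
proof -
  have i: "integrable M (\<lambda>\<omega>. (inner (ZS I a \<omega>) b)\<^sup>2)" for b
    by (rule integrable_inner_square(1)[OF measurable_ZS ZS_square_integrable])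
  have split: "(\<Sum>k<n. g k) - (\<Sum>k<K. g k) = (\<Sum>k\<in>{K..<n}. g k)" if "K \<le> n" for n and g :: "nat \<Rightarrow> real"
    using sum_diff_nat_ivl[of 0 K n g] that by (simp add: atLeast0LessThan)
  have "(\<lambda>n. (\<integral>\<omega>. (\<Sum>k<n. (inner (ZS I a \<omega>) (e k))\<^sup>2) \<partial>M) - (\<integral>\<omega>. (\<Sum>k<K. (inner (ZS I a \<omega>) (e k))\<^sup>2) \<partial>M))
      \<longlonglongrightarrow> (\<integral>\<omega>. (norm (ZS I a \<omega>))\<^sup>2 \<partial>M) - (\<integral>\<omega>. (\<Sum>k<K. (inner (ZS I a \<omega>) (e k))\<^sup>2) \<partial>M)"
    by (intro tendsto_diff tendsto_const parseval_integral_tendsto[OF e]) (simp_all add: ZS_square_integrable)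
  moreover have "\<exists>N. \<forall>n\<ge>N. (\<integral>\<omega>. (\<Sum>k<n. (inner (ZS I a \<omega>) (e k))\<^sup>2) \<partial>M) - (\<integral>\<omega>. (\<Sum>k<K. (inner (ZS I a \<omega>) (e k))\<^sup>2) \<partial>M)
      \<le> (\<Sum>t\<in>I. (a t)\<^sup>2) * (2 * (sqrt (tail e K) * \<Delta>))"
  proof (intro exI[of _ K] allI impI)
    fix n assume n: "K \<le> n"
    have "(\<integral>\<omega>. (\<Sum>k<n. (inner (ZS I a \<omega>) (e k))\<^sup>2) \<partial>M) - (\<integral>\<omega>. (\<Sum>k<K. (inner (ZS I a \<omega>) (e k))\<^sup>2) \<partial>M)
        = (\<integral>\<omega>. (\<Sum>k\<in>{K..<n}. (inner (ZS I a \<omega>) (e k))\<^sup>2) \<partial>M)"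
      unfolding split[OF n, symmetric] using i by simp
    also have "\<dots> \<le> (\<Sum>t\<in>I. (a t)\<^sup>2) * (2 * (sqrt (\<Sum>k\<in>{K..<n}. \<integral>x. (inner (f x) (e k))\<^sup>2 \<partial>P) * \<Delta>))"
      by (rule ZS_partial_bound[OF e I]) simp
    also have "\<dots> \<le> (\<Sum>t\<in>I. (a t)\<^sup>2) * (2 * (sqrt (tail e K) * \<Delta>))"
    proof (intro mult_left_mono mult_right_mono real_sqrt_le_mono)
      have "(\<Sum>k\<in>{K..<n}. \<integral>x. (inner (f x) (e k))\<^sup>2 \<partial>P) = (\<integral>x. (\<Sum>k<n. (inner (f x) (e k))\<^sup>2) - (\<Sum>k<K. (inner (f x) (e k))\<^sup>2) \<partial>P)"
        unfolding split[OF n] using inner_f(2) by simp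
      also have "\<dots> \<le> tail e K"
        unfolding tail_def using bessel[OF e, of "{..<n}"] f2 inner_f(2) by (intro integral_mono) auto
      finally show "(\<Sum>k\<in>{K..<n}. \<integral>x. (inner (f x) (e k))\<^sup>2 \<partial>P) \<le> tail e K" .
    qed (auto simp: \<Delta>_nonneg sum_nonneg)
    finally show "(\<integral>\<omega>. (\<Sum>k<n. (inner (ZS I a \<omega>) (e k))\<^sup>2) \<partial>M) - (\<integral>\<omega>. (\<Sum>k<K. (inner (ZS I a \<omega>) (e k))\<^sup>2) \<partial>M)
      \<le> (\<Sum>t\<in>I. (a t)\<^sup>2) * (2 * (sqrt (tail e K) * \<Delta>))" .
  qed
  ultimately have "(\<integral>\<omega>. (norm (ZS I a \<omega>))\<^sup>2 \<partial>M) - (\<integral>\<omega>. (\<Sum>k<K. (inner (ZS I a \<omega>) (e k))\<^sup>2) \<partial>M)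
      \<le> (\<Sum>t\<in>I. (a t)\<^sup>2) * (2 * (sqrt (tail e K) * \<Delta>))"
    by (rule LIMSEQ_le_const2)
  then show ?thesis using i ZS_square_integrable by simp
qed

end

locale kernel_shift = h_shift M S \<epsilon> f + kernel_weights K L Bd R u T h
  for M :: "'w measure" and S :: "'s measure" and \<epsilon> and f :: "(nat \<Rightarrow> 's) \<Rightarrow> 'h::{real_inner, banach, second_countable_topology}"
    and K L Bd R u T h
begin

definition sw :: "nat \<Rightarrow> 'w \<Rightarrow> 'h" where "sw n \<omega> = (\<Sum>t=1..T n. a n t *\<^sub>R Z (int t) \<omega>)"

lemma sw_ZS: "sw n = ZS {1..T n} (a n)" "sw n = ZS (support n) (a n)"
proof -
  show "sw n = ZS {1..T n} (a n)" by (simp add: sw_def[abs_def] ZS_def[abs_def])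
  have "(\<Sum>t=1..T n. a n t *\<^sub>R Z (int t) \<omega>) = (\<Sum>t\<in>support n. a n t *\<^sub>R Z (int t) \<omega>)" for \<omega>
    by (rule sum_support) (simp add: a_def)
  then show "sw n = ZS (support n) (a n)" by (simp add: sw_def[abs_def] ZS_def[abs_def])
qed

lemma measurable_sw [measurable]: "sw n \<in> borel_measurable M"
  unfolding sw_ZS(1) by simp

lemma sw_variance: "(\<lambda>n. \<integral>\<omega>. (inner (sw n \<omega>) x)\<^sup>2 \<partial>M) \<longlonglongrightarrow> (\<integral>z. (K z)\<^sup>2 \<partial>lborel) * B x x"
proof -
  have "B x x = \<gamma> 0 x x + 2 * (\<Sum>r. \<gamma> (Suc r) x x)" by (simp add: B_def)
  then show ?thesis
    unfolding sw_ZS(1) ZS_inner_square using variance_tendsto[OF summable_\<gamma>, of x x] by (simp only:)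
qed

text \<open>\<open>clt_bound\<close> is applied to the sum over \<open>support n\<close>: its
  cardinality, of order 1 / w, is compensated by the cube of the weights, whereas the full range of
  length \<open>T n\<close> could be too long.\<close>

lemma sw_char: "(\<lambda>n. CLINT \<omega>|M. iexp (inner (sw n \<omega>) x)) \<longlonglongrightarrow> of_real (exp (- ((\<integral>z. (K z)\<^sup>2 \<partial>lborel) * B x x) / 2))"
proof -
  let ?V = "\<lambda>n. \<integral>\<omega>. (inner (sw n \<omega>) x)\<^sup>2 \<partial>M"
  have "(\<lambda>n. (CLINT \<omega>|M. iexp (inner (sw n \<omega>) x)) - of_real (exp (- ?V n / 2))) \<longlonglongrightarrow> 0"
  proof (rule tendstoI)
    fix r :: real assume r: "0 < r"
    define Q where "Q = (\<integral>z. (K z)\<^sup>2 \<partial>lborel)"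
    have Q: "0 \<le> Q" by (simp add: Q_def)
    \<comment> \<open>Then \<eta> (1 + Q) < r / 2, where 1 + Q is the limit of the factor that
      multiplies \<eta> in \<open>clt_bound\<close>.\<close>
    define \<eta> where "\<eta> = r / (2 * (2 + Q))"
    have \<eta>: "0 < \<eta>" using r Q by (simp add: \<eta>_def)
    have smF: "summable (\<lambda>r. sqrt (\<integral>y. (inner (f y) x - trunc r (\<lambda>y. inner (f y) x) y)\<^sup>2 \<partial>P))"
      using summable_d[of x] by (simp add: d_def)
    obtain C where C: "\<And>I (a :: nat \<Rightarrow> real) \<alpha>. finite I \<Longrightarrow> (\<forall>i\<in>I. \<bar>a i\<bar> \<le> \<alpha>) \<Longrightarrow>
      cmod ((CLINT \<omega>|M. iexp (\<Sum>i\<in>I. a i * inner (f (past (int i) \<omega>)) x))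
        - of_real (exp (- (\<integral>\<omega>. (\<Sum>i\<in>I. a i * inner (f (past (int i) \<omega>)) x)\<^sup>2 \<partial>M) / 2)))
      \<le> \<eta> * (1 + (\<Sum>i\<in>I. (a i)\<^sup>2)) + C * real (card I) * \<alpha> ^ 3"
      using clt_bound[OF inner_f(1,2,3) smF \<eta>] by blast
    have bound: "cmod ((CLINT \<omega>|M. iexp (inner (sw n \<omega>) x)) - of_real (exp (- ?V n / 2)))
        \<le> \<eta> * (1 + (\<Sum>t=1..T n. (a n t)\<^sup>2)) + \<bar>C\<bar> * (real (card (support n)) * w n) * (sqrt (w n) * Bd ^ 3)" for n
    proof -
      have "cmod ((CLINT \<omega>|M. iexp (inner (sw n \<omega>) x)) - of_real (exp (- ?V n / 2)))
        \<le> \<eta> * (1 + (\<Sum>t\<in>support n. (a n t)\<^sup>2)) + C * real (card (support n)) * (sqrt (w n) * Bd) ^ 3"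
        using C[of "support n" "a n" "sqrt (w n) * Bd"] abs_a_le by (simp add: sw_ZS(2) inner_ZS Z_def)
      also have "(\<Sum>t\<in>support n. (a n t)\<^sup>2) = (\<Sum>t=1..T n. (a n t)\<^sup>2)"
        by (rule sum_support[symmetric]) (simp add: a_def)
      also have "C * real (card (support n)) * (sqrt (w n) * Bd) ^ 3
          \<le> \<bar>C\<bar> * real (card (support n)) * (sqrt (w n) * Bd) ^ 3"
        using w_nonneg[of n] B by (intro mult_right_mono) auto
      also have "\<dots> = \<bar>C\<bar> * (real (card (support n)) * w n) * (sqrt (w n) * Bd ^ 3)"
        using w_nonneg[of n] by (simp add: power_mult_distrib power3_eq_cube mult_ac)
      finally show ?thesis by simp
    qed
    have "(\<lambda>n. \<eta> * (1 + (\<Sum>t=1..T n. (a n t)\<^sup>2)) + \<bar>C\<bar> * (2 * R + 1) * (sqrt (w n) * Bd ^ 3))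
        \<longlonglongrightarrow> \<eta> * (1 + Q) + \<bar>C\<bar> * (2 * R + 1) * (sqrt 0 * Bd ^ 3)"
      unfolding Q_def by (intro tendsto_intros sum_a_square w_tendsto)
    moreover have "\<eta> * (1 + Q) + \<bar>C\<bar> * (2 * R + 1) * (sqrt 0 * Bd ^ 3) < r"
      using r Q by (simp add: \<eta>_def field_simps add_nonneg_pos)
    ultimately have "\<forall>\<^sub>F n in sequentially. \<eta> * (1 + (\<Sum>t=1..T n. (a n t)\<^sup>2)) + \<bar>C\<bar> * (2 * R + 1) * (sqrt (w n) * Bd ^ 3) < r"
      by (rule order_tendstoD)
    then show "\<forall>\<^sub>F n in sequentially. dist ((CLINT \<omega>|M. iexp (inner (sw n \<omega>) x)) - of_real (exp (- ?V n / 2))) 0 < r"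
      using card_support
    proof eventually_elim
      case (elim n)
      have "\<bar>C\<bar> * (real (card (support n)) * w n) * (sqrt (w n) * Bd ^ 3) \<le> \<bar>C\<bar> * (2 * R + 1) * (sqrt (w n) * Bd ^ 3)"
        using elim(2) w_nonneg[of n] B by (intro mult_right_mono mult_left_mono) auto
      then show ?case using bound[of n] elim(1) unfolding dist_norm diff_zero by linarith
    qed
  qed
  moreover have "(\<lambda>n. complex_of_real (exp (- ?V n / 2))) \<longlonglongrightarrow> of_real (exp (- ((\<integral>z. (K z)\<^sup>2 \<partial>lborel) * B x x) / 2))"
    by (intro tendsto_intros sw_variance) simp
  ultimately show ?thesis using tendsto_add by fastforce
qed

end

section \<open>Long-run covariance kernels\<close>

text \<open>Abstract, so that one proof covers \<open>tensor\<close> and its flip and hence both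
  series in \<open>long_run_cov\<close>. \<open>separating\<close> says that the simple tensors are
  total.\<close>

locale tensor_product =
  fixes tp :: "'h::{real_inner, banach, second_countable_topology} \<Rightarrow> 'h \<Rightarrow> 'k::{real_inner, banach, second_countable_topology}"
  assumes bilinear: "bounded_bilinear tp"
    and inner_tp: "inner (tp x y) (tp a b) = inner x a * inner y b"
    and separating: "(\<And>a b. inner \<kappa> (tp a b) = 0) \<Longrightarrow> \<kappa> = 0"
begin

lemma norm_tp: "norm (tp x y) = norm x * norm y"
  by (simp add: norm_eq_sqrt_inner inner_tp real_sqrt_mult)

lemma tp_diff_right: "tp x (y - z) = tp x y - tp x z"
  by (rule bounded_bilinear.diff_right[OF bilinear])

lemma measurable_tp [measurable (raw)]:
  assumes "X \<in> borel_measurable N" "Y \<in> borel_measurable N"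
  shows "(\<lambda>\<omega>. tp (X \<omega>) (Y \<omega>)) \<in> borel_measurable N"
proof (rule borel_measurable_continuous_Pair[OF assms])
  show "continuous_on UNIV (\<lambda>x. tp (fst x) (snd x))"
    by (intro bounded_bilinear.continuous_on[OF bilinear] continuous_intros)
qed

lemma integrable_tp:
  assumes [measurable]: "X \<in> borel_measurable N" "Y \<in> borel_measurable N"
    and i: "integrable N (\<lambda>\<omega>. (norm (X \<omega>))\<^sup>2)" "integrable N (\<lambda>\<omega>. (norm (Y \<omega>))\<^sup>2)"
  shows "integrable N (\<lambda>\<omega>. tp (X \<omega>) (Y \<omega>))"
proof -
  have "integrable N (\<lambda>\<omega>. norm (X \<omega>) * norm (Y \<omega>))"
    by (rule integrable_mult_of_squares) (use i in simp_all)
  then have "integrable N (\<lambda>\<omega>. norm (tp (X \<omega>) (Y \<omega>)))" by (simp add: norm_tp)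
  then show ?thesis by (subst (asm) integrable_norm_iff) simp_all
qed

lemma inner_integral_tp:
  assumes "X \<in> borel_measurable N" "Y \<in> borel_measurable N"
    and "integrable N (\<lambda>\<omega>. (norm (X \<omega>))\<^sup>2)" "integrable N (\<lambda>\<omega>. (norm (Y \<omega>))\<^sup>2)"
  shows "inner (\<integral>\<omega>. tp (X \<omega>) (Y \<omega>) \<partial>N) (tp a b) = (\<integral>\<omega>. inner (X \<omega>) a * inner (Y \<omega>) b \<partial>N)"
  using integral_inner_left[of "tp a b" N "\<lambda>\<omega>. tp (X \<omega>) (Y \<omega>)"] integrable_tp[OF assms] by (simp add: inner_tp)

end

locale tensor_shift = h_shift M S \<epsilon> f + tensor_product tp
  for M :: "'w measure" and S :: "'s measure" and \<epsilon>
    and f :: "(nat \<Rightarrow> 's) \<Rightarrow> 'h::{real_inner, banach, second_countable_topology}"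
    and tp :: "'h \<Rightarrow> 'h \<Rightarrow> 'k::{real_inner, banach, second_countable_topology}"
begin

lemma inner_lag: "inner (\<integral>\<omega>. tp (Z 0 \<omega>) (Z (int r) \<omega>) \<partial>M) (tp a b) = \<gamma> r a b"
  by (subst inner_integral_tp) (simp_all add: Z_square \<gamma>_def)

text \<open>Bounds on the numbers \<open>\<gamma> r a b\<close> do not control the norm of the
  kernel, which in the application is a Hilbert-Schmidt norm. Instead a second copy of the
  probability space supplies resampled remote innovations: \<open>X\<close> has L2 distance
  \<open>\<delta> r\<close> from \<open>Z (int r)\<close>, and its tensor product with
  \<open>Z 0\<close> has mean zero, so in the mean \<open>Z (int r)\<close> may be replaced by
  \<open>Z (int r) - X\<close>.\<close>

lemma norm_lag_le: "norm (\<integral>\<omega>. tp (Z 0 \<omega>) (Z (int r) \<omega>) \<partial>M) \<le> v * \<delta> r"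
proof -
  interpret MM: pair_prob_space M M ..
  interpret P: prob_space P by (rule prob_space_P)
  define N where "N = M \<Otimes>\<^sub>M M"
  define X where "X z = f (merge_at r (past (int r) (fst z)) (past (int r) (snd z)))" for z
  have [measurable]: "X \<in> borel_measurable (M \<Otimes>\<^sub>M M)" unfolding X_def by measurable
  have law: "distr (M \<Otimes>\<^sub>M M) (SQ \<Otimes>\<^sub>M SQ) (\<lambda>(\<omega>, \<omega>'). (past (int r) \<omega>, past (int r) \<omega>')) = P \<Otimes>\<^sub>M P"
    using pair_measure_distr[of "past (int r)" M SQ "past (int r)" M SQ]
    by (simp add: law_past prob_space_imp_sigma_finite prob_space_P)
  have transfer: "integrable (M \<Otimes>\<^sub>M M) (\<lambda>z. g (past (int r) (fst z)) (past (int r) (snd z))) \<longleftrightarrow> integrable (P \<Otimes>\<^sub>M P) (\<lambda>z. g (fst z) (snd z))"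
    "(\<integral>z. g (past (int r) (fst z)) (past (int r) (snd z)) \<partial>(M \<Otimes>\<^sub>M M)) = (\<integral>z. g (fst z) (snd z) \<partial>(P \<Otimes>\<^sub>M P))"
    if [measurable]: "(\<lambda>z. g (fst z) (snd z)) \<in> borel_measurable (SQ \<Otimes>\<^sub>M SQ)" for g :: "_ \<Rightarrow> _ \<Rightarrow> real"
    unfolding law[symmetric]
    by (subst integrable_distr_eq, measurable, simp add: case_prod_unfold)
       (subst integral_distr, measurable, simp add: case_prod_unfold)
  have fst_int: "integrable (M \<Otimes>\<^sub>M M) (\<lambda>z. g (fst z))" "(\<integral>z. g (fst z) \<partial>(M \<Otimes>\<^sub>M M)) = (\<integral>\<omega>. g \<omega> \<partial>M)"
    if g: "integrable M g" for g :: "'w \<Rightarrow> 'c::{banach, second_countable_topology}"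
  proof -
    have [measurable]: "g \<in> borel_measurable M" using g by simp
    show 1: "integrable (M \<Otimes>\<^sub>M M) (\<lambda>z. g (fst z))"
      by (rule MM.Fubini_integrable) (use g in \<open>simp_all add: prob_space\<close>)
    show "(\<integral>z. g (fst z) \<partial>(M \<Otimes>\<^sub>M M)) = (\<integral>\<omega>. g \<omega> \<partial>M)"
      using MM.integral_fst'[OF 1] by (simp add: prob_space)
  qed
  have Z0: "integrable (M \<Otimes>\<^sub>M M) (\<lambda>z. (norm (Z 0 (fst z)))\<^sup>2)" "(\<integral>z. (norm (Z 0 (fst z)))\<^sup>2 \<partial>(M \<Otimes>\<^sub>M M)) = v\<^sup>2"
    using fst_int[OF Z_square(1)[of 0]] Z_square(2)[of 0] by simp_all
  have X2: "integrable (M \<Otimes>\<^sub>M M) (\<lambda>z. (norm (X z))\<^sup>2)"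
    unfolding X_def using integrable_merge_at[of "\<lambda>x. (norm (f x))\<^sup>2" r] f2
    by (subst transfer(1)[of "\<lambda>x y. (norm (f (merge_at r x y)))\<^sup>2"]) simp_all
  have D2: "integrable (M \<Otimes>\<^sub>M M) (\<lambda>z. (norm (Z (int r) (fst z) - X z))\<^sup>2)"
    "(\<integral>z. (norm (Z (int r) (fst z) - X z))\<^sup>2 \<partial>(M \<Otimes>\<^sub>M M)) = (\<delta> r)\<^sup>2"
    using transfer[of "\<lambda>x y. (norm (f x - f (merge_at r x y)))\<^sup>2"] integrable_f_diff[of r] integral_f_diff[of r]
    by (simp_all add: Z_def X_def)
  \<comment> \<open>Tested against simple tensors, the integral over the second copy turns the
    projection of \<open>X\<close> into \<open>trunc\<close>, which is orthogonal to that of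
    \<open>Z 0\<close>.\<close>
  have zero: "(\<integral>z. tp (Z 0 (fst z)) (X z) \<partial>(M \<Otimes>\<^sub>M M)) = 0"
  proof (rule separating)
    fix a b
    have i: "integrable (M \<Otimes>\<^sub>M M) (\<lambda>z. inner (Z 0 (fst z)) a * inner (X z) b)"
      by (rule integrable_mult_of_squares) (use Z0(1) X2 in \<open>simp_all add: integrable_inner_square(1)\<close>)
    have "inner (\<integral>z. tp (Z 0 (fst z)) (X z) \<partial>(M \<Otimes>\<^sub>M M)) (tp a b) = (\<integral>z. inner (Z 0 (fst z)) a * inner (X z) b \<partial>(M \<Otimes>\<^sub>M M))"
      by (rule inner_integral_tp) (use Z0 X2 in simp_all)
    also have "\<dots> = (\<integral>\<omega>. \<integral>\<omega>'. inner (Z 0 \<omega>) a * inner (X (\<omega>, \<omega>')) b \<partial>M \<partial>M)"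
      using MM.integral_fst'[OF i] by simp
    also have "\<dots> = (\<integral>\<omega>. inner (Z 0 \<omega>) a * trunc r (\<lambda>x. inner (f x) b) (past (int r) \<omega>) \<partial>M)"
    proof (rule Bochner_Integration.integral_cong[OF refl])
      fix \<omega> assume "\<omega> \<in> space M"
      then have [measurable]: "past (int r) \<omega> \<in> space SQ" using measurable_space[OF measurable_past] by blast
      show "(\<integral>\<omega>'. inner (Z 0 \<omega>) a * inner (X (\<omega>, \<omega>')) b \<partial>M) = inner (Z 0 \<omega>) a * trunc r (\<lambda>x. inner (f x) b) (past (int r) \<omega>)"
        using integral_past[of "\<lambda>y. inner (f (merge_at r (past (int r) \<omega>) y)) b" "int r"]
        by (simp add: X_def trunc_def)
    qed
    also have "\<dots> = 0"
      using dep_orthogonal(1)[OF dep_past[OF inner_f(1), of 0 a] _ inner_f[of b], of "int r" r] Z_inner_square(1)[of 0 a]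
      by (simp add: Z_def)
    finally show "inner (\<integral>z. tp (Z 0 (fst z)) (X z) \<partial>(M \<Otimes>\<^sub>M M)) (tp a b) = 0" .
  qed
  have i0: "integrable M (\<lambda>\<omega>. tp (Z 0 \<omega>) (Z (int r) \<omega>))"
    by (rule integrable_tp) (simp_all add: Z_square)
  have i1: "integrable (M \<Otimes>\<^sub>M M) (\<lambda>z. tp (Z 0 (fst z)) (X z))"
    by (rule integrable_tp) (use Z0 X2 in simp_all)
  have i2: "integrable (M \<Otimes>\<^sub>M M) (\<lambda>z. norm (Z 0 (fst z)) * norm (Z (int r) (fst z) - X z))"
    by (rule integrable_mult_of_squares) (use Z0 D2 in simp_all)
  have "(\<integral>\<omega>. tp (Z 0 \<omega>) (Z (int r) \<omega>) \<partial>M) = (\<integral>z. tp (Z 0 (fst z)) (Z (int r) (fst z)) \<partial>(M \<Otimes>\<^sub>M M))"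
    using fst_int(2)[OF i0] by simp
  also have "\<dots> = (\<integral>z. tp (Z 0 (fst z)) (Z (int r) (fst z) - X z) \<partial>(M \<Otimes>\<^sub>M M))"
    using fst_int(1)[OF i0] i1 zero by (simp add: tp_diff_right)
  also have "norm \<dots> \<le> (\<integral>z. norm (tp (Z 0 (fst z)) (Z (int r) (fst z) - X z)) \<partial>(M \<Otimes>\<^sub>M M))"
    by (rule integral_norm_bound)
  also have "\<dots> = (\<integral>z. norm (Z 0 (fst z)) * norm (Z (int r) (fst z) - X z) \<partial>(M \<Otimes>\<^sub>M M))"
    by (simp add: norm_tp)
  also have "\<dots> \<le> \<bar>\<dots>\<bar>" by simp
  also have "\<dots> \<le> sqrt (v\<^sup>2) * sqrt ((\<delta> r)\<^sup>2)"
    unfolding Z0(2)[symmetric] D2(2)[symmetric]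
    by (rule integral_Cauchy_Schwarz) (use Z0(1) D2(1) in simp_all)
  also have "\<dots> = v * \<delta> r" by (simp add: v_nonneg \<delta>_nonneg)
  finally show ?thesis .
qed

lemma lag_series:
  "summable (\<lambda>r. \<integral>\<omega>. tp (Z 0 \<omega>) (Z (int (Suc r)) \<omega>) \<partial>M)"
  "inner (\<Sum>r. \<integral>\<omega>. tp (Z 0 \<omega>) (Z (int (Suc r)) \<omega>) \<partial>M) (tp a b) = (\<Sum>r. \<gamma> (Suc r) a b)"
proof -
  show sm: "summable (\<lambda>r. \<integral>\<omega>. tp (Z 0 \<omega>) (Z (int (Suc r)) \<omega>) \<partial>M)"
    by (rule summable_comparison_test'[of "\<lambda>r. v * \<delta> (Suc r)" 0])
       (use norm_lag_le summable_\<delta> in \<open>auto intro!: summable_mult simp: summable_Suc_iff simp del: of_nat_Suc\<close>)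
  show "inner (\<Sum>r. \<integral>\<omega>. tp (Z 0 \<omega>) (Z (int (Suc r)) \<omega>) \<partial>M) (tp a b) = (\<Sum>r. \<gamma> (Suc r) a b)"
    unfolding inner_lag[symmetric] by (rule bounded_linear.suminf[OF bounded_linear_inner_left sm])
qed

end

section \<open>Tensor products of functions on the cube\<close>

lemma inner_tensor:
  fixes a x :: "'a::euclidean_space L2" and b y :: "'b::euclidean_space L2"
  shows "inner (tensor a b) (tensor x y) = inner a x * inner b y"
proof -
  obtain a' where a: "square_integrable a'" "a = abs_L2 a'" by (rule L2_cases)
  obtain b' where b: "square_integrable b'" "b = abs_L2 b'" by (rule L2_cases)
  obtain x' where x: "square_integrable x'" "x = abs_L2 x'" by (rule L2_cases)
  obtain y' where y: "square_integrable y'" "y = abs_L2 y'" by (rule L2_cases)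
  have t: "tensor (abs_L2 p) (abs_L2 q) = abs_L2 (\<lambda>(s, t). p s * q t)"
    if "square_integrable p" "square_integrable q" for p :: "'a \<Rightarrow> real" and q :: "'b \<Rightarrow> real"
    using that by (simp add: tensor.abs_eq L2_rel_refl)
  have i: "integrable (cube \<Otimes>\<^sub>M cube) (\<lambda>(s, t). (a' s * x' s) * (b' t * y' t))"
    using square_integrable_mult[OF a(1) x(1)] square_integrable_mult[OF b(1) y(1)]
      integrable_abs[OF square_integrable_mult[OF a(1) x(1)]]
    by (intro cube_pair.Fubini_integrable) (simp_all add: abs_mult)
  have "inner (tensor a b) (tensor x y) = (\<integral>z. (case z of (s, t) \<Rightarrow> a' s * b' t) * (case z of (s, t) \<Rightarrow> x' s * y' t) \<partial>cube)"
    unfolding a(2) b(2) x(2) y(2) t[OF a(1) b(1)] t[OF x(1) y(1)]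
    by (rule abs_L2_simps(3)) (rule square_integrable_tensor; fact)+
  also have "\<dots> = (\<integral>z. (case z of (s, t) \<Rightarrow> (a' s * x' s) * (b' t * y' t)) \<partial>(cube \<Otimes>\<^sub>M cube))"
    unfolding cube_prod by (rule Bochner_Integration.integral_cong) (auto simp: mult_ac)
  also have "\<dots> = (\<integral>s. \<integral>t. (a' s * x' s) * (b' t * y' t) \<partial>cube \<partial>cube)"
    using cube_pair.integral_fst'[OF i] by simp
  also have "\<dots> = inner a x * inner b y"
    unfolding a(2) b(2) x(2) y(2) by (simp add: abs_L2_simps a(1) b(1) x(1) y(1))
  finally show ?thesis .
qed

text \<open>The squared norm of each difference expands through \<open>inner_tensor\<close> to 0, so
  representatives do not come up.\<close>

lemma tensor_bilinear:
  fixes a a' :: "'a::euclidean_space L2" and b b' :: "'b::euclidean_space L2"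
  shows "tensor (a + a') b = tensor a b + tensor a' b" "tensor a (b + b') = tensor a b + tensor a b'"
    "tensor (r *\<^sub>R a) b = r *\<^sub>R tensor a b" "tensor a (r *\<^sub>R b) = r *\<^sub>R tensor a b"
proof -
  have eq0: "x = y" if "inner (x - y) (x - y) = 0" for x y :: "('a \<times> 'b) L2"
    using that by simp
  show "tensor (a + a') b = tensor a b + tensor a' b"
    by (rule eq0) (simp add: inner_diff_left inner_diff_right inner_add_left inner_add_right inner_tensor algebra_simps)
  show "tensor a (b + b') = tensor a b + tensor a b'"
    by (rule eq0) (simp add: inner_diff_left inner_diff_right inner_add_left inner_add_right inner_tensor algebra_simps)
  show "tensor (r *\<^sub>R a) b = r *\<^sub>R tensor a b"
    by (rule eq0) (simp add: inner_diff_left inner_diff_right inner_tensor algebra_simps)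
  show "tensor a (r *\<^sub>R b) = r *\<^sub>R tensor a b"
    by (rule eq0) (simp add: inner_diff_left inner_diff_right inner_tensor algebra_simps)
qed

text \<open>Tested on indicators, the hypothesis says that \<open>k\<close> integrates to 0 over all
  measurable rectangles. These form an intersection-stable generator, so the integral vanishes over
  every measurable set and \<open>k\<close> is 0 almost everywhere.\<close>

lemma tensor_separating:
  fixes \<kappa> :: "('a::euclidean_space \<times> 'b::euclidean_space) L2"
  assumes "\<And>a b. inner \<kappa> (tensor a b) = 0"
  shows "\<kappa> = 0"
proof -
  obtain k where k: "square_integrable k" "\<kappa> = abs_L2 k" by (rule L2_cases)
  let ?\<mu> = "cube \<Otimes>\<^sub>M cube :: ('a \<times> 'b) measure"
  interpret \<mu>: prob_space ?\<mu> unfolding cube_prod[symmetric] by (rule prob_space_cube)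
  have k_int: "integrable ?\<mu> k"
    using square_integrable_mult[OF k(1) square_integrable_const[of 1]] unfolding cube_prod[symmetric] by simp
  have rect: "(\<integral>z. k z * indicator (A \<times> B) z \<partial>?\<mu>) = 0" if A: "A \<in> sets borel" and B: "B \<in> sets borel" for A B
  proof -
    have "inner \<kappa> (tensor (abs_L2 (indicator A)) (abs_L2 (indicator B))) = (\<integral>z. k z * (case z of (s, t) \<Rightarrow> indicator A s * indicator B t) \<partial>cube)"
      unfolding k(2) using square_integrable_indicator[OF A] square_integrable_indicator[OF B]
      by (simp add: tensor.abs_eq L2_rel_refl abs_L2_simps k(1) square_integrable_tensor)
    also have "\<dots> = (\<integral>z. k z * indicator (A \<times> B) z \<partial>?\<mu>)"
      unfolding cube_prod by (rule Bochner_Integration.integral_cong) (auto simp: indicator_def)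
    finally show ?thesis using assms by simp
  qed
  have set_int: "set_integrable ?\<mu> E k" if "E \<in> sets ?\<mu>" for E
    unfolding set_integrable_def by (rule integrable_mult_indicator[OF that k_int])
  have all: "(LINT z:E|?\<mu>. k z) = 0" if "E \<in> sets ?\<mu>" for E
    using Int_stable_pair_measure_generator pair_measure_closed that
    unfolding sets_pair_measure
  proof (induct rule: sigma_sets_induct_disjoint)
    case (basic E)
    then show ?case using rect by (auto simp: set_lebesgue_integral_def mult.commute)
  next
    case empty
    show ?case by (simp add: set_lebesgue_integral_def)
  next
    case (compl E)
    then have E: "E \<in> sets ?\<mu>" unfolding sets_pair_measure by simp
    have U: "UNIV \<in> sets ?\<mu>" using sets.top[of ?\<mu>] by (simp add: space_pair_measure)
    have "(LINT z:UNIV|?\<mu>. k z) = 0"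
      using rect[of UNIV UNIV] by (simp add: set_lebesgue_integral_def)
    moreover have "(LINT z:(UNIV - E) \<union> E|?\<mu>. k z) = (LINT z:UNIV - E|?\<mu>. k z) + (LINT z:E|?\<mu>. k z)"
      by (rule set_integral_Un) (use set_int[OF E] set_int[OF sets.Diff[OF U E]] in auto)
    moreover have "(UNIV - E) \<union> E = UNIV" by blast
    ultimately show ?case using compl by simp
  next
    case (union A)
    have s: "A i \<in> sets ?\<mu>" for i using union(2) unfolding sets_pair_measure by blast
    have "(LINT z:(\<Union>i. A i)|?\<mu>. k z) = (\<Sum>i. LINT z:A i|?\<mu>. k z)"
      by (rule lebesgue_integral_countable_add) (use s union(1) set_int in \<open>auto simp: disjoint_family_on_def\<close>)
    then show ?case using union(3) by simp
  qed
  have "AE z in ?\<mu>. k z = 0"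
    using density_unique_real[OF k_int, of "\<lambda>_. 0"] all by simp
  then have "(\<integral>z. (k z)\<^sup>2 \<partial>?\<mu>) = 0"
    by (intro integral_eq_zero_AE) (auto elim: eventually_mono)
  then have "(norm \<kappa>)\<^sup>2 = 0" unfolding k(2) by (simp add: norm_abs_L2[OF k(1)] cube_prod)
  then show ?thesis by simp
qed

lemma tensor_product_tensor: "tensor_product (tensor :: 'a::euclidean_space L2 \<Rightarrow> 'a L2 \<Rightarrow> _)"
proof (rule tensor_product.intro)
  show "bounded_bilinear (tensor :: 'a L2 \<Rightarrow> 'a L2 \<Rightarrow> _)"
  proof
    show "\<exists>K. \<forall>a b :: 'a L2. norm (tensor a b) \<le> norm a * norm b * K"
      by (intro exI[of _ 1]) (simp add: norm_eq_sqrt_inner inner_tensor real_sqrt_mult)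
  qed (simp_all add: tensor_bilinear)
qed (auto simp: inner_tensor intro: tensor_separating)

lemma tensor_product_flip: "tensor_product (\<lambda>x y. tensor y x :: ('a::euclidean_space \<times> 'a) L2)"
proof -
  interpret tensor_product "tensor :: 'a L2 \<Rightarrow> 'a L2 \<Rightarrow> _" by (rule tensor_product_tensor)
  show ?thesis
  proof (rule tensor_product.intro)
    show "bounded_bilinear (\<lambda>x y. tensor y x :: ('a \<times> 'a) L2)"
      by (rule bounded_bilinear.flip[OF bilinear])
  qed (auto simp: inner_tp intro: separating)
qed

lemma inner_long_run_cov:
  fixes g :: "(nat \<Rightarrow> 's) \<Rightarrow> 'a::euclidean_space L2"
  assumes "h_shift M S \<epsilon> g"
  shows "inner (long_run_cov M (h_shift.Z \<epsilon> g)) (tensor a b) = h_shift.B M \<epsilon> g a b"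
proof -
  interpret h_shift M S \<epsilon> g by fact
  interpret t: tensor_shift M S \<epsilon> g tensor
    by (intro tensor_shift.intro assms tensor_product_tensor)
  \<comment> \<open>The tensor of \<open>Z (int (Suc t))\<close> with \<open>Z 0\<close> is the
    flipped product of \<open>Z 0\<close> with \<open>Z (int (Suc t))\<close>, so the second series
    is the same lag series with \<open>a\<close> and \<open>b\<close> exchanged.\<close>
  interpret t': tensor_shift M S \<epsilon> g "\<lambda>x y. tensor y x"
    by (intro tensor_shift.intro assms tensor_product_flip)
  show ?thesis
    unfolding long_run_cov_def cross_moment_def B_def
    using t.inner_lag[of 0 a b] t.lag_series(2)[of a b] t'.lag_series(2)[where a = b and b = a]
    by (simp add: inner_add_left del: of_nat_Suc)
qed

section \<open>From approximability to Bernoulli shifts\<close>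

lemma norm_powr_2: "norm x powr 2 = (norm x)\<^sup>2"
  by (cases "norm x = 0") auto

lemma in_Lp_2: "in_Lp M 2 X \<longleftrightarrow> X \<in> borel_measurable M \<and> integrable M (\<lambda>\<omega>. (norm (X \<omega>))\<^sup>2)"
  by (simp add: in_Lp_def norm_powr_2)

lemma Lp_norm_2: "Lp_norm M 2 X = sqrt (\<integral>\<omega>. (norm (X \<omega>))\<^sup>2 \<partial>M)"
  by (simp add: Lp_norm_def norm_powr_2 powr_half_sqrt)

text \<open>The copy has the law of the innovations and is independent of them, so the pair of pasts
  has law \<open>b.P \<Otimes>\<^sub>M b.P\<close>. Every approximation norm becomes an integral
  over this product, and the particular copies drop out.\<close>

lemma Lp_m_approximable_h_shift:
  fixes Z :: "int \<Rightarrow> 'w \<Rightarrow> 'a::euclidean_space L2" and S :: "'s measure"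
  assumes M: "prob_space M" and appr: "Lp_m_approximable M S 2 Z" and mean: "\<And>t. (\<integral>\<omega>. Z t \<omega> \<partial>M) = 0"
  obtains \<epsilon> f where "h_shift M S \<epsilon> f" "\<And>t. AE \<omega> in M. Z t \<omega> = h_shift.Z \<epsilon> f t \<omega>"
proof -
  interpret prob_space M by fact
  obtain f \<epsilon> \<epsilon>' where f: "f \<in> borel_measurable (\<Pi>\<^sub>M k\<in>(UNIV :: nat set). S)"
    and indep: "indep_vars (\<lambda>_. S) \<epsilon> (UNIV :: int set)" and ident: "\<And>j. distr M S (\<epsilon> j) = distr M S (\<epsilon> 0)"
    and Z: "\<And>t. AE \<omega> in M. Z t \<omega> = f (\<lambda>k. \<epsilon> (t - int k) \<omega>)"
    and copy: "\<And>m t. m \<ge> 1 \<Longrightarrow> indep_var (\<Pi>\<^sub>M k\<in>UNIV. S) (\<lambda>\<omega> k. \<epsilon> k \<omega>) (\<Pi>\<^sub>M k\<in>UNIV. S) (\<lambda>\<omega> k. \<epsilon>' m t k \<omega>) \<and>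
        distr M (\<Pi>\<^sub>M k\<in>UNIV. S) (\<lambda>\<omega> k. \<epsilon>' m t k \<omega>) = distr M (\<Pi>\<^sub>M k\<in>UNIV. S) (\<lambda>\<omega> k. \<epsilon> k \<omega>)"
    and sm: "\<And>t. summable (\<lambda>m. Lp_norm M 2 (\<lambda>\<omega>. Z t \<omega> -
        f (\<lambda>k. if k < Suc m then \<epsilon> (t - int k) \<omega> else \<epsilon>' (Suc m) t (t - int k) \<omega>)))"
    using appr unfolding Lp_m_approximable_def by blast
  have Z_meas: "Z t \<in> borel_measurable M" and Z_sq: "integrable M (\<lambda>\<omega>. (norm (Z t \<omega>))\<^sup>2)" for t
    using appr unfolding Lp_m_approximable_def in_Lp_2 by blast+
  interpret b: bernoulli_shift M S \<epsilon>
    by unfold_locales (use indep ident in auto)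
  note [measurable] = f
  have Zp: "AE \<omega> in M. Z t \<omega> = f (b.past t \<omega>)" for t
    using Z[of t] by (simp add: b.past_def)
  have f2: "integrable b.P (\<lambda>x. (norm (f x))\<^sup>2)"
  proof -
    have "integrable M (\<lambda>\<omega>. (norm (f (b.past 0 \<omega>)))\<^sup>2)"
      by (rule integrable_cong_AE_imp[OF Z_sq[of 0]]) (use Zp[of 0] in \<open>auto elim: eventually_mono\<close>)
    then show ?thesis using b.integrable_past[of "\<lambda>x. (norm (f x))\<^sup>2" 0] by simp
  qed
  have f_mean: "(\<integral>x. f x \<partial>b.P) = 0"
  proof -
    have "(\<integral>\<omega>. Z 0 \<omega> \<partial>M) = (\<integral>\<omega>. f (b.past 0 \<omega>) \<partial>M)"
      by (rule integral_cong_AE) (use Zp Z_meas in auto)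
    then show ?thesis using mean[of 0] b.integral_past[OF f, of 0] by simp
  qed
  have norm_eq: "Lp_norm M 2 (\<lambda>\<omega>. Z 0 \<omega> - f (\<lambda>k. if k < Suc m then \<epsilon> (0 - int k) \<omega> else \<epsilon>' (Suc m) 0 (0 - int k) \<omega>))
      = sqrt (\<integral>z. (norm (f (fst z) - f (merge_at (Suc m) (fst z) (snd z))))\<^sup>2 \<partial>(b.P \<Otimes>\<^sub>M b.P))" for m
  proof -
    define past' where "past' \<omega> = (\<lambda>k. \<epsilon>' (Suc m) 0 (0 - int k) \<omega>)" for \<omega>
    let ?SZ = "\<Pi>\<^sub>M k\<in>(UNIV::int set). S" and ?g = "\<lambda>(x :: int \<Rightarrow> 's) (k::nat). x (0 - int k)"
    have g: "?g \<in> measurable ?SZ b.SQ" by (rule measurable_PiM_single') (auto simp: space_PiM)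
    have ind: "indep_var ?SZ (\<lambda>\<omega> k. \<epsilon> k \<omega>) ?SZ (\<lambda>\<omega> k. \<epsilon>' (Suc m) 0 k \<omega>)"
      and same: "distr M ?SZ (\<lambda>\<omega> k. \<epsilon>' (Suc m) 0 k \<omega>) = distr M ?SZ (\<lambda>\<omega> k. \<epsilon> k \<omega>)"
      using copy[of "Suc m" 0] by simp_all
    have "indep_var b.SQ (?g \<circ> (\<lambda>\<omega> k. \<epsilon> k \<omega>)) b.SQ (?g \<circ> (\<lambda>\<omega> k. \<epsilon>' (Suc m) 0 k \<omega>))"
      by (rule indep_var_compose[OF ind g g])
    then have ind': "indep_var b.SQ (b.past 0) b.SQ past'"
      by (simp add: comp_def b.past_def[abs_def] past'_def[abs_def])
    have meas': "past' \<in> measurable M b.SQ" using indep_var_rv2[OF ind'] .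
    have "distr M b.SQ past' = distr (distr M ?SZ (\<lambda>\<omega> k. \<epsilon>' (Suc m) 0 k \<omega>)) b.SQ ?g"
      using indep_var_rv2[OF ind] g by (subst distr_distr) (auto simp: comp_def past'_def[abs_def])
    also have "\<dots> = distr M b.SQ (b.past 0)"
      unfolding same using indep_var_rv1[OF ind] g by (subst distr_distr) (auto simp: comp_def b.past_def[abs_def])
    finally have law': "distr M b.SQ past' = b.P" by (simp add: b.law_past)
    have law: "distr M (b.SQ \<Otimes>\<^sub>M b.SQ) (\<lambda>\<omega>. (b.past 0 \<omega>, past' \<omega>)) = b.P \<Otimes>\<^sub>M b.P"
      using ind' unfolding indep_var_distribution_eq law' b.law_past by simp
    note [measurable] = meas' Z_meas
    have merge: "(\<lambda>k. if k < Suc m then \<epsilon> (0 - int k) \<omega> else \<epsilon>' (Suc m) 0 (0 - int k) \<omega>) = merge_at (Suc m) (b.past 0 \<omega>) (past' \<omega>)" for \<omega>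
      unfolding merge_at_def b.past_def past'_def ..
    have "(\<integral>\<omega>. (norm (Z 0 \<omega> - f (merge_at (Suc m) (b.past 0 \<omega>) (past' \<omega>))))\<^sup>2 \<partial>M)
        = (\<integral>\<omega>. (norm (f (b.past 0 \<omega>) - f (merge_at (Suc m) (b.past 0 \<omega>) (past' \<omega>))))\<^sup>2 \<partial>M)"
      by (rule integral_cong_AE) (use Zp[of 0] in \<open>auto elim: eventually_mono\<close>)
    also have "\<dots> = (\<integral>z. (norm (f (fst z) - f (merge_at (Suc m) (fst z) (snd z))))\<^sup>2 \<partial>(b.P \<Otimes>\<^sub>M b.P))"
      unfolding law[symmetric] by (subst integral_distr) simp_all
    finally show ?thesis unfolding Lp_norm_2 merge by simp
  qed
  have "summable (\<lambda>r. sqrt (\<integral>z. (norm (f (fst z) - f (merge_at r (fst z) (snd z))))\<^sup>2 \<partial>(b.P \<Otimes>\<^sub>M b.P)))"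
    using sm[of 0] unfolding norm_eq by (subst (asm) summable_Suc_iff)
  then interpret h: h_shift M S \<epsilon> f
    by unfold_locales (use f f2 f_mean in auto)
  show ?thesis
    by (rule that[OF h.h_shift_axioms]) (use Zp in \<open>simp add: h.Z_def\<close>)
qed

lemma long_run_cov_cong:
  assumes "\<And>t. AE \<omega> in M. Z t \<omega> = Z' t \<omega>"
    and [measurable]: "\<And>t. Z t \<in> borel_measurable M" "\<And>t. Z' t \<in> borel_measurable M"
  shows "long_run_cov M Z = long_run_cov M Z'"
proof -
  interpret tensor_product "tensor :: 'b L2 \<Rightarrow> 'b L2 \<Rightarrow> _" by (rule tensor_product_tensor)
  have "cross_moment M (Z s) (Z t) = cross_moment M (Z' s) (Z' t)" for s t
    unfolding cross_moment_def
  proof (rule integral_cong_AE)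
    show "AE \<omega> in M. tensor (Z s \<omega>) (Z t \<omega>) = tensor (Z' s \<omega>) (Z' t \<omega>)"
      using assms(1)[of s] assms(1)[of t] by eventually_elim simp
  qed measurable
  then show ?thesis by (simp add: long_run_cov_def)
qed

section \<open>Covariance operator and the Gaussian limit\<close>

lemma norm_le_of_inner:
  fixes x :: "'h::real_inner"
  assumes "\<And>y. inner x y \<le> c * norm y" "0 \<le> c"
  shows "norm x \<le> c"
proof (cases "x = 0")
  case False
  have "norm x * norm x \<le> c * norm x" using assms(1)[of x] by (simp add: power2_norm_eq_inner[symmetric] power2_eq_square)
  then show ?thesis using False by simp
qed (use assms in simp)

context h_shift
begin

lemma mean_lag:
  shows "inner (\<integral>\<omega>. inner (Z s \<omega>) y *\<^sub>R Z t \<omega> \<partial>M) x = (\<integral>\<omega>. inner (Z s \<omega>) y * inner (Z t \<omega>) x \<partial>M)"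
proof -
  have "integrable M (\<lambda>\<omega>. norm (Z t \<omega>) * \<bar>inner (Z s \<omega>) y\<bar>)"
    by (rule integrable_mult_of_squares) (use Z_square Z_inner_square in simp_all)
  then have "integrable M (\<lambda>\<omega>. norm (inner (Z s \<omega>) y *\<^sub>R Z t \<omega>))" by (simp add: mult.commute)
  then have "integrable M (\<lambda>\<omega>. inner (Z s \<omega>) y *\<^sub>R Z t \<omega>)" by (subst (asm) integrable_norm_iff) simp_all
  then show ?thesis using integral_inner_left[of x M "\<lambda>\<omega>. inner (Z s \<omega>) y *\<^sub>R Z t \<omega>"] by simp
qed

text \<open>The vector representing the functional \<open>B\<close> at \<open>y\<close>.
  \<open>gaussian_with_covariance\<close> takes such vectors as coefficients of its series.\<close>

definition cov_op :: "'h \<Rightarrow> 'h"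
  where "cov_op y = (\<integral>\<omega>. inner (Z 0 \<omega>) y *\<^sub>R Z 0 \<omega> \<partial>M)
    + (\<Sum>r. \<integral>\<omega>. inner (Z 0 \<omega>) y *\<^sub>R Z (int (Suc r)) \<omega> \<partial>M)
    + (\<Sum>r. \<integral>\<omega>. inner (Z (int (Suc r)) \<omega>) y *\<^sub>R Z 0 \<omega> \<partial>M)"

lemma inner_cov_op: "inner x (cov_op y) = B x y"
proof -
  have eq1: "inner (\<integral>\<omega>. inner (Z 0 \<omega>) y *\<^sub>R Z (int r) \<omega> \<partial>M) x = \<gamma> r y x" for r y x
    unfolding mean_lag \<gamma>_def ..
  have eq2: "inner (\<integral>\<omega>. inner (Z (int r) \<omega>) y *\<^sub>R Z 0 \<omega> \<partial>M) x = \<gamma> r x y" for r y x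
    unfolding mean_lag \<gamma>_def by (simp add: mult.commute)
  have le: "norm (\<integral>\<omega>. inner (Z 0 \<omega>) y *\<^sub>R Z (int r) \<omega> \<partial>M) \<le> (norm y * v) * \<delta> r"
    "norm (\<integral>\<omega>. inner (Z (int r) \<omega>) y *\<^sub>R Z 0 \<omega> \<partial>M) \<le> (norm y * v) * \<delta> r" for r
  proof -
    have a: "\<gamma> r a b \<le> norm a * v * (norm b * \<delta> r)" for a b
      using \<gamma>_le[of r a b] by linarith
    show "norm (\<integral>\<omega>. inner (Z 0 \<omega>) y *\<^sub>R Z (int r) \<omega> \<partial>M) \<le> (norm y * v) * \<delta> r"
      by (rule norm_le_of_inner) (use a[of y] v_nonneg \<delta>_nonneg in \<open>simp_all add: eq1 mult_ac\<close>)
    show "norm (\<integral>\<omega>. inner (Z (int r) \<omega>) y *\<^sub>R Z 0 \<omega> \<partial>M) \<le> (norm y * v) * \<delta> r"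
      by (rule norm_le_of_inner) (use a[of _ y] v_nonneg \<delta>_nonneg in \<open>simp_all add: eq2 mult_ac\<close>)
  qed
  have sm_Suc: "summable (\<lambda>r. (norm y * v) * \<delta> (Suc r))"
    using summable_\<delta> by (intro summable_mult) (simp add: summable_Suc_iff)
  have sm1: "summable (\<lambda>r. \<integral>\<omega>. inner (Z 0 \<omega>) y *\<^sub>R Z (int (Suc r)) \<omega> \<partial>M)"
    by (rule summable_comparison_test'[OF sm_Suc, of 0]) (rule le)
  have sm2: "summable (\<lambda>r. \<integral>\<omega>. inner (Z (int (Suc r)) \<omega>) y *\<^sub>R Z 0 \<omega> \<partial>M)"
    by (rule summable_comparison_test'[OF sm_Suc, of 0]) (rule le)
  have "inner (cov_op y) x = \<gamma> 0 y x + (\<Sum>r. \<gamma> (Suc r) y x) + (\<Sum>r. \<gamma> (Suc r) x y)"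
    unfolding cov_op_def inner_add_left bounded_linear.suminf[OF bounded_linear_inner_left sm1]
      bounded_linear.suminf[OF bounded_linear_inner_left sm2] eq1 eq2
    using eq1[of y 0 x] by simp
  then show ?thesis using \<gamma>_0_sym[of x y] by (simp add: B_def inner_commute)
qed

end

text \<open>Factorise the form by \<open>psd_form_expansion\<close> and use the factors as coefficients of independent
  normal variables.\<close>

lemma gaussian_with_covariance:
  fixes Q :: "'h::{real_inner, banach, second_countable_topology} \<Rightarrow> 'h \<Rightarrow> real"
  assumes Q: "psd_form Q" and bound: "\<And>x. Q x x \<le> C * (norm x)\<^sup>2" and op: "\<And>x y. Q x y = inner x (A y)"
    and e: "parseval e" and trace: "\<And>n. (\<Sum>k<n. Q (e k) (e k)) \<le> \<tau>"
  obtains G where "G \<in> borel_measurable normal_seq"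
    and "\<And>x. (CLINT \<omega>|normal_seq. iexp (inner (G \<omega>) x)) = of_real (exp (- Q x x / 2))"
proof -
  interpret psd_form Q by fact
  obtain y where y: "\<And>x. (\<lambda>k. (Q x (y k))\<^sup>2) sums Q x x"
    using psd_form_expansion[OF Q bound] by blast
  \<comment> \<open>The squares of \<open>inner (l k) x\<close> then add up to \<open>Q x x\<close>,
    the variance wanted.\<close>
  define l where "l k = A (y k)" for k
  have l: "inner (l k) x = Q x (y k)" for k x by (simp add: l_def op inner_commute)
  \<comment> \<open>Expanding along the frame and exchanging the sums bounds the total squared norm
    of the coefficients by the trace of \<open>Q\<close>.\<close>
  have le: "(\<Sum>k<n. (norm (l k))\<^sup>2) \<le> \<tau>" for n
  proof (rule LIMSEQ_le_const2)
    show "(\<lambda>N. \<Sum>k<n. \<Sum>i<N. (inner (l k) (e i))\<^sup>2) \<longlonglongrightarrow> (\<Sum>k<n. (norm (l k))\<^sup>2)"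
      by (intro tendsto_sum parseval_tendsto[OF e])
    have "(\<Sum>k<n. \<Sum>i<N. (inner (l k) (e i))\<^sup>2) \<le> \<tau>" for N
    proof -
      have "(\<Sum>k<n. \<Sum>i<N. (inner (l k) (e i))\<^sup>2) = (\<Sum>i<N. \<Sum>k<n. (Q (e i) (y k))\<^sup>2)"
        unfolding l by (rule sum.swap)
      also have "\<dots> \<le> (\<Sum>i<N. Q (e i) (e i))"
        unfolding sums_unique[OF y] by (intro sum_mono sum_le_suminf) (use y in \<open>auto simp: sums_iff\<close>)
      finally show ?thesis using trace[of N] by linarith
    qed
    then show "\<exists>N0. \<forall>N\<ge>N0. (\<Sum>k<n. \<Sum>i<N. (inner (l k) (e i))\<^sup>2) \<le> \<tau>" by blast
  qed
  have "summable (\<lambda>k. (norm (l k))\<^sup>2)"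
    by (rule summableI_nonneg_bounded[where x = \<tau>]) (use le in simp_all)
  then obtain G where "G \<in> borel_measurable normal_seq"
    "\<And>x. (CLINT \<omega>|normal_seq. iexp (inner (G \<omega>) x)) = of_real (exp (- (\<Sum>k. (inner (l k) x)\<^sup>2) / 2))"
    by (rule gaussian_vector_exists) blast
  then show ?thesis
    by (intro that) (simp_all add: l sums_unique[OF y, symmetric])
qed

text \<open>The law on L2 itself serves as the probability space, with the identity as random
  element. The moments are read off the one-dimensional normal laws: the frame turns the trace bound
  into a finite second moment of the norm, polarisation gives the mixed moments, and totality of the
  simple tensors identifies the covariance kernel.\<close>

lemma gaussian_element_exists:
  fixes Q :: "'a::euclidean_space L2 \<Rightarrow> 'a L2 \<Rightarrow> real" and \<kappa> :: "('a \<times> 'a) L2"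
  assumes Q: "psd_form Q" and bound: "\<And>x. Q x x \<le> C * (norm x)\<^sup>2" and op: "\<And>x y. Q x y = inner x (A y)"
    and e: "parseval e" and trace: "\<And>n. (\<Sum>k<n. Q (e k) (e k)) \<le> \<tau>"
    and \<kappa>: "\<And>a b. inner \<kappa> (tensor a b) = Q a b"
  obtains N :: "'a L2 measure" where "prob_space N" "sets N = sets borel" "in_Lp N 2 (\<lambda>x. x)" "gaussian N (\<lambda>x. x)" "(\<integral>x. x \<partial>N) = 0"
    "cross_moment N (\<lambda>x. x) (\<lambda>x. x) = \<kappa>"
    "\<And>x. (CLINT z|N. iexp (inner z x)) = of_real (exp (- Q x x / 2))"
proof -
  interpret psd_form Q by fact
  interpret tensor_product "tensor :: 'a L2 \<Rightarrow> 'a L2 \<Rightarrow> _" by (rule tensor_product_tensor)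
  interpret \<gamma>: prob_space std_normal_distribution by (rule prob_space_std_normal)
  interpret \<nu>: prob_space normal_seq by (rule prob_space_normal_seq)
  obtain G where G [measurable]: "G \<in> borel_measurable normal_seq"
    and char: "\<And>x. (CLINT \<omega>|normal_seq. iexp (inner (G \<omega>) x)) = of_real (exp (- Q x x / 2))"
    using gaussian_with_covariance[OF Q bound op e trace] by blast
  define N where "N = distr normal_seq borel G"
  interpret N: prob_space N unfolding N_def by (rule \<nu>.prob_space_distr) simp
  have sets_N [measurable_cong, simp]: "sets N = sets borel" by (simp add: N_def)
  have charN: "(CLINT z|N. iexp (inner z x)) = of_real (exp (- Q x x / 2))" for x
    unfolding N_def by (subst integral_distr) (simp_all add: char)
  have law: "distr N borel (\<lambda>z. inner z x) = distr std_normal_distribution borel (\<lambda>g. sqrt (Q x x) * g)" for x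
  proof (rule normal_law_of_char[OF N.prob_space_axioms _ nonneg])
    show "(CLINT z|N. iexp (t * inner z x)) = of_real (exp (- t\<^sup>2 * Q x x / 2))" for t
      using charN[of "t *\<^sub>R x"] by (simp add: scale_left scale_right power2_eq_square mult_ac)
  qed simp
  have sq: "integrable std_normal_distribution (\<lambda>g. g\<^sup>2)" "(\<integral>g. g\<^sup>2 \<partial>std_normal_distribution) = 1"
    using std_normal_distribution_even_moments[of 1] by (simp_all add: fact_numeral)
  have lin: "(\<integral>g. g \<partial>std_normal_distribution) = 0"
    using integral_std_normal_distribution_moment_odd[of 1] by simp
  have mean_x: "(\<integral>z. inner z x \<partial>N) = 0" for x
  proof -
    have "(\<integral>z. inner z x \<partial>N) = (\<integral>y. y \<partial>distr N borel (\<lambda>z. inner z x))"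
      by (subst integral_distr) simp_all
    also have "\<dots> = (\<integral>g. sqrt (Q x x) * g \<partial>std_normal_distribution)"
      unfolding law by (subst integral_distr) simp_all
    finally show ?thesis using lin by simp
  qed
  have var_x: "integrable N (\<lambda>z. (inner z x)\<^sup>2)" "(\<integral>z. (inner z x)\<^sup>2 \<partial>N) = Q x x" for x
  proof -
    have i: "integrable std_normal_distribution (\<lambda>g. (sqrt (Q x x) * g)\<^sup>2)"
      using sq(1) by (simp add: power_mult_distrib)
    have "integrable (distr N borel (\<lambda>z. inner z x)) (\<lambda>y. y\<^sup>2)"
      unfolding law by (subst integrable_distr_eq) (use i in simp_all)
    then show "integrable N (\<lambda>z. (inner z x)\<^sup>2)" by (subst (asm) integrable_distr_eq) simp_all
    have "(\<integral>z. (inner z x)\<^sup>2 \<partial>N) = (\<integral>y. y\<^sup>2 \<partial>distr N borel (\<lambda>z. inner z x))"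
      by (subst integral_distr) simp_all
    also have "\<dots> = (\<integral>g. (sqrt (Q x x) * g)\<^sup>2 \<partial>std_normal_distribution)"
      unfolding law by (subst integral_distr) simp_all
    also have "\<dots> = Q x x"
      using sq(2) nonneg[of x] by (simp add: power_mult_distrib)
    finally show "(\<integral>z. (inner z x)\<^sup>2 \<partial>N) = Q x x" .
  qed
  have norm2: "integrable N (\<lambda>z. (norm z)\<^sup>2)"
  proof (rule integrableI_nonneg)
    have "(\<integral>\<^sup>+z. ennreal ((norm z)\<^sup>2) \<partial>N) = (\<integral>\<^sup>+z. (\<Sum>k. ennreal ((inner z (e k))\<^sup>2)) \<partial>N)"
    proof (rule nn_integral_cong)
      fix z
      have "(\<lambda>k. (inner z (e k))\<^sup>2) sums (norm z)\<^sup>2" using e by (simp add: parseval_def)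
      then show "ennreal ((norm z)\<^sup>2) = (\<Sum>k. ennreal ((inner z (e k))\<^sup>2))"
        by (subst suminf_ennreal2) (auto simp: sums_iff)
    qed
    also have "\<dots> = (\<Sum>k. \<integral>\<^sup>+z. ennreal ((inner z (e k))\<^sup>2) \<partial>N)"
      by (rule nn_integral_suminf) simp
    also have "\<dots> = (\<Sum>k. ennreal (Q (e k) (e k)))"
      by (simp add: nn_integral_eq_integral[OF var_x(1)] var_x(2))
    also have "\<dots> < \<infinity>"
    proof -
      have "summable (\<lambda>k. Q (e k) (e k))"
        by (rule summableI_nonneg_bounded[where x = \<tau>]) (use nonneg trace in simp_all)
      then show ?thesis by (subst suminf_ennreal2) (simp_all add: nonneg)
    qed
    finally show "(\<integral>\<^sup>+z. ennreal ((norm z)\<^sup>2) \<partial>N) < \<infinity>" .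
  qed simp_all
  have int: "integrable N (\<lambda>z. z)"
    by (rule integrable_of_square_norm) (use norm2 N.finite_measure_axioms in simp_all)
  have prod: "(\<integral>z. inner z a * inner z b \<partial>N) = Q a b" for a b
  proof -
    have i: "integrable N (\<lambda>z. inner z a * inner z b)"
      by (rule integrable_mult_of_squares) (simp_all add: var_x)
    have "(inner z (a + b))\<^sup>2 = (inner z a)\<^sup>2 + 2 * (inner z a * inner z b) + (inner z b)\<^sup>2" for z
      by (simp add: inner_add_right power2_eq_square algebra_simps)
    then have "Q (a + b) (a + b) = Q a a + 2 * (\<integral>z. inner z a * inner z b \<partial>N) + Q b b"
      using var_x(2)[of "a + b"] var_x[of a] var_x[of b] i by simp
    moreover have "Q (a + b) (a + b) = Q a a + 2 * Q a b + Q b b"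
      using sym[of a b] by (simp add: add_left add_right)
    ultimately show ?thesis by linarith
  qed
  show ?thesis
  proof
    show "prob_space N" by (rule N.prob_space_axioms)
    show "sets N = sets borel" by simp
    show "in_Lp N 2 (\<lambda>x. x)" using norm2 by (simp add: in_Lp_2)
    show "gaussian N (\<lambda>x. x)"
      unfolding gaussian_def
    proof (intro conjI allI)
      fix x
      show "\<exists>\<mu> \<sigma>. distr N borel (\<lambda>\<omega>. inner \<omega> x) = return borel \<mu> \<or>
          \<sigma> > 0 \<and> distr N borel (\<lambda>\<omega>. inner \<omega> x) = density lborel (normal_density \<mu> \<sigma>)"
        unfolding law using normal_law_cases[OF nonneg, of x] by blast
    qed simp
    show "(\<integral>x. x \<partial>N) = 0"
    proof -
      have "inner (\<integral>x. x \<partial>N) x = 0" for x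
        using integral_inner_left[of x N "\<lambda>z. z"] int mean_x[of x] by simp
      then show ?thesis using inner_eq_zero_iff by blast
    qed
    show "cross_moment N (\<lambda>x. x) (\<lambda>x. x) = \<kappa>"
    proof -
      have "inner (cross_moment N (\<lambda>x. x) (\<lambda>x. x) - \<kappa>) (tensor a b) = 0" for a b
        unfolding cross_moment_def inner_diff_left \<kappa>
        by (subst inner_integral_tp) (simp_all add: norm2 prod)
      then show ?thesis using separating by fastforce
    qed
    show "(CLINT z|N. iexp (inner z x)) = of_real (exp (- Q x x / 2))" for x by (rule charN)
  qed
qed

section \<open>Local means of one sample\<close>

text \<open>\<open>near\<close> is what local stationarity at \<open>u\<close> leaves after the
  random factors are integrated out; \<open>rate\<close> is the undersmoothing condition that
  removes the bias.\<close>

locale local_sample = kernel_shift M S \<epsilon> f K L Bd R u T h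
  for M :: "'w measure" and S :: "'s measure" and \<epsilon> and f :: "(nat \<Rightarrow> 's) \<Rightarrow> 'a::euclidean_space L2"
    and K L Bd R u T h +
  fixes X V :: "nat \<Rightarrow> nat \<Rightarrow> 'w \<Rightarrow> 'a L2" and m :: "real \<Rightarrow> 'a L2" and C\<^sub>m C :: real
  assumes model: "\<And>N t \<omega>. t \<in> {1..N} \<Longrightarrow> \<omega> \<in> space M \<Longrightarrow> X N t \<omega> = m (real t / real N) + V N t \<omega>"
    and V_meas: "\<And>N t. t \<in> {1..N} \<Longrightarrow> V N t \<in> borel_measurable M"
    and V_square: "\<And>N t. t \<in> {1..N} \<Longrightarrow> integrable M (\<lambda>\<omega>. (norm (V N t \<omega>))\<^sup>2)"
    and m_lip: "\<And>a b. a \<in> {0..1} \<Longrightarrow> b \<in> {0..1} \<Longrightarrow> norm (m b - m a) \<le> C\<^sub>m * \<bar>a - b\<bar>"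
    and near: "\<And>N t. t \<in> {1..N} \<Longrightarrow>
      (\<integral>\<omega>. (norm (V N t \<omega> - Z (int t) \<omega>))\<^sup>2 \<partial>M) \<le> C * (\<bar>real t / real N - u\<bar> + 1 / real N)\<^sup>2"
    and C\<^sub>m: "0 \<le> C\<^sub>m" and C: "0 \<le> C"
    and rate: "(\<lambda>n. real (T n) * h n ^ 3) \<longlonglongrightarrow> 0"
begin

abbreviation lm :: "nat \<Rightarrow> 'w \<Rightarrow> 'a L2" where "lm n \<equiv> local_mean K (h n) u (T n) X"

definition G :: "nat \<Rightarrow> 'w \<Rightarrow> 'a L2" where "G n \<omega> = (1 / sqrt (w n)) *\<^sub>R (lm n \<omega> - m u)"

text \<open>The drift of the mean over the kernel window, plus the Riemann error of the total
  weight, which only approximates 1 / sqrt (w n).\<close>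

definition bias :: "nat \<Rightarrow> 'a L2"
  where "bias n = (\<Sum>t\<in>support n. a n t *\<^sub>R (m (real t / real (T n)) - m u)) + ((\<Sum>t=1..T n. a n t) - 1 / sqrt (w n)) *\<^sub>R m u"

definition dev :: "nat \<Rightarrow> 'w \<Rightarrow> 'a L2"
  where "dev n \<omega> = (\<Sum>t\<in>support n. a n t *\<^sub>R (V (T n) t \<omega> - Z (int t) \<omega>))"

lemma X_meas: "t \<in> {1..N} \<Longrightarrow> X N t \<in> borel_measurable M"
  using V_meas[of t N] by (subst measurable_cong[OF model]) auto

lemma X_square: "t \<in> {1..N} \<Longrightarrow> integrable M (\<lambda>\<omega>. (norm (X N t \<omega>))\<^sup>2)"
  using integrable_norm_square_add[of "\<lambda>_. m (real t / real N)" M "V N t"] V_meas[of t N] V_square[of t N]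
  by (subst Bochner_Integration.integrable_cong[OF refl, where g = "\<lambda>\<omega>. (norm (m (real t / real N) + V N t \<omega>))\<^sup>2"]) (simp_all add: model)

lemma measurable_lm [measurable]: "lm n \<in> borel_measurable M"
  unfolding local_mean_def[abs_def]
  by (intro borel_measurable_scaleR borel_measurable_sum borel_measurable_const X_meas)

lemma lm_square: "integrable M (\<lambda>\<omega>. (norm (lm n \<omega>))\<^sup>2)"
proof -
  have "integrable M (\<lambda>\<omega>. (norm (\<Sum>t=1..T n. K ((u - real t / real (T n)) / h n) *\<^sub>R X (T n) t \<omega>))\<^sup>2)"
    by (rule integrable_norm_square_sum)
       (use X_meas X_square in \<open>auto simp: power_mult_distrib intro!: borel_measurable_scaleR\<close>)
  then show ?thesis by (simp add: local_mean_def power_mult_distrib power_divide)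
qed

lemma measurable_G [measurable]: "G n \<in> borel_measurable M"
  unfolding G_def[abs_def] by measurable

lemma G_square: "integrable M (\<lambda>\<omega>. (norm (G n \<omega>))\<^sup>2)"
  using integrable_norm_square_diff[of "lm n" M "\<lambda>_. m u"] lm_square[of n]
  by (simp add: G_def power_mult_distrib power_divide)

lemma sw_square: "integrable M (\<lambda>\<omega>. (norm (sw n \<omega>))\<^sup>2)"
  unfolding sw_ZS(1) by (rule ZS_square_integrable)

text \<open>The three parts are the main term, the error of the stationary approximation and a
  deterministic error; the last two turn out to be negligible even after standardising.\<close>

lemma G_eq:
  assumes "0 < w n" "\<omega> \<in> space M"
  shows "G n \<omega> = sw n \<omega> + (dev n \<omega> + bias n)"
proof -
  have zero: "a n t *\<^sub>R x = 0" if "K ((u - real t / real (T n)) / h n) = 0" for t and x :: "'a L2"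
    using that by (simp add: a_def)
  have "(1 / sqrt (w n)) *\<^sub>R lm n \<omega> = (1 / sqrt (w n) * w n) *\<^sub>R (\<Sum>t=1..T n. K ((u - real t / real (T n)) / h n) *\<^sub>R X (T n) t \<omega>)"
    by (simp add: local_mean_def w_def)
  also have "1 / sqrt (w n) * w n = sqrt (w n)"
    using assms(1) by (simp add: real_div_sqrt)
  also have "sqrt (w n) *\<^sub>R (\<Sum>t=1..T n. K ((u - real t / real (T n)) / h n) *\<^sub>R X (T n) t \<omega>)
      = (\<Sum>t=1..T n. a n t *\<^sub>R (m (real t / real (T n)) + V (T n) t \<omega>))"
    unfolding scaleR_sum_right by (intro sum.cong refl) (simp add: a_def model assms(2))
  also have "\<dots> = (\<Sum>t=1..T n. a n t *\<^sub>R Z (int t) \<omega>) + (\<Sum>t=1..T n. a n t *\<^sub>R (V (T n) t \<omega> - Z (int t) \<omega>))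
      + (\<Sum>t=1..T n. a n t *\<^sub>R (m (real t / real (T n)) - m u)) + (\<Sum>t=1..T n. a n t) *\<^sub>R m u"
    unfolding scaleR_sum_left sum.distrib[symmetric] by (intro sum.cong refl) (simp add: algebra_simps)
  also have "(\<Sum>t=1..T n. a n t *\<^sub>R (V (T n) t \<omega> - Z (int t) \<omega>)) = dev n \<omega>"
    unfolding dev_def by (rule sum_support) (rule zero)
  also have "(\<Sum>t=1..T n. a n t *\<^sub>R (m (real t / real (T n)) - m u)) = (\<Sum>t\<in>support n. a n t *\<^sub>R (m (real t / real (T n)) - m u))"
    by (rule sum_support) (rule zero)
  finally show ?thesis
    by (simp add: G_def sw_def bias_def scaleR_diff_right scaleR_diff_left)
qed

lemma T_mesh: "0 < T n \<Longrightarrow> 1 / real (T n) = w n * h n"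
  using h(1)[of n] by (simp add: w_def)

lemma card_square_bound:
  assumes "0 < w n" "real (card (support n)) * w n \<le> 2 * R + 1"
  shows "(real (card (support n)) * sqrt (w n))\<^sup>2 \<le> (2 * R + 1)\<^sup>2 / w n"
proof -
  have "(real (card (support n)) * sqrt (w n))\<^sup>2 = (real (card (support n)) * w n)\<^sup>2 / w n"
    using assms(1) by (simp add: power2_eq_square field_simps)
  also have "\<dots> \<le> (2 * R + 1)\<^sup>2 / w n"
    using assms by (intro divide_right_mono power_mono) auto
  finally show ?thesis .
qed

text \<open>The reason for \<open>rate\<close>: a deviation of order h, divided by sqrt (w n), has
  square of this order.\<close>

lemma mesh_rate: "0 < T n \<Longrightarrow> (h n)\<^sup>2 / w n = real (T n) * h n ^ 3"
  by (simp add: w_def power2_eq_square power3_eq_cube)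

lemma measurable_dev [measurable]: "dev n \<in> borel_measurable M"
  unfolding dev_def[abs_def]
  by (intro borel_measurable_sum borel_measurable_scaleR borel_measurable_diff borel_measurable_const measurable_Z V_meas)
     (simp add: support_def)

lemma VZ_square: "t \<in> {1..N} \<Longrightarrow> integrable M (\<lambda>\<omega>. (norm (V N t \<omega> - Z (int t) \<omega>))\<^sup>2)"
  by (intro integrable_norm_square_diff V_meas V_square Z_square measurable_Z) auto

text \<open>Nothing is known about the dependence among the differences \<open>V - Z\<close>, so
  Cauchy-Schwarz over the support is used. Its loss, a factor of order 1 / w, is affordable because
  each difference is of order h: the total is of order h^2 / w.\<close>

lemma dev_bound:
  assumes "0 < T n" "0 < w n" "w n \<le> 1" "real (card (support n)) * w n \<le> 2 * R + 1"
  shows "integrable M (\<lambda>\<omega>. (norm (dev n \<omega>))\<^sup>2)"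
    and "(\<integral>\<omega>. (norm (dev n \<omega>))\<^sup>2 \<partial>M) \<le> ((2 * R + 1)\<^sup>2 * (Bd\<^sup>2 * (C * (R + 1)\<^sup>2))) * (real (T n) * h n ^ 3)"
proof -
  let ?I = "support n"
  have range: "t \<in> {1..T n}" if "t \<in> ?I" for t using that by (simp add: support_def)
  have i: "integrable M (\<lambda>\<omega>. (norm (a n t *\<^sub>R (V (T n) t \<omega> - Z (int t) \<omega>)))\<^sup>2)" if "t \<in> ?I" for t
    using VZ_square[OF range[OF that]] by (simp add: power_mult_distrib)
  show int: "integrable M (\<lambda>\<omega>. (norm (dev n \<omega>))\<^sup>2)"
    unfolding dev_def
    by (intro integrable_norm_square_sum i borel_measurable_scaleR borel_measurable_diff borel_measurable_const measurable_Z V_meas range)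
  have le: "(norm (dev n \<omega>))\<^sup>2 \<le> real (card ?I) * (\<Sum>t\<in>?I. (norm (a n t *\<^sub>R (V (T n) t \<omega> - Z (int t) \<omega>)))\<^sup>2)" for \<omega>
  proof -
    have "(norm (dev n \<omega>))\<^sup>2 \<le> (\<Sum>t\<in>?I. norm (a n t *\<^sub>R (V (T n) t \<omega> - Z (int t) \<omega>)))\<^sup>2"
      unfolding dev_def by (intro power_mono norm_sum) simp
    also have "\<dots> \<le> real (card ?I) * (\<Sum>t\<in>?I. (norm (a n t *\<^sub>R (V (T n) t \<omega> - Z (int t) \<omega>)))\<^sup>2)"
      using sum_squared_le_sum_of_squares[of "\<lambda>t. norm (a n t *\<^sub>R (V (T n) t \<omega> - Z (int t) \<omega>))" ?I] by (simp add: mult.commute)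
    finally show ?thesis .
  qed
  have each: "(\<integral>\<omega>. (norm (a n t *\<^sub>R (V (T n) t \<omega> - Z (int t) \<omega>)))\<^sup>2 \<partial>M) \<le> w n * Bd\<^sup>2 * (C * ((R + 1) * h n)\<^sup>2)" if t: "t \<in> ?I" for t
  proof -
    \<comment> \<open>The support contributes R h, and 1 / T = w h \<le> h contributes the
      1.\<close>
    have "\<bar>real t / real (T n) - u\<bar> + 1 / real (T n) \<le> (R + 1) * h n"
    proof -
      have "w n * h n \<le> 1 * h n" using assms(3) h(1)[of n] by (intro mult_right_mono) auto
      then show ?thesis
        using support_bound[OF assms(1) t] by (simp add: T_mesh[OF assms(1)] abs_minus_commute algebra_simps)
    qed
    then have "(\<bar>real t / real (T n) - u\<bar> + 1 / real (T n))\<^sup>2 \<le> ((R + 1) * h n)\<^sup>2"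
      by (intro power_mono) auto
    then have "(\<integral>\<omega>. (norm (V (T n) t \<omega> - Z (int t) \<omega>))\<^sup>2 \<partial>M) \<le> C * ((R + 1) * h n)\<^sup>2"
      using near[OF range[OF t]] C by (meson mult_left_mono order_trans)
    moreover have "(a n t)\<^sup>2 \<le> w n * Bd\<^sup>2"
    proof -
      have "\<bar>a n t\<bar>\<^sup>2 \<le> (sqrt (w n) * Bd)\<^sup>2" by (intro power_mono abs_a_le) simp
      then show ?thesis using w_nonneg[of n] by (simp add: power_mult_distrib)
    qed
    ultimately have "(a n t)\<^sup>2 * (\<integral>\<omega>. (norm (V (T n) t \<omega> - Z (int t) \<omega>))\<^sup>2 \<partial>M) \<le> (w n * Bd\<^sup>2) * (C * ((R + 1) * h n)\<^sup>2)"
      by (intro mult_mono) (use w_nonneg[of n] in auto)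
    then show ?thesis by (simp add: power_mult_distrib)
  qed
  have "(\<integral>\<omega>. (norm (dev n \<omega>))\<^sup>2 \<partial>M) \<le> (\<integral>\<omega>. real (card ?I) * (\<Sum>t\<in>?I. (norm (a n t *\<^sub>R (V (T n) t \<omega> - Z (int t) \<omega>)))\<^sup>2) \<partial>M)"
    by (rule integral_mono[OF int _ le]) (intro integrable_mult_right Bochner_Integration.integrable_sum i)
  also have "\<dots> = real (card ?I) * (\<Sum>t\<in>?I. \<integral>\<omega>. (norm (a n t *\<^sub>R (V (T n) t \<omega> - Z (int t) \<omega>)))\<^sup>2 \<partial>M)"
    using i by (simp add: Bochner_Integration.integral_sum)
  also have "\<dots> \<le> real (card ?I) * (\<Sum>t\<in>?I. w n * Bd\<^sup>2 * (C * ((R + 1) * h n)\<^sup>2))"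
    by (intro mult_left_mono sum_mono each) auto
  also have "\<dots> = (real (card ?I) * sqrt (w n))\<^sup>2 * (Bd\<^sup>2 * (C * ((R + 1) * h n)\<^sup>2))"
    using assms(2) by (simp add: power_mult_distrib power2_eq_square[of "real (card ?I)"])
  also have "\<dots> \<le> (2 * R + 1)\<^sup>2 / w n * (Bd\<^sup>2 * (C * ((R + 1) * h n)\<^sup>2))"
    by (intro mult_right_mono card_square_bound assms) (use C in auto)
  also have "\<dots> = ((2 * R + 1)\<^sup>2 * (Bd\<^sup>2 * (C * (R + 1)\<^sup>2))) * ((h n)\<^sup>2 / w n)"
    by (simp add: power_mult_distrib)
  finally show "(\<integral>\<omega>. (norm (dev n \<omega>))\<^sup>2 \<partial>M) \<le> ((2 * R + 1)\<^sup>2 * (Bd\<^sup>2 * (C * (R + 1)\<^sup>2))) * (real (T n) * h n ^ 3)"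
    unfolding mesh_rate[OF assms(1)] .
qed

text \<open>On the support the mean moves by at most \<open>C\<^sub>m * R * h n\<close>, which
  summed over order 1 / w weights gives the first term; the Riemann error of order w, divided by
  sqrt w, gives the second.\<close>

lemma bias_bound:
  assumes "0 < T n" "0 < w n" "real (card (support n)) * w n \<le> 2 * R + 1"
    and riemann: "\<bar>w n * (\<Sum>t=1..T n. K ((u - real t / real (T n)) / h n)) - 1\<bar> \<le> L * (2 * R + 3) * w n"
  shows "(norm (bias n))\<^sup>2 \<le> 2 * (((2 * R + 1)\<^sup>2 * (Bd * (C\<^sub>m * R))\<^sup>2) * (real (T n) * h n ^ 3)) + 2 * ((L * (2 * R + 3) * norm (m u))\<^sup>2 * w n)"
proof -
  have "norm (\<Sum>t\<in>support n. a n t *\<^sub>R (m (real t / real (T n)) - m u)) \<le> (\<Sum>t\<in>support n. (sqrt (w n) * Bd) * (C\<^sub>m * (R * h n)))"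
  proof (rule sum_norm_le)
    fix t assume t: "t \<in> support n"
    then have "t \<in> {1..T n}" by (simp add: support_def)
    then have "norm (m (real t / real (T n)) - m u) \<le> C\<^sub>m * \<bar>u - real t / real (T n)\<bar>"
      using u by (intro m_lip) auto
    also have "\<dots> \<le> C\<^sub>m * (R * h n)" by (intro mult_left_mono support_bound assms t C\<^sub>m)
    finally show "norm (a n t *\<^sub>R (m (real t / real (T n)) - m u)) \<le> (sqrt (w n) * Bd) * (C\<^sub>m * (R * h n))"
      unfolding norm_scaleR by (intro mult_mono abs_a_le) (use w_nonneg[of n] B in auto)
  qed
  also have "\<dots> = (real (card (support n)) * sqrt (w n)) * (Bd * (C\<^sub>m * R) * h n)" by simp
  finally have "(norm (\<Sum>t\<in>support n. a n t *\<^sub>R (m (real t / real (T n)) - m u)))\<^sup>2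
      \<le> ((real (card (support n)) * sqrt (w n)) * (Bd * (C\<^sub>m * R) * h n))\<^sup>2"
    by (rule power_mono) simp
  also have "\<dots> = (real (card (support n)) * sqrt (w n))\<^sup>2 * (Bd * (C\<^sub>m * R) * h n)\<^sup>2" by (rule power_mult_distrib)
  also have "\<dots> \<le> (2 * R + 1)\<^sup>2 / w n * (Bd * (C\<^sub>m * R) * h n)\<^sup>2"
    by (intro mult_right_mono card_square_bound assms) auto
  also have "\<dots> = ((2 * R + 1)\<^sup>2 * (Bd * (C\<^sub>m * R))\<^sup>2) * ((h n)\<^sup>2 / w n)" by (simp add: power_mult_distrib)
  finally have 1: "(norm (\<Sum>t\<in>support n. a n t *\<^sub>R (m (real t / real (T n)) - m u)))\<^sup>2
      \<le> ((2 * R + 1)\<^sup>2 * (Bd * (C\<^sub>m * R))\<^sup>2) * (real (T n) * h n ^ 3)"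
    unfolding mesh_rate[OF assms(1)] .
  have "(\<Sum>t=1..T n. a n t) - 1 / sqrt (w n) = (w n * (\<Sum>t=1..T n. K ((u - real t / real (T n)) / h n)) - 1) / sqrt (w n)"
  proof -
    have "w n * x / sqrt (w n) = sqrt (w n) * x" for x
      using real_div_sqrt[of "w n"] assms(2) by (metis less_imp_le times_divide_eq_left)
    then show ?thesis unfolding diff_divide_distrib a_def sum_distrib_left[symmetric] by (simp only:)
  qed
  then have "\<bar>(\<Sum>t=1..T n. a n t) - 1 / sqrt (w n)\<bar> \<le> L * (2 * R + 3) * w n / sqrt (w n)"
    using riemann assms(2) by (simp add: divide_right_mono)
  also have "\<dots> = L * (2 * R + 3) * sqrt (w n)"
    using real_div_sqrt[of "w n"] assms(2) by (metis less_imp_le times_divide_eq_right)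
  finally have "norm (((\<Sum>t=1..T n. a n t) - 1 / sqrt (w n)) *\<^sub>R m u) \<le> (L * (2 * R + 3) * sqrt (w n)) * norm (m u)"
    unfolding norm_scaleR by (rule mult_right_mono) simp
  then have "(norm (((\<Sum>t=1..T n. a n t) - 1 / sqrt (w n)) *\<^sub>R m u))\<^sup>2 \<le> ((L * (2 * R + 3) * sqrt (w n)) * norm (m u))\<^sup>2"
    by (rule power_mono) simp
  also have "\<dots> = (L * (2 * R + 3) * norm (m u))\<^sup>2 * w n"
    using assms(2) by (simp add: power_mult_distrib)
  finally have 2: "(norm (((\<Sum>t=1..T n. a n t) - 1 / sqrt (w n)) *\<^sub>R m u))\<^sup>2 \<le> (L * (2 * R + 3) * norm (m u))\<^sup>2 * w n" .
  have "(norm (bias n))\<^sup>2 \<le> 2 * (norm (\<Sum>t\<in>support n. a n t *\<^sub>R (m (real t / real (T n)) - m u)))\<^sup>2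
      + 2 * (norm (((\<Sum>t=1..T n. a n t) - 1 / sqrt (w n)) *\<^sub>R m u))\<^sup>2"
    unfolding bias_def by (rule order_trans[OF power_mono[OF norm_triangle_ineq norm_ge_zero] square_add_le])
  with 1 2 show ?thesis by linarith
qed

lemma G_approx: "(\<lambda>n. \<integral>\<omega>. (norm (G n \<omega> - sw n \<omega>))\<^sup>2 \<partial>M) \<longlonglongrightarrow> 0"
proof -
  obtain c1 where c1: "c1 = (2 * R + 1)\<^sup>2 * (Bd\<^sup>2 * (C * (R + 1)\<^sup>2))" by blast
  obtain c2 where c2: "c2 = (2 * R + 1)\<^sup>2 * (Bd * (C\<^sub>m * R))\<^sup>2" by blast
  obtain c3 where c3: "c3 = (L * (2 * R + 3) * norm (m u))\<^sup>2" by blast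
  let ?b = "\<lambda>n. 2 * (c1 * (real (T n) * h n ^ 3)) + 2 * (2 * (c2 * (real (T n) * h n ^ 3)) + 2 * (c3 * w n))"
  have riemann: "\<forall>\<^sub>F n in sequentially. \<bar>w n * (\<Sum>t=1..T n. K ((u - real t / real (T n)) / h n)) - (\<integral>z. K z \<partial>lborel)\<bar>
      \<le> L * (2 * R + 3) * w n"
    by (rule riemann_bound) (use lip supp L in auto)
  have "\<forall>\<^sub>F n in sequentially. norm (\<integral>\<omega>. (norm (G n \<omega> - sw n \<omega>))\<^sup>2 \<partial>M) \<le> ?b n"
    using ev_T card_support riemann
  proof eventually_elim
    case (elim n)
    then have dev: "integrable M (\<lambda>\<omega>. (norm (dev n \<omega>))\<^sup>2)" "(\<integral>\<omega>. (norm (dev n \<omega>))\<^sup>2 \<partial>M) \<le> c1 * (real (T n) * h n ^ 3)"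
      and bias: "(norm (bias n))\<^sup>2 \<le> 2 * (c2 * (real (T n) * h n ^ 3)) + 2 * (c3 * w n)"
      using dev_bound[of n] bias_bound[of n] K_int by (simp_all add: c1 c2 c3)
    have "(\<integral>\<omega>. (norm (G n \<omega> - sw n \<omega>))\<^sup>2 \<partial>M) = (\<integral>\<omega>. (norm (dev n \<omega> + bias n))\<^sup>2 \<partial>M)"
      by (rule Bochner_Integration.integral_cong) (use elim G_eq[of n] in auto)
    also have "\<dots> \<le> (\<integral>\<omega>. 2 * (norm (dev n \<omega>))\<^sup>2 + 2 * (norm (bias n))\<^sup>2 \<partial>M)"
    proof (rule integral_mono)
      show "integrable M (\<lambda>\<omega>. (norm (dev n \<omega> + bias n))\<^sup>2)"
        by (intro integrable_norm_square_add dev) auto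
      show "(norm (dev n \<omega> + bias n))\<^sup>2 \<le> 2 * (norm (dev n \<omega>))\<^sup>2 + 2 * (norm (bias n))\<^sup>2" for \<omega>
        by (rule order_trans[OF power_mono[OF norm_triangle_ineq norm_ge_zero] square_add_le])
    qed (use dev in simp)
    also have "\<dots> = 2 * (\<integral>\<omega>. (norm (dev n \<omega>))\<^sup>2 \<partial>M) + 2 * (norm (bias n))\<^sup>2"
      using dev by (simp add: prob_space)
    finally show ?case using dev bias by simp
  qed
  moreover have "?b \<longlonglongrightarrow> 2 * (c1 * 0) + 2 * (2 * (c2 * 0) + 2 * (c3 * 0))"
    by (intro tendsto_intros rate w_tendsto)
  ultimately show ?thesis by (simp add: Lim_null_comparison)
qed

end

section \<open>Energy beyond the first coordinates of a frame\<close>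

definition remainder :: "(nat \<Rightarrow> 'h::real_inner) \<Rightarrow> nat \<Rightarrow> 'h \<Rightarrow> real"
  where "remainder e k x = (norm x)\<^sup>2 - (\<Sum>i<k. (inner x (e i))\<^sup>2)"

lemma remainder_nonneg: "parseval e \<Longrightarrow> 0 \<le> remainder e k x"
  using bessel[of e "{..<k}" x] by (simp add: remainder_def)

lemma remainder_le: "remainder e k x \<le> (norm x)\<^sup>2"
  by (simp add: remainder_def sum_nonneg)

text \<open>Along a Parseval frame the remainder is a nonnegative quadratic form; like a squared
  norm it is then subadditive up to the factor 2.\<close>

lemma remainder_parallelogram:
  "remainder e k (x + y) + remainder e k (x - y) = 2 * remainder e k x + 2 * remainder e k y"
proof -
  have "(norm (x + y))\<^sup>2 + (norm (x - y))\<^sup>2 = 2 * (norm x)\<^sup>2 + 2 * (norm y)\<^sup>2"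
    by (simp add: power2_norm_eq_inner inner_add_left inner_add_right inner_diff_left inner_diff_right)
  moreover have "(\<Sum>i<k. (inner (x + y) (e i))\<^sup>2) + (\<Sum>i<k. (inner (x - y) (e i))\<^sup>2)
      = 2 * (\<Sum>i<k. (inner x (e i))\<^sup>2) + 2 * (\<Sum>i<k. (inner y (e i))\<^sup>2)"
    unfolding sum_distrib_left sum.distrib[symmetric]
    by (intro sum.cong refl) (simp add: inner_add_left inner_diff_left power2_eq_square algebra_simps)
  ultimately show ?thesis by (simp add: remainder_def)
qed

lemma remainder_add_le: "parseval e \<Longrightarrow> remainder e k (x + y) \<le> 2 * remainder e k x + 2 * remainder e k y"
  and remainder_diff_le: "parseval e \<Longrightarrow> remainder e k (x - y) \<le> 2 * remainder e k x + 2 * remainder e k y"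
  using remainder_parallelogram[of e k x y] remainder_nonneg[of e k "x - y"] remainder_nonneg[of e k "x + y"] by linarith+

lemma remainder_scaleR: "remainder e k (c *\<^sub>R x) = c\<^sup>2 * remainder e k x"
  by (simp add: remainder_def power_mult_distrib sum_distrib_left[symmetric] right_diff_distrib)

lemma integrable_remainder:
  fixes X :: "'w \<Rightarrow> 'h::{real_inner, second_countable_topology}"
  assumes "X \<in> borel_measurable M" "integrable M (\<lambda>\<omega>. (norm (X \<omega>))\<^sup>2)"
  shows "integrable M (\<lambda>\<omega>. remainder e k (X \<omega>))"
  unfolding remainder_def using assms integrable_inner_square(1)[OF assms] by simp

context local_sample
begin

lemma sw_bound: "(\<integral>\<omega>. (norm (sw n \<omega>))\<^sup>2 \<partial>M) \<le> (\<Sum>t=1..T n. (a n t)\<^sup>2) * (2 * (v * \<Delta>))"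
proof -
  obtain e :: "nat \<Rightarrow> 'a L2" where "\<And>x. (\<lambda>k. (inner x (e k))\<^sup>2) sums (norm x)\<^sup>2"
    using parseval_frame_exists by blast
  then have "parseval e" by (simp add: parseval_def)
  then show ?thesis unfolding sw_ZS(1) by (rule ZS_bound) simp
qed

lemma G_second_moment:
  obtains c where "\<forall>\<^sub>F n in sequentially. (\<integral>\<omega>. (norm (G n \<omega>))\<^sup>2 \<partial>M) \<le> c"
    and "\<forall>\<^sub>F n in sequentially. (\<integral>\<omega>. (norm (sw n \<omega>))\<^sup>2 \<partial>M) \<le> c"
proof -
  define \<kappa> where "\<kappa> = (\<integral>z. (K z)\<^sup>2 \<partial>lborel)"
  define c where "c = (\<kappa> + 1) * (2 * (v * \<Delta>))"
  have "\<kappa> < \<kappa> + 1" by simp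
  from order_tendstoD(2)[OF sum_a_square[folded \<kappa>_def] this]
  have sw: "\<forall>\<^sub>F n in sequentially. (\<integral>\<omega>. (norm (sw n \<omega>))\<^sup>2 \<partial>M) \<le> c"
  proof eventually_elim
    case (elim n)
    have "(\<Sum>t=1..T n. (a n t)\<^sup>2) * (2 * (v * \<Delta>)) \<le> c"
      unfolding c_def using elim v_nonneg \<Delta>_nonneg by (intro mult_right_mono) auto
    then show ?case using sw_bound[of n] by linarith
  qed
  have "(0::real) < 1" by simp
  from order_tendstoD(2)[OF G_approx this] sw
  have "\<forall>\<^sub>F n in sequentially. (\<integral>\<omega>. (norm (G n \<omega>))\<^sup>2 \<partial>M) \<le> 2 * 1 + 2 * c"
  proof eventually_elim
    case (elim n)
    have i: "integrable M (\<lambda>\<omega>. (norm (G n \<omega> - sw n \<omega>))\<^sup>2)"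
      by (intro integrable_norm_square_diff G_square sw_square) measurable
    have "(\<integral>\<omega>. (norm (G n \<omega>))\<^sup>2 \<partial>M) \<le> (\<integral>\<omega>. 2 * (norm (G n \<omega> - sw n \<omega>))\<^sup>2 + 2 * (norm (sw n \<omega>))\<^sup>2 \<partial>M)"
    proof (rule integral_mono[OF G_square])
      show "(norm (G n \<omega>))\<^sup>2 \<le> 2 * (norm (G n \<omega> - sw n \<omega>))\<^sup>2 + 2 * (norm (sw n \<omega>))\<^sup>2" for \<omega>
        using order_trans[OF power_mono[OF norm_triangle_ineq[of "G n \<omega> - sw n \<omega>" "sw n \<omega>"] norm_ge_zero] square_add_le] by simp
    qed (use i sw_square in simp)
    also have "\<dots> = 2 * (\<integral>\<omega>. (norm (G n \<omega> - sw n \<omega>))\<^sup>2 \<partial>M) + 2 * (\<integral>\<omega>. (norm (sw n \<omega>))\<^sup>2 \<partial>M)"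
      using i sw_square by simp
    finally show ?case using elim by linarith
  qed
  moreover have "\<forall>\<^sub>F n in sequentially. (\<integral>\<omega>. (norm (sw n \<omega>))\<^sup>2 \<partial>M) \<le> 2 * 1 + 2 * c"
    using sw
  proof eventually_elim
    case (elim n)
    moreover have "0 \<le> (\<integral>\<omega>. (norm (sw n \<omega>))\<^sup>2 \<partial>M)" by simp
    ultimately show ?case by linarith
  qed
  ultimately show ?thesis by (rule that)
qed

text \<open>The deviation from \<open>m u\<close> is sqrt (w n) times \<open>G n\<close>, whose
  second moments are eventually bounded.\<close>

lemma lm_tendsto: "(\<lambda>n. \<integral>\<omega>. (norm (lm n \<omega> - m u))\<^sup>2 \<partial>M) \<longlonglongrightarrow> 0"
proof -
  obtain c where c: "\<forall>\<^sub>F n in sequentially. (\<integral>\<omega>. (norm (G n \<omega>))\<^sup>2 \<partial>M) \<le> c"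
    by (rule G_second_moment)
  have "\<forall>\<^sub>F n in sequentially. norm (\<integral>\<omega>. (norm (lm n \<omega> - m u))\<^sup>2 \<partial>M) \<le> w n * c"
    using c ev_T
  proof eventually_elim
    case (elim n)
    then have "(norm (lm n \<omega> - m u))\<^sup>2 = w n * (norm (G n \<omega>))\<^sup>2" for \<omega>
      by (simp add: G_def power_mult_distrib power_divide)
    then have "(\<integral>\<omega>. (norm (lm n \<omega> - m u))\<^sup>2 \<partial>M) = w n * (\<integral>\<omega>. (norm (G n \<omega>))\<^sup>2 \<partial>M)" by simp
    then show ?case using elim by (simp add: abs_mult)
  qed
  moreover have "(\<lambda>n. w n * c) \<longlonglongrightarrow> 0" using tendsto_mult_right[OF w_tendsto, of c] by simp
  ultimately show ?thesis by (rule Lim_null_comparison)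
qed

text \<open>Two replacements, both controlled in L2: \<open>G\<close> by \<open>sw\<close>, and the
  moving factor \<open>\<alpha> n\<close> by its limit. The limit factor then goes into the argument
  of \<open>sw_char\<close>.\<close>

lemma G_char:
  assumes "\<alpha> \<longlonglongrightarrow> l"
  shows "(\<lambda>n. CLINT \<omega>|M. iexp (inner (\<alpha> n *\<^sub>R G n \<omega>) x)) \<longlonglongrightarrow> of_real (exp (- (l\<^sup>2 * ((\<integral>z. (K z)\<^sup>2 \<partial>lborel) * B x x)) / 2))"
proof -
  obtain c where c: "\<forall>\<^sub>F n in sequentially. (\<integral>\<omega>. (norm (sw n \<omega>))\<^sup>2 \<partial>M) \<le> c"
    by (rule G_second_moment)
  let ?b = "\<lambda>n. norm x * (\<bar>\<alpha> n\<bar> * sqrt (\<integral>\<omega>. (norm (G n \<omega> - sw n \<omega>))\<^sup>2 \<partial>M) + \<bar>\<alpha> n - l\<bar> * sqrt c)"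
  have "\<forall>\<^sub>F n in sequentially. norm ((CLINT \<omega>|M. iexp (inner (\<alpha> n *\<^sub>R G n \<omega>) x)) - (CLINT \<omega>|M. iexp (inner (sw n \<omega>) (l *\<^sub>R x)))) \<le> ?b n"
    using c
  proof eventually_elim
    case (elim n)
    have i: "integrable M (\<lambda>\<omega>. (norm (G n \<omega> - sw n \<omega>))\<^sup>2)"
      by (intro integrable_norm_square_diff G_square sw_square) measurable
    have i1: "integrable M (\<lambda>\<omega>. norm (G n \<omega> - sw n \<omega>))" "integrable M (\<lambda>\<omega>. norm (sw n \<omega>))"
      by (rule square_integrable_imp_integrable; use i sw_square in simp)+
    have ic: "integrable M (\<lambda>\<omega>. iexp (Y \<omega>))" if "Y \<in> borel_measurable M" for Y
      by (rule integrable_const_bound[where B = 1]) (use that in auto)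
    have eq: "(CLINT \<omega>|M. iexp (inner (\<alpha> n *\<^sub>R G n \<omega>) x)) - (CLINT \<omega>|M. iexp (inner (sw n \<omega>) (l *\<^sub>R x)))
        = (CLINT \<omega>|M. iexp (inner (\<alpha> n *\<^sub>R G n \<omega>) x) - iexp (inner (sw n \<omega>) (l *\<^sub>R x)))"
      by (rule Bochner_Integration.integral_diff[symmetric]) (rule ic; measurable)+
    have "norm ((CLINT \<omega>|M. iexp (inner (\<alpha> n *\<^sub>R G n \<omega>) x)) - (CLINT \<omega>|M. iexp (inner (sw n \<omega>) (l *\<^sub>R x))))
        \<le> (\<integral>\<omega>. norm (iexp (inner (\<alpha> n *\<^sub>R G n \<omega>) x) - iexp (inner (sw n \<omega>) (l *\<^sub>R x))) \<partial>M)"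
      unfolding eq by (rule integral_norm_bound)
    also have "\<dots> \<le> (\<integral>\<omega>. norm x * (\<bar>\<alpha> n\<bar> * norm (G n \<omega> - sw n \<omega>) + \<bar>\<alpha> n - l\<bar> * norm (sw n \<omega>)) \<partial>M)"
    proof (rule integral_mono)
      show "integrable M (\<lambda>\<omega>. norm (iexp (inner (\<alpha> n *\<^sub>R G n \<omega>) x) - iexp (inner (sw n \<omega>) (l *\<^sub>R x))))"
        by (intro integrable_norm Bochner_Integration.integrable_diff ic) measurable
      fix \<omega>
      have "norm (iexp (inner (\<alpha> n *\<^sub>R G n \<omega>) x) - iexp (inner (sw n \<omega>) (l *\<^sub>R x))) \<le> \<bar>inner (\<alpha> n *\<^sub>R G n \<omega>) x - inner (sw n \<omega>) (l *\<^sub>R x)\<bar>"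
        by (rule cmod_iexp_diff_le)
      also have "inner (\<alpha> n *\<^sub>R G n \<omega>) x - inner (sw n \<omega>) (l *\<^sub>R x) = inner (\<alpha> n *\<^sub>R (G n \<omega> - sw n \<omega>) + (\<alpha> n - l) *\<^sub>R sw n \<omega>) x"
        by (simp add: inner_diff_left inner_add_left algebra_simps)
      also have "\<bar>\<dots>\<bar> \<le> norm (\<alpha> n *\<^sub>R (G n \<omega> - sw n \<omega>) + (\<alpha> n - l) *\<^sub>R sw n \<omega>) * norm x"
        by (rule Cauchy_Schwarz_ineq2)
      also have "\<dots> \<le> (norm (\<alpha> n *\<^sub>R (G n \<omega> - sw n \<omega>)) + norm ((\<alpha> n - l) *\<^sub>R sw n \<omega>)) * norm x"
        by (intro mult_right_mono norm_triangle_ineq) simp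
      finally show "norm (iexp (inner (\<alpha> n *\<^sub>R G n \<omega>) x) - iexp (inner (sw n \<omega>) (l *\<^sub>R x)))
          \<le> norm x * (\<bar>\<alpha> n\<bar> * norm (G n \<omega> - sw n \<omega>) + \<bar>\<alpha> n - l\<bar> * norm (sw n \<omega>))"
        by (simp add: mult.commute)
    qed (use i1 in simp)
    also have "\<dots> = norm x * (\<bar>\<alpha> n\<bar> * (\<integral>\<omega>. norm (G n \<omega> - sw n \<omega>) \<partial>M) + \<bar>\<alpha> n - l\<bar> * (\<integral>\<omega>. norm (sw n \<omega>) \<partial>M))"
      using i1 by simp
    also have "\<dots> \<le> ?b n"
    proof (intro mult_left_mono add_mono)
      show "(\<integral>\<omega>. norm (G n \<omega> - sw n \<omega>) \<partial>M) \<le> sqrt (\<integral>\<omega>. (norm (G n \<omega> - sw n \<omega>))\<^sup>2 \<partial>M)"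
        using expectation_le_sqrt[of M "\<lambda>\<omega>. norm (G n \<omega> - sw n \<omega>)"] i prob_space_axioms by simp
      have "(\<integral>\<omega>. norm (sw n \<omega>) \<partial>M) \<le> sqrt (\<integral>\<omega>. (norm (sw n \<omega>))\<^sup>2 \<partial>M)"
        using expectation_le_sqrt[of M "\<lambda>\<omega>. norm (sw n \<omega>)"] sw_square prob_space_axioms by simp
      also have "\<dots> \<le> sqrt c" using elim by simp
      finally show "(\<integral>\<omega>. norm (sw n \<omega>) \<partial>M) \<le> sqrt c" .
    qed auto
    finally show ?case .
  qed
  moreover have "?b \<longlonglongrightarrow> norm x * (\<bar>l\<bar> * sqrt 0 + \<bar>l - l\<bar> * sqrt c)"
    by (intro tendsto_intros G_approx assms)
  ultimately have "(\<lambda>n. (CLINT \<omega>|M. iexp (inner (\<alpha> n *\<^sub>R G n \<omega>) x)) - (CLINT \<omega>|M. iexp (inner (sw n \<omega>) (l *\<^sub>R x)))) \<longlonglongrightarrow> 0"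
    by (simp add: Lim_null_comparison)
  from tendsto_add[OF this sw_char[of "l *\<^sub>R x"]]
  show ?thesis
    by (simp add: B_scale_left B_sym[of x "l *\<^sub>R x"] power2_eq_square mult_ac)
qed

lemma G_remainder:
  assumes e: "parseval e" and r: "0 < r"
  shows "\<exists>k0. \<forall>k\<ge>k0. \<forall>\<^sub>F n in sequentially. (\<integral>\<omega>. remainder e k (G n \<omega>) \<partial>M) \<le> r"
proof -
  define \<kappa> where "\<kappa> = (\<integral>z. (K z)\<^sup>2 \<partial>lborel)"
  have \<kappa>: "0 \<le> \<kappa>" by (simp add: \<kappa>_def)
  have "(\<lambda>k. (\<kappa> + 1) * (2 * (sqrt (tail e k) * \<Delta>))) \<longlonglongrightarrow> (\<kappa> + 1) * (2 * (sqrt 0 * \<Delta>))"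
    by (intro tendsto_intros tail_tendsto[OF e])
  then have "\<forall>\<^sub>F k in sequentially. (\<kappa> + 1) * (2 * (sqrt (tail e k) * \<Delta>)) < r / 4"
    by (rule order_tendstoD) (use r in simp)
  then obtain k0 where k0: "\<And>k. k \<ge> k0 \<Longrightarrow> (\<kappa> + 1) * (2 * (sqrt (tail e k) * \<Delta>)) < r / 4"
    unfolding eventually_sequentially by blast
  have "\<forall>\<^sub>F n in sequentially. (\<integral>\<omega>. remainder e k (G n \<omega>) \<partial>M) \<le> r" if "k \<ge> k0" for k
  proof -
    have "\<kappa> < \<kappa> + 1" "0 < r / 4" using r by auto
    from order_tendstoD(2)[OF sum_a_square[folded \<kappa>_def] this(1)] order_tendstoD(2)[OF G_approx this(2)]
    show ?thesis
    proof eventually_elim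
      case (elim n)
      have i: "integrable M (\<lambda>\<omega>. (norm (G n \<omega> - sw n \<omega>))\<^sup>2)"
        by (intro integrable_norm_square_diff G_square sw_square) measurable
      have ir: "integrable M (\<lambda>\<omega>. remainder e k (sw n \<omega>))" "integrable M (\<lambda>\<omega>. remainder e k (G n \<omega>))"
        by (intro integrable_remainder sw_square G_square; measurable)+
      have tail0: "0 \<le> tail e k"
        unfolding tail_def using bessel[OF e, of "{..<k}"] by (intro Bochner_Integration.integral_nonneg) simp_all
      have "(\<integral>\<omega>. remainder e k (sw n \<omega>) \<partial>M) \<le> (\<Sum>t=1..T n. (a n t)\<^sup>2) * (2 * (sqrt (tail e k) * \<Delta>))"
        unfolding sw_ZS(1) remainder_def by (rule ZS_tail_bound[OF e]) simp
      also have "\<dots> \<le> (\<kappa> + 1) * (2 * (sqrt (tail e k) * \<Delta>))"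
        using elim tail0 \<Delta>_nonneg by (intro mult_right_mono) auto
      finally have sw: "(\<integral>\<omega>. remainder e k (sw n \<omega>) \<partial>M) \<le> r / 4" using k0[OF that] by linarith
      have "(\<integral>\<omega>. remainder e k (G n \<omega>) \<partial>M) \<le> (\<integral>\<omega>. 2 * (norm (G n \<omega> - sw n \<omega>))\<^sup>2 + 2 * remainder e k (sw n \<omega>) \<partial>M)"
      proof (rule integral_mono[OF ir(2)])
        show "remainder e k (G n \<omega>) \<le> 2 * (norm (G n \<omega> - sw n \<omega>))\<^sup>2 + 2 * remainder e k (sw n \<omega>)" for \<omega>
          using remainder_add_le[OF e, of k "G n \<omega> - sw n \<omega>" "sw n \<omega>"] remainder_le[of e k "G n \<omega> - sw n \<omega>"] by simp
      qed (use i ir in simp)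
      also have "\<dots> = 2 * (\<integral>\<omega>. (norm (G n \<omega> - sw n \<omega>))\<^sup>2 \<partial>M) + 2 * (\<integral>\<omega>. remainder e k (sw n \<omega>) \<partial>M)"
        using i ir by simp
      finally show ?case using elim sw by linarith
    qed
  qed
  then show ?thesis by blast
qed

end

section \<open>Two samples\<close>

text \<open>The squared norms differ by at most the squared distance plus 2 norm d times the
  distance; mean square convergence makes the expectation of this vanish, and Markov's inequality
  applies.\<close>

lemma tendsto_in_prob_norm_square:
  fixes D :: "nat \<Rightarrow> 'w \<Rightarrow> 'h::{real_inner, second_countable_topology}"
  assumes M: "prob_space M" and D [measurable]: "\<And>n. D n \<in> borel_measurable M"
    and D2: "\<And>n. integrable M (\<lambda>\<omega>. (norm (D n \<omega>))\<^sup>2)"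
    and lim: "(\<lambda>n. \<integral>\<omega>. (norm (D n \<omega> - d))\<^sup>2 \<partial>M) \<longlonglongrightarrow> 0"
  shows "tendsto_in_prob M (\<lambda>n \<omega>. (norm (D n \<omega>))\<^sup>2) ((norm d)\<^sup>2)"
  unfolding tendsto_in_prob_def
proof (intro allI impI)
  interpret prob_space M by fact
  fix e :: real assume e: "0 < e"
  let ?E = "\<lambda>n. \<integral>\<omega>. (norm (D n \<omega> - d))\<^sup>2 \<partial>M"
  let ?b = "\<lambda>n. (?E n + 2 * norm d * sqrt (?E n)) / e"
  have "\<forall>\<^sub>F n in sequentially. norm (measure M {\<omega> \<in> space M. e < \<bar>(norm (D n \<omega>))\<^sup>2 - (norm d)\<^sup>2\<bar>}) \<le> ?b n"
  proof (intro always_eventually allI)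
    fix n
    have i: "integrable M (\<lambda>\<omega>. (norm (D n \<omega> - d))\<^sup>2)"
      by (rule integrable_norm_square_diff) (use D2 in simp_all)
    have i1: "integrable M (\<lambda>\<omega>. norm (D n \<omega> - d))"
      by (rule square_integrable_imp_integrable) (use i in simp_all)
    have ia: "integrable M (\<lambda>\<omega>. \<bar>(norm (D n \<omega>))\<^sup>2 - (norm d)\<^sup>2\<bar>)" using D2[of n] by simp
    have le: "\<bar>(norm (D n \<omega>))\<^sup>2 - (norm d)\<^sup>2\<bar> \<le> (norm (D n \<omega> - d))\<^sup>2 + 2 * norm d * norm (D n \<omega> - d)" for \<omega>
    proof -
      have "(norm (D n \<omega>))\<^sup>2 = (norm (D n \<omega> - d))\<^sup>2 + 2 * inner (D n \<omega> - d) d + (norm d)\<^sup>2"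
        by (simp add: power2_norm_eq_inner inner_diff_left inner_diff_right inner_commute)
      moreover have "\<bar>inner (D n \<omega> - d) d\<bar> \<le> norm (D n \<omega> - d) * norm d" by (rule Cauchy_Schwarz_ineq2)
      ultimately have "\<bar>(norm (D n \<omega>))\<^sup>2 - (norm d)\<^sup>2\<bar> \<le> (norm (D n \<omega> - d))\<^sup>2 + 2 * (norm (D n \<omega> - d) * norm d)"
        using zero_le_power2[of "norm (D n \<omega> - d)"] by linarith
      then show ?thesis by (simp add: mult_ac)
    qed
    have "measure M {\<omega> \<in> space M. e < \<bar>(norm (D n \<omega>))\<^sup>2 - (norm d)\<^sup>2\<bar>} \<le> measure M {\<omega> \<in> space M. e \<le> \<bar>(norm (D n \<omega>))\<^sup>2 - (norm d)\<^sup>2\<bar>}"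
      by (rule finite_measure_mono) auto
    also have "\<dots> \<le> (\<integral>\<omega>. \<bar>(norm (D n \<omega>))\<^sup>2 - (norm d)\<^sup>2\<bar> \<partial>M) / e"
      by (rule integral_Markov_inequality_measure[where A = "{}"]) (use ia e in auto)
    also have "\<dots> \<le> ?b n"
    proof (rule divide_right_mono)
      have "(\<integral>\<omega>. \<bar>(norm (D n \<omega>))\<^sup>2 - (norm d)\<^sup>2\<bar> \<partial>M) \<le> (\<integral>\<omega>. (norm (D n \<omega> - d))\<^sup>2 + 2 * norm d * norm (D n \<omega> - d) \<partial>M)"
        by (rule integral_mono[OF ia _ le]) (use i i1 in simp)
      also have "\<dots> = ?E n + 2 * norm d * (\<integral>\<omega>. norm (D n \<omega> - d) \<partial>M)" using i i1 by simp
      also have "\<dots> \<le> ?E n + 2 * norm d * sqrt (?E n)"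
        using expectation_le_sqrt[of M "\<lambda>\<omega>. norm (D n \<omega> - d)"] i M by (intro add_left_mono mult_left_mono) simp_all
      finally show "(\<integral>\<omega>. \<bar>(norm (D n \<omega>))\<^sup>2 - (norm d)\<^sup>2\<bar> \<partial>M) \<le> ?E n + 2 * norm d * sqrt (?E n)" .
    qed (use e in simp)
    finally show "norm (measure M {\<omega> \<in> space M. e < \<bar>(norm (D n \<omega>))\<^sup>2 - (norm d)\<^sup>2\<bar>}) \<le> ?b n" by simp
  qed
  moreover have "?b \<longlonglongrightarrow> (0 + 2 * norm d * sqrt 0) / e"
    by (intro tendsto_intros lim) (use e in simp)
  ultimately show "(\<lambda>n. measure M {\<omega> \<in> space M. e < \<bar>(norm (D n \<omega>))\<^sup>2 - (norm d)\<^sup>2\<bar>}) \<longlonglongrightarrow> 0"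
    by (simp add: Lim_null_comparison)
qed

lemma tendsto_infinity_in_prob_mult:
  assumes M: "prob_space M" and [measurable]: "\<And>n. Y n \<in> borel_measurable M"
    and Y: "tendsto_in_prob M Y c" and c: "0 < c" and b: "filterlim b at_top sequentially"
  shows "tendsto_infinity_in_prob M (\<lambda>n \<omega>. b n * Y n \<omega>)"
  unfolding tendsto_infinity_in_prob_def
proof
  interpret prob_space M by fact
  fix B :: real
  let ?p = "\<lambda>n. measure M {\<omega> \<in> space M. c / 2 < \<bar>Y n \<omega> - c\<bar>}"
  have p: "(\<lambda>n. 1 - ?p n) \<longlonglongrightarrow> 1 - 0"
    by (intro tendsto_diff tendsto_const Y[unfolded tendsto_in_prob_def, rule_format]) (use c in simp)
  \<comment> \<open>On the event |Y - c| \<le> c / 2 one has Y \<ge> c / 2, so this size of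
    \<open>b n\<close> forces b Y > B.\<close>
  have "\<forall>\<^sub>F n in sequentially. max 1 (2 * B / c + 1) \<le> b n"
    using b unfolding filterlim_at_top by blast
  then have ev: "\<forall>\<^sub>F n in sequentially. 1 - ?p n \<le> measure M {\<omega> \<in> space M. B < b n * Y n \<omega>}"
  proof eventually_elim
    case (elim n)
    have "1 - ?p n = measure M {\<omega> \<in> space M. \<not> c / 2 < \<bar>Y n \<omega> - c\<bar>}"
      by (rule prob_neg[symmetric]) measurable
    also have "\<dots> \<le> measure M {\<omega> \<in> space M. B < b n * Y n \<omega>}"
    proof (rule finite_measure_mono)
      show "{\<omega> \<in> space M. \<not> c / 2 < \<bar>Y n \<omega> - c\<bar>} \<subseteq> {\<omega> \<in> space M. B < b n * Y n \<omega>}"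
      proof safe
        fix \<omega> assume "\<not> c / 2 < \<bar>Y n \<omega> - c\<bar>"
        then have "c / 2 \<le> Y n \<omega>" using c by linarith
        then have "b n * (c / 2) \<le> b n * Y n \<omega>" using elim by (intro mult_left_mono) auto
        moreover have "B < b n * (c / 2)"
        proof -
          have "2 * B / c < b n" using elim by simp
          then show ?thesis using c by (simp add: field_simps)
        qed
        ultimately show "B < b n * Y n \<omega>" by linarith
      qed
    qed measurable
    finally show ?case .
  qed
  show "(\<lambda>n. measure M {\<omega> \<in> space M. B < b n * Y n \<omega>}) \<longlonglongrightarrow> 1"
    by (rule tendsto_sandwich[OF ev _ _ tendsto_const]) (use p in auto)
qed

locale two_samples =
  one: local_sample M S \<epsilon> f K L Bd R u T h X V m\<^sub>1 C\<^sub>1 D\<^sub>1 +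
  two: local_sample M S' \<epsilon>' f' K L Bd R u T' h Y W m\<^sub>2 C\<^sub>2 D\<^sub>2
  for M :: "'w measure" and S :: "'s measure" and \<epsilon> and f :: "(nat \<Rightarrow> 's) \<Rightarrow> 'a::euclidean_space L2"
    and K L Bd R u T h X V m\<^sub>1 C\<^sub>1 D\<^sub>1
    and S' :: "'s' measure" and \<epsilon>' and f' :: "(nat \<Rightarrow> 's') \<Rightarrow> 'a L2" and T' Y W m\<^sub>2 C\<^sub>2 D\<^sub>2 +
  fixes \<theta> :: real
  assumes independent: "\<And>N N'. one.indep_var
      (\<Pi>\<^sub>M t\<in>{1..N}. borel) (\<lambda>\<omega>. \<lambda>t\<in>{1..N}. X N t \<omega>)
      (\<Pi>\<^sub>M t\<in>{1..N'}. borel) (\<lambda>\<omega>. \<lambda>t\<in>{1..N'}. Y N' t \<omega>)"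
    and \<theta>: "0 < \<theta>" "\<theta> < 1" and ratio: "(\<lambda>n. real (T n) / (real (T n) + real (T' n))) \<longlonglongrightarrow> \<theta>"
begin

definition scaling :: "nat \<Rightarrow> real"
  where "scaling n = real (T n) * real (T' n) * h n / (real (T n) + real (T' n))"

text \<open>\<alpha> and \<beta> are what the standardisations of the two samples leave of the
  common scaling (\<open>sqrt_scaling\<close>). The scaling T T' h / (T + T') is T h times the share
  of the other sample, hence the weight 1 - \<theta> for the first covariance and \<theta> for the
  second.\<close>

definition \<alpha> :: "nat \<Rightarrow> real" where "\<alpha> n = sqrt (real (T' n) / (real (T n) + real (T' n)))"

definition \<beta> :: "nat \<Rightarrow> real" where "\<beta> n = sqrt (real (T n) / (real (T n) + real (T' n)))"

lemma stat_eq: "two_sample_stat K (h n) u (T n) (T' n) X Y \<omega> = scaling n * (norm (one.lm n \<omega> - two.lm n \<omega>))\<^sup>2"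
  by (simp add: two_sample_stat_def scaling_def)

lemma scaling_nonneg: "0 \<le> scaling n"
  using one.h(1)[of n] by (simp add: scaling_def)

lemma ev_TT: "\<forall>\<^sub>F n in sequentially. 0 < T n \<and> 0 < T' n \<and> 0 < one.w n \<and> 0 < two.w n"
  using one.ev_T two.ev_T by eventually_elim auto

lemma ratio': "(\<lambda>n. real (T' n) / (real (T n) + real (T' n))) \<longlonglongrightarrow> 1 - \<theta>"
proof (rule Lim_transform_eventually)
  show "(\<lambda>n. 1 - real (T n) / (real (T n) + real (T' n))) \<longlonglongrightarrow> 1 - \<theta>"
    by (intro tendsto_intros ratio)
  show "\<forall>\<^sub>F n in sequentially. 1 - real (T n) / (real (T n) + real (T' n)) = real (T' n) / (real (T n) + real (T' n))"
    using ev_TT by eventually_elim (simp add: field_simps)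
qed

lemma \<alpha>_tendsto: "\<alpha> \<longlonglongrightarrow> sqrt (1 - \<theta>)" unfolding \<alpha>_def by (intro tendsto_intros ratio')

lemma \<beta>_tendsto: "\<beta> \<longlonglongrightarrow> sqrt \<theta>" unfolding \<beta>_def by (intro tendsto_intros ratio)

lemma sqrt_scaling:
  assumes "0 < T n" "0 < T' n"
  shows "sqrt (scaling n) = \<alpha> n / sqrt (one.w n)" "sqrt (scaling n) = \<beta> n / sqrt (two.w n)"
  using assms one.h(1)[of n] unfolding \<alpha>_def \<beta>_def scaling_def one.w_def two.w_def real_sqrt_divide[symmetric]
  by (auto simp: field_simps)

lemma scaled_lm:
  assumes "0 < T n" "0 < T' n"
  shows "sqrt (scaling n) *\<^sub>R (one.lm n \<omega> - m\<^sub>1 u) = \<alpha> n *\<^sub>R one.G n \<omega>"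
    and "sqrt (scaling n) *\<^sub>R (two.lm n \<omega> - m\<^sub>2 u) = \<beta> n *\<^sub>R two.G n \<omega>"
  using sqrt_scaling[OF assms] by (simp_all add: one.G_def two.G_def divide_inverse mult.commute)

lemma independent_lm: "one.indep_var borel (one.lm n) borel (two.lm n)"
proof -
  define F :: "nat \<Rightarrow> (nat \<Rightarrow> 'a L2) \<Rightarrow> 'a L2"
    where "F N x = (1 / (real N * h n)) *\<^sub>R (\<Sum>t=1..N. K ((u - real t / real N) / h n) *\<^sub>R x t)" for N x
  have F: "F N \<in> borel_measurable (\<Pi>\<^sub>M t\<in>{1..N}. borel)" for N
    unfolding F_def[abs_def]
    by (intro borel_measurable_scaleR borel_measurable_sum borel_measurable_const measurable_component_singleton)
  have "one.indep_var borel (F (T n) \<circ> (\<lambda>\<omega>. \<lambda>t\<in>{1..T n}. X (T n) t \<omega>)) borel (F (T' n) \<circ> (\<lambda>\<omega>. \<lambda>t\<in>{1..T' n}. Y (T' n) t \<omega>))"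
    by (rule one.indep_var_compose[OF independent F F])
  moreover have "F N \<circ> (\<lambda>\<omega>. \<lambda>t\<in>{1..N}. P N t \<omega>) = local_mean K (h n) u N P" for N and P :: "nat \<Rightarrow> nat \<Rightarrow> 'w \<Rightarrow> 'a L2"
    by (auto simp: fun_eq_iff F_def local_mean_def intro!: arg_cong[where f = "scaleR _"] sum.cong)
  ultimately show ?thesis by simp
qed

text \<open>The centring \<open>y\<close> cancels in the difference. When the means at
  \<open>u\<close> agree it is chosen as their common value, so that both factors are characters of
  standardised local means.\<close>

lemma independent_char:
  "(CLINT \<omega>|M. iexp (inner (c *\<^sub>R (one.lm n \<omega> - two.lm n \<omega>)) x))
    = (CLINT \<omega>|M. iexp (inner (c *\<^sub>R (one.lm n \<omega> - y)) x)) * (CLINT \<omega>|M. iexp (inner (c *\<^sub>R (two.lm n \<omega> - y)) (- x)))"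
proof -
  let ?g = "\<lambda>z x. iexp (inner (c *\<^sub>R (z - y)) x)"
  have "one.indep_var borel ((\<lambda>z. ?g z x) \<circ> one.lm n) borel ((\<lambda>z. ?g z (- x)) \<circ> two.lm n)"
    by (rule one.indep_var_compose[OF independent_lm]) measurable
  then have ind: "one.indep_var borel (\<lambda>\<omega>. ?g (one.lm n \<omega>) x) borel (\<lambda>\<omega>. ?g (two.lm n \<omega>) (- x))"
    by (simp add: comp_def)
  have i: "integrable M (\<lambda>\<omega>. iexp (Q \<omega>))" if "Q \<in> borel_measurable M" for Q
    by (rule one.integrable_const_bound[where B = 1]) (use that in auto)
  have "(CLINT \<omega>|M. iexp (inner (c *\<^sub>R (one.lm n \<omega> - two.lm n \<omega>)) x)) = (CLINT \<omega>|M. ?g (one.lm n \<omega>) x * ?g (two.lm n \<omega>) (- x))"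
    by (rule Bochner_Integration.integral_cong) (simp_all add: exp_add[symmetric] inner_diff_left algebra_simps)
  also have "\<dots> = (CLINT \<omega>|M. ?g (one.lm n \<omega>) x) * (CLINT \<omega>|M. ?g (two.lm n \<omega>) (- x))"
    by (rule one.indep_var_lebesgue_integral[OF ind]) (intro i; measurable)+
  finally show ?thesis .
qed

definition \<kappa> :: real where "\<kappa> = (\<integral>z. (K z)\<^sup>2 \<partial>lborel)"

definition Q :: "'a L2 \<Rightarrow> 'a L2 \<Rightarrow> real"
  where "Q x y = \<kappa> * ((1 - \<theta>) * one.B x y + \<theta> * two.B x y)"

lemma \<kappa>_nonneg: "0 \<le> \<kappa>" by (simp add: \<kappa>_def)

text \<open>Both numbers are limits of variances by \<open>sw_variance\<close>; the series defining
  \<open>B\<close> does not show a sign.\<close>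

lemma \<kappa>_B_nonneg: "0 \<le> \<kappa> * one.B x x" "0 \<le> \<kappa> * two.B x x"
  unfolding \<kappa>_def using one.sw_variance[of x] two.sw_variance[of x] by (auto intro: tendsto_lowerbound)

lemma Q_form: "psd_form Q"
proof
  show "Q (x + y) z = Q x z + Q y z" for x y z
    by (simp add: Q_def one.B_add_left two.B_add_left algebra_simps)
  show "Q (r *\<^sub>R x) z = r * Q x z" for r x z
    by (simp add: Q_def one.B_scale_left two.B_scale_left algebra_simps)
  show "Q x y = Q y x" for x y
    unfolding Q_def by (subst one.B_sym, subst two.B_sym) (rule refl)
  show "0 \<le> Q x x" for x
  proof -
    have "Q x x = (1 - \<theta>) * (\<kappa> * one.B x x) + \<theta> * (\<kappa> * two.B x x)" by (simp add: Q_def algebra_simps)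
    then show ?thesis using \<kappa>_B_nonneg[of x] \<theta> by simp
  qed
qed

lemma weighted_le:
  assumes "x \<le> c" "y \<le> d"
  shows "\<kappa> * ((1 - \<theta>) * x + \<theta> * y) \<le> \<kappa> * ((1 - \<theta>) * c + \<theta> * d)"
  using assms \<theta> \<kappa>_nonneg by (intro mult_left_mono add_mono) auto

lemma Q_le: "Q x x \<le> (\<kappa> * ((1 - \<theta>) * (2 * (one.v * one.\<Delta>)) + \<theta> * (2 * (two.v * two.\<Delta>)))) * (norm x)\<^sup>2"
  using weighted_le[OF one.B_le two.B_le, of x x] by (simp add: Q_def algebra_simps)

lemma trace_Q_le:
  assumes "parseval e"
  shows "(\<Sum>k<n. Q (e k) (e k)) \<le> \<kappa> * ((1 - \<theta>) * (2 * (one.v * one.\<Delta>)) + \<theta> * (2 * (two.v * two.\<Delta>)))"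
  using weighted_le[OF one.trace_B_le[OF assms, of "{..<n}"] two.trace_B_le[OF assms, of "{..<n}"]]
  unfolding Q_def sum_distrib_left[symmetric] sum.distrib by simp

lemma char_tendsto:
  assumes "m\<^sub>1 u = m\<^sub>2 u"
  shows "(\<lambda>n. CLINT \<omega>|M. iexp (inner (sqrt (scaling n) *\<^sub>R (one.lm n \<omega> - two.lm n \<omega>)) x)) \<longlonglongrightarrow> of_real (exp (- Q x x / 2))"
proof -
  have "(\<lambda>n. (CLINT \<omega>|M. iexp (inner (\<alpha> n *\<^sub>R one.G n \<omega>) x)) * (CLINT \<omega>|M. iexp (inner (\<beta> n *\<^sub>R two.G n \<omega>) (- x))))
    \<longlonglongrightarrow> of_real (exp (- ((sqrt (1 - \<theta>))\<^sup>2 * (\<kappa> * one.B x x)) / 2)) * of_real (exp (- ((sqrt \<theta>)\<^sup>2 * (\<kappa> * two.B (- x) (- x))) / 2))"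
    unfolding \<kappa>_def by (intro tendsto_mult one.G_char two.G_char \<alpha>_tendsto \<beta>_tendsto)
  moreover have "of_real (exp (- ((sqrt (1 - \<theta>))\<^sup>2 * (\<kappa> * one.B x x)) / 2)) * of_real (exp (- ((sqrt \<theta>)\<^sup>2 * (\<kappa> * two.B (- x) (- x))) / 2))
      = complex_of_real (exp (- Q x x / 2))"
  proof -
    have "two.B (- x) (- x) = two.B x x"
      using two.B_scale_left[of "-1" x "- x"] two.B_scale_left[of "-1" x x] two.B_sym[of x "- x"] by simp
    then show ?thesis
      unfolding of_real_mult[symmetric] exp_add[symmetric] Q_def using \<theta> by (simp add: field_simps)
  qed
  moreover have "\<forall>\<^sub>F n in sequentially. (CLINT \<omega>|M. iexp (inner (\<alpha> n *\<^sub>R one.G n \<omega>) x)) * (CLINT \<omega>|M. iexp (inner (\<beta> n *\<^sub>R two.G n \<omega>) (- x)))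
      = (CLINT \<omega>|M. iexp (inner (sqrt (scaling n) *\<^sub>R (one.lm n \<omega> - two.lm n \<omega>)) x))"
    using ev_TT
  proof eventually_elim
    case (elim n)
    then show ?case
      unfolding independent_char[where y = "m\<^sub>1 u"] using scaled_lm[of n] assms by simp
  qed
  ultimately show ?thesis using Lim_transform_eventually by fastforce
qed

lemma remainder_eventually:
  assumes m: "m\<^sub>1 u = m\<^sub>2 u" and e: "parseval e" and r: "0 < r"
  shows "\<exists>k0. \<forall>k\<ge>k0. \<forall>\<^sub>F n in sequentially.
    (\<integral>\<omega>. remainder e k (sqrt (scaling n) *\<^sub>R (one.lm n \<omega> - two.lm n \<omega>)) \<partial>M) \<le> r"
proof -
  have r4: "0 < r / 4" using r by simp
  obtain k1 where k1: "\<And>k. k \<ge> k1 \<Longrightarrow> \<forall>\<^sub>F n in sequentially. (\<integral>\<omega>. remainder e k (one.G n \<omega>) \<partial>M) \<le> r / 4"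
    using one.G_remainder[OF e r4] by blast
  obtain k2 where k2: "\<And>k. k \<ge> k2 \<Longrightarrow> \<forall>\<^sub>F n in sequentially. (\<integral>\<omega>. remainder e k (two.G n \<omega>) \<partial>M) \<le> r / 4"
    using two.G_remainder[OF e r4] by blast
  have "\<forall>\<^sub>F n in sequentially. (\<integral>\<omega>. remainder e k (sqrt (scaling n) *\<^sub>R (one.lm n \<omega> - two.lm n \<omega>)) \<partial>M) \<le> r"
    if k: "k \<ge> max k1 k2" for k
  proof -
    have "k1 \<le> k" "k2 \<le> k" using k by auto
    from k1[OF this(1)] k2[OF this(2)] ev_TT show ?thesis
    proof eventually_elim
      case (elim n)
      have eq: "sqrt (scaling n) *\<^sub>R (one.lm n \<omega> - two.lm n \<omega>) = \<alpha> n *\<^sub>R one.G n \<omega> - \<beta> n *\<^sub>R two.G n \<omega>" for \<omega>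
      proof -
        have "sqrt (scaling n) *\<^sub>R (one.lm n \<omega> - two.lm n \<omega>)
            = sqrt (scaling n) *\<^sub>R (one.lm n \<omega> - m\<^sub>1 u) - sqrt (scaling n) *\<^sub>R (two.lm n \<omega> - m\<^sub>2 u)"
          using m by (simp add: algebra_simps)
        then show ?thesis using scaled_lm[of n] elim by simp
      qed
      have i: "integrable M (\<lambda>\<omega>. remainder e k (one.G n \<omega>))" "integrable M (\<lambda>\<omega>. remainder e k (two.G n \<omega>))"
        by (intro integrable_remainder one.G_square two.G_square one.measurable_G two.measurable_G)+
      have le1: "(\<alpha> n)\<^sup>2 \<le> 1" "(\<beta> n)\<^sup>2 \<le> 1"
        using elim by (simp_all add: \<alpha>_def \<beta>_def)
      have le: "remainder e k (\<alpha> n *\<^sub>R one.G n \<omega> - \<beta> n *\<^sub>R two.G n \<omega>) \<le> 2 * remainder e k (one.G n \<omega>) + 2 * remainder e k (two.G n \<omega>)" for \<omega>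
      proof -
        have "remainder e k (\<alpha> n *\<^sub>R one.G n \<omega> - \<beta> n *\<^sub>R two.G n \<omega>) \<le> 2 * ((\<alpha> n)\<^sup>2 * remainder e k (one.G n \<omega>)) + 2 * ((\<beta> n)\<^sup>2 * remainder e k (two.G n \<omega>))"
          using remainder_diff_le[OF e] unfolding remainder_scaleR[symmetric] by blast
        moreover have "(\<alpha> n)\<^sup>2 * remainder e k (one.G n \<omega>) \<le> 1 * remainder e k (one.G n \<omega>)"
          "(\<beta> n)\<^sup>2 * remainder e k (two.G n \<omega>) \<le> 1 * remainder e k (two.G n \<omega>)"
          by (intro mult_right_mono le1 remainder_nonneg e)+
        ultimately show ?thesis by linarith
      qed
      have "(\<integral>\<omega>. remainder e k (\<alpha> n *\<^sub>R one.G n \<omega> - \<beta> n *\<^sub>R two.G n \<omega>) \<partial>M)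
          \<le> (\<integral>\<omega>. 2 * remainder e k (one.G n \<omega>) + 2 * remainder e k (two.G n \<omega>) \<partial>M)"
      proof (rule integral_mono[OF _ _ le])
        show "integrable M (\<lambda>\<omega>. remainder e k (\<alpha> n *\<^sub>R one.G n \<omega> - \<beta> n *\<^sub>R two.G n \<omega>))"
          by (intro integrable_remainder integrable_norm_square_diff borel_measurable_diff borel_measurable_scaleR borel_measurable_const one.measurable_G two.measurable_G)
             (simp_all add: power_mult_distrib one.G_square two.G_square)
      qed (use i in simp)
      also have "\<dots> = 2 * (\<integral>\<omega>. remainder e k (one.G n \<omega>) \<partial>M) + 2 * (\<integral>\<omega>. remainder e k (two.G n \<omega>) \<partial>M)"
        using i by simp
      finally show ?case unfolding eq using elim by linarith
    qed
  qed
  then show ?thesis by blast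
qed

lemma null_limit:
  assumes m: "m\<^sub>1 u = m\<^sub>2 u"
  shows "\<exists>(N :: 'a L2 measure) (Z :: 'a L2 \<Rightarrow> 'a L2).
    prob_space N \<and> in_Lp N 2 Z \<and> gaussian N Z \<and> (\<integral>\<omega>. Z \<omega> \<partial>N) = 0 \<and>
    cross_moment N Z Z = (\<integral>z. (K z)\<^sup>2 \<partial>lborel) *\<^sub>R
      ((1 - \<theta>) *\<^sub>R long_run_cov M one.Z + \<theta> *\<^sub>R long_run_cov M two.Z) \<and>
    weak_conv_m (\<lambda>n. distr M borel (two_sample_stat K (h n) u (T n) (T' n) X Y)) (distr N borel (\<lambda>\<omega>. (norm (Z \<omega>))\<^sup>2))"
proof -
  obtain e :: "nat \<Rightarrow> 'a L2" where "\<And>x. (\<lambda>k. (inner x (e k))\<^sup>2) sums (norm x)\<^sup>2"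
    using parseval_frame_exists by blast
  then have e: "parseval e" by (simp add: parseval_def)
  define \<Psi> where "\<Psi> = \<kappa> *\<^sub>R ((1 - \<theta>) *\<^sub>R long_run_cov M one.Z + \<theta> *\<^sub>R long_run_cov M two.Z)"
  have op: "Q x y = inner x (\<kappa> *\<^sub>R ((1 - \<theta>) *\<^sub>R one.cov_op y + \<theta> *\<^sub>R two.cov_op y))" for x y
    by (simp add: Q_def inner_add_right one.inner_cov_op two.inner_cov_op)
  have \<Psi>: "inner \<Psi> (tensor a b) = Q a b" for a b
    by (simp add: Q_def \<Psi>_def inner_add_left inner_long_run_cov[OF one.h_shift_axioms] inner_long_run_cov[OF two.h_shift_axioms])
  obtain N :: "'a L2 measure" where N: "prob_space N" "sets N = sets borel" "in_Lp N 2 (\<lambda>x. x)" "gaussian N (\<lambda>x. x)"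
    "(\<integral>x. x \<partial>N) = 0" "cross_moment N (\<lambda>x. x) (\<lambda>x. x) = \<Psi>"
    and char: "\<And>x. (CLINT z|N. iexp (inner z x)) = of_real (exp (- Q x x / 2))"
    by (rule gaussian_element_exists[OF Q_form Q_le op e trace_Q_le[OF e] \<Psi>]) blast
  let ?W = "\<lambda>n \<omega>. sqrt (scaling n) *\<^sub>R (one.lm n \<omega> - two.lm n \<omega>)"
  have "weak_conv_m (\<lambda>n. distr M borel (\<lambda>\<omega>. (norm (?W n \<omega>))\<^sup>2)) (distr N borel (\<lambda>z. (norm z)\<^sup>2))"
  proof (rule char_tendsto_imp_weak_conv_norm[OF one.prob_space_axioms N(1), where e = e])
    show "?W n \<in> borel_measurable M" for n by measurable
    show "(\<lambda>x. x) \<in> borel_measurable N" using N(2) by (simp add: measurable_def sets_eq_imp_space_eq)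
    show "(\<lambda>n. CLINT \<omega>|M. iexp (inner (?W n \<omega>) x)) \<longlonglongrightarrow> (CLINT z|N. iexp (inner z x))" for x
      unfolding char by (rule char_tendsto[OF m])
    show "(\<lambda>k. (inner x (e k))\<^sup>2) sums (norm x)\<^sup>2" for x using e by (simp add: parseval_def)
    have "integrable M (\<lambda>\<omega>. (norm (one.lm n \<omega> - two.lm n \<omega>))\<^sup>2)" for n
      by (intro integrable_norm_square_diff one.lm_square two.lm_square one.measurable_lm two.measurable_lm)
    then show "integrable M (\<lambda>\<omega>. (norm (?W n \<omega>))\<^sup>2)" for n by (simp add: power_mult_distrib)
    show "\<exists>k0. \<forall>k\<ge>k0. \<forall>\<^sub>F n in sequentially. (\<integral>\<omega>. (norm (?W n \<omega>))\<^sup>2 - (\<Sum>i<k. (inner (?W n \<omega>) (e i))\<^sup>2) \<partial>M) \<le> r" if "0 < r" for r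
      using remainder_eventually[OF m e that] unfolding remainder_def .
  qed
  moreover have "(\<lambda>\<omega>. (norm (?W n \<omega>))\<^sup>2) = two_sample_stat K (h n) u (T n) (T' n) X Y" for n
    using scaling_nonneg[of n] by (auto simp: stat_eq power_mult_distrib)
  ultimately have "weak_conv_m (\<lambda>n. distr M borel (two_sample_stat K (h n) u (T n) (T' n) X Y)) (distr N borel (\<lambda>z. (norm z)\<^sup>2))"
    by simp
  then show ?thesis
    using N unfolding \<Psi>_def \<kappa>_def by (intro exI[of _ N] exI[of _ "\<lambda>x. x"]) simp
qed

lemma alternative_limit:
  "tendsto_in_prob M (\<lambda>n \<omega>. (norm (one.lm n \<omega> - two.lm n \<omega>))\<^sup>2) ((norm (m\<^sub>1 u - m\<^sub>2 u))\<^sup>2)"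
proof (rule tendsto_in_prob_norm_square[OF one.prob_space_axioms])
  show "(\<lambda>\<omega>. one.lm n \<omega> - two.lm n \<omega>) \<in> borel_measurable M" for n by measurable
  show "integrable M (\<lambda>\<omega>. (norm (one.lm n \<omega> - two.lm n \<omega>))\<^sup>2)" for n
    by (intro integrable_norm_square_diff one.lm_square two.lm_square one.measurable_lm two.measurable_lm)
  let ?E = "\<lambda>n. \<integral>\<omega>. (norm (one.lm n \<omega> - m\<^sub>1 u))\<^sup>2 \<partial>M" and ?F = "\<lambda>n. \<integral>\<omega>. (norm (two.lm n \<omega> - m\<^sub>2 u))\<^sup>2 \<partial>M"
  have le: "norm (\<integral>\<omega>. (norm (one.lm n \<omega> - two.lm n \<omega> - (m\<^sub>1 u - m\<^sub>2 u)))\<^sup>2 \<partial>M) \<le> 2 * ?E n + 2 * ?F n" for n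
  proof -
    have i: "integrable M (\<lambda>\<omega>. (norm (one.lm n \<omega> - m\<^sub>1 u))\<^sup>2)" "integrable M (\<lambda>\<omega>. (norm (two.lm n \<omega> - m\<^sub>2 u))\<^sup>2)"
      by (intro integrable_norm_square_diff one.lm_square two.lm_square one.measurable_lm two.measurable_lm; simp)+
    have "(\<integral>\<omega>. (norm (one.lm n \<omega> - two.lm n \<omega> - (m\<^sub>1 u - m\<^sub>2 u)))\<^sup>2 \<partial>M)
        = (\<integral>\<omega>. (norm ((one.lm n \<omega> - m\<^sub>1 u) - (two.lm n \<omega> - m\<^sub>2 u)))\<^sup>2 \<partial>M)"
      by (simp add: algebra_simps)
    also have "\<dots> \<le> (\<integral>\<omega>. 2 * (norm (one.lm n \<omega> - m\<^sub>1 u))\<^sup>2 + 2 * (norm (two.lm n \<omega> - m\<^sub>2 u))\<^sup>2 \<partial>M)"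
    proof (rule integral_mono)
      show "integrable M (\<lambda>\<omega>. (norm ((one.lm n \<omega> - m\<^sub>1 u) - (two.lm n \<omega> - m\<^sub>2 u)))\<^sup>2)"
        by (rule integrable_norm_square_diff) (use i in simp_all)
      show "(norm ((one.lm n \<omega> - m\<^sub>1 u) - (two.lm n \<omega> - m\<^sub>2 u)))\<^sup>2 \<le> 2 * (norm (one.lm n \<omega> - m\<^sub>1 u))\<^sup>2 + 2 * (norm (two.lm n \<omega> - m\<^sub>2 u))\<^sup>2" for \<omega>
        by (rule order_trans[OF power_mono[OF norm_triangle_ineq4 norm_ge_zero] square_add_le])
    qed (use i in simp)
    also have "\<dots> = 2 * ?E n + 2 * ?F n" using i by simp
    finally show ?thesis by simp
  qed
  have "(\<lambda>n. 2 * ?E n + 2 * ?F n) \<longlonglongrightarrow> 2 * 0 + 2 * 0"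
    by (intro tendsto_intros one.lm_tendsto two.lm_tendsto)
  then have lim: "(\<lambda>n. 2 * ?E n + 2 * ?F n) \<longlonglongrightarrow> 0" by simp
  show "(\<lambda>n. \<integral>\<omega>. (norm (one.lm n \<omega> - two.lm n \<omega> - (m\<^sub>1 u - m\<^sub>2 u)))\<^sup>2 \<partial>M) \<longlonglongrightarrow> 0"
    by (rule Lim_null_comparison[OF _ lim]) (rule always_eventually, rule allI, rule le)
qed

lemma stat_tendsto_infinity:
  assumes "0 < norm (m\<^sub>1 u - m\<^sub>2 u)"
  shows "tendsto_infinity_in_prob M (\<lambda>n. two_sample_stat K (h n) u (T n) (T' n) X Y)"
proof -
  have "filterlim (\<lambda>n. real (T' n) / (real (T n) + real (T' n)) * (real (T n) * h n)) at_top sequentially"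
    by (rule filterlim_tendsto_pos_mult_at_top[OF ratio' _ one.Th]) (use \<theta> in simp)
  then have "filterlim scaling at_top sequentially"
    by (simp add: scaling_def[abs_def] mult_ac)
  moreover have "0 < (norm (m\<^sub>1 u - m\<^sub>2 u))\<^sup>2" using assms by simp
  ultimately show ?thesis
    unfolding stat_eq[abs_def] using alternative_limit
    by (intro tendsto_infinity_in_prob_mult[OF one.prob_space_axioms]) measurable
qed

end

section \<open>From the hypotheses to the two samples\<close>

lemma square_le_one_plus_powr:
  fixes x \<rho> :: real
  assumes "0 < x" "2 \<le> \<rho>"
  shows "x\<^sup>2 \<le> 1 + x powr \<rho>"
proof (cases "x \<le> 1")
  case True
  then have "x\<^sup>2 \<le> 1" using assms by (simp add: power_le_one)
  then show ?thesis using powr_ge_zero[of x \<rho>] by linarith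
next
  case False
  then have "x powr 2 \<le> x powr \<rho>" using assms by (intro powr_mono) auto
  then show ?thesis using assms by simp
qed

lemma local_sample_exists:
  fixes X V :: "nat \<Rightarrow> nat \<Rightarrow> 'w \<Rightarrow> 'a::euclidean_space L2" and vs :: "real \<Rightarrow> int \<Rightarrow> 'w \<Rightarrow> 'a L2" and S :: "'s measure"
  assumes M: "prob_space M" and ls: "locally_stationary M 2 \<rho> V vs" and \<rho>: "2 \<le> \<rho>"
    and appr: "Lp_m_approximable M S 2 (vs u)" and mean: "\<And>t. (\<integral>\<omega>. vs u t \<omega> \<partial>M) = 0"
    and model: "\<And>N t \<omega>. t \<in> {1..N} \<Longrightarrow> \<omega> \<in> space M \<Longrightarrow> X N t \<omega> = m (real t / real N) + V N t \<omega>"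
    and m_lip: "\<And>a b. a \<in> {0..1} \<Longrightarrow> b \<in> {0..1} \<Longrightarrow> norm (m b - m a) \<le> C\<^sub>m * \<bar>a - b\<bar>" and C\<^sub>m: "0 \<le> C\<^sub>m"
    and kw: "kernel_weights K L Bd R u T h" and rate: "(\<lambda>n. real (T n) * h n ^ 3) \<longlonglongrightarrow> 0"
  obtains \<epsilon> f C where "local_sample M S \<epsilon> f K L Bd R u T h X V m C\<^sub>m C"
    and "long_run_cov M (vs u) = long_run_cov M (h_shift.Z \<epsilon> f)"
proof -
  interpret prob_space M by fact
  obtain \<epsilon> f where hs: "h_shift M S \<epsilon> f" and Z: "\<And>t. AE \<omega> in M. vs u t \<omega> = h_shift.Z \<epsilon> f t \<omega>"
    using Lp_m_approximable_h_shift[OF M appr mean] by blast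
  interpret h_shift M S \<epsilon> f by fact
  interpret k: kernel_weights K L Bd R u T h by fact
  have u: "u \<in> {0..1}" using k.u by simp
  have vs_meas: "vs u t \<in> borel_measurable M" for t
    using appr unfolding Lp_m_approximable_def in_Lp_2 by blast
  obtain U C where U: "\<And>N t. t \<in> {1..N} \<Longrightarrow> U N t \<in> borel_measurable M \<and> (AE \<omega> in M. 0 < U N t \<omega>) \<and>
      integrable M (\<lambda>\<omega>. U N t \<omega> powr \<rho>) \<and> (\<integral>\<omega>. U N t \<omega> powr \<rho> \<partial>M) < C \<and>
      (AE \<omega> in M. norm (V N t \<omega> - vs u (int t) \<omega>) \<le> (\<bar>real t / real N - u\<bar> + 1 / real N) * U N t \<omega>)"
    using ls u unfolding locally_stationary_def by fast
  have V: "V N t \<in> borel_measurable M" "integrable M (\<lambda>\<omega>. (norm (V N t \<omega>))\<^sup>2)" if "t \<in> {1..N}" for N t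
    using ls that unfolding locally_stationary_def in_Lp_2 by blast+
  have near: "(\<integral>\<omega>. (norm (V N t \<omega> - Z (int t) \<omega>))\<^sup>2 \<partial>M) \<le> (1 + \<bar>C\<bar>) * (\<bar>real t / real N - u\<bar> + 1 / real N)\<^sup>2"
    if t: "t \<in> {1..N}" for N t
  proof -
    let ?d = "\<bar>real t / real N - u\<bar> + 1 / real N"
    have "(\<integral>\<omega>. (norm (V N t \<omega> - Z (int t) \<omega>))\<^sup>2 \<partial>M) \<le> (\<integral>\<omega>. ?d\<^sup>2 * (1 + U N t \<omega> powr \<rho>) \<partial>M)"
    proof (rule integral_mono_AE)
      show "integrable M (\<lambda>\<omega>. (norm (V N t \<omega> - Z (int t) \<omega>))\<^sup>2)"
        by (intro integrable_norm_square_diff V t Z_square measurable_Z)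
      have "AE \<omega> in M. 0 < U N t \<omega>" "AE \<omega> in M. norm (V N t \<omega> - vs u (int t) \<omega>) \<le> ?d * U N t \<omega>"
        using U[OF t] by auto
      with Z[of "int t"] show "AE \<omega> in M. (norm (V N t \<omega> - Z (int t) \<omega>))\<^sup>2 \<le> ?d\<^sup>2 * (1 + U N t \<omega> powr \<rho>)"
      proof eventually_elim
        case (elim \<omega>)
        then have "(norm (V N t \<omega> - Z (int t) \<omega>))\<^sup>2 \<le> (?d * U N t \<omega>)\<^sup>2" by (intro power_mono) auto
        also have "\<dots> = ?d\<^sup>2 * (U N t \<omega>)\<^sup>2" by (rule power_mult_distrib)
        \<comment> \<open>Here \<rho> \<ge> 2 enters: moments of order \<rho> control second
          moments.\<close>
        also have "\<dots> \<le> ?d\<^sup>2 * (1 + U N t \<omega> powr \<rho>)"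
          using elim \<rho> by (intro mult_left_mono square_le_one_plus_powr) auto
        finally show ?case .
      qed
    qed (use U[OF t] in simp)
    also have "\<dots> = ?d\<^sup>2 * (1 + (\<integral>\<omega>. U N t \<omega> powr \<rho> \<partial>M))" using U[OF t] by (simp add: prob_space)
    also have "\<dots> \<le> ?d\<^sup>2 * (1 + \<bar>C\<bar>)" using U[OF t] by (intro mult_left_mono) auto
    finally show ?thesis by (simp only: mult.commute)
  qed
  have "local_sample M S \<epsilon> f K L Bd R u T h X V m C\<^sub>m (1 + \<bar>C\<bar>)"
    by (intro local_sample.intro kernel_shift.intro local_sample_axioms.intro hs kw) (use model V m_lip near C\<^sub>m rate in auto)
  moreover have "long_run_cov M (vs u) = long_run_cov M Z"
    by (rule long_run_cov_cong[OF Z vs_meas measurable_Z])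
  ultimately show ?thesis by (rule that)
qed

theorem proposition4p1:
  fixes M :: "'w measure"
    and X Y v w :: "nat \<Rightarrow> nat \<Rightarrow> 'w \<Rightarrow> (real ^ 'd) L2"
    and vs ws :: "real \<Rightarrow> int \<Rightarrow> 'w \<Rightarrow> (real ^ 'd) L2"
    and m\<^sub>1 m\<^sub>2 :: "real \<Rightarrow> (real ^ 'd) L2"
    and S\<^sub>1 :: "real \<Rightarrow> 's1 measure" and S\<^sub>2 :: "real \<Rightarrow> 's2 measure"
    and C\<^sub>m \<rho>\<^sub>1 \<rho>\<^sub>2 \<theta> u :: real
    and K\<^sub>1 :: "real \<Rightarrow> real"
    and T\<^sub>1 T\<^sub>2 :: "nat \<Rightarrow> nat" and h :: "nat \<Rightarrow> real"
  assumes "prob_space M"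
    and independent: "\<And>N\<^sub>1 N\<^sub>2. prob_space.indep_var M
      (\<Pi>\<^sub>M t\<in>{1..N\<^sub>1}. borel) (\<lambda>\<omega>. \<lambda>t\<in>{1..N\<^sub>1}. X N\<^sub>1 t \<omega>)
      (\<Pi>\<^sub>M t\<in>{1..N\<^sub>2}. borel) (\<lambda>\<omega>. \<lambda>t\<in>{1..N\<^sub>2}. Y N\<^sub>2 t \<omega>)"
    and model_X: "\<And>T t \<omega>. t \<in> {1..T} \<Longrightarrow> \<omega> \<in> space M \<Longrightarrow> X T t \<omega> = m\<^sub>1 (real t / real T) + v T t \<omega>"
    and model_Y: "\<And>T t \<omega>. t \<in> {1..T} \<Longrightarrow> \<omega> \<in> space M \<Longrightarrow> Y T t \<omega> = m\<^sub>2 (real t / real T) + w T t \<omega>"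
    and "C\<^sub>m > 0"
    and "\<And>a b. a \<in> {0..1} \<Longrightarrow> b \<in> {0..1} \<Longrightarrow> norm (m\<^sub>1 b - m\<^sub>1 a) \<le> C\<^sub>m * \<bar>a - b\<bar>"
    and "\<And>a b. a \<in> {0..1} \<Longrightarrow> b \<in> {0..1} \<Longrightarrow> norm (m\<^sub>2 b - m\<^sub>2 a) \<le> C\<^sub>m * \<bar>a - b\<bar>"
    and "\<rho>\<^sub>1 \<ge> 2" and "locally_stationary M 2 \<rho>\<^sub>1 v vs"
    and "\<rho>\<^sub>2 \<ge> 2" and "locally_stationary M 2 \<rho>\<^sub>2 w ws"
    and "\<And>T t. t \<in> {1..T} \<Longrightarrow> (\<integral>\<omega>. v T t \<omega> \<partial>M) = 0"
    and "\<And>T t. t \<in> {1..T} \<Longrightarrow> (\<integral>\<omega>. w T t \<omega> \<partial>M) = 0"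
    and "\<And>a. a \<in> {0..1} \<Longrightarrow> Lp_m_approximable M (S\<^sub>1 a) 2 (vs a)"
    and "\<And>a. a \<in> {0..1} \<Longrightarrow> Lp_m_approximable M (S\<^sub>2 a) 2 (ws a)"
    and "\<And>a t. a \<in> {0..1} \<Longrightarrow> (\<integral>\<omega>. vs a t \<omega> \<partial>M) = 0"
    and "\<And>a t. a \<in> {0..1} \<Longrightarrow> (\<integral>\<omega>. ws a t \<omega> \<partial>M) = 0"
    and "\<And>z. K\<^sub>1 (- z) = K\<^sub>1 z" and "bounded (range K\<^sub>1)" and "\<exists>L. L-lipschitz_on UNIV K\<^sub>1"
    and "compact (closure {z. K\<^sub>1 z \<noteq> 0})" and "(\<integral>z. K\<^sub>1 z \<partial>lborel) = 1"
    and "\<And>n. h n > 0" and "h \<longlonglongrightarrow> 0"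
    and "filterlim (\<lambda>n. min (T\<^sub>1 n) (T\<^sub>2 n)) at_top sequentially"
    and "filterlim (\<lambda>n. min (real (T\<^sub>1 n) * h n) (1 / (real (T\<^sub>1 n) * h n ^ 3))) at_top sequentially"
    and "(\<lambda>n. real (T\<^sub>1 n) / (real (T\<^sub>1 n) + real (T\<^sub>2 n))) \<longlonglongrightarrow> \<theta>" and "0 < \<theta>" and "\<theta> < 1"
    and "0 < u" and "u < 1"
  shows "(m\<^sub>1 u = m\<^sub>2 u \<longrightarrow>
      (\<exists>(N :: (real ^ 'd) L2 measure) (Z :: (real ^ 'd) L2 \<Rightarrow> (real ^ 'd) L2).
        prob_space N \<and> in_Lp N 2 Z \<and> gaussian N Z \<and> (\<integral>\<omega>. Z \<omega> \<partial>N) = 0 \<and>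
        cross_moment N Z Z = (\<integral>z. (K\<^sub>1 z)\<^sup>2 \<partial>lborel) *\<^sub>R
          ((1 - \<theta>) *\<^sub>R long_run_cov M (vs u) + \<theta> *\<^sub>R long_run_cov M (ws u)) \<and>
        weak_conv_m (\<lambda>n. distr M borel (two_sample_stat K\<^sub>1 (h n) u (T\<^sub>1 n) (T\<^sub>2 n) X Y))
          (distr N borel (\<lambda>\<omega>. (norm (Z \<omega>))\<^sup>2)))) \<and>
    (norm (m\<^sub>1 u - m\<^sub>2 u) > 0 \<longrightarrow>
      tendsto_in_prob M
        (\<lambda>n \<omega>. (norm (local_mean K\<^sub>1 (h n) u (T\<^sub>1 n) X \<omega> - local_mean K\<^sub>1 (h n) u (T\<^sub>2 n) Y \<omega>))\<^sup>2)
        ((norm (m\<^sub>1 u - m\<^sub>2 u))\<^sup>2) \<and>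
      tendsto_infinity_in_prob M
        (\<lambda>n. two_sample_stat K\<^sub>1 (h n) u (T\<^sub>1 n) (T\<^sub>2 n) X Y))"
proof -
  interpret prob_space M by fact
  note X_lip = assms(6) and Y_lip = assms(7) and v = assms(8,9) and w = assms(10,11)
    and v_appr = assms(14) and w_appr = assms(15) and v_mean = assms(16) and w_mean = assms(17)
    and K_bdd = assms(19) and K_lip = assms(20) and K_supp = assms(21) and K_int = assms(22)
    and h = assms(23,24) and T_rate = assms(26) and ratio = assms(27) and \<theta> = assms(28,29) and u = assms(30,31)
  obtain B where B: "\<bar>K\<^sub>1 z\<bar> \<le> B" for z
    using K_bdd by (auto simp: bounded_iff)
  obtain L where L: "L-lipschitz_on UNIV K\<^sub>1" using K_lip by blast
  obtain R' where R': "\<And>z. z \<in> closure {z. K\<^sub>1 z \<noteq> 0} \<Longrightarrow> norm z \<le> R'"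
    using compact_imp_bounded[OF K_supp] by (auto simp: bounded_iff)
  define R where "R = max 0 R'"
  have R: "K\<^sub>1 z = 0" if "R < \<bar>z\<bar>" for z
    using R'[of z] closure_subset[of "{z. K\<^sub>1 z \<noteq> 0}"] that by (auto simp: R_def)
  have Th: "filterlim (\<lambda>n. real (T\<^sub>1 n) * h n) at_top sequentially"
    by (rule filterlim_at_top_mono[OF T_rate]) (auto intro: always_eventually)
  have "filterlim (\<lambda>n. 1 / (real (T\<^sub>1 n) * h n ^ 3)) at_top sequentially"
    by (rule filterlim_at_top_mono[OF T_rate]) (auto intro: always_eventually)
  then have Th3: "(\<lambda>n. real (T\<^sub>1 n) * h n ^ 3) \<longlonglongrightarrow> 0"
    using tendsto_inverse_0_at_top by (fastforce simp: inverse_eq_divide)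
  \<comment> \<open>A quotient by \<open>T\<^sub>1 n\<close> is 0 where the sample size vanishes, so
    the identities below are claimed only eventually.\<close>
  have pos: "\<forall>\<^sub>F n in sequentially. 0 < real (T\<^sub>1 n)"
    using filterlim_at_top_dense[THEN iffD1, OF Th, rule_format, of 0]
    by eventually_elim (use h(1) in \<open>simp add: zero_less_mult_iff less_imp_le not_less[symmetric]\<close>)
  \<comment> \<open>The rates are assumed for the first sample only. Since \<theta> lies strictly
    between 0 and 1, the quotient of the sample sizes has a positive finite limit, which transfers
    both rates to the second sample.\<close>
  have "(\<lambda>n. 1 / (real (T\<^sub>1 n) / (real (T\<^sub>1 n) + real (T\<^sub>2 n))) - 1) \<longlonglongrightarrow> 1 / \<theta> - 1"
    by (intro tendsto_intros ratio) (use \<theta> in simp)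
  then have quotient: "(\<lambda>n. real (T\<^sub>2 n) / real (T\<^sub>1 n)) \<longlonglongrightarrow> 1 / \<theta> - 1"
    by (rule Lim_transform_eventually) (use pos in \<open>eventually_elim, simp add: field_simps\<close>)
  have "filterlim (\<lambda>n. real (T\<^sub>2 n) / real (T\<^sub>1 n) * (real (T\<^sub>1 n) * h n)) at_top sequentially"
    by (rule filterlim_tendsto_pos_mult_at_top[OF quotient _ Th]) (use \<theta> in simp)
  then have Th': "filterlim (\<lambda>n. real (T\<^sub>2 n) * h n) at_top sequentially"
    by (rule filterlim_cong[THEN iffD1, rotated 3]) (use pos in \<open>auto elim: eventually_mono\<close>)
  have "(\<lambda>n. real (T\<^sub>2 n) / real (T\<^sub>1 n) * (real (T\<^sub>1 n) * h n ^ 3)) \<longlonglongrightarrow> (1 / \<theta> - 1) * 0"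
    by (intro tendsto_mult quotient Th3)
  then have "(\<lambda>n. real (T\<^sub>2 n) * h n ^ 3) \<longlonglongrightarrow> (1 / \<theta> - 1) * 0"
    by (rule Lim_transform_eventually) (use pos in \<open>auto elim: eventually_mono\<close>)
  then have Th3': "(\<lambda>n. real (T\<^sub>2 n) * h n ^ 3) \<longlonglongrightarrow> 0" by simp
  have kernel: "\<bar>K\<^sub>1 x - K\<^sub>1 y\<bar> \<le> L * \<bar>x - y\<bar>" "0 \<le> L" "0 \<le> R" for x y
    using lipschitz_onD[OF L, of x y] lipschitz_on_nonneg[OF L] by (auto simp: dist_real_def R_def)
  have kw: "kernel_weights K\<^sub>1 L B R u T\<^sub>1 h" "kernel_weights K\<^sub>1 L B R u T\<^sub>2 h"
    by unfold_locales (use kernel B R K_int u h Th Th' in auto)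
  have unit: "u \<in> {0..1}" using u by simp
  have C\<^sub>m: "0 \<le> C\<^sub>m" using \<open>C\<^sub>m > 0\<close> by simp
  obtain \<epsilon> f C where one: "local_sample M (S\<^sub>1 u) \<epsilon> f K\<^sub>1 L B R u T\<^sub>1 h X v m\<^sub>1 C\<^sub>m C"
    and cov1: "long_run_cov M (vs u) = long_run_cov M (h_shift.Z \<epsilon> f)"
    using local_sample_exists[OF prob_space_axioms v(2,1) v_appr[OF unit] v_mean[OF unit] model_X X_lip C\<^sub>m kw(1) Th3] by blast
  obtain \<epsilon>' f' C' where two: "local_sample M (S\<^sub>2 u) \<epsilon>' f' K\<^sub>1 L B R u T\<^sub>2 h Y w m\<^sub>2 C\<^sub>m C'"
    and cov2: "long_run_cov M (ws u) = long_run_cov M (h_shift.Z \<epsilon>' f')"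
    using local_sample_exists[OF prob_space_axioms w(2,1) w_appr[OF unit] w_mean[OF unit] model_Y Y_lip C\<^sub>m kw(2) Th3'] by blast
  interpret two_samples M "S\<^sub>1 u" \<epsilon> f K\<^sub>1 L B R u T\<^sub>1 h X v m\<^sub>1 C\<^sub>m C "S\<^sub>2 u" \<epsilon>' f' T\<^sub>2 Y w m\<^sub>2 C\<^sub>m C' \<theta>
    by (intro two_samples.intro two_samples_axioms.intro one two independent \<theta> ratio)
  show ?thesis
    unfolding cov1 cov2 using null_limit alternative_limit stat_tendsto_infinity by blast
qed

end
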